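(* Consider the FeGSAM algorithm described in the context, under the mixing, contraction, Lipschitz/boundedness and independence assumptions stated there, with $c_{FSAM}=1-\frac{\alpha\varphi_2}2$ and output $\theta_{\hat T}$ after $T$ iterations. (1) In the homogeneous setting, where $\varepsilon=0$, choosing $\alpha=\frac{8\log(NT)}{T\varphi_2}$ and $K=T/N$, one gets $T=\tilde{\mathcal O}\big(\frac1{N\epsilon}\big)$ sample complexity for achieving $\mathbb E[\|\theta_{\hat T}\|_c^2]\le\epsilon$. Furthermore, the communication complexity is $T/K=N$, which is independent of the error $\epsilon$. (2) In the heterogeneous setting, where $\varepsilon>0$, choosing $\alpha=\frac{8\log(NT)}{T\varphi_2}$ and $K=\sqrt T/N$, one gets $T=\tilde{\mathcal O}\big(\frac1{N\epsilon}\big)$ sample complexity for achieving $\mathbb E[\|\theta_{\hat T}\|_c^2]\le\epsilon$. Furthermore, the communication complexity is $T/K=\sqrt N/\sqrt\epsilon$ (logarithmic factors being ignored), which depends on the error $\epsilon$. Here $T$ is assumed large enough that $\alpha$ satisfies the step-size requirements listed in the context and $T>\max\{4\tau_\alpha,N\}$, where $\tau_\alpha=\lceil2\log_\rho\alpha\rceil$.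
   Context: FeGSAM algorithm. There are $N$ agents, a norm $\|\cdot\|_c$ on $\mathbb R^d$, a step size $\alpha>0$ and a synchronization period $K\ge1$. Agent $i$ has functions $G^i(\theta,y)\in\mathbb R^d$, $b^i(y)\in\mathbb R^d$ and a noise process $(y^i_t)_{t\ge0}$ that is Markovian in $t$. All agents start at a common $\theta^i_0=\theta_0$. For $t=0,\dots,T-1$: $\theta^i_{t+1}=\theta^i_t+\alpha\big(G^i(\theta^i_t,y^i_t)-\theta^i_t+b^i(y^i_t)\big)$, and if $K$ divides $t+1$ (a communication round) every $\theta^i_{t+1}$ is then replaced by $\frac1N\sum_j\theta^j_{t+1}$. Finally $\hat T$ is sampled, independently of all other randomness, from $q(t)=c_{FSAM}^{-t}/\sum_{t'=0}^{T-1}c_{FSAM}^{-t'}$, $t=0,\dots,T-1$, and the output is $\theta_{\hat T}=\frac1N\sum_i\theta^i_{\hat T}$. $\mathcal F_t$ is the sigma-algebra generated by $\{\theta^i_r\}_{r\le t,\,i\le N}$ and $\mathbb E_t[\cdot]=\mathbb E[\cdot\mid\mathcal F_t]$. $\tilde{\mathcal O}$ ignores logarithmic terms. Mixing assumption. For every $i$ there is a function $\bar G^i$ with $\lim_{t\to\infty}\mathbb E[G^i(\theta,y^i_t)]=\bar G^i(\theta)$, and $\mathbb E[b^i(y^i_t)]$ converges to a vector $\bar b^i$. $\theta^{i,*}$ denotes the fixed point $\bar G^i(\theta^{i,*})+\bar b^i=\theta^{i,*}$, $\theta^*$ the fixed point of the averaged operator, $\frac1N\sum_i\bar G^i(\theta^*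 )=\theta^*$ (this is the vector $0$), $\eta_i=\|\theta^{i,*}-\theta^*\|_c$ and $\varepsilon=\frac1N\sum_i\eta_i$ (the heterogeneity level, distinct from the target accuracy $\epsilon>0$). There exist $m_1,m_2,m_3,m_4\ge0$ and $\rho\in[0,1)$ such that for every $i$: $\|\bar G^i(\theta)-\mathbb E[G^i(\theta,y^i_t)]\|_c\le m_1\|\theta\|_c\rho^t$, $\|\mathbb E[b^i(y^i_t)]\|_c\le m_2\rho^t+m_3\eta_i$, $\|\mathbb E[\frac1N\sum_ib^i(y^i_t)]\|_c\le m_4\rho^t$. Contraction assumption. There is $\gamma_c\in(0,1)$ with $\|\bar G^i(\theta_1)-\bar G^i(\theta_2)\|_c\le\gamma_c\|\theta_1-\theta_2\|_c$ for all $i,\theta_1,\theta_2$. Lipschitz/boundedness assumption. There are constants $A_1,A_2,B$ with $\|G^i(\theta_1,y)-G^i(\theta_2,y)\|_c\le A_1\|\theta_1-\theta_2\|_c$, $\|G^i(\theta,y)\|_c\le A_2\|\theta\|_c$, $\|b^i(y)\|_c\le B$ for all $i,\theta,\theta_1,\theta_2,y$. Independence assumption. The noise is independent across agents: for all measurable $f,g$, all $r\le t$ and $i\ne j$, $\mathbb E_{t-r}[f(y^i_t)g(y^j_t)]=\mathbb E_{t-r}[f(y^i_t)]\,\mathbb E_{t-r}[g(y^j_t)]$. Definition of $\varphi_2$. $\|\cdot\|_s$ is a norm on $\mathbb R^d$ such that $\frac12\|\cdot\|_s^2$ is $L$-smooth with respect to $\|\cdot\|_s$; $l_{cs},u_{cs}>0$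 satisfy $l_{cs}\|\cdot\|_s\le\|\cdot\|_c\le u_{cs}\|\cdot\|_s$; $\psi>0$. $\varphi_1=\frac{1+\psi u_{cs}^2}{1+\psi l_{cs}^2}$, $\varphi_2=1-\gamma_c\varphi_1^{1/2}$, with $\psi$ small enough that $\varphi_2\in(0,1)$. Step-size requirements. With $\tau=\tau_\alpha$: (a) $\alpha\le\min\{\frac1{360\tau(A_2^2+1)},\frac{\varphi_2}{2C_{15}(\tau)}\}$; (b) $\alpha^2\le\min\{\frac1{\varphi_2^2},\frac{\ln(5/4)}{2(1+\tilde A_1)(K-1)^2}\}$, $\alpha^2(\log_\rho\alpha+1)\le\frac v{2K^2}$, $\alpha^2(\log_\rho\alpha+1)^3\exp(\alpha\varphi_2(2\log_\rho\alpha+1))\le\frac v{4K}\exp\big(-\varphi_2\sqrt{\tfrac{\ln(5/4)}{2(1+\tilde A_1)}}\big)$; (c) $\alpha\tau\le\min\{\frac1{24\sqrt{A_2^2+1}},\frac1{8(A_2+1)}\}$; (d) $\alpha\le\min\{\frac1{C_1},\frac1{8\tau C_2},\frac1{40\tau C_1^2}\}$. Here $u_{cm}=(1+\psi u_{cs}^2)^{1/2}$; $l_{c2}\|\cdot\|_2\le\|\cdot\|_c\le u_{c2}\|\cdot\|_2$; $\tilde A_1=\frac{2A_1^2u_{c2}^2}{l_{c2}^2}$, $\tilde A_2=\frac{2A_2^2u_{c2}^2}{l_{c2}^2}$; $v=\frac{\varphi_2}{80\tilde A_2C_{17}u_{cm}^2}$; $C_1=3\sqrt{A_2^2+1}$,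 $C_2=3C_1+8$; $\zeta_4=\sqrt{\varphi_2/10}$, $\zeta_2=\sqrt{\frac{\varphi_2}{10}\cdot\frac{\psi l_{cs}^2}{2LA_2}}$, $\zeta_3=\sqrt{\frac{\varphi_2}{10}\cdot\frac{\psi l_{cs}^2}{L(A_1+1)}}$; $C_3=\frac{m_4L}{\psi l_{cs}^2}$; $C_4=\frac L{\psi l_{cs}^2}\big(\frac L{2\psi l_{cs}^2}+\alpha A_2(1+\frac{u_{cm}^2}{\zeta_2^2})+\alpha(A_1+1)(\frac{3u_{cm}^2}{2\zeta_3^2}+2)+3m_1\alpha^2\big)$; $C_5=\frac L{\psi l_{cs}^2}\big((\frac{3u_{cm}^2}{2\zeta_3^2}+\frac32)(A_1+1)+A_2+\frac{Lu_{cm}^2}{2l_{cs}^2\zeta_4^2\psi}+\frac{3A_1^2\alpha^2}2\big)$; $C_6=\frac L{2l_{cs}^2\psi}\big((\frac{3u_{cm}^2}{\zeta_3^2}+3)(A_1+1)+m_1\alpha\big)$; $C_{15}(\tau)=\big(\frac{6m_1Lu_{cm}^2}{l_{cs}^2\psi}+\frac{6L(A_2+1)^2u_{cm}^2}{2\psi l_{cs}^2}+144(A_2^2+1)C_4u_{cm}^2\big)\tau^2$; $C_{17}=3A_1C_3+8A_1^2C_4+C_5+C_6$.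
   Formalization: Mixing bounds are assumed for the chain from every initial state, and the noise is Markov given all agents' joint past; as stated, noise frozen at a random ±1 with b(y)=y is a counterexample. Hidden constants are chosen after the types of the sample and state spaces. *)

theory Defs
  imports "HOL-Probability.Probability"
begin

section \<open>Norms and smoothness\<close>

definition is_norm :: "('v::real_vector \<Rightarrow> real) \<Rightarrow> bool" where
  "is_norm nrm \<longleftrightarrow>
     (\<forall>x. 0 \<le> nrm x) \<and> (\<forall>x. nrm x = 0 \<longleftrightarrow> x = 0) \<and>
     (\<forall>a x. nrm (a *\<^sub>R x) = \<bar>a\<bar> * nrm x) \<and> (\<forall>x y. nrm (x + y) \<le> nrm x + nrm y)"

text \<open>The gradient of \<open>f\<close> is \<open>L\<close>-Lipschitz from \<open>nrm\<close> to its dual norm; the dual norm is unfolded.\<close>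

definition smooth_wrt :: "('v::euclidean_space \<Rightarrow> real) \<Rightarrow> real \<Rightarrow> ('v \<Rightarrow> real) \<Rightarrow> bool" where
  "smooth_wrt nrm L f \<longleftrightarrow>
     (\<exists>f'. (\<forall>x. (f has_derivative f' x) (at x)) \<and>
           (\<forall>x y h. \<bar>f' x h - f' y h\<bar> \<le> L * nrm (x - y) * nrm h))"


section \<open>Problem constants\<close>

text \<open>Everything the hidden constants of the complexity bounds may depend on (together with the
  common starting point). The number of agents is not among them.\<close>

record 'v constants =
  nrm_c :: "'v \<Rightarrow> real"
  nrm_s :: "'v \<Rightarrow> real"
  smL :: real
  lcs :: real
  ucs :: real
  lc2 :: real
  uc2 :: real
  psi :: real
  gam :: real
  cA1 :: real
  cA2 :: real
  cB :: real
  m1 :: real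
  m2 :: real
  m3 :: real
  m4 :: real
  rho :: real

definition phi1 :: "'v constants \<Rightarrow> real" where
  "phi1 c = (1 + psi c * (ucs c)\<^sup>2) / (1 + psi c * (lcs c)\<^sup>2)"

definition phi2 :: "'v constants \<Rightarrow> real" where
  "phi2 c = 1 - gam c * sqrt (phi1 c)"

definition valid_constants :: "('v::euclidean_space) constants \<Rightarrow> bool" where
  "valid_constants c \<longleftrightarrow>
     is_norm (nrm_c c) \<and> is_norm (nrm_s c) \<and>
     smooth_wrt (nrm_s c) (smL c) (\<lambda>x. (nrm_s c x)\<^sup>2 / 2) \<and>
     0 < lcs c \<and> 0 < ucs c \<and>
     (\<forall>x. lcs c * nrm_s c x \<le> nrm_c c x \<and> nrm_c c x \<le> ucs c * nrm_s c x) \<and>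
     0 < lc2 c \<and> 0 < uc2 c \<and>
     (\<forall>x. lc2 c * norm x \<le> nrm_c c x \<and> nrm_c c x \<le> uc2 c * norm x) \<and>
     0 < psi c \<and> 0 < gam c \<and> gam c < 1 \<and> 0 < phi2 c \<and> phi2 c < 1 \<and>
     0 \<le> cA1 c \<and> 0 \<le> cA2 c \<and> 0 \<le> cB c \<and>
     0 \<le> m1 c \<and> 0 \<le> m2 c \<and> 0 \<le> m3 c \<and> 0 \<le> m4 c \<and> 0 \<le> rho c \<and> rho c < 1"


section \<open>Step-size requirements\<close>

definition ucm :: "'v constants \<Rightarrow> real" where
  "ucm c = sqrt (1 + psi c * (ucs c)\<^sup>2)"

definition tA1 :: "'v constants \<Rightarrow> real" where
  "tA1 c = 2 * (cA1 c)\<^sup>2 * (uc2 c)\<^sup>2 / (lc2 c)\<^sup>2"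

definition tA2 :: "'v constants \<Rightarrow> real" where
  "tA2 c = 2 * (cA2 c)\<^sup>2 * (uc2 c)\<^sup>2 / (lc2 c)\<^sup>2"

definition C1 :: "'v constants \<Rightarrow> real" where
  "C1 c = 3 * sqrt ((cA2 c)\<^sup>2 + 1)"

definition C2 :: "'v constants \<Rightarrow> real" where
  "C2 c = 3 * C1 c + 8"

definition zeta2 :: "'v constants \<Rightarrow> real" where
  "zeta2 c = sqrt (phi2 c / 10 * (psi c * (lcs c)\<^sup>2 / (2 * smL c * cA2 c)))"

definition zeta3 :: "'v constants \<Rightarrow> real" where
  "zeta3 c = sqrt (phi2 c / 10 * (psi c * (lcs c)\<^sup>2 / (smL c * (cA1 c + 1))))"

definition zeta4 :: "'v constants \<Rightarrow> real" where
  "zeta4 c = sqrt (phi2 c / 10)"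

definition C3 :: "'v constants \<Rightarrow> real" where
  "C3 c = m4 c * smL c / (psi c * (lcs c)\<^sup>2)"

definition C4 :: "'v constants \<Rightarrow> real \<Rightarrow> real" where
  "C4 c \<alpha> = smL c / (psi c * (lcs c)\<^sup>2) *
     (smL c / (2 * psi c * (lcs c)\<^sup>2)
      + \<alpha> * cA2 c * (1 + (ucm c)\<^sup>2 / (zeta2 c)\<^sup>2)
      + \<alpha> * (cA1 c + 1) * (3 * (ucm c)\<^sup>2 / (2 * (zeta3 c)\<^sup>2) + 2)
      + 3 * m1 c * \<alpha>\<^sup>2)"

definition C5 :: "'v constants \<Rightarrow> real \<Rightarrow> real" where
  "C5 c \<alpha> = smL c / (psi c * (lcs c)\<^sup>2) *
     ((3 * (ucm c)\<^sup>2 / (2 * (zeta3 c)\<^sup>2) + 3 / 2) * (cA1 c + 1)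
      + cA2 c
      + smL c * (ucm c)\<^sup>2 / (2 * (lcs c)\<^sup>2 * (zeta4 c)\<^sup>2 * psi c)
      + 3 * (cA1 c)\<^sup>2 * \<alpha>\<^sup>2 / 2)"

definition C6 :: "'v constants \<Rightarrow> real \<Rightarrow> real" where
  "C6 c \<alpha> = smL c / (2 * (lcs c)\<^sup>2 * psi c) *
     ((3 * (ucm c)\<^sup>2 / (zeta3 c)\<^sup>2 + 3) * (cA1 c + 1) + m1 c * \<alpha>)"

definition C15 :: "'v constants \<Rightarrow> real \<Rightarrow> nat \<Rightarrow> real" where
  "C15 c \<alpha> \<tau> =
     (6 * m1 c * smL c * (ucm c)\<^sup>2 / ((lcs c)\<^sup>2 * psi c)
      + 6 * smL c * (cA2 c + 1)\<^sup>2 * (ucm c)\<^sup>2 / (2 * psi c * (lcs c)\<^sup>2)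
      + 144 * ((cA2 c)\<^sup>2 + 1) * C4 c \<alpha> * (ucm c)\<^sup>2) * (real \<tau>)\<^sup>2"

definition C17 :: "'v constants \<Rightarrow> real \<Rightarrow> real" where
  "C17 c \<alpha> = 3 * cA1 c * C3 c + 8 * (cA1 c)\<^sup>2 * C4 c \<alpha> + C5 c \<alpha> + C6 c \<alpha>"

text \<open>The denominator of \<open>v = \<phi>\<^sub>2 / (80 \<cdot> tA2 \<cdot> C17 \<cdot> ucm\<^sup>2)\<close>.\<close>

definition vden :: "'v constants \<Rightarrow> real \<Rightarrow> real" where
  "vden c \<alpha> = 80 * tA2 c * C17 c \<alpha> * (ucm c)\<^sup>2"

text \<open>For \<open>rho = 0\<close> the library conventions give \<open>log 0 \<alpha> = 0\<close>, the limit of \<open>log \<rho> \<alpha>\<close> as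
  \<open>\<rho>\<close> tends to \<open>0\<close> from the right.\<close>

definition mix_time :: "'v constants \<Rightarrow> real \<Rightarrow> nat" where
  "mix_time c \<alpha> = nat \<lceil>2 * log (rho c) \<alpha>\<rceil>"

text \<open>A bound \<open>x \<le> p / q\<close> is written \<open>x * q \<le> p\<close> whenever \<open>q\<close> can vanish (for \<open>\<tau> = 0\<close>,
  \<open>K = 1\<close> or \<open>A\<^sub>2 = 0\<close>), so that \<open>q = 0\<close> means no restriction; in HOL \<open>p / 0\<close> would be \<open>0\<close>.\<close>

definition step_size_ok :: "'v constants \<Rightarrow> real \<Rightarrow> nat \<Rightarrow> nat \<Rightarrow> bool" where
  "step_size_ok c \<alpha> \<tau> K \<longleftrightarrow>
     \<alpha> * (360 * real \<tau> * ((cA2 c)\<^sup>2 + 1)) \<le> 1 \<and>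
     \<alpha> * (2 * C15 c \<alpha> \<tau>) \<le> phi2 c \<and>
     \<alpha>\<^sup>2 \<le> 1 / (phi2 c)\<^sup>2 \<and>
     \<alpha>\<^sup>2 * (2 * (1 + tA1 c) * (real K - 1)\<^sup>2) \<le> ln (5 / 4) \<and>
     \<alpha>\<^sup>2 * (log (rho c) \<alpha> + 1) * (2 * (real K)\<^sup>2 * vden c \<alpha>) \<le> phi2 c \<and>
     \<alpha>\<^sup>2 * (log (rho c) \<alpha> + 1) ^ 3 * exp (\<alpha> * phi2 c * (2 * log (rho c) \<alpha> + 1))
         * (4 * real K * vden c \<alpha>)
       \<le> phi2 c * exp (- phi2 c * sqrt (ln (5 / 4) / (2 * (1 + tA1 c)))) \<and>
     \<alpha> * real \<tau> \<le> 1 / (24 * sqrt ((cA2 c)\<^sup>2 + 1)) \<and>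
     \<alpha> * real \<tau> \<le> 1 / (8 * (cA2 c + 1)) \<and>
     \<alpha> \<le> 1 / C1 c \<and>
     \<alpha> * (8 * real \<tau> * C2 c) \<le> 1 \<and>
     \<alpha> * (40 * real \<tau> * (C1 c)\<^sup>2) \<le> 1"

definition step_size :: "'v constants \<Rightarrow> nat \<Rightarrow> nat \<Rightarrow> real" where
  "step_size c N T = 8 * ln (real N * real T) / (real T * phi2 c)"

definition admissible :: "'v constants \<Rightarrow> nat \<Rightarrow> nat \<Rightarrow> nat \<Rightarrow> bool" where
  "admissible c N T K \<longleftrightarrow>
     1 \<le> N \<and> 1 \<le> K \<and> N < T \<and>
     4 * mix_time c (step_size c N T) < T \<and>
     step_size_ok c (step_size c N T) (mix_time c (step_size c N T)) K"


section \<open>Federated instances and the algorithm\<close>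

text \<open>Agents are \<open>0, \<dots>, nag - 1\<close>. Agent \<open>i\<close> has state space \<open>spc i\<close>, transition kernel
  \<open>ker i\<close> and noise \<open>noise i t\<close>, a random variable on \<open>prb\<close>; \<open>fixl i\<close> stands for \<open>\<theta>\<^sup>i\<^sup>,\<^sup>*\<close> and
  \<open>fixg\<close> for \<open>\<theta>\<^sup>*\<close>.\<close>

record ('v, 's, 'w) fed =
  nag :: nat
  spc :: "nat \<Rightarrow> 's measure"
  ker :: "nat \<Rightarrow> 's \<Rightarrow> 's measure"
  prb :: "'w measure"
  noise :: "nat \<Rightarrow> nat \<Rightarrow> 'w \<Rightarrow> 's"
  opG :: "nat \<Rightarrow> 'v \<Rightarrow> 's \<Rightarrow> 'v"
  opb :: "nat \<Rightarrow> 's \<Rightarrow> 'v"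
  Gbar :: "nat \<Rightarrow> 'v \<Rightarrow> 'v"
  bbar :: "nat \<Rightarrow> 'v"
  fixl :: "nat \<Rightarrow> 'v"
  fixg :: 'v

definition agent_avg :: "nat \<Rightarrow> (nat \<Rightarrow> 'v::real_vector) \<Rightarrow> 'v" where
  "agent_avg N x = (1 / real N) *\<^sub>R (\<Sum>i<N. x i)"

primrec theta :: "('v::real_vector, 's, 'w) fed \<Rightarrow> 'v \<Rightarrow> real \<Rightarrow> nat \<Rightarrow> nat \<Rightarrow> nat \<Rightarrow> 'w \<Rightarrow> 'v" where
  "theta I \<theta>0 \<alpha> K 0 = (\<lambda>i \<omega>. \<theta>0)"
| "theta I \<theta>0 \<alpha> K (Suc t) = (\<lambda>i \<omega>.
     let local = (\<lambda>j. theta I \<theta>0 \<alpha> K t j \<omega> +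
           \<alpha> *\<^sub>R (opG I j (theta I \<theta>0 \<alpha> K t j \<omega>) (noise I j t \<omega>)
                  - theta I \<theta>0 \<alpha> K t j \<omega> + opb I j (noise I j t \<omega>)))
     in if K dvd Suc t then agent_avg (nag I) local else local i)"

definition theta_avg :: "('v::real_vector, 's, 'w) fed \<Rightarrow> 'v \<Rightarrow> real \<Rightarrow> nat \<Rightarrow> nat \<Rightarrow> 'w \<Rightarrow> 'v" where
  "theta_avg I \<theta>0 \<alpha> K t \<omega> = agent_avg (nag I) (\<lambda>i. theta I \<theta>0 \<alpha> K t i \<omega>)"

definition comm_rounds :: "nat \<Rightarrow> nat \<Rightarrow> nat" where
  "comm_rounds T K = card {t. t < T \<and> K dvd Suc t}"

definition eta :: "('v::real_vector) constants \<Rightarrow> ('v, 's, 'w) fed \<Rightarrow> nat \<Rightarrow> real" where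
  "eta c I i = nrm_c c (fixl I i - fixg I)"

definition heterogeneity :: "('v::real_vector) constants \<Rightarrow> ('v, 's, 'w) fed \<Rightarrow> real" where
  "heterogeneity c I = (1 / real (nag I)) * (\<Sum>i<nag I. eta c I i)"


section \<open>Sigma-algebras and Markov noise\<close>

definition gen_alg :: "'w measure \<Rightarrow> 'p set \<Rightarrow> ('p \<Rightarrow> 's measure) \<Rightarrow> ('p \<Rightarrow> 'w \<Rightarrow> 's) \<Rightarrow> 'w measure" where
  "gen_alg M P S X = sigma (space M) (\<Union>p\<in>P. {X p -` A \<inter> space M | A. A \<in> sets (S p)})"

definition iter_filtration ::
    "('v::euclidean_space, 's, 'w) fed \<Rightarrow> 'v \<Rightarrow> real \<Rightarrow> nat \<Rightarrow> nat \<Rightarrow> 'w measure" where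
  "iter_filtration I \<theta>0 \<alpha> K t =
     gen_alg (prb I) ({..<nag I} \<times> {..t}) (\<lambda>_. borel) (\<lambda>(i, r). theta I \<theta>0 \<alpha> K r i)"

definition noise_filtration :: "('v, 's, 'w) fed \<Rightarrow> nat \<Rightarrow> 'w measure" where
  "noise_filtration I t =
     gen_alg (prb I) ({..<nag I} \<times> {..t}) (\<lambda>(i, r). spc I i) (\<lambda>(i, r). noise I i r)"

text \<open>Each agent's noise is a time-homogeneous Markov chain with respect to the joint past of all
  agents.\<close>

definition markov_noise :: "('v, 's, 'w) fed \<Rightarrow> bool" where
  "markov_noise I \<longleftrightarrow>
     prob_space (prb I) \<and>
     (\<forall>i<nag I.
        ker I i \<in> spc I i \<rightarrow>\<^sub>M prob_algebra (spc I i) \<and>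
        (\<forall>t. noise I i t \<in> prb I \<rightarrow>\<^sub>M spc I i) \<and>
        (\<forall>t. \<forall>A\<in>sets (spc I i).
           AE \<omega> in prb I.
             real_cond_exp (prb I) (noise_filtration I t)
               (\<lambda>\<omega>. indicator A (noise I i (Suc t) \<omega>)) \<omega>
             = measure (ker I i (noise I i t \<omega>)) A))"

text \<open>Law at time \<open>t\<close> of agent \<open>i\<close>'s chain when it is started from state \<open>y\<close>.\<close>

primrec state_law :: "('v, 's, 'w) fed \<Rightarrow> nat \<Rightarrow> 's \<Rightarrow> nat \<Rightarrow> 's measure" where
  "state_law I i y 0 = return (spc I i) y"
| "state_law I i y (Suc t) = bind (state_law I i y t) (ker I i)"


section \<open>Assumptions\<close>

definition fixed_points :: "('v::real_vector, 's, 'w) fed \<Rightarrow> bool" where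
  "fixed_points I \<longleftrightarrow>
     (\<forall>i<nag I. Gbar I i (fixl I i) + bbar I i = fixl I i) \<and>
     agent_avg (nag I) (\<lambda>i. Gbar I i (fixg I)) = fixg I"

text \<open>The expectations are those of the chains started from arbitrary states, so that the Markov
  property turns the bounds into bounds conditional on the past. Bounds for one initial law only would not do: a chain that never leaves its random
  initial state can satisfy them.\<close>

definition mixing :: "('v::euclidean_space) constants \<Rightarrow> ('v, 's, 'w) fed \<Rightarrow> bool" where
  "mixing c I \<longleftrightarrow>
     (\<forall>i<nag I. \<forall>y\<in>space (spc I i).
        (\<forall>\<theta>. (\<lambda>t. \<integral>z. opG I i \<theta> z \<partial>state_law I i y t) \<longlonglongrightarrow> Gbar I i \<theta>) \<and>
        (\<lambda>t. \<integral>z. opb I i z \<partial>state_law I i y t) \<longlonglongrightarrow> bbar I i \<and>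
        (\<forall>\<theta> t. nrm_c c (Gbar I i \<theta> - (\<integral>z. opG I i \<theta> z \<partial>state_law I i y t))
                 \<le> m1 c * nrm_c c \<theta> * rho c ^ t) \<and>
        (\<forall>t. nrm_c c (\<integral>z. opb I i z \<partial>state_law I i y t)
                 \<le> m2 c * rho c ^ t + m3 c * eta c I i)) \<and>
     (\<forall>y. (\<forall>i<nag I. y i \<in> space (spc I i)) \<longrightarrow>
        (\<forall>t. nrm_c c (agent_avg (nag I) (\<lambda>i. \<integral>z. opb I i z \<partial>state_law I i (y i) t))
                 \<le> m4 c * rho c ^ t))"

definition contraction :: "('v::real_vector) constants \<Rightarrow> ('v, 's, 'w) fed \<Rightarrow> bool" where
  "contraction c I \<longleftrightarrow>
     (\<forall>i<nag I. \<forall>x y. nrm_c c (Gbar I i x - Gbar I i y) \<le> gam c * nrm_c c (x - y))"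

definition lipschitz_bounded :: "('v::euclidean_space) constants \<Rightarrow> ('v, 's, 'w) fed \<Rightarrow> bool" where
  "lipschitz_bounded c I \<longleftrightarrow>
     (\<forall>i<nag I.
        (\<forall>\<theta>. opG I i \<theta> \<in> borel_measurable (spc I i)) \<and> opb I i \<in> borel_measurable (spc I i) \<and>
        (\<forall>z\<in>space (spc I i).
           (\<forall>x y. nrm_c c (opG I i x z - opG I i y z) \<le> cA1 c * nrm_c c (x - y)) \<and>
           (\<forall>x. nrm_c c (opG I i x z) \<le> cA2 c * nrm_c c x) \<and>
           nrm_c c (opb I i z) \<le> cB c))"

definition independent_agents ::
    "('v::euclidean_space, 's, 'w) fed \<Rightarrow> 'v \<Rightarrow> real \<Rightarrow> nat \<Rightarrow> bool" where
  "independent_agents I \<theta>0 \<alpha> K \<longleftrightarrow>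
     (\<forall>i<nag I. \<forall>j<nag I. i \<noteq> j \<longrightarrow>
        (\<forall>t. \<forall>r\<le>t. \<forall>f\<in>borel_measurable (spc I i). \<forall>g\<in>borel_measurable (spc I j).
           bounded (f ` space (spc I i)) \<longrightarrow> bounded (g ` space (spc I j)) \<longrightarrow>
           (AE \<omega> in prb I.
              real_cond_exp (prb I) (iter_filtration I \<theta>0 \<alpha> K (t - r))
                (\<lambda>\<omega>. f (noise I i t \<omega>) * g (noise I j t \<omega>)) \<omega>
              = real_cond_exp (prb I) (iter_filtration I \<theta>0 \<alpha> K (t - r))
                  (\<lambda>\<omega>. f (noise I i t \<omega>) :: real) \<omega>
                * real_cond_exp (prb I) (iter_filtration I \<theta>0 \<alpha> K (t - r))
                  (\<lambda>\<omega>. g (noise I j t \<omega>) :: real) \<omega>)))"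

definition c_fsam :: "'v constants \<Rightarrow> real \<Rightarrow> real" where
  "c_fsam c \<alpha> = 1 - \<alpha> * phi2 c / 2"

text \<open>\<open>That\<close> is the random output time; the noise variables are all the other randomness.\<close>

definition output_time ::
    "'v constants \<Rightarrow> ('v, 's, 'w) fed \<Rightarrow> real \<Rightarrow> nat \<Rightarrow> ('w \<Rightarrow> nat) \<Rightarrow> bool" where
  "output_time c I \<alpha> T That \<longleftrightarrow>
     (\<forall>t<T. measure (prb I) {\<omega> \<in> space (prb I). That \<omega> = t}
              = inverse (c_fsam c \<alpha>) ^ t / (\<Sum>t'<T. inverse (c_fsam c \<alpha>) ^ t')) \<and>
     That \<in> prb I \<rightarrow>\<^sub>M count_space UNIV \<and>
     prob_space.indep_set (prb I)
       {That -` A \<inter> space (prb I) | A. A \<in> UNIV}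
       (sets (gen_alg (prb I) ({..<nag I} \<times> UNIV) (\<lambda>(i, t). spc I i) (\<lambda>(i, t). noise I i t)))"

definition fegsam ::
    "('v::euclidean_space) constants \<Rightarrow> 'v \<Rightarrow> ('v, 's, 'w) fed \<Rightarrow> real \<Rightarrow> nat \<Rightarrow> nat \<Rightarrow> ('w \<Rightarrow> nat) \<Rightarrow> bool"
  where
  "fegsam c \<theta>0 I \<alpha> K T That \<longleftrightarrow>
     markov_noise I \<and> fixed_points I \<and> mixing c I \<and> contraction c I \<and> lipschitz_bounded c I \<and>
     independent_agents I \<theta>0 \<alpha> K \<and> output_time c I \<alpha> T That"

definition output_error ::
    "('v::euclidean_space) constants \<Rightarrow> 'v \<Rightarrow> ('v, 's, 'w) fed \<Rightarrow> real \<Rightarrow> nat \<Rightarrow> ('w \<Rightarrow> nat) \<Rightarrow> real" where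
  "output_error c \<theta>0 I \<alpha> K That =
     (\<integral>\<omega>. (nrm_c c (theta_avg I \<theta>0 \<alpha> K (That \<omega>) \<omega>))\<^sup>2 \<partial>prb I)"


section \<open>Orders up to logarithmic factors\<close>

text \<open>Functions of the number \<open>N\<close> of agents and the target accuracy \<open>e\<close>; the hidden constants
  are uniform in both.\<close>

definition soft_O :: "(nat \<Rightarrow> real \<Rightarrow> real) \<Rightarrow> (nat \<Rightarrow> real \<Rightarrow> real) \<Rightarrow> bool" where
  "soft_O f g \<longleftrightarrow>
     (\<exists>(C::real) (p::nat). \<forall>N\<ge>1. \<forall>e>0. \<bar>f N e\<bar> \<le> C * \<bar>g N e\<bar> * (1 + ln (1 + \<bar>g N e\<bar>)) ^ p)"

definition soft_Theta :: "(nat \<Rightarrow> real \<Rightarrow> real) \<Rightarrow> (nat \<Rightarrow> real \<Rightarrow> real) \<Rightarrow> bool" where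
  "soft_Theta f g \<longleftrightarrow> soft_O f g \<and> soft_O g f"

end

theory Submission imports Defs "HOL-Real_Asymp.Real_Asymp" begin

text \<open>The iterates are a linear filter of the operators and the noise, so \<open>\<theta> = X + W\<close> with \<open>W\<close> the response to
  the centred noise alone. The remainder \<open>X\<close> contracts pathwise in the given norm, and no smooth Lyapunov
  function is needed: only \<open>W\<close> is estimated in the Euclidean norm. Correlations of \<open>W\<close> with the noise are
  small because, with the parameter frozen \<open>m = O(ln (1 / \<alpha>))\<close> steps back, the noise has mixed up to
  \<open>\<alpha>\<close>. For the averaged iterate, conditional independence of the agents reduces the variance to order
  \<open>\<alpha> m / N + (\<alpha> m)\<^sup>2\<close>. The deviation of the agents from their average is controlled by restarting
  the filter at every communication round. Sampling with geometric weights makes the initial error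
  polynomially small in \<open>N T\<close>, which leaves an error of order \<open>ln\<^sup>4 T / (N T)\<close>; it is at most \<open>e\<close> as soon as
  \<open>T \<ge> D x (1 + ln (1 + x))\<^sup>4\<close> with \<open>x = 1 / (N e)\<close>.\<close>

section \<open>Averages over the agents and the local filter\<close>

lemma agent_avg_add: "agent_avg N (\<lambda>i. x i + y i) = agent_avg N x + agent_avg N y"
  by (simp add: agent_avg_def sum.distrib scaleR_add_right)

lemma agent_avg_diff: "agent_avg N (\<lambda>i. x i - y i) = agent_avg N x - agent_avg N y"
  by (simp add: agent_avg_def sum_subtractf scaleR_diff_right)

lemma agent_avg_scaleR: "agent_avg N (\<lambda>i. a *\<^sub>R x i) = a *\<^sub>R agent_avg N x"
  by (simp add: agent_avg_def scaleR_sum_right[symmetric] mult.commute)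

lemma agent_avg_mult: "agent_avg N (\<lambda>i. a * x i) = a * agent_avg N (x :: nat \<Rightarrow> real)"
  by (simp add: agent_avg_def sum_distrib_left[symmetric])

lemma agent_avg_const: "1 \<le> N \<Longrightarrow> agent_avg N (\<lambda>i. x) = x"
  by (simp add: agent_avg_def sum_constant_scaleR)

lemma agent_avg_zero [simp]: "agent_avg N (\<lambda>i. 0) = 0"
  by (simp add: agent_avg_def)

lemma agent_avg_cong: "(\<And>i. i < N \<Longrightarrow> x i = y i) \<Longrightarrow> agent_avg N x = agent_avg N y"
  by (simp add: agent_avg_def)

lemma agent_avg_mono:
  "(\<And>i. i < N \<Longrightarrow> x i \<le> y i) \<Longrightarrow> agent_avg N x \<le> agent_avg N (y :: nat \<Rightarrow> real)"
  by (auto simp: agent_avg_def intro!: divide_right_mono sum_mono)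

lemma agent_avg_nonneg: "(\<And>i. i < N \<Longrightarrow> 0 \<le> x i) \<Longrightarrow> 0 \<le> agent_avg N (x :: nat \<Rightarrow> real)"
  by (auto simp: agent_avg_def intro!: divide_nonneg_nonneg sum_nonneg)

lemma norm_agent_avg_le: "norm (agent_avg N x) \<le> agent_avg N (\<lambda>i. norm (x i))"
  by (simp add: agent_avg_def divide_right_mono norm_sum)

lemma agent_avg_sum: "agent_avg N (\<lambda>i. \<Sum>r\<in>R. x r i) = (\<Sum>r\<in>R. agent_avg N (x r))"
  unfolding agent_avg_def by (subst sum.swap) (simp add: scaleR_sum_right)

lemma is_norm_simps:
  assumes "is_norm nrm"
  shows "0 \<le> nrm x" "nrm (a *\<^sub>R x) = \<bar>a\<bar> * nrm x" "nrm (x + y) \<le> nrm x + nrm y" "nrm 0 = 0"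
  using assms by (auto simp: is_norm_def)

lemma is_norm_agent_avg_le:
  assumes "is_norm nrm"
  shows "nrm (agent_avg N x) \<le> agent_avg N (\<lambda>i. nrm (x i))"
proof -
  have "nrm (\<Sum>i<n. x i) \<le> (\<Sum>i<n. nrm (x i))" for n
    by (induction n) (auto simp: is_norm_simps[OF assms] intro: order_trans[OF is_norm_simps(3)[OF assms]])
  then show ?thesis
    by (simp add: agent_avg_def is_norm_simps[OF assms] divide_right_mono)
qed

lemma agent_avg_power2_le: "(agent_avg N x)\<^sup>2 \<le> agent_avg N (\<lambda>i. (x i :: real)\<^sup>2)"
proof (cases "N = 0")
  case False
  have "(\<Sum>i<N. x i)\<^sup>2 \<le> real N * (\<Sum>i<N. (x i)\<^sup>2)"
    using sum_squared_le_sum_of_squares[of x "{..<N}"] by (simp add: mult.commute)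
  with False show ?thesis
    by (simp add: agent_avg_def power_divide field_simps power2_eq_square)
qed (simp add: agent_avg_def)

lemma is_norm_agent_avg_power2_le:
  assumes "is_norm nrm"
  shows "(nrm (agent_avg N x))\<^sup>2 \<le> agent_avg N (\<lambda>i. (nrm (x i))\<^sup>2)"
proof -
  have "(nrm (agent_avg N x))\<^sup>2 \<le> (agent_avg N (\<lambda>i. nrm (x i)))\<^sup>2"
    by (intro power_mono is_norm_agent_avg_le is_norm_simps(1) assms)
  also have "\<dots> \<le> agent_avg N (\<lambda>i. (nrm (x i))\<^sup>2)" by (rule agent_avg_power2_le)
  finally show ?thesis .
qed

lemma is_norm_norm: "is_norm (norm :: 'v::real_normed_vector \<Rightarrow> real)"
  by (auto simp: is_norm_def norm_triangle_ineq)

lemmas norm_agent_avg_power2_le = is_norm_agent_avg_power2_le[OF is_norm_norm]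

lemma agent_avg_variance_le:
  fixes x :: "nat \<Rightarrow> 'v::real_inner"
  assumes "1 \<le> N"
  shows "agent_avg N (\<lambda>i. (norm (x i - agent_avg N x))\<^sup>2) \<le> agent_avg N (\<lambda>i. (norm (x i))\<^sup>2)"
proof -
  define a where "a = agent_avg N x"
  have S: "(\<Sum>i<N. x i) = real N *\<^sub>R a" using assms by (simp add: a_def agent_avg_def)
  have "(\<Sum>i<N. (norm (x i - a))\<^sup>2) = (\<Sum>i<N. (norm (x i))\<^sup>2 - 2 * (x i \<bullet> a) + (norm a)\<^sup>2)"
    by (simp add: power2_norm_eq_inner inner_diff_left inner_diff_right inner_commute algebra_simps)
  also have "\<dots> = (\<Sum>i<N. (norm (x i))\<^sup>2) - 2 * ((\<Sum>i<N. x i) \<bullet> a) + real N * (norm a)\<^sup>2"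
    by (simp add: sum.distrib sum_subtractf sum_distrib_left inner_sum_left)
  also have "\<dots> \<le> (\<Sum>i<N. (norm (x i))\<^sup>2)"
    by (simp add: S power2_norm_eq_inner)
  finally show ?thesis
    by (simp add: agent_avg_def a_def divide_right_mono)
qed

lemma power2_sum_le: "(a + b)\<^sup>2 \<le> 2 * a\<^sup>2 + 2 * (b::real)\<^sup>2"
  using sum_squares_bound[of a b] by (simp add: power2_sum)

lemma norm_add_power2_le:
  fixes x y :: "'v::real_normed_vector"
  shows "(norm (x + y))\<^sup>2 \<le> 2 * (norm x)\<^sup>2 + 2 * (norm y)\<^sup>2"
  by (meson norm_ge_zero norm_triangle_ineq order_trans power2_sum_le power_mono)

lemma convex_power2_le:
  assumes "0 < p" "p < 1"
  shows "((1 - p) * a + b)\<^sup>2 \<le> (1 - p) * a\<^sup>2 + (b::real)\<^sup>2 / p"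
proof -
  have "(1 - p) * a\<^sup>2 + b\<^sup>2 / p - ((1 - p) * a + b)\<^sup>2 = (1 - p) * (p * a - b)\<^sup>2 / p"
    using assms by (simp add: field_simps power2_eq_square)
  also have "\<dots> \<ge> 0" using assms by simp
  finally show ?thesis by simp
qed

lemma inner_young:
  fixes x y :: "'v::real_inner"
  assumes "0 < k"
  shows "x \<bullet> y \<le> (k * (norm x)\<^sup>2 + (norm y)\<^sup>2 / k) / 2"
proof -
  have "x \<bullet> y \<le> norm x * norm y" by (rule norm_cauchy_schwarz)
  moreover have "0 \<le> (k * norm x - norm y)\<^sup>2 / k" using assms by simp
  moreover have "(k * norm x - norm y)\<^sup>2 / k = k * (norm x)\<^sup>2 + (norm y)\<^sup>2 / k - 2 * (norm x * norm y)"
    using assms by (simp add: field_simps power2_eq_square)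
  ultimately have "2 * (norm x * norm y) \<le> k * (norm x)\<^sup>2 + (norm y)\<^sup>2 / k" by simp
  with \<open>x \<bullet> y \<le> norm x * norm y\<close> show ?thesis by simp
qed

locale fed_steps =
  fixes N K :: nat and \<alpha> :: real
  assumes N1: "1 \<le> N" and K1: "1 \<le> K" and \<alpha>_pos: "0 < \<alpha>" and \<alpha>_le: "\<alpha> \<le> 1/2"
begin

abbreviation "av \<equiv> agent_avg N"

text \<open>The input \<open>u\<close> is smoothed locally; a communication round replaces the local values by
  \<open>l\<close> times their average, so \<open>l = 1\<close> averages and \<open>l = 0\<close> restarts from zero.\<close>

primrec local_filter :: "real \<Rightarrow> 'v::real_vector \<Rightarrow> (nat \<Rightarrow> nat \<Rightarrow> 'v) \<Rightarrow> nat \<Rightarrow> nat \<Rightarrow> 'v" where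
  "local_filter l y0 u 0 = (\<lambda>i. y0)"
| "local_filter l y0 u (Suc t) = (\<lambda>i.
     if K dvd Suc t then l *\<^sub>R av (\<lambda>j. (1 - \<alpha>) *\<^sub>R local_filter l y0 u t j + \<alpha> *\<^sub>R u t j)
     else (1 - \<alpha>) *\<^sub>R local_filter l y0 u t i + \<alpha> *\<^sub>R u t i)"

lemma local_filter_add:
  "local_filter l (y0 + y1) (\<lambda>t i. u t i + w t i) t i = local_filter l y0 u t i + local_filter l y1 w t i"
proof (induction t arbitrary: i)
  case (Suc t)
  then show ?case
    by (simp add: scaleR_add_right[symmetric] agent_avg_add[symmetric])
      (simp add: algebra_simps)
qed simp

lemma av_local_filter_Suc:
  "av (local_filter 1 y0 u (Suc t)) = (1 - \<alpha>) *\<^sub>R av (local_filter 1 y0 u t) + \<alpha> *\<^sub>R av (u t)"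
  using N1 by (cases "K dvd Suc t") (auto simp: agent_avg_const agent_avg_add agent_avg_scaleR)

lemma is_norm_local_filter_Suc_le:
  assumes "is_norm nrm" "l = 0 \<or> l = 1"
  shows "av (\<lambda>i. (nrm (local_filter l y0 u (Suc t) i))\<^sup>2)
     \<le> av (\<lambda>i. (nrm ((1 - \<alpha>) *\<^sub>R local_filter l y0 u t i + \<alpha> *\<^sub>R u t i))\<^sup>2)"
proof (cases "K dvd Suc t")
  case True
  show ?thesis
    using assms(2)
  proof
    assume "l = 0"
    with True show ?thesis by (simp add: agent_avg_nonneg is_norm_simps[OF assms(1)])
  next
    assume "l = 1"
    with True N1 show ?thesis
      using is_norm_agent_avg_power2_le[OF assms(1)] by (simp add: agent_avg_const)
  qed
qed simp

text \<open>The filter at time \<open>t\<close> if the local updates after time \<open>s\<close> were ignored: only the effect of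
  communication rounds in between is kept.\<close>

definition frozen :: "real \<Rightarrow> 'v::real_vector \<Rightarrow> (nat \<Rightarrow> nat \<Rightarrow> 'v) \<Rightarrow> nat \<Rightarrow> nat \<Rightarrow> nat \<Rightarrow> 'v" where
  "frozen l y0 u s t i =
     (if \<exists>r. s < r \<and> r \<le> t \<and> K dvd r then l *\<^sub>R av (local_filter l y0 u s) else local_filter l y0 u s i)"

lemma av_frozen_power2_le:
  fixes y0 :: "'v::real_normed_vector"
  assumes "l = 0 \<or> l = 1"
  shows "av (\<lambda>i. (norm (frozen l y0 u s t i))\<^sup>2) \<le> av (\<lambda>i. (norm (local_filter l y0 u s i))\<^sup>2)"
proof -
  have "frozen l y0 u s t = (\<lambda>i. l *\<^sub>R av (local_filter l y0 u s)) \<or> frozen l y0 u s t = local_filter l y0 u s"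
    by (auto simp: frozen_def fun_eq_iff)
  then show ?thesis
    using assms N1 norm_agent_avg_power2_le[of N "local_filter l y0 u s"]
    by (auto simp: agent_avg_const agent_avg_nonneg)
qed

lemma norm_av_local_filter_diff_le:
  fixes y0 :: "'v::real_normed_vector"
  assumes "s \<le> t"
  shows "norm (av (local_filter 1 y0 u t) - av (local_filter 1 y0 u s))
    \<le> \<alpha> * (\<Sum>r\<in>{s..<t}. norm (av (\<lambda>i. u r i - local_filter 1 y0 u r i)))"
  using assms
proof (induction t rule: dec_induct)
  case (step t)
  have "av (local_filter 1 y0 u (Suc t)) - av (local_filter 1 y0 u s)
      = (av (local_filter 1 y0 u t) - av (local_filter 1 y0 u s)) + \<alpha> *\<^sub>R av (\<lambda>i. u t i - local_filter 1 y0 u t i)"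
    unfolding av_local_filter_Suc by (simp add: agent_avg_diff algebra_simps)
  then have "norm (av (local_filter 1 y0 u (Suc t)) - av (local_filter 1 y0 u s))
      \<le> norm (av (local_filter 1 y0 u t) - av (local_filter 1 y0 u s)) + norm (\<alpha> *\<^sub>R av (\<lambda>i. u t i - local_filter 1 y0 u t i))"
    by (metis norm_triangle_ineq)
  with step show ?case using \<alpha>_pos by (simp add: distrib_left)
qed simp

lemma norm_local_filter_frozen_le:
  fixes y0 :: "'v::real_normed_vector"
  assumes l: "l = 0 \<or> l = 1" and "s \<le> t"
  shows "norm (local_filter l y0 u t i - frozen l y0 u s t i)
    \<le> \<alpha> * (\<Sum>r\<in>{s..<t}. norm (u r i - local_filter l y0 u r i) + av (\<lambda>j. norm (u r j - local_filter l y0 u r j)))"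
  using assms(2)
proof (induction t rule: dec_induct)
  case base
  have "frozen l y0 u s s i = local_filter l y0 u s i" by (auto simp: frozen_def)
  then show ?case by simp
next
  case (step t)
  let ?h = "\<lambda>r. norm (u r i - local_filter l y0 u r i)" and ?a = "\<lambda>r. av (\<lambda>j. norm (u r j - local_filter l y0 u r j))"
  have noise_term: "0 \<le> ?h r" "0 \<le> ?a r" for r by (auto intro: agent_avg_nonneg)
  show ?case
  proof (cases "K dvd Suc t")
    case True
    then have fz: "frozen l y0 u s (Suc t) i = l *\<^sub>R av (local_filter l y0 u s)"
      using step.hyps by (auto simp: frozen_def)
    show ?thesis
      using l
    proof
      assume "l = 0"
      then show ?thesis using True fz \<alpha>_pos noise_term
        by (simp add: sum_nonneg add_nonneg_nonneg)
    next
      assume l1: "l = 1"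
      have "local_filter l y0 u (Suc t) i = av (local_filter 1 y0 u (Suc t))"
        using True l1 N1 by (simp add: agent_avg_const)
      then have "norm (local_filter l y0 u (Suc t) i - frozen l y0 u s (Suc t) i)
          \<le> \<alpha> * (\<Sum>r\<in>{s..<Suc t}. norm (av (\<lambda>i. u r i - local_filter 1 y0 u r i)))"
        unfolding fz using l1 norm_av_local_filter_diff_le[of s "Suc t" y0 u] step.hyps by simp
      also have "\<dots> \<le> \<alpha> * (\<Sum>r\<in>{s..<Suc t}. ?h r + ?a r)"
        using \<alpha>_pos noise_term l1 norm_agent_avg_le[of N]
        by (intro mult_left_mono sum_mono) (auto intro!: add_increasing)
      finally show ?thesis .
    qed
  next
    case False
    then have fz: "frozen l y0 u s (Suc t) i = frozen l y0 u s t i"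
      by (auto simp: frozen_def le_Suc_eq)
    have "local_filter l y0 u (Suc t) i - frozen l y0 u s (Suc t) i
       = (local_filter l y0 u t i - frozen l y0 u s t i) + \<alpha> *\<^sub>R (u t i - local_filter l y0 u t i)"
      using False by (simp add: fz algebra_simps)
    then have "norm (local_filter l y0 u (Suc t) i - frozen l y0 u s (Suc t) i)
       \<le> norm (local_filter l y0 u t i - frozen l y0 u s t i) + \<alpha> * ?h t"
      using \<alpha>_pos norm_triangle_ineq by (smt (verit) norm_scaleR)
    also have "\<dots> \<le> \<alpha> * (\<Sum>r\<in>{s..<t}. ?h r + ?a r) + \<alpha> * (?h t + ?a t)"
      using step.IH noise_term \<alpha>_pos by (intro add_mono mult_left_mono) auto
    also have "\<dots> = \<alpha> * (\<Sum>r\<in>{s..<Suc t}. ?h r + ?a r)"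
      using step.hyps by (simp add: distrib_left)
    finally show ?thesis .
  qed
qed

lemma av_local_filter_frozen_power2_le:
  fixes y0 :: "'v::real_normed_vector"
  assumes l: "l = 0 \<or> l = 1" and "s \<le> t" "t - s \<le> m"
  shows "av (\<lambda>i. (norm (local_filter l y0 u t i - frozen l y0 u s t i))\<^sup>2)
    \<le> 4 * \<alpha>\<^sup>2 * real m * (\<Sum>r\<in>{s..<t}. av (\<lambda>i. (norm (u r i - local_filter l y0 u r i))\<^sup>2))"
proof -
  let ?h = "\<lambda>r i. norm (u r i - local_filter l y0 u r i)"
  have "(norm (local_filter l y0 u t i - frozen l y0 u s t i))\<^sup>2
      \<le> \<alpha>\<^sup>2 * real m * (\<Sum>r\<in>{s..<t}. 2 * (?h r i)\<^sup>2 + 2 * av (\<lambda>j. (?h r j)\<^sup>2))" for i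
  proof -
    have "(norm (local_filter l y0 u t i - frozen l y0 u s t i))\<^sup>2 \<le> (\<alpha> * (\<Sum>r\<in>{s..<t}. ?h r i + av (?h r)))\<^sup>2"
      by (intro power_mono norm_local_filter_frozen_le assms) auto
    also have "\<dots> \<le> \<alpha>\<^sup>2 * (real (t - s) * (\<Sum>r\<in>{s..<t}. (?h r i + av (?h r))\<^sup>2))"
      using sum_squared_le_sum_of_squares[of "\<lambda>r. ?h r i + av (?h r)" "{s..<t}"]
      by (simp add: power_mult_distrib mult_left_mono mult.commute)
    also have "\<dots> \<le> \<alpha>\<^sup>2 * (real m * (\<Sum>r\<in>{s..<t}. 2 * (?h r i)\<^sup>2 + 2 * av (\<lambda>j. (?h r j)\<^sup>2)))"
      using assms(3)
      by (intro mult_left_mono mult_mono sum_mono order_trans[OF power2_sum_le] add_mono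
          agent_avg_power2_le sum_nonneg) auto
    finally show ?thesis by (simp add: mult.assoc)
  qed
  then have "av (\<lambda>i. (norm (local_filter l y0 u t i - frozen l y0 u s t i))\<^sup>2)
     \<le> av (\<lambda>i. \<alpha>\<^sup>2 * real m * (\<Sum>r\<in>{s..<t}. 2 * (?h r i)\<^sup>2 + 2 * av (\<lambda>j. (?h r j)\<^sup>2)))"
    by (intro agent_avg_mono)
  also have "\<dots> = \<alpha>\<^sup>2 * real m * (\<Sum>r\<in>{s..<t}. 4 * av (\<lambda>j. (?h r j)\<^sup>2))"
    using N1 by (simp add: agent_avg_mult agent_avg_sum agent_avg_add agent_avg_const)
  finally show ?thesis by (simp add: sum_distrib_left[symmetric] algebra_simps)
qed

lemma consensus_le:
  fixes y0 :: "'v::real_inner"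
  shows "av (\<lambda>i. (norm (local_filter 1 y0 u t i - av (local_filter 1 y0 u t)))\<^sup>2) \<le> av (\<lambda>i. (norm (local_filter 0 0 u t i))\<^sup>2)"
proof -
  have "\<exists>p. \<forall>i. local_filter 1 y0 u t i = p + local_filter 0 0 u t i"
  proof (induction t)
    case (Suc t)
    then obtain p where p: "\<And>i. local_filter 1 y0 u t i = p + local_filter 0 0 u t i" by blast
    show ?case
      by (cases "K dvd Suc t")
        (auto simp: p algebra_simps intro: exI[of _ "p - \<alpha> *\<^sub>R p"])
  qed auto
  then obtain p where p: "\<And>i. local_filter 1 y0 u t i = p + local_filter 0 0 u t i" by blast
  have "av (local_filter 1 y0 u t) = p + av (local_filter 0 0 u t)"
    using N1 by (simp add: p[abs_def] agent_avg_add agent_avg_const)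
  then show ?thesis
    using agent_avg_variance_le[OF N1, of "local_filter 0 0 u t"] by (simp add: p)
qed

lemma norm_local_filter_0_le:
  fixes u :: "nat \<Rightarrow> nat \<Rightarrow> 'v::real_normed_vector"
  shows "norm (local_filter 0 0 u t i) \<le> \<alpha> * (\<Sum>r\<in>{t - t mod K..<t}. norm (u r i))"
proof (induction t)
  case (Suc t)
  show ?case
  proof (cases "K dvd Suc t")
    case True
    then show ?thesis by (simp add: mod_eq_0_iff_dvd)
  next
    case False
    then have "Suc t mod K = Suc (t mod K)" by (auto simp: mod_Suc dvd_eq_mod_eq_0 split: if_splits)
    then have s: "{Suc t - Suc t mod K..<Suc t} = insert t {t - t mod K..<t}"
      by auto
    have "norm (local_filter 0 0 u (Suc t) i) \<le> (1 - \<alpha>) * norm (local_filter 0 0 u t i) + \<alpha> * norm (u t i)"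
      using False \<alpha>_pos \<alpha>_le norm_triangle_ineq[of "(1 - \<alpha>) *\<^sub>R local_filter 0 0 u t i" "\<alpha> *\<^sub>R u t i"]
      by simp
    also have "\<dots> \<le> norm (local_filter 0 0 u t i) + \<alpha> * norm (u t i)"
      using \<alpha>_pos by (simp add: algebra_simps)
    finally show ?thesis using Suc.IH by (simp only: s) (simp add: algebra_simps)
  qed
qed simp

lemma av_local_filter_0_power2_le:
  fixes u :: "nat \<Rightarrow> nat \<Rightarrow> 'v::real_normed_vector"
  shows "av (\<lambda>i. (norm (local_filter 0 0 u t i))\<^sup>2)
    \<le> \<alpha>\<^sup>2 * real K * (\<Sum>r\<in>{t - t mod K..<t}. av (\<lambda>i. (norm (u r i))\<^sup>2))"
proof -
  have "(norm (local_filter 0 0 u t i))\<^sup>2 \<le> \<alpha>\<^sup>2 * real K * (\<Sum>r\<in>{t - t mod K..<t}. (norm (u r i))\<^sup>2)" for i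
  proof -
    have "(norm (local_filter 0 0 u t i))\<^sup>2 \<le> (\<alpha> * (\<Sum>r\<in>{t - t mod K..<t}. norm (u r i)))\<^sup>2"
      by (intro power_mono norm_local_filter_0_le) auto
    also have "\<dots> \<le> \<alpha>\<^sup>2 * (real (t mod K) * (\<Sum>r\<in>{t - t mod K..<t}. (norm (u r i))\<^sup>2))"
      using sum_squared_le_sum_of_squares[of "\<lambda>r. norm (u r i)" "{t - t mod K..<t}"]
      by (simp add: power_mult_distrib mult_left_mono mult.commute)
    also have "\<dots> \<le> \<alpha>\<^sup>2 * (real K * (\<Sum>r\<in>{t - t mod K..<t}. (norm (u r i))\<^sup>2))"
      using K1 by (intro mult_left_mono mult_right_mono sum_nonneg) (auto simp: less_imp_le)
    finally show ?thesis by (simp add: mult.assoc)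
  qed
  then have "av (\<lambda>i. (norm (local_filter 0 0 u t i))\<^sup>2)
     \<le> av (\<lambda>i. \<alpha>\<^sup>2 * real K * (\<Sum>r\<in>{t - t mod K..<t}. (norm (u r i))\<^sup>2))"
    by (intro agent_avg_mono)
  then show ?thesis by (simp add: agent_avg_mult agent_avg_sum)
qed

end

section \<open>Bounded random variables and conditional expectations\<close>

definition bounded_rv :: "'w measure \<Rightarrow> ('w \<Rightarrow> 'b::euclidean_space) \<Rightarrow> bool" where
  "bounded_rv F X \<longleftrightarrow> X \<in> borel_measurable F \<and> (\<exists>C. \<forall>\<omega>\<in>space F. norm (X \<omega>) \<le> C)"

lemma bounded_rv_cong:
  assumes "\<And>\<omega>. \<omega> \<in> space F \<Longrightarrow> X \<omega> = Y \<omega>"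
  shows "bounded_rv F X \<longleftrightarrow> bounded_rv F Y"
  using measurable_cong[of F X Y borel, OF assms] assms by (auto simp: bounded_rv_def)

lemma bounded_rvI: "X \<in> borel_measurable F \<Longrightarrow> (\<And>\<omega>. \<omega> \<in> space F \<Longrightarrow> norm (X \<omega>) \<le> C) \<Longrightarrow> bounded_rv F X"
  by (auto simp: bounded_rv_def)

lemma bounded_rv_measurable: "bounded_rv F X \<Longrightarrow> X \<in> borel_measurable F"
  by (simp add: bounded_rv_def)

lemma bounded_rv_bound:
  assumes "bounded_rv F X"
  obtains C where "0 \<le> C" "\<And>\<omega>. \<omega> \<in> space F \<Longrightarrow> norm (X \<omega>) \<le> C"
proof -
  obtain C where C: "\<forall>\<omega>\<in>space F. norm (X \<omega>) \<le> C" using assms by (auto simp: bounded_rv_def)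
  show ?thesis by (rule that[of "max 0 C"]) (use C in auto)
qed

lemma bounded_rv_mono:
  "bounded_rv F X \<Longrightarrow> subalgebra M F \<Longrightarrow> bounded_rv M X"
  unfolding bounded_rv_def using measurable_from_subalg[of M F X borel]
  by (metis subalgebra_def)

lemma bounded_rv_const: "bounded_rv F (\<lambda>\<omega>. x)"
  by (auto simp: bounded_rv_def)

lemma bounded_rv_add:
  assumes "bounded_rv F X" "bounded_rv F Y"
  shows "bounded_rv F (\<lambda>\<omega>. X \<omega> + Y \<omega>)"
proof -
  obtain C where C: "\<And>\<omega>. \<omega> \<in> space F \<Longrightarrow> norm (X \<omega>) \<le> C" using assms(1) by (rule bounded_rv_bound) blast
  obtain D where D: "\<And>\<omega>. \<omega> \<in> space F \<Longrightarrow> norm (Y \<omega>) \<le> D" using assms(2) by (rule bounded_rv_bound) blast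
  show ?thesis
  proof (rule bounded_rvI)
    show "(\<lambda>\<omega>. X \<omega> + Y \<omega>) \<in> borel_measurable F"
      by (rule borel_measurable_add) (rule bounded_rv_measurable, fact)+
    show "norm (X \<omega> + Y \<omega>) \<le> C + D" if "\<omega> \<in> space F" for \<omega>
      by (rule norm_triangle_mono) (rule C D, fact)+
  qed
qed

lemma bounded_rv_inner:
  assumes "bounded_rv F X" "bounded_rv F Y"
  shows "bounded_rv F (\<lambda>\<omega>. X \<omega> \<bullet> Y \<omega>)"
proof -
  obtain C where C: "\<And>\<omega>. \<omega> \<in> space F \<Longrightarrow> norm (X \<omega>) \<le> C" using assms(1) by (rule bounded_rv_bound) blast
  obtain D where D: "0 \<le> D" "\<And>\<omega>. \<omega> \<in> space F \<Longrightarrow> norm (Y \<omega>) \<le> D" using assms(2) by (rule bounded_rv_bound) blast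
  show ?thesis
  proof (rule bounded_rvI)
    show "(\<lambda>\<omega>. X \<omega> \<bullet> Y \<omega>) \<in> borel_measurable F"
      by (rule borel_measurable_inner) (rule bounded_rv_measurable, fact)+
    show "norm (X \<omega> \<bullet> Y \<omega>) \<le> \<bar>C\<bar> * D" if "\<omega> \<in> space F" for \<omega>
      using Cauchy_Schwarz_ineq2[of "X \<omega>" "Y \<omega>"] mult_mono[OF C[OF that] D(2)[OF that]]
        mult_right_mono[OF abs_ge_self[of C] D(1)] order_trans[OF norm_ge_zero C[OF that]] by simp
  qed
qed

lemma bounded_rv_scaleR:
  assumes "bounded_rv F (X :: _ \<Rightarrow> real)" "bounded_rv F Y"
  shows "bounded_rv F (\<lambda>\<omega>. X \<omega> *\<^sub>R Y \<omega>)"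
proof -
  obtain C where C: "\<And>\<omega>. \<omega> \<in> space F \<Longrightarrow> norm (X \<omega>) \<le> C" using assms(1) by (rule bounded_rv_bound) blast
  obtain D where D: "0 \<le> D" "\<And>\<omega>. \<omega> \<in> space F \<Longrightarrow> norm (Y \<omega>) \<le> D" using assms(2) by (rule bounded_rv_bound) blast
  show ?thesis
  proof (rule bounded_rvI)
    show "(\<lambda>\<omega>. X \<omega> *\<^sub>R Y \<omega>) \<in> borel_measurable F"
      by (rule borel_measurable_scaleR) (rule bounded_rv_measurable, fact)+
    show "norm (X \<omega> *\<^sub>R Y \<omega>) \<le> \<bar>C\<bar> * D" if "\<omega> \<in> space F" for \<omega>
      using mult_mono[OF C[OF that] D(2)[OF that]]
        mult_right_mono[OF abs_ge_self[of C] D(1)] order_trans[OF norm_ge_zero C[OF that]] by simp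
  qed
qed

lemma bounded_rv_mult:
  "bounded_rv F (X :: _ \<Rightarrow> real) \<Longrightarrow> bounded_rv F Y \<Longrightarrow> bounded_rv F (\<lambda>\<omega>. X \<omega> * Y \<omega>)"
  using bounded_rv_inner[of F X Y] by simp

lemma bounded_rv_norm: "bounded_rv F X \<Longrightarrow> bounded_rv F (\<lambda>\<omega>. norm (X \<omega>))"
  by (auto simp: bounded_rv_def)

lemma bounded_rv_power2: "bounded_rv F (X :: _ \<Rightarrow> real) \<Longrightarrow> bounded_rv F (\<lambda>\<omega>. (X \<omega>)\<^sup>2)"
  unfolding power2_eq_square by (rule bounded_rv_mult)

lemma bounded_rv_scale: "bounded_rv F X \<Longrightarrow> bounded_rv F (\<lambda>\<omega>. a *\<^sub>R X \<omega>)"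
  by (intro bounded_rv_scaleR bounded_rv_const)

lemma bounded_rv_cmult: "bounded_rv F (X :: _ \<Rightarrow> real) \<Longrightarrow> bounded_rv F (\<lambda>\<omega>. a * X \<omega>)"
  by (intro bounded_rv_mult bounded_rv_const)

lemma bounded_rv_divide: "bounded_rv F (X :: _ \<Rightarrow> real) \<Longrightarrow> bounded_rv F (\<lambda>\<omega>. X \<omega> / a)"
  using bounded_rv_cmult[of F X "1 / a"] by simp

lemma bounded_rv_diff:
  "bounded_rv F X \<Longrightarrow> bounded_rv F Y \<Longrightarrow> bounded_rv F (\<lambda>\<omega>. X \<omega> - Y \<omega>)"
  using bounded_rv_add[of F X "\<lambda>\<omega>. (- 1) *\<^sub>R Y \<omega>"] bounded_rv_scale[of F Y "-1"] by simp

lemma bounded_rv_sum: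
  "(\<And>r. r \<in> R \<Longrightarrow> bounded_rv F (X r)) \<Longrightarrow> bounded_rv F (\<lambda>\<omega>. \<Sum>r\<in>R. X r \<omega>)"
  by (induction R rule: infinite_finite_induct) (auto intro: bounded_rv_const bounded_rv_add)

lemma bounded_rv_agent_avg:
  "(\<And>i. i < N \<Longrightarrow> bounded_rv F (X i)) \<Longrightarrow> bounded_rv F (\<lambda>\<omega>. agent_avg N (\<lambda>i. X i \<omega>))"
  unfolding agent_avg_def by (intro bounded_rv_scale bounded_rv_sum) auto

lemma bounded_rv_if: "bounded_rv F X \<Longrightarrow> bounded_rv F Y \<Longrightarrow> bounded_rv F (\<lambda>\<omega>. if b then X \<omega> else Y \<omega>)"
  by (cases b) simp_all

lemma bounded_rv_eq:
  assumes "X \<in> borel_measurable F"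
  shows "bounded_rv F (\<lambda>\<omega>. of_bool (X \<omega> = (a :: 'b::euclidean_space)) :: real)"
  using assms by (intro bounded_rvI[where C = 1]) auto

lemmas bounded_rv_intros = bounded_rv_add bounded_rv_diff bounded_rv_mult bounded_rv_inner bounded_rv_scaleR
  bounded_rv_norm bounded_rv_power2 bounded_rv_agent_avg bounded_rv_sum bounded_rv_divide bounded_rv_if
  bounded_rv_const

lemma is_norm_continuous:
  fixes nrm :: "'v::euclidean_space \<Rightarrow> real"
  assumes "is_norm nrm" "\<And>x. nrm x \<le> A * norm x"
  shows "continuous_on S nrm"
proof -
  have le: "nrm x - nrm y \<le> A * norm (x - y)" for x y
    using is_norm_simps(3)[OF assms(1), of "x - y" y] assms(2)[of "x - y"] by simp
  have "A-lipschitz_on S nrm" if "0 \<le> A"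
  proof (intro lipschitz_onI that)
    fix x y show "dist (nrm x) (nrm y) \<le> A * dist x y"
      using le[of x y] le[of y x] by (simp add: dist_norm norm_minus_commute[of y x])
  qed
  moreover have "0 \<le> A"
  proof -
    obtain b :: 'v where "b \<in> Basis" using nonempty_Basis by blast
    then show ?thesis using assms(2)[of b] is_norm_simps(1)[OF assms(1), of b] by simp
  qed
  ultimately show ?thesis using lipschitz_on_continuous_on by blast
qed

lemma bounded_rv_is_norm:
  fixes nrm :: "'v::euclidean_space \<Rightarrow> real"
  assumes "is_norm nrm" "\<And>x. nrm x \<le> A * norm x" "bounded_rv F X"
  shows "bounded_rv F (\<lambda>\<omega>. nrm (X \<omega>))"
proof -
  obtain C where C: "0 \<le> C" "\<And>\<omega>. \<omega> \<in> space F \<Longrightarrow> norm (X \<omega>) \<le> C"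
    using bounded_rv_bound[OF assms(3)] by blast
  have "nrm (X \<omega>) \<le> \<bar>A\<bar> * C" if "\<omega> \<in> space F" for \<omega>
    using order_trans[OF assms(2)[of "X \<omega>"] mult_mono[OF abs_ge_self C(2)[OF that]]] by simp
  moreover have "(\<lambda>\<omega>. nrm (X \<omega>)) \<in> borel_measurable F"
    using borel_measurable_continuous_onI[OF is_norm_continuous[OF assms(1,2)]] assms(3)
    by (auto dest: bounded_rv_measurable intro: measurable_compose)
  ultimately show ?thesis
    using is_norm_simps(1)[OF assms(1)] by (intro bounded_rvI[where C = "\<bar>A\<bar> * C"]) auto
qed

text \<open>The assumptions on the noise speak about deterministic parameters; they reach random ones through
  finite-valued approximations.\<close>

lemma bounded_rv_round:
  fixes X :: "'w \<Rightarrow> 'b::euclidean_space"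
  assumes X: "bounded_rv F X" and e: "0 < e"
  obtains X' where "X' \<in> borel_measurable F" "finite (X' ` space F)"
    "\<And>\<omega>. \<omega> \<in> space F \<Longrightarrow> norm (X \<omega> - X' \<omega>) \<le> e"
proof -
  define d where "d = e / real DIM('b)"
  have d: "0 < d" using e by (simp add: d_def)
  obtain C where C: "0 \<le> C" "\<And>\<omega>. \<omega> \<in> space F \<Longrightarrow> norm (X \<omega>) \<le> C"
    using bounded_rv_bound[OF X] by blast
  define g where "g k = (\<Sum>b\<in>Basis. (d * real_of_int (k b)) *\<^sub>R b)" for k :: "'b \<Rightarrow> int"
  define X' where "X' \<omega> = (\<Sum>b\<in>Basis. (d * real_of_int \<lfloor>(X \<omega> \<bullet> b) / d\<rfloor>) *\<^sub>R b)" for \<omega>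
  define n where "n = \<lceil>C / d\<rceil> + 1"
  have [measurable]: "X \<in> borel_measurable F" using X by (rule bounded_rv_measurable)
  have [measurable]: "X' \<in> borel_measurable F"
    unfolding X'_def[abs_def] by measurable
  have "X' \<omega> \<in> g ` (Basis \<rightarrow>\<^sub>E {-n..n})" if "\<omega> \<in> space F" for \<omega>
  proof
    let ?k = "restrict (\<lambda>b. \<lfloor>(X \<omega> \<bullet> b) / d\<rfloor>) Basis"
    show "X' \<omega> = g ?k" by (simp add: X'_def g_def)
    show "?k \<in> Basis \<rightarrow>\<^sub>E {-n..n}"
    proof (intro restrict_PiE[THEN iffD2] Pi_I)
      fix b :: 'b assume "b \<in> Basis"
      then have "\<bar>X \<omega> \<bullet> b\<bar> \<le> C" using Basis_le_norm C(2)[OF that] order_trans by blast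
      then have "\<bar>(X \<omega> \<bullet> b) / d\<bar> \<le> C / d" using d by (simp add: divide_right_mono)
      then have "- n \<le> \<lfloor>(X \<omega> \<bullet> b) / d\<rfloor>" "\<lfloor>(X \<omega> \<bullet> b) / d\<rfloor> \<le> n"
        unfolding n_def by linarith+
      then show "\<lfloor>(X \<omega> \<bullet> b) / d\<rfloor> \<in> {-n..n}" by simp
    qed
  qed
  then have fin: "finite (X' ` space F)"
    by (rule finite_subset[OF image_subsetI finite_imageI[OF finite_PiE]]) simp_all
  have "norm (X \<omega> - X' \<omega>) \<le> e" for \<omega>
  proof -
    have "X \<omega> - X' \<omega> = (\<Sum>b\<in>Basis. (X \<omega> \<bullet> b - d * real_of_int \<lfloor>(X \<omega> \<bullet> b) / d\<rfloor>) *\<^sub>R b)"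
      by (simp add: X'_def euclidean_representation scaleR_diff_left sum_subtractf)
    also have "norm \<dots> \<le> (\<Sum>b\<in>(Basis::'b set). d)"
    proof (intro sum_norm_le)
      fix b :: 'b assume "b \<in> Basis"
      have "d * real_of_int \<lfloor>(X \<omega> \<bullet> b) / d\<rfloor> \<le> d * ((X \<omega> \<bullet> b) / d)"
        using d by (intro mult_left_mono) auto
      moreover have "(X \<omega> \<bullet> b) / d \<le> real_of_int \<lfloor>(X \<omega> \<bullet> b) / d\<rfloor> + 1" by linarith
      then have "d * ((X \<omega> \<bullet> b) / d) \<le> d * (real_of_int \<lfloor>(X \<omega> \<bullet> b) / d\<rfloor> + 1)"
        using d by (rule mult_left_mono[OF _ less_imp_le])
      ultimately have "\<bar>X \<omega> \<bullet> b - d * real_of_int \<lfloor>(X \<omega> \<bullet> b) / d\<rfloor>\<bar> \<le> d"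
        using d by (simp add: distrib_left)
      then show "norm ((X \<omega> \<bullet> b - d * real_of_int \<lfloor>(X \<omega> \<bullet> b) / d\<rfloor>) *\<^sub>R b) \<le> d"
        using \<open>b \<in> Basis\<close> by simp
    qed
    also have "\<dots> = e" by (simp add: d_def)
    finally show ?thesis .
  qed
  with fin show ?thesis by (intro that[of X']) auto
qed

lemma finite_valued_eq_sum:
  assumes "finite R" "x \<in> R"
  shows "h x = (\<Sum>a\<in>R. of_bool (x = a) * h a :: real)"
proof -
  have "(\<Sum>a\<in>R. of_bool (x = a) * h a) = (\<Sum>a\<in>R. if x = a then h a else 0)"
    by (intro sum.cong) auto
  with assms show ?thesis by simp
qed

lemma bounded_rv_caratheodory:
  fixes G :: "'b::euclidean_space \<Rightarrow> 's \<Rightarrow> 'c::euclidean_space"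
  assumes Z: "bounded_rv F Z" and Y: "Y \<in> F \<rightarrow>\<^sub>M S"
    and G: "\<And>x. G x \<in> borel_measurable S"
    and lip: "\<And>x x' y. y \<in> space S \<Longrightarrow> norm (G x y - G x' y) \<le> A * norm (x - x')"
    and bd: "\<And>y. y \<in> space S \<Longrightarrow> norm (G 0 y) \<le> B"
  shows "bounded_rv F (\<lambda>\<omega>. G (Z \<omega>) (Y \<omega>))"
proof -
  obtain C where C: "0 \<le> C" "\<And>\<omega>. \<omega> \<in> space F \<Longrightarrow> norm (Z \<omega>) \<le> C"
    using bounded_rv_bound[OF Z] by blast
  have YS: "Y \<omega> \<in> space S" if "\<omega> \<in> space F" for \<omega> using measurable_space[OF Y that] .
  have "norm (G (Z \<omega>) (Y \<omega>)) \<le> \<bar>A\<bar> * C + B" if "\<omega> \<in> space F" for \<omega>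
  proof -
    have "norm (G (Z \<omega>) (Y \<omega>)) \<le> norm (G (Z \<omega>) (Y \<omega>) - G 0 (Y \<omega>)) + norm (G 0 (Y \<omega>))"
      using norm_triangle_sub[of "G (Z \<omega>) (Y \<omega>)" "G 0 (Y \<omega>)"] by simp
    also have "\<dots> \<le> A * norm (Z \<omega>) + B"
      using lip[OF YS[OF that], of "Z \<omega>" 0] bd[OF YS[OF that]] by simp
    also have "A * norm (Z \<omega>) \<le> \<bar>A\<bar> * C" using C(2)[OF that] by (intro mult_mono) auto
    finally show ?thesis by simp
  qed
  moreover have "(\<lambda>\<omega>. G (Z \<omega>) (Y \<omega>)) \<in> borel_measurable F"
  proof -
    have "\<forall>n. \<exists>Z'. Z' \<in> borel_measurable F \<and> finite (Z' ` space F) \<and>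
        (\<forall>\<omega>\<in>space F. norm (Z \<omega> - Z' \<omega>) \<le> 1 / real (Suc n))"
    proof
      fix n show "\<exists>Z'. Z' \<in> borel_measurable F \<and> finite (Z' ` space F) \<and>
        (\<forall>\<omega>\<in>space F. norm (Z \<omega> - Z' \<omega>) \<le> 1 / real (Suc n))"
        by (rule bounded_rv_round[OF Z, of "1 / real (Suc n)"]) auto
    qed
    then obtain Zn where Zn: "\<And>n. Zn n \<in> borel_measurable F" "\<And>n. finite (Zn n ` space F)"
        "\<And>n \<omega>. \<omega> \<in> space F \<Longrightarrow> norm (Z \<omega> - Zn n \<omega>) \<le> 1 / real (Suc n)"
      unfolding choice_iff by blast
    show ?thesis
    proof (rule borel_measurable_LIMSEQ_metric)
      fix n
      have "Zn n \<in> F \<rightarrow>\<^sub>M count_space (Zn n ` space F)"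
        unfolding measurable_count_space_eq2[OF Zn(2)] using measurable_sets[OF Zn(1)] by auto
      then show "(\<lambda>\<omega>. G (Zn n \<omega>) (Y \<omega>)) \<in> borel_measurable F"
        using measurable_compose_countable'[where f = "\<lambda>x \<omega>. G x (Y \<omega>)" and g = "Zn n" and N = borel,
            OF measurable_compose[OF Y G] _ countable_finite[OF Zn(2)]] by simp
    next
      fix \<omega> assume \<omega>: "\<omega> \<in> space F"
      have "(\<lambda>n. \<bar>A\<bar> * (1 / real (Suc n))) \<longlonglongrightarrow> \<bar>A\<bar> * 0"
        by (intro tendsto_mult tendsto_const LIMSEQ_inverse_real_of_nat[unfolded inverse_eq_divide])
      moreover have "norm (G (Zn n \<omega>) (Y \<omega>) - G (Z \<omega>) (Y \<omega>)) \<le> \<bar>A\<bar> * (1 / real (Suc n))" for n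
      proof -
        have "norm (G (Zn n \<omega>) (Y \<omega>) - G (Z \<omega>) (Y \<omega>)) \<le> A * norm (Zn n \<omega> - Z \<omega>)"
          by (rule lip[OF YS[OF \<omega>]])
        also have "\<dots> \<le> \<bar>A\<bar> * (1 / real (Suc n))"
          using Zn(3)[OF \<omega>, of n] by (intro mult_mono) (auto simp: norm_minus_commute)
        finally show ?thesis .
      qed
      ultimately have "(\<lambda>n. G (Zn n \<omega>) (Y \<omega>) - G (Z \<omega>) (Y \<omega>)) \<longlonglongrightarrow> 0"
        using Lim_null_comparison[of "\<lambda>n. G (Zn n \<omega>) (Y \<omega>) - G (Z \<omega>) (Y \<omega>)" "\<lambda>n. \<bar>A\<bar> * (1 / real (Suc n))" sequentially]
        by (simp del: of_nat_Suc)
      then show "(\<lambda>n. G (Zn n \<omega>) (Y \<omega>)) \<longlonglongrightarrow> G (Z \<omega>) (Y \<omega>)"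
        by (rule LIM_zero_cancel)
    qed
  qed
  ultimately show ?thesis by (rule bounded_rvI[rotated])
qed

context prob_space
begin

lemma integrable_bounded_rv: "bounded_rv M X \<Longrightarrow> integrable M X"
  by (auto simp: bounded_rv_def intro: integrable_const_bound)

lemma bounded_rv_expectation_mono:
  assumes "bounded_rv M X" "bounded_rv M Y" "\<And>\<omega>. \<omega> \<in> space M \<Longrightarrow> X \<omega> \<le> (Y \<omega> :: real)"
  shows "expectation X \<le> expectation Y"
  using assms by (intro integral_mono integrable_bounded_rv) auto

lemma abs_expectation_le:
  fixes X :: "'a \<Rightarrow> real"
  assumes "\<And>\<omega>. \<omega> \<in> space M \<Longrightarrow> \<bar>X \<omega>\<bar> \<le> C" "0 \<le> C"
  shows "\<bar>expectation X\<bar> \<le> C"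
proof (cases "integrable M X")
  case True
  have "\<bar>expectation X\<bar> \<le> expectation (\<lambda>\<omega>. \<bar>X \<omega>\<bar>)" by (rule integral_abs_bound)
  also have "\<dots> \<le> expectation (\<lambda>\<omega>. C)" using True assms by (intro integral_mono) auto
  finally show ?thesis by (simp add: prob_space)
qed (simp add: not_integrable_integral_eq assms)

lemma expectation_agent_avg:
  assumes "\<And>i. i < N \<Longrightarrow> bounded_rv M (X i)"
  shows "expectation (\<lambda>\<omega>. agent_avg N (\<lambda>i. X i \<omega>)) = agent_avg N (\<lambda>i. expectation (X i))"
  unfolding agent_avg_def using assms by (simp add: integrable_bounded_rv)

text \<open>Characterising conditional expectations by test functions allows every bounded version of them,
  in particular the explicit ones given by the transition kernel.\<close>

definition cexp_of :: "'a measure \<Rightarrow> ('a \<Rightarrow> real) \<Rightarrow> ('a \<Rightarrow> real) \<Rightarrow> bool" where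
  "cexp_of F X C \<longleftrightarrow> bounded_rv F C \<and>
     (\<forall>W. bounded_rv F W \<longrightarrow> expectation (\<lambda>\<omega>. W \<omega> * X \<omega>) = expectation (\<lambda>\<omega>. W \<omega> * C \<omega>))"

lemma cexp_of_exists:
  assumes F: "subalgebra M F" and X: "bounded_rv M X"
  obtains C where "cexp_of F X C" "AE \<omega> in M. C \<omega> = real_cond_exp M F X \<omega>"
proof -
  interpret finite_measure_subalgebra M F by standard (rule F)
  obtain B where B: "0 \<le> B" "\<And>\<omega>. \<omega> \<in> space M \<Longrightarrow> norm (X \<omega>) \<le> B"
    using bounded_rv_bound[OF X] by blast
  define C where "C \<omega> = max (- B) (min B (real_cond_exp M F X \<omega>))" for \<omega>
  have iX: "integrable M X" using X by (rule integrable_bounded_rv)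
  have "AE \<omega> in M. real_cond_exp M F X \<omega> \<ge> - B" "AE \<omega> in M. real_cond_exp M F X \<omega> \<le> B"
    using B(2) by (intro real_cond_exp_ge_c real_cond_exp_le_c iX AE_I2; force simp: abs_le_iff)+
  then have AE: "AE \<omega> in M. C \<omega> = real_cond_exp M F X \<omega>"
    by eventually_elim (simp add: C_def)
  have C: "bounded_rv F C"
    using B(1) by (intro bounded_rvI[where C = B]) (auto simp: C_def[abs_def])
  have CM[measurable]: "C \<in> borel_measurable M" using C F by (auto dest: bounded_rv_measurable measurable_from_subalg)
  have "expectation (\<lambda>\<omega>. W \<omega> * X \<omega>) = expectation (\<lambda>\<omega>. W \<omega> * C \<omega>)" if W: "bounded_rv F W" for W
  proof -
    have WM: "bounded_rv M W" using W F by (rule bounded_rv_mono)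
    note [measurable] = bounded_rv_measurable[OF WM] bounded_rv_measurable[OF X]
    have "expectation (\<lambda>\<omega>. W \<omega> * X \<omega>) = expectation (\<lambda>\<omega>. W \<omega> * real_cond_exp M F X \<omega>)"
      using W X WM by (intro real_cond_exp_intg(2)[symmetric] integrable_bounded_rv bounded_rv_mult)
        (auto dest: bounded_rv_measurable)
    also have "\<dots> = expectation (\<lambda>\<omega>. W \<omega> * C \<omega>)"
      using AE by (intro integral_cong_AE) auto
    finally show ?thesis .
  qed
  with C AE show ?thesis by (intro that[of C]) (auto simp: cexp_of_def)
qed

lemma cexp_of_finite_valued:
  assumes F: "subalgebra M F" and Z: "Z \<in> borel_measurable F" "finite (Z ` space M)"
    and h: "\<And>a. bounded_rv M (h a)" and c: "\<And>a. cexp_of F (h a) (c a)"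
  shows "cexp_of F (\<lambda>\<omega>. h (Z \<omega> :: 'b::euclidean_space) \<omega>) (\<lambda>\<omega>. c (Z \<omega>) \<omega>)"
proof -
  let ?R = "Z ` space M"
  have sp: "space F = space M" using F by (simp add: subalgebra_def)
  have eq: "f (Z \<omega>) \<omega> = (\<Sum>a\<in>?R. of_bool (Z \<omega> = a) * f a \<omega>)" if "\<omega> \<in> space M" for \<omega> and f :: "'b \<Rightarrow> 'a \<Rightarrow> real"
    using finite_valued_eq_sum[OF Z(2), of "Z \<omega>" "\<lambda>a. f a \<omega>"] that by simp
  have "bounded_rv F (\<lambda>\<omega>. \<Sum>a\<in>?R. of_bool (Z \<omega> = a) * c a \<omega>)"
    using c Z by (intro bounded_rv_intros bounded_rv_eq) (auto simp: cexp_of_def)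
  then have b: "bounded_rv F (\<lambda>\<omega>. c (Z \<omega>) \<omega>)"
    by (rule bounded_rv_cong[THEN iffD1, rotated]) (simp add: sp eq[of _ c])
  have "expectation (\<lambda>\<omega>. W \<omega> * h (Z \<omega>) \<omega>) = expectation (\<lambda>\<omega>. W \<omega> * c (Z \<omega>) \<omega>)" if W: "bounded_rv F W" for W
  proof -
    have ind: "bounded_rv F (\<lambda>\<omega>. W \<omega> * of_bool (Z \<omega> = a))" for a
      using W Z by (intro bounded_rv_intros bounded_rv_eq)
    have indM: "bounded_rv M (\<lambda>\<omega>. W \<omega> * of_bool (Z \<omega> = a))" for a
      using ind F by (rule bounded_rv_mono)
    have cM: "bounded_rv M (c a)" for a
      using c F by (auto simp: cexp_of_def intro: bounded_rv_mono)
    have "expectation (\<lambda>\<omega>. W \<omega> * h (Z \<omega>) \<omega>) = expectation (\<lambda>\<omega>. \<Sum>a\<in>?R. (W \<omega> * of_bool (Z \<omega> = a)) * h a \<omega>)"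
      by (intro Bochner_Integration.integral_cong refl)
        (subst eq[of _ h], auto simp: sum_distrib_left mult.assoc)
    also have "\<dots> = (\<Sum>a\<in>?R. expectation (\<lambda>\<omega>. (W \<omega> * of_bool (Z \<omega> = a)) * h a \<omega>))"
      by (intro Bochner_Integration.integral_sum integrable_bounded_rv bounded_rv_mult[OF indM h])
    also have "\<dots> = (\<Sum>a\<in>?R. expectation (\<lambda>\<omega>. (W \<omega> * of_bool (Z \<omega> = a)) * c a \<omega>))"
      using c ind by (intro sum.cong) (auto simp: cexp_of_def)
    also have "\<dots> = expectation (\<lambda>\<omega>. \<Sum>a\<in>?R. (W \<omega> * of_bool (Z \<omega> = a)) * c a \<omega>)"
      by (intro Bochner_Integration.integral_sum[symmetric] integrable_bounded_rv bounded_rv_mult[OF indM cM])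
    also have "\<dots> = expectation (\<lambda>\<omega>. W \<omega> * c (Z \<omega>) \<omega>)"
      by (intro Bochner_Integration.integral_cong refl)
        (subst eq[of _ c], auto simp: sum_distrib_left mult.assoc)
    finally show ?thesis .
  qed
  with b show ?thesis by (auto simp: cexp_of_def)
qed

text \<open>Conditioning reduces the second moment; testing against \<open>C\<close> itself gives
  \<open>E C\<^sup>2 = E (C X) = E (C Y)\<close>.\<close>

lemma cexp_of_second_moment_le:
  assumes F: "subalgebra M F" and C: "cexp_of F X C" and Y: "bounded_rv M Y"
    and XY: "\<And>W. bounded_rv F W \<Longrightarrow> expectation (\<lambda>\<omega>. W \<omega> * X \<omega>) = expectation (\<lambda>\<omega>. W \<omega> * Y \<omega>)"
  shows "expectation (\<lambda>\<omega>. (C \<omega>)\<^sup>2) \<le> expectation (\<lambda>\<omega>. (Y \<omega>)\<^sup>2)"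
proof -
  have CF: "bounded_rv F C" and CM: "bounded_rv M C"
    using C F by (auto simp: cexp_of_def intro: bounded_rv_mono)
  have "expectation (\<lambda>\<omega>. (C \<omega>)\<^sup>2) = expectation (\<lambda>\<omega>. C \<omega> * X \<omega>)"
    using C CF by (simp add: cexp_of_def power2_eq_square)
  also have "\<dots> = expectation (\<lambda>\<omega>. C \<omega> * Y \<omega>)" by (rule XY[OF CF])
  also have "\<dots> \<le> expectation (\<lambda>\<omega>. ((C \<omega>)\<^sup>2 + (Y \<omega>)\<^sup>2) / 2)"
    using CM Y sum_squares_bound[of "C \<omega>" "Y \<omega>" for \<omega>]
    by (intro bounded_rv_expectation_mono bounded_rv_intros) (auto simp: field_simps)
  also have "\<dots> = (expectation (\<lambda>\<omega>. (C \<omega>)\<^sup>2) + expectation (\<lambda>\<omega>. (Y \<omega>)\<^sup>2)) / 2"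
    using CM Y by (simp add: integrable_bounded_rv bounded_rv_power2)
  finally show ?thesis by simp
qed

end

section \<open>Markovian noise\<close>

lemma eq_if_abs_diff_le:
  fixes a b :: real
  assumes "\<And>e. 0 < e \<Longrightarrow> \<bar>a - b\<bar> \<le> M * e" "0 \<le> M"
  shows "a = b"
proof (rule ccontr)
  assume "a \<noteq> b"
  define d where "d = \<bar>a - b\<bar>"
  have d: "0 < d" using \<open>a \<noteq> b\<close> by (simp add: d_def)
  have "d \<le> M * (d / (M + 1))" unfolding d_def using \<open>a \<noteq> b\<close> assms(2) by (intro assms(1)) simp
  also have "\<dots> < d" using d assms(2) by (simp add: field_simps)
  finally show False by simp
qed

lemma space_gen_alg [simp]: "space (gen_alg M Q S X) = space M"
  by (simp add: gen_alg_def space_measure_of_conv)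

lemma sets_gen_alg:
  "sets (gen_alg M Q S X) = sigma_sets (space M) (\<Union>p\<in>Q. {X p -` A \<inter> space M | A. A \<in> sets (S p)})"
  unfolding gen_alg_def by (rule sets_measure_of) auto

lemma measurable_gen_alg:
  assumes "p \<in> Q" "X p \<in> space M \<rightarrow> space (S p)"
  shows "X p \<in> gen_alg M Q S X \<rightarrow>\<^sub>M S p"
proof (rule measurableI)
  fix A assume "A \<in> sets (S p)"
  then have "X p -` A \<inter> space M \<in> sigma_sets (space M) (\<Union>p\<in>Q. {X p -` A \<inter> space M | A. A \<in> sets (S p)})"
    using assms(1) by (intro sigma_sets.Basic) auto
  then show "X p -` A \<inter> space (gen_alg M Q S X) \<in> sets (gen_alg M Q S X)"
    by (simp add: sets_gen_alg)
qed (use assms(2) in auto)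

lemma subalgebra_gen_alg:
  assumes "space F = space M" "\<And>p. p \<in> Q \<Longrightarrow> X p \<in> F \<rightarrow>\<^sub>M S p"
  shows "subalgebra F (gen_alg M Q S X)"
proof -
  have "(\<Union>p\<in>Q. {X p -` A \<inter> space M | A. A \<in> sets (S p)}) \<subseteq> sets F"
    using measurable_sets[OF assms(2)] assms(1) by auto
  from sets.sigma_sets_subset[OF this] show ?thesis
    by (simp add: subalgebra_def sets_gen_alg assms(1))
qed

lemma (in prob_space) cexp_of_sum:
  assumes F: "subalgebra M F" and X: "\<And>i. i \<in> R \<Longrightarrow> bounded_rv M (X i)"
    and c: "\<And>i. i \<in> R \<Longrightarrow> cexp_of F (X i) (C i)"
  shows "cexp_of F (\<lambda>\<omega>. \<Sum>i\<in>R. X i \<omega>) (\<lambda>\<omega>. \<Sum>i\<in>R. C i \<omega>)"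
  unfolding cexp_of_def
proof (intro conjI allI impI)
  show "bounded_rv F (\<lambda>\<omega>. \<Sum>i\<in>R. C i \<omega>)"
    using c by (intro bounded_rv_sum) (auto simp: cexp_of_def)
next
  fix W :: "'a \<Rightarrow> real" assume W: "bounded_rv F W"
  have WM: "bounded_rv M W" using W F by (rule bounded_rv_mono)
  have CM: "bounded_rv M (C i)" if "i \<in> R" for i
    using c[OF that] F by (auto simp: cexp_of_def intro: bounded_rv_mono)
  have "expectation (\<lambda>\<omega>. W \<omega> * (\<Sum>i\<in>R. X i \<omega>)) = (\<Sum>i\<in>R. expectation (\<lambda>\<omega>. W \<omega> * X i \<omega>))"
    unfolding sum_distrib_left by (intro Bochner_Integration.integral_sum integrable_bounded_rv bounded_rv_mult[OF WM X])
  also have "\<dots> = (\<Sum>i\<in>R. expectation (\<lambda>\<omega>. W \<omega> * C i \<omega>))"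
    using c W by (intro sum.cong) (auto simp: cexp_of_def)
  also have "\<dots> = expectation (\<lambda>\<omega>. W \<omega> * (\<Sum>i\<in>R. C i \<omega>))"
    unfolding sum_distrib_left by (intro Bochner_Integration.integral_sum[symmetric] integrable_bounded_rv bounded_rv_mult[OF WM CM])
  finally show "expectation (\<lambda>\<omega>. W \<omega> * (\<Sum>i\<in>R. X i \<omega>)) = expectation (\<lambda>\<omega>. W \<omega> * (\<Sum>i\<in>R. C i \<omega>))" .
qed

text \<open>\<open>\<xi> = 1\<close> treats the additive noise as part of the noise; \<open>\<xi> = 0\<close> treats it as
  a bounded drift, because heterogeneous agents have no mixing rate for it.\<close>

locale fed_run = fed_steps "nag I" K \<alpha>
  for I :: "('v::euclidean_space, 's, 'w) fed" and K :: nat and \<alpha> :: real +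
  fixes \<theta>0 :: 'v and nrm :: "'v \<Rightarrow> real" and A \<gamma> \<rho> \<xi> :: real
  assumes markov: "markov_noise I"
    and indep: "independent_agents I \<theta>0 \<alpha> K"
    and G_meas: "i < nag I \<Longrightarrow> opG I i x \<in> borel_measurable (spc I i)"
    and b_meas: "i < nag I \<Longrightarrow> opb I i \<in> borel_measurable (spc I i)"
    and G_lip: "i < nag I \<Longrightarrow> z \<in> space (spc I i) \<Longrightarrow> norm (opG I i x z - opG I i x' z) \<le> A * norm (x - x')"
    and G_le: "i < nag I \<Longrightarrow> z \<in> space (spc I i) \<Longrightarrow> norm (opG I i x z) \<le> A * norm x"
    and b_le: "i < nag I \<Longrightarrow> z \<in> space (spc I i) \<Longrightarrow> norm (opb I i z) \<le> A"
    and Gbar_lip: "i < nag I \<Longrightarrow> norm (Gbar I i x - Gbar I i x') \<le> A * norm (x - x')"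
    and Gbar_0: "i < nag I \<Longrightarrow> Gbar I i 0 = 0"
    and Gbar_nrm: "i < nag I \<Longrightarrow> nrm (Gbar I i x) \<le> \<gamma> * nrm x"
    and G_mix: "i < nag I \<Longrightarrow> y \<in> space (spc I i) \<Longrightarrow>
      norm (Gbar I i x - (\<integral>z. opG I i x z \<partial>state_law I i y t)) \<le> A * norm x * \<rho> ^ t"
    and b_mix_avg: "(\<And>i. i < nag I \<Longrightarrow> ys i \<in> space (spc I i)) \<Longrightarrow>
      norm (agent_avg (nag I) (\<lambda>i. \<integral>z. opb I i z \<partial>state_law I i (ys i) t)) \<le> A * \<rho> ^ t"
    and b_mix: "\<xi> = 1 \<Longrightarrow> i < nag I \<Longrightarrow> y \<in> space (spc I i) \<Longrightarrow>
      norm (\<integral>z. opb I i z \<partial>state_law I i y t) \<le> A * \<rho> ^ t"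
    and \<xi>01: "\<xi> = 0 \<or> \<xi> = 1"
    and nrm: "is_norm nrm" and nrm_le: "nrm x \<le> A * norm x" and norm_le: "norm x \<le> A * nrm x"
    and A1: "1 \<le> A" and \<gamma>0: "0 \<le> \<gamma>" and \<gamma>1: "\<gamma> < 1" and \<rho>0: "0 \<le> \<rho>"
begin

abbreviation "N \<equiv> nag I"
abbreviation "P \<equiv> prb I"
abbreviation "th \<equiv> theta I \<theta>0 \<alpha> K"
abbreviation "Fn \<equiv> noise_filtration I"
abbreviation "Fi \<equiv> iter_filtration I \<theta>0 \<alpha> K"

sublocale prob_space P
  using markov by (simp add: markov_noise_def)

lemma noise_measurable: "i < N \<Longrightarrow> noise I i t \<in> P \<rightarrow>\<^sub>M spc I i"
  using markov by (simp add: markov_noise_def)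

lemma noise_space: "i < N \<Longrightarrow> \<omega> \<in> space P \<Longrightarrow> noise I i t \<omega> \<in> space (spc I i)"
  using measurable_space[OF noise_measurable] .

lemma space_Fn [simp]: "space (Fn t) = space P"
  by (simp add: noise_filtration_def)

lemma noise_Fn: "i < N \<Longrightarrow> r \<le> t \<Longrightarrow> noise I i r \<in> Fn t \<rightarrow>\<^sub>M spc I i"
  unfolding noise_filtration_def
  using measurable_gen_alg[of "(i, r)" "{..<N} \<times> {..t}" "\<lambda>(i, r). noise I i r" P "\<lambda>(i, r). spc I i"] noise_space
  by auto

lemma subalgebra_Fn: "subalgebra P (Fn t)"
  unfolding noise_filtration_def by (rule subalgebra_gen_alg) (auto intro: noise_measurable)

lemma subalgebra_Fn_mono: "s \<le> t \<Longrightarrow> subalgebra (Fn t) (Fn s)"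
  unfolding noise_filtration_def[of I s] by (rule subalgebra_gen_alg) (auto intro!: noise_Fn)

lemma Fn_mono: "bounded_rv (Fn s) X \<Longrightarrow> s \<le> t \<Longrightarrow> bounded_rv (Fn t) X"
  by (rule bounded_rv_mono[OF _ subalgebra_Fn_mono])

lemma Fn_P: "bounded_rv (Fn s) X \<Longrightarrow> bounded_rv P X"
  by (rule bounded_rv_mono[OF _ subalgebra_Fn])

lemma G_rv:
  assumes "i < N" "bounded_rv F Z" "noise I i r \<in> F \<rightarrow>\<^sub>M spc I i"
  shows "bounded_rv F (\<lambda>\<omega>. opG I i (Z \<omega>) (noise I i r \<omega>))"
  using assms(2,3) G_meas[OF assms(1)] G_lip[OF assms(1)]
proof (rule bounded_rv_caratheodory)
  show "norm (opG I i 0 y) \<le> 0" if "y \<in> space (spc I i)" for y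
    using G_le[OF assms(1) that, of 0] by simp
qed

lemma b_rv:
  assumes "i < N" "noise I i r \<in> F \<rightarrow>\<^sub>M spc I i"
  shows "bounded_rv F (\<lambda>\<omega>. opb I i (noise I i r \<omega>))"
  using measurable_compose[OF assms(2) b_meas[OF assms(1)]] b_le[OF assms(1) measurable_space[OF assms(2)]]
  by (rule bounded_rvI)

lemma Gbar_rv:
  assumes "i < N" "bounded_rv F Z"
  shows "bounded_rv F (\<lambda>\<omega>. Gbar I i (Z \<omega>))"
  using bounded_rv_caratheodory[of F Z "\<lambda>_. ()" "count_space UNIV" "\<lambda>x _. Gbar I i x" A 0]
    Gbar_lip[OF assms(1)] Gbar_0[OF assms(1)] assms(2) by simp

lemma th_rv: "i < N \<Longrightarrow> bounded_rv (Fn t) (th t i)"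
proof (induction t arbitrary: i)
  case (Suc t)
  have loc: "bounded_rv (Fn (Suc t)) (\<lambda>\<omega>. th t j \<omega> + \<alpha> *\<^sub>R (opG I j (th t j \<omega>) (noise I j t \<omega>)
      - th t j \<omega> + opb I j (noise I j t \<omega>)))" if "j < N" for j
    using Fn_mono[OF Suc.IH[OF that], of "Suc t"] noise_Fn[OF that, of t "Suc t"] that
    by (auto intro!: bounded_rv_add bounded_rv_scale bounded_rv_diff G_rv b_rv)
  show ?case
    using loc Suc.prems by (cases "K dvd Suc t") (auto intro!: bounded_rv_agent_avg simp: Let_def)
qed (simp add: bounded_rv_const)

lemma space_Fi [simp]: "space (Fi t) = space P"
  by (simp add: iter_filtration_def)

lemma subalgebra_Fi_Fn: "subalgebra (Fn t) (Fi t)"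
  unfolding iter_filtration_def
  by (rule subalgebra_gen_alg) (auto intro!: bounded_rv_measurable Fn_mono[OF th_rv])

lemma subalgebra_Fi: "subalgebra P (Fi t)"
  using subalgebra_Fn[of t] subalgebra_Fi_Fn[of t] by (auto simp: subalgebra_def)

lemma th_Fi:
  assumes "i < N" "r \<le> t"
  shows "bounded_rv (Fi t) (th r i)"
proof -
  have "th r i \<in> borel_measurable (Fi t)"
    unfolding iter_filtration_def
    using measurable_gen_alg[of "(i, r)" "{..<N} \<times> {..t}" "\<lambda>(i, r). th r i" P "\<lambda>_. borel"] assms by auto
  moreover obtain C where "\<And>\<omega>. \<omega> \<in> space P \<Longrightarrow> norm (th r i \<omega>) \<le> C"
    using bounded_rv_bound[OF th_rv[OF assms(1), of r]] by auto
  ultimately show ?thesis by (intro bounded_rvI) auto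
qed

lemma state_law_kernel:
  assumes "i < N"
  shows "(\<lambda>y. state_law I i y m) \<in> spc I i \<rightarrow>\<^sub>M prob_algebra (spc I i)"
proof (induction m)
  case (Suc m)
  have "ker I i \<in> spc I i \<rightarrow>\<^sub>M prob_algebra (spc I i)"
    using markov assms by (simp add: markov_noise_def)
  from measurable_bind_prob_space[OF Suc this] show ?case by simp
qed simp

lemma ker_measurable:
  "i < N \<Longrightarrow> ker I i \<in> spc I i \<rightarrow>\<^sub>M prob_algebra (spc I i)"
  using markov by (simp add: markov_noise_def)

lemma state_law_space:
  assumes "i < N" "y \<in> space (spc I i)"
  shows "prob_space (state_law I i y m)" "sets (state_law I i y m) = sets (spc I i)"
    "space (state_law I i y m) = space (spc I i)"
proof -
  have "state_law I i y m \<in> space (prob_algebra (spc I i))"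
    using measurable_space[OF state_law_kernel[OF assms(1)] assms(2)] .
  then show "prob_space (state_law I i y m)" "sets (state_law I i y m) = sets (spc I i)"
    by (auto simp: space_prob_algebra)
  then show "space (state_law I i y m) = space (spc I i)" using sets_eq_imp_space_eq by blast
qed

lemma kernel_integral_measurable:
  fixes f :: "'s \<Rightarrow> 'b::euclidean_space"
  assumes "Q \<in> S \<rightarrow>\<^sub>M prob_algebra S" "f \<in> borel_measurable S"
  shows "(\<lambda>y. \<integral>z. f z \<partial>Q y) \<in> borel_measurable S"
  using measurable_compose[OF measurable_prob_algebraD[OF assms(1)] integral_measurable_subprob_algebra[OF assms(2)]] .

lemma kernel_integral_bound:
  fixes f :: "'s \<Rightarrow> real"
  assumes "Q \<in> S \<rightarrow>\<^sub>M prob_algebra S" "y \<in> space S" "\<And>z. z \<in> space S \<Longrightarrow> \<bar>f z\<bar> \<le> B" "0 \<le> B"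
  shows "\<bar>\<integral>z. f z \<partial>Q y\<bar> \<le> B"
proof -
  have "Q y \<in> space (prob_algebra S)" using measurable_space[OF assms(1,2)] .
  then have "prob_space (Q y)" "space (Q y) = space S"
    by (auto simp: space_prob_algebra dest: sets_eq_imp_space_eq)
  then show ?thesis using prob_space.abs_expectation_le[of "Q y" f B] assms(3,4) by auto
qed

lemma markov_step_indicator:
  fixes W :: "'w \<Rightarrow> real"
  assumes i: "i < N" and W: "bounded_rv (Fn t) W" and B: "B \<in> sets (spc I i)"
  shows "expectation (\<lambda>\<omega>. W \<omega> * indicator B (noise I i (Suc t) \<omega>))
    = expectation (\<lambda>\<omega>. W \<omega> * (\<integral>z. indicator B z \<partial>ker I i (noise I i t \<omega>)))"
proof -
  interpret finite_measure_subalgebra P "Fn t" by standard (rule subalgebra_Fn)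
  have WP: "bounded_rv P W" using W by (rule Fn_P)
  let ?X = "\<lambda>\<omega>. indicator B (noise I i (Suc t) \<omega>) :: real"
  have X: "bounded_rv P ?X"
    using measurable_compose[OF noise_measurable[OF i] borel_measurable_indicator[OF B]]
    by (rule bounded_rvI[where C = 1]) (auto simp: indicator_def)
  have km: "(\<lambda>\<omega>. \<integral>z. indicator B z \<partial>ker I i (noise I i t \<omega>) :: real) \<in> borel_measurable P"
    using measurable_compose[OF noise_measurable[OF i]
        kernel_integral_measurable[OF ker_measurable[OF i] borel_measurable_indicator[OF B]]] .
  have "expectation (\<lambda>\<omega>. W \<omega> * ?X \<omega>) = expectation (\<lambda>\<omega>. W \<omega> * real_cond_exp P (Fn t) ?X \<omega>)"
    using W X WP by (intro real_cond_exp_intg(2)[symmetric] integrable_bounded_rv bounded_rv_mult)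
      (auto dest: bounded_rv_measurable)
  also have "\<dots> = expectation (\<lambda>\<omega>. W \<omega> * (\<integral>z. indicator B z \<partial>ker I i (noise I i t \<omega>)))"
  proof (rule integral_cong_AE)
    have "AE \<omega> in P. real_cond_exp P (Fn t) ?X \<omega> = measure (ker I i (noise I i t \<omega>)) B"
      using markov i B unfolding markov_noise_def by blast
    then show "AE \<omega> in P. W \<omega> * real_cond_exp P (Fn t) ?X \<omega>
        = W \<omega> * (\<integral>z. indicator B z \<partial>ker I i (noise I i t \<omega>))"
      using AE_space
    proof eventually_elim
      fix \<omega> assume "\<omega> \<in> space P" and eq: "real_cond_exp P (Fn t) ?X \<omega> = measure (ker I i (noise I i t \<omega>)) B"
      then have "ker I i (noise I i t \<omega>) \<in> space (prob_algebra (spc I i))"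
        using measurable_space[OF ker_measurable[OF i]] noise_space[OF i] by blast
      then have "B \<inter> space (ker I i (noise I i t \<omega>)) = B"
        using B sets.sets_into_space by (auto simp: space_prob_algebra)
      then show "W \<omega> * real_cond_exp P (Fn t) ?X \<omega>
        = W \<omega> * (\<integral>z. indicator B z \<partial>ker I i (noise I i t \<omega>))"
        by (simp add: eq)
    qed
  qed (use bounded_rv_measurable[OF WP] km in auto)
  finally show ?thesis .
qed

lemma markov_step:
  fixes W :: "'w \<Rightarrow> real"
  assumes i: "i < N" and W: "bounded_rv (Fn t) W" and f: "bounded_rv (spc I i) (f :: 's \<Rightarrow> real)"
  shows "expectation (\<lambda>\<omega>. W \<omega> * f (noise I i (Suc t) \<omega>))
    = expectation (\<lambda>\<omega>. W \<omega> * (\<integral>z. f z \<partial>ker I i (noise I i t \<omega>)))" (is "?L f = ?R f")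
proof -
  obtain C where C: "0 \<le> C" "\<And>\<omega>. \<omega> \<in> space P \<Longrightarrow> \<bar>W \<omega>\<bar> \<le> C"
    using bounded_rv_bound[OF W] by auto
  obtain B where B: "0 \<le> B" "\<And>z. z \<in> space (spc I i) \<Longrightarrow> \<bar>f z\<bar> \<le> B"
    using bounded_rv_bound[OF f] by auto
  have WP: "bounded_rv P W" using W by (rule Fn_P)
  have kp: "prob_space (ker I i z)" "sets (ker I i z) = sets (spc I i)" "space (ker I i z) = space (spc I i)"
    if "z \<in> space (spc I i)" for z
    using measurable_space[OF ker_measurable[OF i] that]
    by (auto simp: space_prob_algebra dest: sets_eq_imp_space_eq)
  have rvL: "bounded_rv P (\<lambda>\<omega>. g (noise I i r \<omega>))" if g: "bounded_rv (spc I i) g" for g :: "'s \<Rightarrow> real" and r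
  proof -
    obtain B where "\<And>z. z \<in> space (spc I i) \<Longrightarrow> norm (g z) \<le> B" using bounded_rv_bound[OF g] by blast
    then have "norm (g (noise I i r \<omega>)) \<le> B" if "\<omega> \<in> space P" for \<omega>
      using noise_space[OF i that] by blast
    with measurable_compose[OF noise_measurable[OF i] bounded_rv_measurable[OF g]] show ?thesis
      by (rule bounded_rvI)
  qed
  have krv: "bounded_rv (spc I i) (\<lambda>y. \<integral>z. g z \<partial>ker I i y)" if g: "bounded_rv (spc I i) g" for g :: "'s \<Rightarrow> real"
  proof -
    obtain B where B: "0 \<le> B" "\<And>z. z \<in> space (spc I i) \<Longrightarrow> \<bar>g z\<bar> \<le> B" using bounded_rv_bound[OF g] by auto
    show ?thesis
      by (rule bounded_rvI[OF kernel_integral_measurable[OF ker_measurable[OF i] bounded_rv_measurable[OF g]], where C = B])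
        (use kernel_integral_bound[OF ker_measurable[OF i] _ B(2) B(1)] in auto)
  qed
  note rvR = rvL[OF krv]
  have close: "\<bar>?L f - ?R f\<bar> \<le> 2 * C * e" if e: "0 < e" for e
  proof -
    obtain f' where f': "f' \<in> borel_measurable (spc I i)" "finite (f' ` space (spc I i))"
      and fe: "\<And>z. z \<in> space (spc I i) \<Longrightarrow> norm (f z - f' z) \<le> e"
      using bounded_rv_round[OF f e] by blast
    have f'B: "\<bar>f' z\<bar> \<le> B + e" if "z \<in> space (spc I i)" for z
      using B(2)[OF that] fe[OF that] by (auto simp: abs_le_iff)
    have f'rv: "bounded_rv (spc I i) f'" using f'(1) f'B by (intro bounded_rvI[where C = "B + e"]) auto
    let ?V = "f' ` space (spc I i)"
    let ?D = "\<lambda>a. f' -` {a} \<inter> space (spc I i)"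
    have D: "?D a \<in> sets (spc I i)" for a using f'(1) by (auto intro: measurable_sets)
    have f'eq: "f' z = (\<Sum>a\<in>?V. a * indicator (?D a) z)" if "z \<in> space (spc I i)" for z
    proof -
      have "(\<Sum>a\<in>?V. a * indicator (?D a) z) = (\<Sum>a\<in>?V. of_bool (f' z = a) * a)"
        using that by (intro sum.cong) (auto simp: indicator_def)
      also have "\<dots> = f' z" using finite_valued_eq_sum[OF f'(2), of "f' z" "\<lambda>a. a"] that by simp
      finally show ?thesis by simp
    qed
    have irv: "bounded_rv (spc I i) (indicator (?D a) :: 's \<Rightarrow> real)" for a
      using D by (intro bounded_rvI[where C = 1]) (auto simp: indicator_def)
    have "?L f' = expectation (\<lambda>\<omega>. \<Sum>a\<in>?V. a * (W \<omega> * indicator (?D a) (noise I i (Suc t) \<omega>)))"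
    proof (intro Bochner_Integration.integral_cong refl)
      fix \<omega> assume "\<omega> \<in> space P"
      then show "W \<omega> * f' (noise I i (Suc t) \<omega>) = (\<Sum>a\<in>?V. a * (W \<omega> * indicator (?D a) (noise I i (Suc t) \<omega>)))"
        by (subst f'eq[OF noise_space[OF i]]) (simp_all add: sum_distrib_left mult.left_commute)
    qed
    also have "\<dots> = (\<Sum>a\<in>?V. a * expectation (\<lambda>\<omega>. W \<omega> * indicator (?D a) (noise I i (Suc t) \<omega>)))"
      by (simp only: Bochner_Integration.integral_sum[OF integrable_bounded_rv[OF bounded_rv_cmult[OF bounded_rv_mult[OF WP rvL[OF irv]]]]]) simp
    also have "\<dots> = (\<Sum>a\<in>?V. a * expectation (\<lambda>\<omega>. W \<omega> * (\<integral>z. indicator (?D a) z \<partial>ker I i (noise I i t \<omega>))))"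
      using markov_step_indicator[OF i W D] by simp
    also have "\<dots> = expectation (\<lambda>\<omega>. \<Sum>a\<in>?V. a * (W \<omega> * (\<integral>z. indicator (?D a) z \<partial>ker I i (noise I i t \<omega>))))"
      by (simp only: Bochner_Integration.integral_sum[OF integrable_bounded_rv[OF bounded_rv_cmult[OF bounded_rv_mult[OF WP rvR[OF irv]]]]]) simp
    also have "\<dots> = ?R f'"
    proof (intro Bochner_Integration.integral_cong refl)
      fix \<omega> assume "\<omega> \<in> space P"
      then have y: "noise I i t \<omega> \<in> space (spc I i)" by (rule noise_space[OF i])
      interpret Q: prob_space "ker I i (noise I i t \<omega>)" by (rule kp(1)[OF y])
      have "(\<integral>z. f' z \<partial>ker I i (noise I i t \<omega>)) = (\<integral>z. (\<Sum>a\<in>?V. a * indicator (?D a) z) \<partial>ker I i (noise I i t \<omega>))"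
        by (intro Bochner_Integration.integral_cong refl f'eq) (simp add: kp(3)[OF y])
      also have "\<dots> = (\<Sum>a\<in>?V. a * (\<integral>z. indicator (?D a) z \<partial>ker I i (noise I i t \<omega>)))"
      proof (subst Bochner_Integration.integral_sum)
        show "integrable (ker I i (noise I i t \<omega>)) (\<lambda>z. a * indicator (?D a) z)" for a
          using D[of a] kp(2)[OF y] by (intro integrable_mult_right integrable_real_indicator) (auto simp: Q.emeasure_eq_measure)
      qed simp
      finally show "(\<Sum>a\<in>?V. a * (W \<omega> * (\<integral>z. indicator (?D a) z \<partial>ker I i (noise I i t \<omega>))))
          = W \<omega> * (\<integral>z. f' z \<partial>ker I i (noise I i t \<omega>))"
        by (simp add: sum_distrib_left algebra_simps)
    qed
    finally have eq: "?L f' = ?R f'" .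
    have dL: "\<bar>?L f - ?L f'\<bar> \<le> C * e"
    proof -
      have "?L f - ?L f' = expectation (\<lambda>\<omega>. W \<omega> * (f (noise I i (Suc t) \<omega>) - f' (noise I i (Suc t) \<omega>)))"
        unfolding right_diff_distrib
        by (intro Bochner_Integration.integral_diff[symmetric] integrable_bounded_rv bounded_rv_mult[OF WP rvL] f f'rv)
      also have "\<bar>\<dots>\<bar> \<le> C * e"
        using C e fe[OF noise_space[OF i]] by (intro abs_expectation_le) (auto simp: abs_mult intro!: mult_mono)
      finally show ?thesis .
    qed
    have dR: "\<bar>?R f - ?R f'\<bar> \<le> C * e"
    proof -
      have "?R f - ?R f' = expectation (\<lambda>\<omega>. W \<omega> * ((\<integral>z. f z \<partial>ker I i (noise I i t \<omega>)) - (\<integral>z. f' z \<partial>ker I i (noise I i t \<omega>))))"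
        unfolding right_diff_distrib
        by (intro Bochner_Integration.integral_diff[symmetric] integrable_bounded_rv bounded_rv_mult[OF WP rvR] f f'rv)
      also have "\<bar>\<dots>\<bar> \<le> C * e"
      proof (rule abs_expectation_le)
        fix \<omega> assume w: "\<omega> \<in> space P"
        then have y: "noise I i t \<omega> \<in> space (spc I i)" by (rule noise_space[OF i])
        interpret Q: prob_space "ker I i (noise I i t \<omega>)" by (rule kp(1)[OF y])
        have qrv: "bounded_rv (ker I i (noise I i t \<omega>)) g" if "bounded_rv (spc I i) g" for g :: "'s \<Rightarrow> real"
          using that kp(2,3)[OF y] measurable_cong_sets[OF kp(2)[OF y] refl, of borel] by (auto simp: bounded_rv_def)
        have "(\<integral>z. f z \<partial>ker I i (noise I i t \<omega>)) - (\<integral>z. f' z \<partial>ker I i (noise I i t \<omega>))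
            = (\<integral>z. f z - f' z \<partial>ker I i (noise I i t \<omega>))"
          by (intro Bochner_Integration.integral_diff[symmetric] Q.integrable_bounded_rv qrv f f'rv)
        also have "\<bar>\<dots>\<bar> \<le> e"
          using fe kp(3)[OF y] e by (intro Q.abs_expectation_le) auto
        finally show "\<bar>W \<omega> * ((\<integral>z. f z \<partial>ker I i (noise I i t \<omega>)) - (\<integral>z. f' z \<partial>ker I i (noise I i t \<omega>)))\<bar> \<le> C * e"
          using C w by (auto simp: abs_mult intro!: mult_mono)
      qed (use C(1) e in auto)
      finally show ?thesis .
    qed
    have "\<bar>?L f - ?R f\<bar> = \<bar>(?L f - ?L f') - (?R f - ?R f')\<bar>" using eq by simp
    also have "\<dots> \<le> \<bar>?L f - ?L f'\<bar> + \<bar>?R f - ?R f'\<bar>" by (rule abs_triangle_ineq4)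
    also have "\<dots> \<le> 2 * C * e" using dL dR by linarith
    finally show ?thesis .
  qed
  show ?thesis by (rule eq_if_abs_diff_le[OF close]) (use C(1) in auto)
qed

lemma markov_lag:
  fixes f :: "'s \<Rightarrow> real"
  assumes i: "i < N" and f: "bounded_rv (spc I i) f"
  shows "cexp_of (Fn s) (\<lambda>\<omega>. f (noise I i (s + m) \<omega>)) (\<lambda>\<omega>. \<integral>z. f z \<partial>state_law I i (noise I i s \<omega>) m)"
proof -
  have krv: "bounded_rv (spc I i) (\<lambda>y. \<integral>z. g z \<partial>Q y)"
    if Q: "Q \<in> spc I i \<rightarrow>\<^sub>M prob_algebra (spc I i)" and g: "bounded_rv (spc I i) g" for g :: "'s \<Rightarrow> real" and Q
  proof -
    obtain B where B: "0 \<le> B" "\<And>z. z \<in> space (spc I i) \<Longrightarrow> \<bar>g z\<bar> \<le> B" using bounded_rv_bound[OF g] by auto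
    show ?thesis
      by (rule bounded_rvI[OF kernel_integral_measurable[OF Q bounded_rv_measurable[OF g]], where C = B])
        (use kernel_integral_bound[OF Q _ B(2) B(1)] in auto)
  qed
  have "bounded_rv (Fn s) (\<lambda>\<omega>. \<integral>z. f z \<partial>state_law I i (noise I i s \<omega>) m)"
  proof -
    have h: "bounded_rv (spc I i) (\<lambda>y. \<integral>z. f z \<partial>state_law I i y m)"
      by (rule krv[OF state_law_kernel[OF i] f])
    obtain B where B: "\<And>y. y \<in> space (spc I i) \<Longrightarrow> norm (\<integral>z. f z \<partial>state_law I i y m) \<le> B"
      using bounded_rv_bound[OF h] by blast
    show ?thesis
      by (rule bounded_rvI[OF measurable_compose[OF noise_Fn[OF i order_refl] bounded_rv_measurable[OF h]], where C = B])
        (use B noise_space[OF i] in auto)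
  qed
  moreover have "expectation (\<lambda>\<omega>. W \<omega> * f (noise I i (s + m) \<omega>))
     = expectation (\<lambda>\<omega>. W \<omega> * (\<integral>z. f z \<partial>state_law I i (noise I i s \<omega>) m))"
    if W: "bounded_rv (Fn s) W" for W
    using f
  proof (induction m arbitrary: f)
    case 0
    show ?case
      by (intro Bochner_Integration.integral_cong refl)
        (simp add: integral_return noise_space[OF i] bounded_rv_measurable[OF 0])
  next
    case (Suc m)
    have "expectation (\<lambda>\<omega>. W \<omega> * f (noise I i (s + Suc m) \<omega>))
        = expectation (\<lambda>\<omega>. W \<omega> * (\<integral>z. f z \<partial>ker I i (noise I i (s + m) \<omega>)))"
      using markov_step[OF i Fn_mono[OF W] Suc.prems, of "s + m"] by simp
    also have "\<dots> = expectation (\<lambda>\<omega>. W \<omega> * (\<integral>y. (\<integral>z. f z \<partial>ker I i y) \<partial>state_law I i (noise I i s \<omega>) m))"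
      by (rule Suc.IH[OF krv[OF ker_measurable[OF i] Suc.prems]])
    also have "\<dots> = expectation (\<lambda>\<omega>. W \<omega> * (\<integral>z. f z \<partial>state_law I i (noise I i s \<omega>) (Suc m)))"
    proof (intro Bochner_Integration.integral_cong refl)
      fix \<omega> assume "\<omega> \<in> space P"
      then have y: "noise I i s \<omega> \<in> space (spc I i)" by (rule noise_space[OF i])
      let ?S = "state_law I i (noise I i s \<omega>) m"
      note S = state_law_space[OF i y, of m]
      obtain B where B: "\<And>z. z \<in> space (spc I i) \<Longrightarrow> norm (f z) \<le> B" using bounded_rv_bound[OF Suc.prems] by blast
      have k: "ker I i \<in> ?S \<rightarrow>\<^sub>M subprob_algebra (spc I i)"
        using measurable_prob_algebraD[OF ker_measurable[OF i]] measurable_cong_sets[OF S(2) refl, of "subprob_algebra (spc I i)"] by simp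
      have "(\<integral>z. f z \<partial>bind ?S (ker I i)) = (\<integral>y. (\<integral>z. f z \<partial>ker I i y) \<partial>?S)"
      proof (rule integral_bind[OF bounded_rv_measurable[OF Suc.prems] _ k, where B = B and B' = 1])
        show "finite_measure ?S" using S(1) by (simp add: prob_space_def)
        have "emeasure (ker I i x) (space (ker I i x)) \<le> ennreal 1" if "x \<in> space ?S" for x
          using measurable_space[OF ker_measurable[OF i]] that S(3) prob_space.emeasure_space_1
          by (fastforce simp: space_prob_algebra)
        then show "AE x in ?S. emeasure (ker I i x) (space (ker I i x)) \<le> ennreal 1" by (intro AE_I2)
      qed (use B in auto)
      then show "W \<omega> * (\<integral>y. (\<integral>z. f z \<partial>ker I i y) \<partial>?S)
          = W \<omega> * (\<integral>z. f z \<partial>state_law I i (noise I i s \<omega>) (Suc m))" by simp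
    qed
    finally show ?case .
  qed
  ultimately show ?thesis by (simp add: cexp_of_def)
qed

definition obs_noise :: "real \<Rightarrow> nat \<Rightarrow> 'v \<Rightarrow> 's \<Rightarrow> 'v" where
  "obs_noise k i x z = opG I i x z - Gbar I i x + k *\<^sub>R opb I i z"

text \<open>The conditional mean of the noise given its state \<open>m\<close> steps earlier.\<close>

definition obs_noise_mean :: "real \<Rightarrow> nat \<Rightarrow> nat \<Rightarrow> 'v \<Rightarrow> 's \<Rightarrow> 'v" where
  "obs_noise_mean k i m x y = (\<integral>z. opG I i x z \<partial>state_law I i y m) - Gbar I i x
     + k *\<^sub>R (\<integral>z. opb I i z \<partial>state_law I i y m)"

lemma Gbar_le: "i < N \<Longrightarrow> norm (Gbar I i x) \<le> A * norm x"
  using Gbar_lip[of i x 0] Gbar_0[of i] by simp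

lemma obs_noise_le:
  assumes "i < N" "z \<in> space (spc I i)" "k = 0 \<or> k = 1"
  shows "norm (obs_noise k i x z) \<le> 2 * A * norm x + A"
proof -
  have "norm (obs_noise k i x z) \<le> norm (opG I i x z) + norm (Gbar I i x) + norm (k *\<^sub>R opb I i z)"
    unfolding obs_noise_def using norm_triangle_ineq norm_triangle_ineq4 by (smt (verit))
  moreover have "norm (k *\<^sub>R opb I i z) \<le> A" using assms(3) b_le[OF assms(1,2)] A1 by auto
  ultimately show ?thesis using G_le[OF assms(1,2), of x] Gbar_le[OF assms(1), of x] by linarith
qed

lemma obs_noise_le_power2:
  assumes "i < N" "z \<in> space (spc I i)" "k = 0 \<or> k = 1"
  shows "(norm (obs_noise k i x z))\<^sup>2 \<le> 8 * A\<^sup>2 * (1 + (norm x)\<^sup>2)"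
proof -
  have "(norm (obs_noise k i x z))\<^sup>2 \<le> (2 * A * norm x + A)\<^sup>2" by (intro power_mono obs_noise_le assms) auto
  also have "\<dots> \<le> 2 * (2 * A * norm x)\<^sup>2 + 2 * A\<^sup>2" by (rule power2_sum_le)
  also have "\<dots> \<le> 8 * A\<^sup>2 * (1 + (norm x)\<^sup>2)" by (simp add: algebra_simps power_mult_distrib)
  finally show ?thesis .
qed

lemma obs_noise_lip:
  assumes "i < N" "z \<in> space (spc I i)"
  shows "norm (obs_noise k i x z - obs_noise k i x' z) \<le> 2 * A * norm (x - x')"
proof -
  have "obs_noise k i x z - obs_noise k i x' z = (opG I i x z - opG I i x' z) - (Gbar I i x - Gbar I i x')"
    by (simp add: obs_noise_def)
  then show ?thesis
    using norm_triangle_ineq4[of "opG I i x z - opG I i x' z" "Gbar I i x - Gbar I i x'"]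
      G_lip[OF assms, of x x'] Gbar_lip[OF assms(1), of x x'] by simp
qed

lemma obs_noise_rv:
  assumes "i < N" "bounded_rv F Z" "noise I i r \<in> F \<rightarrow>\<^sub>M spc I i"
  shows "bounded_rv F (\<lambda>\<omega>. obs_noise k i (Z \<omega>) (noise I i r \<omega>))"
  unfolding obs_noise_def by (intro bounded_rv_add bounded_rv_diff bounded_rv_scale G_rv Gbar_rv b_rv assms)

lemma integral_state_law_inner:
  fixes f :: "'s \<Rightarrow> 'v"
  assumes "i < N" "y \<in> space (spc I i)" "bounded_rv (spc I i) f"
  shows "(\<integral>z. f z \<bullet> k \<partial>state_law I i y m) = (\<integral>z. f z \<partial>state_law I i y m) \<bullet> k"
    "integrable (state_law I i y m) f"
proof -
  note S = state_law_space[OF assms(1,2), of m]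
  interpret S: prob_space "state_law I i y m" by (rule S(1))
  have "bounded_rv (state_law I i y m) f"
    using assms(3) S(3) measurable_cong_sets[OF S(2) refl, of borel] by (auto simp: bounded_rv_def)
  then show "integrable (state_law I i y m) f" by (rule S.integrable_bounded_rv)
  then show "(\<integral>z. f z \<bullet> k \<partial>state_law I i y m) = (\<integral>z. f z \<partial>state_law I i y m) \<bullet> k" by simp
qed

lemma G_spc: "i < N \<Longrightarrow> bounded_rv (spc I i) (opG I i x)"
  by (rule bounded_rvI[OF G_meas G_le])

lemma b_spc: "i < N \<Longrightarrow> bounded_rv (spc I i) (opb I i)"
  by (rule bounded_rvI[OF b_meas b_le])

lemma obs_noise_spc: "i < N \<Longrightarrow> bounded_rv (spc I i) (obs_noise k i x)"
  unfolding obs_noise_def[abs_def] by (intro bounded_rv_add bounded_rv_diff bounded_rv_scale G_spc b_spc bounded_rv_const)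

lemma integral_obs_noise:
  assumes i: "i < N" and y: "y \<in> space (spc I i)"
  shows "(\<integral>z. obs_noise k i x z \<bullet> e \<partial>state_law I i y m) = obs_noise_mean k i m x y \<bullet> e"
proof -
  interpret S: prob_space "state_law I i y m" by (rule state_law_space[OF assms])
  note int = integral_state_law_inner(2)[OF i y G_spc[OF i]] integral_state_law_inner(2)[OF i y b_spc[OF i]]
  have "(\<integral>z. obs_noise k i x z \<partial>state_law I i y m) = obs_noise_mean k i m x y"
    unfolding obs_noise_def obs_noise_mean_def using int by (simp add: S.prob_space)
  then show ?thesis using integral_state_law_inner(1)[OF i y obs_noise_spc[OF i]] by simp
qed

lemma obs_noise_inner_spc: "i < N \<Longrightarrow> bounded_rv (spc I i) (\<lambda>z. obs_noise k i x z \<bullet> e)"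
  by (intro bounded_rv_inner obs_noise_spc bounded_rv_const)

lemma cexp_obs_noise:
  assumes i: "i < N" and Z: "Z \<in> borel_measurable (Fn s)" "finite (Z ` space P)"
  shows "cexp_of (Fn s) (\<lambda>\<omega>. obs_noise k i (Z \<omega>) (noise I i (s + m) \<omega>) \<bullet> e)
    (\<lambda>\<omega>. obs_noise_mean k i m (Z \<omega>) (noise I i s \<omega>) \<bullet> e)"
proof (rule cexp_of_finite_valued[OF subalgebra_Fn Z, of "\<lambda>a \<omega>. obs_noise k i a (noise I i (s + m) \<omega>) \<bullet> e"
      "\<lambda>a \<omega>. obs_noise_mean k i m a (noise I i s \<omega>) \<bullet> e"])
  show "bounded_rv P (\<lambda>\<omega>. obs_noise k i a (noise I i (s + m) \<omega>) \<bullet> e)" for a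
    by (intro bounded_rv_inner obs_noise_rv[OF i] noise_measurable[OF i] bounded_rv_const)
  fix a
  have "cexp_of (Fn s) (\<lambda>\<omega>. obs_noise k i a (noise I i (s + m) \<omega>) \<bullet> e)
      (\<lambda>\<omega>. \<integral>z. obs_noise k i a z \<bullet> e \<partial>state_law I i (noise I i s \<omega>) m)"
    by (rule markov_lag[OF i obs_noise_inner_spc[OF i]])
  moreover have "bounded_rv (Fn s) (\<lambda>\<omega>. \<integral>z. obs_noise k i a z \<bullet> e \<partial>state_law I i (noise I i s \<omega>) m) \<longleftrightarrow>
      bounded_rv (Fn s) (\<lambda>\<omega>. obs_noise_mean k i m a (noise I i s \<omega>) \<bullet> e)"
    by (rule bounded_rv_cong) (simp add: integral_obs_noise[OF i] noise_space[OF i])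
  moreover have "expectation (\<lambda>\<omega>. W \<omega> * (\<integral>z. obs_noise k i a z \<bullet> e \<partial>state_law I i (noise I i s \<omega>) m))
      = expectation (\<lambda>\<omega>. W \<omega> * (obs_noise_mean k i m a (noise I i s \<omega>) \<bullet> e))" for W
    by (intro Bochner_Integration.integral_cong refl) (simp add: integral_obs_noise[OF i] noise_space[OF i])
  ultimately show "cexp_of (Fn s) (\<lambda>\<omega>. obs_noise k i a (noise I i (s + m) \<omega>) \<bullet> e)
      (\<lambda>\<omega>. obs_noise_mean k i m a (noise I i s \<omega>) \<bullet> e)"
    by (simp add: cexp_of_def)
qed

lemma obs_noise_mean_rv:
  assumes i: "i < N" and Z: "Z \<in> borel_measurable (Fn s)" "finite (Z ` space P)"
  shows "bounded_rv (Fn s) (\<lambda>\<omega>. obs_noise_mean k i m (Z \<omega>) (noise I i s \<omega>))"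
proof -
  have "bounded_rv (Fn s) (\<lambda>\<omega>. obs_noise_mean k i m (Z \<omega>) (noise I i s \<omega>) \<bullet> e)" for e
    using cexp_obs_noise[OF i Z, of k m e] by (simp add: cexp_of_def)
  then have "bounded_rv (Fn s) (\<lambda>\<omega>. \<Sum>e\<in>Basis. (obs_noise_mean k i m (Z \<omega>) (noise I i s \<omega>) \<bullet> e) *\<^sub>R e)"
    by (intro bounded_rv_sum bounded_rv_scaleR bounded_rv_const)
  then show ?thesis by (simp add: euclidean_representation)
qed

lemma expectation_inner_obs_noise:
  assumes i: "i < N" and Z: "Z \<in> borel_measurable (Fn s)" "finite (Z ` space P)" and w: "bounded_rv (Fn s) w"
  shows "expectation (\<lambda>\<omega>. w \<omega> \<bullet> obs_noise k i (Z \<omega>) (noise I i (s + m) \<omega>))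
    = expectation (\<lambda>\<omega>. w \<omega> \<bullet> obs_noise_mean k i m (Z \<omega>) (noise I i s \<omega>))"
proof -
  have Zrv: "bounded_rv P Z"
  proof -
    have "\<And>\<omega>. \<omega> \<in> space P \<Longrightarrow> norm (Z \<omega>) \<le> Max (norm ` Z ` space P)" using Z(2) by (intro Max_ge) auto
    then show ?thesis
      using measurable_from_subalg[OF subalgebra_Fn Z(1)] by (intro bounded_rvI) auto
  qed
  have we: "bounded_rv (Fn s) (\<lambda>\<omega>. w \<omega> \<bullet> e)" for e by (intro bounded_rv_inner w bounded_rv_const)
  have 1: "bounded_rv P (\<lambda>\<omega>. (w \<omega> \<bullet> e) * (obs_noise k i (Z \<omega>) (noise I i (s + m) \<omega>) \<bullet> e))" for e
    by (intro bounded_rv_mult Fn_P[OF we] bounded_rv_inner bounded_rv_const obs_noise_rv[OF i Zrv] noise_measurable[OF i])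
  have 2: "bounded_rv P (\<lambda>\<omega>. (w \<omega> \<bullet> e) * (obs_noise_mean k i m (Z \<omega>) (noise I i s \<omega>) \<bullet> e))" for e
    by (intro bounded_rv_mult Fn_P[OF we] bounded_rv_inner bounded_rv_const Fn_P[OF obs_noise_mean_rv[OF i Z]])
  show ?thesis
    using cexp_obs_noise[OF i Z, of k m] we
    by (subst (1 2) euclidean_inner) (simp add: Bochner_Integration.integral_sum integrable_bounded_rv 1 2 cexp_of_def)
qed

section \<open>Independence across agents\<close>

lemma cexp_obs_noise_product:
  assumes ij: "i < N" "j < N" "i \<noteq> j"
    and Zi: "Zi \<in> borel_measurable (Fi s)" "finite (Zi ` space P)"
    and Zj: "Zj \<in> borel_measurable (Fi s)" "finite (Zj ` space P)"
    and c: "\<And>i a. i < N \<Longrightarrow> cexp_of (Fi s) (\<lambda>\<omega>. obs_noise 1 i a (noise I i (s + m) \<omega>) \<bullet> e) (c i a)"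
    and cAE: "\<And>i a. i < N \<Longrightarrow> AE \<omega> in P. c i a \<omega>
       = real_cond_exp P (Fi s) (\<lambda>\<omega>. obs_noise 1 i a (noise I i (s + m) \<omega>) \<bullet> e) \<omega>"
  shows "cexp_of (Fi s)
    (\<lambda>\<omega>. (obs_noise 1 i (Zi \<omega>) (noise I i (s + m) \<omega>) \<bullet> e) * (obs_noise 1 j (Zj \<omega>) (noise I j (s + m) \<omega>) \<bullet> e))
    (\<lambda>\<omega>. c i (Zi \<omega>) \<omega> * c j (Zj \<omega>) \<omega>)"
proof -
  let ?h = "\<lambda>i a \<omega>. obs_noise 1 i a (noise I i (s + m) \<omega>) \<bullet> e"
  have hrv: "bounded_rv P (?h i (Z \<omega>))" if "i < N" "bounded_rv P Z" for i and Z :: "'w \<Rightarrow> 'v" and \<omega>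
    by (intro bounded_rv_inner obs_noise_rv[OF that(1)] bounded_rv_const noise_measurable that)
  have hrv': "bounded_rv P (\<lambda>\<omega>. ?h i (Z \<omega>) \<omega>)" if "i < N" "bounded_rv P Z" for i and Z :: "'w \<Rightarrow> 'v"
    by (intro bounded_rv_inner obs_noise_rv[OF that(1)] bounded_rv_const noise_measurable that)
  have ZiP: "bounded_rv P Zi"
  proof -
    have "\<And>\<omega>. \<omega> \<in> space P \<Longrightarrow> norm (Zi \<omega>) \<le> Max (norm ` Zi ` space P)" using Zi(2) by (intro Max_ge) auto
    then show ?thesis
      using measurable_from_subalg[OF subalgebra_Fi Zi(1)] by (intro bounded_rvI) auto
  qed
  have base: "cexp_of (Fi s) (\<lambda>\<omega>. ?h i a \<omega> * ?h j b \<omega>) (\<lambda>\<omega>. c i a \<omega> * c j b \<omega>)" for a b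
    unfolding cexp_of_def
  proof (intro conjI allI impI)
    have cF: "bounded_rv (Fi s) (c i a)" "bounded_rv (Fi s) (c j b)"
      using c[OF ij(1), of a] c[OF ij(2), of b] by (auto simp: cexp_of_def)
    then show cc: "bounded_rv (Fi s) (\<lambda>\<omega>. c i a \<omega> * c j b \<omega>)" by (rule bounded_rv_mult)
    fix W :: "'w \<Rightarrow> real" assume W: "bounded_rv (Fi s) W"
    interpret finite_measure_subalgebra P "Fi s" by standard (rule subalgebra_Fi)
    have hi: "bounded_rv P (?h i a)" and hj: "bounded_rv P (?h j b)"
      using hrv[OF ij(1) bounded_rv_const] hrv[OF ij(2) bounded_rv_const] by blast+
    have hh: "bounded_rv P (\<lambda>\<omega>. ?h i a \<omega> * ?h j b \<omega>)" by (rule bounded_rv_mult[OF hi hj])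
    have WP: "bounded_rv P W" by (rule bounded_rv_mono[OF W subalgebra_Fi])
    have bdd: "bounded ((\<lambda>z. obs_noise 1 i a z \<bullet> e) ` space (spc I i))" if i: "i < N" for i a
    proof -
      obtain B where "\<And>z. z \<in> space (spc I i) \<Longrightarrow> norm (obs_noise 1 i a z \<bullet> e) \<le> B"
        using bounded_rv_bound[OF obs_noise_inner_spc[OF i, of 1 a e]] by blast
      then show ?thesis by (auto simp: bounded_iff)
    qed
    have "AE \<omega> in P. real_cond_exp P (Fi s) (\<lambda>\<omega>. ?h i a \<omega> * ?h j b \<omega>) \<omega>
        = real_cond_exp P (Fi s) (?h i a) \<omega> * real_cond_exp P (Fi s) (?h j b) \<omega>"
      using indep[unfolded independent_agents_def, rule_format, OF ij, of m "s + m" "\<lambda>z. obs_noise 1 i a z \<bullet> e" "\<lambda>z. obs_noise 1 j b z \<bullet> e"]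
        bdd[OF ij(1), of a] bdd[OF ij(2), of b] bounded_rv_measurable[OF obs_noise_inner_spc[OF ij(1), of 1 a e]]
        bounded_rv_measurable[OF obs_noise_inner_spc[OF ij(2), of 1 b e]] by simp
    then have AE: "AE \<omega> in P. W \<omega> * real_cond_exp P (Fi s) (\<lambda>\<omega>. ?h i a \<omega> * ?h j b \<omega>) \<omega> = W \<omega> * (c i a \<omega> * c j b \<omega>)"
      using cAE[OF ij(1), of a] cAE[OF ij(2), of b] by eventually_elim simp
    have "expectation (\<lambda>\<omega>. W \<omega> * (?h i a \<omega> * ?h j b \<omega>))
       = expectation (\<lambda>\<omega>. W \<omega> * real_cond_exp P (Fi s) (\<lambda>\<omega>. ?h i a \<omega> * ?h j b \<omega>) \<omega>)"
      by (rule real_cond_exp_intg(2)[symmetric, OF integrable_bounded_rv[OF bounded_rv_mult[OF WP hh]]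
            bounded_rv_measurable[OF W] bounded_rv_measurable[OF hh]])
    also have "\<dots> = expectation (\<lambda>\<omega>. W \<omega> * (c i a \<omega> * c j b \<omega>))"
      by (rule integral_cong_AE[OF _ _ AE])
        (auto intro!: borel_measurable_times bounded_rv_measurable[OF WP] bounded_rv_measurable[OF bounded_rv_mono[OF cc subalgebra_Fi]]
            bounded_rv_measurable[OF bounded_rv_mono[OF cF(1) subalgebra_Fi]] bounded_rv_measurable[OF bounded_rv_mono[OF cF(2) subalgebra_Fi]]
            simp del: times_divide_eq_right)
    finally show "expectation (\<lambda>\<omega>. W \<omega> * (?h i a \<omega> * ?h j b \<omega>)) = expectation (\<lambda>\<omega>. W \<omega> * (c i a \<omega> * c j b \<omega>))" .
  qed
  have 1: "cexp_of (Fi s) (\<lambda>\<omega>. ?h i (Zi \<omega>) \<omega> * ?h j b \<omega>) (\<lambda>\<omega>. c i (Zi \<omega>) \<omega> * c j b \<omega>)" for b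
    by (rule cexp_of_finite_valued[OF subalgebra_Fi Zi, of "\<lambda>a \<omega>. ?h i a \<omega> * ?h j b \<omega>" "\<lambda>a \<omega>. c i a \<omega> * c j b \<omega>"])
      (rule bounded_rv_mult[OF hrv'[OF ij(1) bounded_rv_const] hrv'[OF ij(2) bounded_rv_const]], rule base)
  show ?thesis
    by (rule cexp_of_finite_valued[OF subalgebra_Fi Zj, of "\<lambda>b \<omega>. ?h i (Zi \<omega>) \<omega> * ?h j b \<omega>" "\<lambda>b \<omega>. c i (Zi \<omega>) \<omega> * c j b \<omega>"])
      (rule bounded_rv_mult[OF hrv'[OF ij(1) ZiP] hrv'[OF ij(2) bounded_rv_const]], rule 1)
qed

lemma finite_valued_rv:
  fixes Z :: "'w \<Rightarrow> 'v"
  assumes "Z \<in> borel_measurable F" "finite (Z ` space P)" "space F = space P"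
  shows "bounded_rv F Z"
proof -
  have "\<And>\<omega>. \<omega> \<in> space P \<Longrightarrow> norm (Z \<omega>) \<le> Max (norm ` Z ` space P)" using assms(2) by (intro Max_ge) auto
  with assms show ?thesis by (intro bounded_rvI[where C = "Max (norm ` Z ` space P)"]) auto
qed

lemma independent_component_second_moment:
  fixes e :: 'v and m :: nat
  assumes Z: "\<And>i. i < N \<Longrightarrow> Z i \<in> borel_measurable (Fi s)" "\<And>i. i < N \<Longrightarrow> finite (Z i ` space P)"
  defines "X \<equiv> \<lambda>i \<omega>. obs_noise 1 i (Z i \<omega>) (noise I i (s + m) \<omega>) \<bullet> e"
    and "Y \<equiv> \<lambda>i \<omega>. obs_noise_mean 1 i m (Z i \<omega>) (noise I i s \<omega>) \<bullet> e"
  shows "expectation (\<lambda>\<omega>. (\<Sum>i<N. X i \<omega>)\<^sup>2)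
    \<le> (\<Sum>i<N. expectation (\<lambda>\<omega>. (X i \<omega>)\<^sup>2)) + expectation (\<lambda>\<omega>. (\<Sum>i<N. Y i \<omega>)\<^sup>2)"
proof -
  have ZF: "bounded_rv (Fi s) (Z i)" if "i < N" for i
    by (rule finite_valued_rv[OF Z(1,2)[OF that]]) simp
  have ZP: "bounded_rv P (Z i)" if "i < N" for i by (rule bounded_rv_mono[OF ZF[OF that] subalgebra_Fi])
  have ZFn: "Z i \<in> borel_measurable (Fn s)" if "i < N" for i
    by (rule measurable_from_subalg[OF subalgebra_Fi_Fn Z(1)[OF that]])
  have hrv: "bounded_rv P (\<lambda>\<omega>. obs_noise 1 i a (noise I i (s + m) \<omega>) \<bullet> e)" if "i < N" for i a
    by (intro bounded_rv_inner obs_noise_rv[OF that bounded_rv_const] bounded_rv_const noise_measurable that)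
  have Xrv: "bounded_rv P (X i)" if "i < N" for i
    unfolding X_def by (intro bounded_rv_inner obs_noise_rv[OF that ZP] bounded_rv_const noise_measurable that)
  have Yrv: "bounded_rv P (Y i)" if "i < N" for i
    unfolding Y_def by (intro bounded_rv_inner Fn_P[OF obs_noise_mean_rv[OF that ZFn Z(2)]] bounded_rv_const that)
  have "\<exists>c. cexp_of (Fi s) (\<lambda>\<omega>. obs_noise 1 i a (noise I i (s + m) \<omega>) \<bullet> e) c \<and>
     (AE \<omega> in P. c \<omega> = real_cond_exp P (Fi s) (\<lambda>\<omega>. obs_noise 1 i a (noise I i (s + m) \<omega>) \<bullet> e) \<omega>)" if "i < N" for i a
    by (rule cexp_of_exists[OF subalgebra_Fi hrv[OF that]]) blast
  then have "\<forall>i a. \<exists>c. i < N \<longrightarrow> cexp_of (Fi s) (\<lambda>\<omega>. obs_noise 1 i a (noise I i (s + m) \<omega>) \<bullet> e) c \<and>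
     (AE \<omega> in P. c \<omega> = real_cond_exp P (Fi s) (\<lambda>\<omega>. obs_noise 1 i a (noise I i (s + m) \<omega>) \<bullet> e) \<omega>)" by blast
  then obtain c where c: "\<And>i a. i < N \<Longrightarrow> cexp_of (Fi s) (\<lambda>\<omega>. obs_noise 1 i a (noise I i (s + m) \<omega>) \<bullet> e) (c i a)"
    and cAE: "\<And>i a. i < N \<Longrightarrow> AE \<omega> in P. c i a \<omega> = real_cond_exp P (Fi s) (\<lambda>\<omega>. obs_noise 1 i a (noise I i (s + m) \<omega>) \<bullet> e) \<omega>"
    unfolding choice_iff by blast
  define C where "C i \<omega> = c i (Z i \<omega>) \<omega>" for i \<omega>
  have cC: "cexp_of (Fi s) (X i) (C i)" if "i < N" for i
    unfolding X_def C_def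
    by (rule cexp_of_finite_valued[OF subalgebra_Fi Z[OF that], of "\<lambda>a \<omega>. obs_noise 1 i a (noise I i (s + m) \<omega>) \<bullet> e" "c i"])
      (rule hrv[OF that], rule c[OF that])
  have Crv: "bounded_rv P (C i)" if "i < N" for i
    using cC[OF that] bounded_rv_mono[OF _ subalgebra_Fi] by (auto simp: cexp_of_def)
  have cross: "expectation (\<lambda>\<omega>. X i \<omega> * X j \<omega>) = expectation (\<lambda>\<omega>. C i \<omega> * C j \<omega>)" if "i < N" "j < N" "i \<noteq> j" for i j
  proof -
    have "cexp_of (Fi s) (\<lambda>\<omega>. X i \<omega> * X j \<omega>) (\<lambda>\<omega>. C i \<omega> * C j \<omega>)"
      unfolding X_def C_def
      by (rule cexp_obs_noise_product[OF that Z(1,2)[OF that(1)] Z(1,2)[OF that(2)] c cAE])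
    then have "expectation (\<lambda>\<omega>. 1 * (X i \<omega> * X j \<omega>)) = expectation (\<lambda>\<omega>. 1 * (C i \<omega> * C j \<omega>))"
      unfolding cexp_of_def using bounded_rv_const[of "Fi s" "1::real"] by blast
    then show ?thesis by simp
  qed
  have sq: "expectation (\<lambda>\<omega>. (\<Sum>i<N. f i \<omega>)\<^sup>2) = (\<Sum>i<N. \<Sum>j<N. expectation (\<lambda>\<omega>. f i \<omega> * f j \<omega>))"
    if "\<And>i. i < N \<Longrightarrow> bounded_rv P (f i)" for f :: "nat \<Rightarrow> 'w \<Rightarrow> real"
  proof -
    have rv: "bounded_rv P (\<lambda>\<omega>. f i \<omega> * f j \<omega>)" if "i \<in> {..<N}" "j \<in> {..<N}" for i j
      using that \<open>\<And>i. i < N \<Longrightarrow> bounded_rv P (f i)\<close> by (intro bounded_rv_mult) auto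
    have "expectation (\<lambda>\<omega>. (\<Sum>i<N. f i \<omega>)\<^sup>2) = (\<Sum>i<N. expectation (\<lambda>\<omega>. \<Sum>j<N. f i \<omega> * f j \<omega>))"
      unfolding power2_eq_square sum_product
      by (intro Bochner_Integration.integral_sum integrable_bounded_rv bounded_rv_sum rv)
    also have "\<dots> = (\<Sum>i<N. \<Sum>j<N. expectation (\<lambda>\<omega>. f i \<omega> * f j \<omega>))"
      by (intro sum.cong refl Bochner_Integration.integral_sum integrable_bounded_rv rv)
    finally show ?thesis .
  qed
  have "expectation (\<lambda>\<omega>. (\<Sum>i<N. X i \<omega>)\<^sup>2) = (\<Sum>i<N. \<Sum>j<N. expectation (\<lambda>\<omega>. X i \<omega> * X j \<omega>))"
    by (rule sq[OF Xrv])
  also have "\<dots> \<le> (\<Sum>i<N. \<Sum>j<N. expectation (\<lambda>\<omega>. C i \<omega> * C j \<omega>) + (if i = j then expectation (\<lambda>\<omega>. (X i \<omega>)\<^sup>2) else 0))"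
  proof (intro sum_mono)
    fix i j assume ij: "i \<in> {..<N}" "j \<in> {..<N}"
    have "0 \<le> expectation (\<lambda>\<omega>. C i \<omega> * C i \<omega>)" by (intro integral_nonneg_AE) auto
    then show "expectation (\<lambda>\<omega>. X i \<omega> * X j \<omega>)
        \<le> expectation (\<lambda>\<omega>. C i \<omega> * C j \<omega>) + (if i = j then expectation (\<lambda>\<omega>. (X i \<omega>)\<^sup>2) else 0)"
      using ij cross[of i j] by (auto simp: power2_eq_square)
  qed
  also have "\<dots> = expectation (\<lambda>\<omega>. (\<Sum>i<N. C i \<omega>)\<^sup>2) + (\<Sum>i<N. expectation (\<lambda>\<omega>. (X i \<omega>)\<^sup>2))"
    by (simp add: sq[OF Crv] sum.distrib)
  also have "expectation (\<lambda>\<omega>. (\<Sum>i<N. C i \<omega>)\<^sup>2) \<le> expectation (\<lambda>\<omega>. (\<Sum>i<N. Y i \<omega>)\<^sup>2)"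
  proof (rule cexp_of_second_moment_le[OF subalgebra_Fi])
    show "cexp_of (Fi s) (\<lambda>\<omega>. \<Sum>i<N. X i \<omega>) (\<lambda>\<omega>. \<Sum>i<N. C i \<omega>)"
      by (rule cexp_of_sum[OF subalgebra_Fi]) (use Xrv cC in auto)
    show "bounded_rv P (\<lambda>\<omega>. \<Sum>i<N. Y i \<omega>)" by (intro bounded_rv_sum) (use Yrv in auto)
    have "cexp_of (Fn s) (\<lambda>\<omega>. \<Sum>i<N. X i \<omega>) (\<lambda>\<omega>. \<Sum>i<N. Y i \<omega>)"
      by (rule cexp_of_sum[OF subalgebra_Fn]) (use Xrv cexp_obs_noise[OF _ ZFn Z(2)] in \<open>auto simp: X_def Y_def\<close>)
    then show "expectation (\<lambda>\<omega>. W \<omega> * (\<Sum>i<N. X i \<omega>)) = expectation (\<lambda>\<omega>. W \<omega> * (\<Sum>i<N. Y i \<omega>))"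
      if "bounded_rv (Fi s) W" for W
      using bounded_rv_mono[OF that subalgebra_Fi_Fn] unfolding cexp_of_def by blast
  qed
  finally show ?thesis by simp
qed

lemma norm_power2_Basis: "(norm (x :: 'v))\<^sup>2 = (\<Sum>e\<in>Basis. (x \<bullet> e)\<^sup>2)"
  unfolding power2_norm_eq_inner by (subst euclidean_inner) (simp add: power2_eq_square)

lemma independent_second_moment:
  fixes m :: nat
  assumes Z: "\<And>i. i < N \<Longrightarrow> Z i \<in> borel_measurable (Fi s)" "\<And>i. i < N \<Longrightarrow> finite (Z i ` space P)"
  defines "X \<equiv> \<lambda>i \<omega>. obs_noise 1 i (Z i \<omega>) (noise I i (s + m) \<omega>)"
    and "Y \<equiv> \<lambda>i \<omega>. obs_noise_mean 1 i m (Z i \<omega>) (noise I i s \<omega>)"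
  shows "expectation (\<lambda>\<omega>. (norm (av (\<lambda>i. X i \<omega>)))\<^sup>2)
    \<le> av (\<lambda>i. expectation (\<lambda>\<omega>. (norm (X i \<omega>))\<^sup>2)) / real N + expectation (\<lambda>\<omega>. (norm (av (\<lambda>i. Y i \<omega>)))\<^sup>2)"
proof -
  have ZF: "bounded_rv (Fi s) (Z i)" if "i < N" for i
    by (rule finite_valued_rv[OF Z(1,2)[OF that]]) simp
  have ZP: "bounded_rv P (Z i)" if "i < N" for i by (rule bounded_rv_mono[OF ZF[OF that] subalgebra_Fi])
  have ZFn: "Z i \<in> borel_measurable (Fn s)" if "i < N" for i
    by (rule measurable_from_subalg[OF subalgebra_Fi_Fn Z(1)[OF that]])
  have Xrv: "bounded_rv P (X i)" if "i < N" for i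
    unfolding X_def by (intro obs_noise_rv[OF that ZP] noise_measurable that)
  have Yrv: "bounded_rv P (Y i)" if "i < N" for i
    unfolding Y_def by (intro Fn_P[OF obs_noise_mean_rv[OF that ZFn Z(2)]] that)
  have norm_av: "expectation (\<lambda>\<omega>. (norm (av (\<lambda>i. f i \<omega>)))\<^sup>2)
      = (\<Sum>e\<in>Basis. expectation (\<lambda>\<omega>. (\<Sum>i<N. f i \<omega> \<bullet> e)\<^sup>2)) / (real N)\<^sup>2"
    if "\<And>i. i < N \<Longrightarrow> bounded_rv P (f i)" for f :: "nat \<Rightarrow> 'w \<Rightarrow> 'v"
  proof -
    have "bounded_rv P (\<lambda>\<omega>. (\<Sum>i<N. f i \<omega> \<bullet> e)\<^sup>2)" for e
      using that by (intro bounded_rv_power2 bounded_rv_sum bounded_rv_inner bounded_rv_const) auto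
    then show ?thesis
      unfolding norm_power2_Basis agent_avg_def
      by (simp add: inner_sum_left power_divide integrable_bounded_rv flip: sum_divide_distrib)
  qed
  have nX: "expectation (\<lambda>\<omega>. (norm (av (\<lambda>i. X i \<omega>)))\<^sup>2)
      = (\<Sum>e\<in>Basis. expectation (\<lambda>\<omega>. (\<Sum>i<N. X i \<omega> \<bullet> e)\<^sup>2)) / (real N)\<^sup>2"
    by (rule norm_av) (rule Xrv)
  have "expectation (\<lambda>\<omega>. (norm (av (\<lambda>i. X i \<omega>)))\<^sup>2)
      \<le> (\<Sum>e\<in>Basis. (\<Sum>i<N. expectation (\<lambda>\<omega>. (X i \<omega> \<bullet> e)\<^sup>2)) + expectation (\<lambda>\<omega>. (\<Sum>i<N. Y i \<omega> \<bullet> e)\<^sup>2)) / (real N)\<^sup>2"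
    unfolding nX unfolding X_def Y_def
    by (intro divide_right_mono sum_mono independent_component_second_moment Z) auto
  also have "\<dots> = (\<Sum>i<N. expectation (\<lambda>\<omega>. (norm (X i \<omega>))\<^sup>2)) / (real N)\<^sup>2 + expectation (\<lambda>\<omega>. (norm (av (\<lambda>i. Y i \<omega>)))\<^sup>2)"
  proof -
    have "expectation (\<lambda>\<omega>. (norm (X i \<omega>))\<^sup>2) = (\<Sum>e\<in>Basis. expectation (\<lambda>\<omega>. (X i \<omega> \<bullet> e)\<^sup>2))" if "i < N" for i
      unfolding norm_power2_Basis
      by (intro Bochner_Integration.integral_sum integrable_bounded_rv bounded_rv_power2 bounded_rv_inner Xrv[OF that] bounded_rv_const)
    then have "(\<Sum>i<N. expectation (\<lambda>\<omega>. (norm (X i \<omega>))\<^sup>2)) = (\<Sum>e\<in>Basis. \<Sum>i<N. expectation (\<lambda>\<omega>. (X i \<omega> \<bullet> e)\<^sup>2))"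
      by (subst sum.swap) simp
    then show ?thesis by (simp add: norm_av[OF Yrv] sum.distrib add_divide_distrib)
  qed
  also have "(\<Sum>i<N. expectation (\<lambda>\<omega>. (norm (X i \<omega>))\<^sup>2)) / (real N)\<^sup>2 = av (\<lambda>i. expectation (\<lambda>\<omega>. (norm (X i \<omega>))\<^sup>2)) / real N"
    by (simp add: agent_avg_def power2_eq_square)
  finally show ?thesis .
qed

section \<open>Second moments and frozen parameters\<close>

definition noise_term :: "real \<Rightarrow> nat \<Rightarrow> nat \<Rightarrow> 'w \<Rightarrow> 'v" where
  "noise_term k t i \<omega> = obs_noise k i (th t i \<omega>) (noise I i t \<omega>)"

definition drift :: "nat \<Rightarrow> nat \<Rightarrow> 'w \<Rightarrow> 'v" where
  "drift t i \<omega> = Gbar I i (th t i \<omega>) + (1 - \<xi>) *\<^sub>R opb I i (noise I i t \<omega>)"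

lemma th_eq_local_filter:
  assumes "\<And>t i. u t i = opG I i (th t i \<omega>) (noise I i t \<omega>) + opb I i (noise I i t \<omega>)"
  shows "th t i \<omega> = local_filter 1 \<theta>0 u t i"
proof (induction t arbitrary: i)
  case (Suc t)
  have "th t j \<omega> + \<alpha> *\<^sub>R (opG I j (th t j \<omega>) (noise I j t \<omega>) - th t j \<omega> + opb I j (noise I j t \<omega>))
     = (1 - \<alpha>) *\<^sub>R th t j \<omega> + \<alpha> *\<^sub>R u t j" for j
    by (simp add: assms algebra_simps)
  then show ?case by (simp add: Let_def Suc.IH)
qed simp

lemma th_local_filter: "th t i \<omega> = local_filter 1 \<theta>0 (\<lambda>t i. drift t i \<omega> + noise_term \<xi> t i \<omega>) t i"
  by (rule th_eq_local_filter) (simp add: drift_def noise_term_def obs_noise_def algebra_simps)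

lemma th_local_filter_full: "th t i \<omega> = local_filter 1 \<theta>0 (\<lambda>t i. Gbar I i (th t i \<omega>) + noise_term 1 t i \<omega>) t i"
  by (rule th_eq_local_filter) (simp add: noise_term_def obs_noise_def)

lemma noise_term_rv: "i < N \<Longrightarrow> bounded_rv (Fn t) (noise_term k t i)"
  unfolding noise_term_def[abs_def] by (intro obs_noise_rv th_rv noise_Fn order_refl)

lemma drift_rv: "i < N \<Longrightarrow> bounded_rv (Fn t) (drift t i)"
  unfolding drift_def[abs_def] by (intro bounded_rv_add bounded_rv_scale Gbar_rv b_rv th_rv noise_Fn order_refl)

lemma local_filter_rv:
  assumes "\<And>t i. i < N \<Longrightarrow> bounded_rv (Fn t) (u t i)" "i < N"
  shows "bounded_rv (Fn t) (\<lambda>\<omega>. local_filter l y0 (\<lambda>t i. u t i \<omega>) t i)"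
  using assms(2)
proof (induction t arbitrary: i)
  case (Suc t)
  have loc: "bounded_rv (Fn (Suc t)) (\<lambda>\<omega>. (1 - \<alpha>) *\<^sub>R local_filter l y0 (\<lambda>t i. u t i \<omega>) t j + \<alpha> *\<^sub>R u t j \<omega>)" if "j < N" for j
    using Fn_mono[OF Suc.IH[OF that], of "Suc t"] Fn_mono[OF assms(1)[OF that], of t "Suc t"]
    by (intro bounded_rv_add bounded_rv_scale) auto
  show ?case
    using loc Suc.prems by (cases "K dvd Suc t") (auto intro!: bounded_rv_agent_avg bounded_rv_scale)
qed (simp add: bounded_rv_const)

definition rv_family :: "(nat \<Rightarrow> 'w \<Rightarrow> 'v) \<Rightarrow> bool" where
  "rv_family Y \<longleftrightarrow> (\<forall>i<N. bounded_rv P (Y i))"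

definition msq :: "(nat \<Rightarrow> 'w \<Rightarrow> 'v) \<Rightarrow> real" where
  "msq Y = expectation (\<lambda>\<omega>. av (\<lambda>i. (norm (Y i \<omega>))\<^sup>2))"

lemma famI: "(\<And>i. i < N \<Longrightarrow> bounded_rv P (Y i)) \<Longrightarrow> rv_family Y"
  by (simp add: rv_family_def)

lemma rv_family_add: "rv_family X \<Longrightarrow> rv_family Y \<Longrightarrow> rv_family (\<lambda>i \<omega>. X i \<omega> + Y i \<omega>)"
  by (simp add: rv_family_def bounded_rv_add)

lemma rv_family_diff: "rv_family X \<Longrightarrow> rv_family Y \<Longrightarrow> rv_family (\<lambda>i \<omega>. X i \<omega> - Y i \<omega>)"
  by (simp add: rv_family_def bounded_rv_diff)

lemma rv_family_av: "rv_family Y \<Longrightarrow> bounded_rv P (\<lambda>\<omega>. av (\<lambda>i. Y i \<omega>))"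
  by (intro bounded_rv_agent_avg) (simp add: rv_family_def)

lemma rv_family_noise_term: "rv_family (noise_term k t)"
  by (intro famI Fn_P[OF noise_term_rv])

lemma rv_family_drift: "rv_family (drift t)"
  by (intro famI Fn_P[OF drift_rv])

lemma rv_family_th: "rv_family (th t)"
  by (intro famI Fn_P[OF th_rv])

lemma rv_family_inner: "rv_family X \<Longrightarrow> rv_family Y \<Longrightarrow> bounded_rv P (\<lambda>\<omega>. av (\<lambda>i. X i \<omega> \<bullet> Y i \<omega>))"
  by (intro bounded_rv_agent_avg bounded_rv_inner) (simp_all add: rv_family_def)

lemma rv_family_sq: "rv_family Y \<Longrightarrow> bounded_rv P (\<lambda>\<omega>. av (\<lambda>i. (norm (Y i \<omega>))\<^sup>2))"
  by (intro bounded_rv_agent_avg bounded_rv_power2 bounded_rv_norm) (simp add: rv_family_def)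

lemma msq_nonneg: "0 \<le> msq Y"
  unfolding msq_def by (intro integral_nonneg_AE AE_I2 agent_avg_nonneg) simp

lemma expectation_lin:
  assumes "bounded_rv P f" "bounded_rv P g"
  shows "expectation (\<lambda>\<omega>. a * f \<omega> + b * g \<omega> + (c::real)) = a * expectation f + b * expectation g + c"
  using integrable_bounded_rv[OF assms(1)] integrable_bounded_rv[OF assms(2)] by (simp add: prob_space)

lemma msq_le_lin:
  assumes "rv_family X" "bounded_rv P f" "bounded_rv P g"
    and "\<And>\<omega>. \<omega> \<in> space P \<Longrightarrow> av (\<lambda>i. (norm (X i \<omega>))\<^sup>2) \<le> a * f \<omega> + b * g \<omega> + c"
  shows "msq X \<le> a * expectation f + b * expectation g + c"
  unfolding msq_def expectation_lin[OF assms(2,3), symmetric]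
  by (intro bounded_rv_expectation_mono rv_family_sq assms bounded_rv_add bounded_rv_cmult bounded_rv_const)

lemma msq_affine:
  assumes "rv_family X" "rv_family Y"
    and "\<And>i \<omega>. i < N \<Longrightarrow> \<omega> \<in> space P \<Longrightarrow> (norm (X i \<omega>))\<^sup>2 \<le> a * (norm (Y i \<omega>))\<^sup>2 + b"
  shows "msq X \<le> a * msq Y + b"
proof -
  have "msq X \<le> a * expectation (\<lambda>\<omega>. av (\<lambda>i. (norm (Y i \<omega>))\<^sup>2)) + 0 * expectation (\<lambda>\<omega>. 0) + b"
  proof (rule msq_le_lin[OF assms(1) rv_family_sq[OF assms(2)] bounded_rv_const])
    fix \<omega> assume w: "\<omega> \<in> space P"
    have "av (\<lambda>i. (norm (X i \<omega>))\<^sup>2) \<le> av (\<lambda>i. a * (norm (Y i \<omega>))\<^sup>2 + b)"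
      by (rule agent_avg_mono) (rule assms(3)[OF _ w])
    then show "av (\<lambda>i. (norm (X i \<omega>))\<^sup>2) \<le> a * av (\<lambda>i. (norm (Y i \<omega>))\<^sup>2) + 0 * 0 + b"
      by (simp add: agent_avg_add agent_avg_mult agent_avg_const[OF N1])
  qed
  then show ?thesis by (simp add: msq_def)
qed

lemma msq_add_le:
  assumes "rv_family X" "rv_family Y"
  shows "msq (\<lambda>i \<omega>. X i \<omega> + Y i \<omega>) \<le> 2 * msq X + 2 * msq Y"
proof -
  have "msq (\<lambda>i \<omega>. X i \<omega> + Y i \<omega>) \<le> 2 * expectation (\<lambda>\<omega>. av (\<lambda>i. (norm (X i \<omega>))\<^sup>2))
      + 2 * expectation (\<lambda>\<omega>. av (\<lambda>i. (norm (Y i \<omega>))\<^sup>2)) + 0"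
  proof (rule msq_le_lin[OF rv_family_add[OF assms] rv_family_sq[OF assms(1)] rv_family_sq[OF assms(2)]])
    fix \<omega>
    have "av (\<lambda>i. (norm (X i \<omega> + Y i \<omega>))\<^sup>2) \<le> av (\<lambda>i. 2 * (norm (X i \<omega>))\<^sup>2 + 2 * (norm (Y i \<omega>))\<^sup>2)"
      by (intro agent_avg_mono norm_add_power2_le)
    then show "av (\<lambda>i. (norm (X i \<omega> + Y i \<omega>))\<^sup>2)
        \<le> 2 * av (\<lambda>i. (norm (X i \<omega>))\<^sup>2) + 2 * av (\<lambda>i. (norm (Y i \<omega>))\<^sup>2) + 0"
      by (simp add: agent_avg_add agent_avg_mult)
  qed
  then show ?thesis by (simp add: msq_def)
qed

lemma msq_diff_le:
  assumes "rv_family X" "rv_family Y"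
  shows "msq (\<lambda>i \<omega>. X i \<omega> - Y i \<omega>) \<le> 2 * msq X + 2 * msq Y"
  using msq_add_le[of X "\<lambda>i \<omega>. - Y i \<omega>"] rv_family_diff[of "\<lambda>i \<omega>. 0" Y] assms
  by (simp add: msq_def rv_family_def bounded_rv_const)

lemma msq_young:
  assumes "rv_family X" "rv_family Y" "0 < k"
  shows "expectation (\<lambda>\<omega>. av (\<lambda>i. X i \<omega> \<bullet> Y i \<omega>)) \<le> (k * msq X + msq Y / k) / 2"
proof -
  have "expectation (\<lambda>\<omega>. av (\<lambda>i. X i \<omega> \<bullet> Y i \<omega>))
      \<le> expectation (\<lambda>\<omega>. (k / 2) * av (\<lambda>i. (norm (X i \<omega>))\<^sup>2) + (1 / (2 * k)) * av (\<lambda>i. (norm (Y i \<omega>))\<^sup>2) + 0)"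
  proof (rule bounded_rv_expectation_mono)
    fix \<omega>
    have "av (\<lambda>i. X i \<omega> \<bullet> Y i \<omega>) \<le> av (\<lambda>i. (k / 2) * (norm (X i \<omega>))\<^sup>2 + (1 / (2 * k)) * (norm (Y i \<omega>))\<^sup>2)"
    proof (intro agent_avg_mono)
      fix i show "X i \<omega> \<bullet> Y i \<omega> \<le> (k / 2) * (norm (X i \<omega>))\<^sup>2 + (1 / (2 * k)) * (norm (Y i \<omega>))\<^sup>2"
        using inner_young[OF assms(3), of "X i \<omega>" "Y i \<omega>"] by (simp add: add_divide_distrib)
    qed
    then show "av (\<lambda>i. X i \<omega> \<bullet> Y i \<omega>)
        \<le> (k / 2) * av (\<lambda>i. (norm (X i \<omega>))\<^sup>2) + (1 / (2 * k)) * av (\<lambda>i. (norm (Y i \<omega>))\<^sup>2) + 0"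
      unfolding agent_avg_add agent_avg_mult by simp
  qed (intro bounded_rv_add bounded_rv_cmult bounded_rv_const rv_family_sq rv_family_inner assms)+
  also have "\<dots> = (k / 2) * msq X + (1 / (2 * k)) * msq Y + 0"
    unfolding msq_def by (rule expectation_lin[OF rv_family_sq rv_family_sq]) fact+
  finally show ?thesis by (simp add: add_divide_distrib)
qed

lemma msq_le_sum:
  assumes "rv_family X" "\<And>r. r \<in> R \<Longrightarrow> rv_family (Y r)"
    and le: "\<And>\<omega>. \<omega> \<in> space P \<Longrightarrow> av (\<lambda>i. (norm (X i \<omega>))\<^sup>2) \<le> c * (\<Sum>r\<in>R. av (\<lambda>i. (norm (Y r i \<omega>))\<^sup>2))"
    and b: "\<And>r. r \<in> R \<Longrightarrow> msq (Y r) \<le> b" and "0 \<le> c"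
  shows "msq X \<le> c * (real (card R) * b)"
proof -
  have "msq X \<le> expectation (\<lambda>\<omega>. c * (\<Sum>r\<in>R. av (\<lambda>i. (norm (Y r i \<omega>))\<^sup>2)))"
    unfolding msq_def
    by (intro bounded_rv_expectation_mono rv_family_sq bounded_rv_cmult bounded_rv_sum assms)
  also have "\<dots> = c * (\<Sum>r\<in>R. msq (Y r))"
    unfolding msq_def using rv_family_sq[OF assms(2)] by (simp add: Bochner_Integration.integral_sum integrable_bounded_rv)
  also have "\<dots> \<le> c * (\<Sum>r\<in>R. b)" using b \<open>0 \<le> c\<close> by (intro mult_left_mono sum_mono)
  finally show ?thesis by simp
qed

definition Gam :: "real \<Rightarrow> real" where "Gam v = 8 * A\<^sup>2 * (1 + v)"

lemma A_sq: "1 \<le> A\<^sup>2"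
  using A1 by (simp add: one_le_power)

lemma Gam_ge: "0 \<le> v \<Longrightarrow> 8 \<le> Gam v"
  using mult_mono[of 1 "A\<^sup>2" 1 "1 + v"] A_sq by (simp add: Gam_def)

lemma msq_noise_term_le:
  assumes "msq (th t) \<le> v" "k = 0 \<or> k = 1"
  shows "msq (noise_term k t) \<le> Gam v"
proof -
  have "msq (noise_term k t) \<le> 8 * A\<^sup>2 * msq (th t) + 8 * A\<^sup>2"
  proof (rule msq_affine[OF rv_family_noise_term rv_family_th])
    fix i \<omega> assume "i < N" "\<omega> \<in> space P"
    from obs_noise_le_power2[OF this(1) noise_space[OF this, of t] assms(2), of "th t i \<omega>"]
    show "(norm (noise_term k t i \<omega>))\<^sup>2 \<le> 8 * A\<^sup>2 * (norm (th t i \<omega>))\<^sup>2 + 8 * A\<^sup>2"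
      by (simp add: noise_term_def distrib_left)
  qed
  also have "\<dots> \<le> 8 * A\<^sup>2 * v + 8 * A\<^sup>2" using assms(1) by (intro add_mono mult_left_mono) auto
  finally show ?thesis by (simp add: Gam_def distrib_left)
qed

lemma msq_increment_le:
  assumes "msq (th t) \<le> v"
  shows "msq (\<lambda>i \<omega>. drift t i \<omega> + noise_term \<xi> t i \<omega> - th t i \<omega>) \<le> Gam v"
proof -
  have "msq (\<lambda>i \<omega>. drift t i \<omega> + noise_term \<xi> t i \<omega> - th t i \<omega>) \<le> 8 * A\<^sup>2 * msq (th t) + 8 * A\<^sup>2"
  proof (rule msq_affine[OF rv_family_diff[OF rv_family_add[OF rv_family_drift rv_family_noise_term] rv_family_th] rv_family_th])
    fix i \<omega> assume i: "i < N" and w: "\<omega> \<in> space P"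
    let ?x = "th t i \<omega>" and ?y = "noise I i t \<omega>"
    have "norm (drift t i \<omega> + noise_term \<xi> t i \<omega> - ?x) = norm (opG I i ?x ?y - ?x + opb I i ?y)"
      by (simp add: drift_def noise_term_def obs_noise_def algebra_simps)
    also have "\<dots> \<le> norm (opG I i ?x ?y) + norm ?x + norm (opb I i ?y)"
      using norm_triangle_ineq norm_triangle_ineq4 by (smt (verit))
    also have "\<dots> \<le> A * norm ?x + A * norm ?x + A"
      using G_le[OF i noise_space[OF i w, of t], of ?x] b_le[OF i noise_space[OF i w, of t]]
        mult_right_mono[OF A1 norm_ge_zero[of ?x]] by linarith
    finally have "norm (drift t i \<omega> + noise_term \<xi> t i \<omega> - ?x) \<le> 2 * A * norm ?x + A" by simp
    then have "(norm (drift t i \<omega> + noise_term \<xi> t i \<omega> - ?x))\<^sup>2 \<le> (2 * A * norm ?x + A)\<^sup>2"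
      by (intro power_mono) auto
    also have "\<dots> \<le> 2 * (2 * A * norm ?x)\<^sup>2 + 2 * A\<^sup>2" by (rule power2_sum_le)
    also have "\<dots> \<le> 8 * A\<^sup>2 * (norm ?x)\<^sup>2 + 8 * A\<^sup>2" by (simp add: power_mult_distrib)
    finally show "(norm (drift t i \<omega> + noise_term \<xi> t i \<omega> - ?x))\<^sup>2 \<le> 8 * A\<^sup>2 * (norm ?x)\<^sup>2 + 8 * A\<^sup>2" .
  qed
  also have "\<dots> \<le> 8 * A\<^sup>2 * v + 8 * A\<^sup>2" using assms by (intro add_mono mult_left_mono) auto
  finally show ?thesis by (simp add: Gam_def distrib_left)
qed

definition noise_filter :: "real \<Rightarrow> nat \<Rightarrow> nat \<Rightarrow> 'w \<Rightarrow> 'v" where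
  "noise_filter l t i \<omega> = local_filter l 0 (\<lambda>t i. noise_term \<xi> t i \<omega>) t i"

definition noise_filter_frozen :: "real \<Rightarrow> nat \<Rightarrow> nat \<Rightarrow> nat \<Rightarrow> 'w \<Rightarrow> 'v" where
  "noise_filter_frozen l s t i \<omega> = frozen l 0 (\<lambda>t i. noise_term \<xi> t i \<omega>) s t i"

lemma noise_filter_rv: "i < N \<Longrightarrow> bounded_rv (Fn t) (noise_filter l t i)"
  unfolding noise_filter_def[abs_def] by (rule local_filter_rv[OF noise_term_rv])

lemma rv_family_noise_filter: "rv_family (noise_filter l t)"
  by (intro famI Fn_P[OF noise_filter_rv])

lemma noise_filter_frozen_rv: "i < N \<Longrightarrow> bounded_rv (Fn s) (noise_filter_frozen l s t i)"
  unfolding noise_filter_frozen_def[abs_def] frozen_def noise_filter_def[symmetric]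
  by (intro bounded_rv_if bounded_rv_scale bounded_rv_agent_avg noise_filter_rv)

lemma rv_family_noise_filter_frozen: "rv_family (noise_filter_frozen l s t)"
  by (intro famI Fn_P[OF noise_filter_frozen_rv])

lemma msq_noise_filter_frozen_le:
  assumes "l = 0 \<or> l = 1"
  shows "msq (noise_filter_frozen l s t) \<le> msq (noise_filter l s)"
  unfolding msq_def noise_filter_def noise_filter_frozen_def
  by (rule bounded_rv_expectation_mono[OF rv_family_sq[OF rv_family_noise_filter_frozen[unfolded noise_filter_frozen_def[abs_def]]]
        rv_family_sq[OF rv_family_noise_filter[unfolded noise_filter_def[abs_def]]]])
    (rule av_frozen_power2_le[OF assms])

end

text \<open>The lag \<open>m\<close> is long enough for the noise to mix up to \<open>\<alpha>\<close>; the smallness condition lets the \<open>\<delta>\<close>-terms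
  below be absorbed.\<close>

locale fed_lag = fed_run I K \<alpha> \<theta>0 nrm A \<gamma> \<rho> \<xi>
  for I :: "('v::euclidean_space, 's, 'w) fed" and K \<alpha> \<theta>0 nrm A \<gamma> \<rho> \<xi> +
  fixes m :: nat
  assumes m1: "1 \<le> m" and rho_m: "\<rho> ^ m \<le> \<alpha>"
    and small: "9024 * A ^ 8 * (\<alpha> * real m) \<le> (1 - \<gamma>)\<^sup>2"
    and \<alpha>K: "\<alpha> * real K \<le> 1"
begin

definition "\<delta> = \<alpha> * real m"

lemma \<delta>_pos: "0 < \<delta>" using \<alpha>_pos m1 by (simp add: \<delta>_def)

lemma \<alpha>_\<delta>: "\<alpha> \<le> \<delta>" using mult_left_mono[of 1 "real m" \<alpha>] \<alpha>_pos m1 by (simp add: \<delta>_def)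

lemma \<delta>_small: "9024 * A ^ 8 * \<delta> \<le> 1"
proof -
  have "(1 - \<gamma>)\<^sup>2 \<le> 1" using \<gamma>0 \<gamma>1 by (simp add: power_le_one)
  with small show ?thesis unfolding \<delta>_def by linarith
qed

lemma \<delta>_A2: "9024 * A\<^sup>2 * \<delta> \<le> 1"
proof -
  have "A\<^sup>2 \<le> A ^ 8" using A1 by (intro power_increasing) auto
  then have "9024 * A\<^sup>2 * \<delta> \<le> 9024 * A ^ 8 * \<delta>" using \<delta>_pos by (intro mult_right_mono) auto
  with \<delta>_small show ?thesis by linarith
qed

lemma \<delta>_le: "\<delta> \<le> 1 / 9024"
proof -
  have "9024 * \<delta> \<le> 9024 * A\<^sup>2 * \<delta>" using mult_right_mono[OF A_sq, of "9024 * \<delta>"] \<delta>_pos by (simp add: mult.commute mult.left_commute)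
  with \<delta>_A2 show ?thesis by simp
qed

lemma noise_filter_frozen_diff_le:
  assumes l: "l = 0 \<or> l = 1" and s: "s \<le> t" "t - s \<le> m"
    and v: "\<And>r. r \<le> t \<Longrightarrow> msq (th r) \<le> v" and y: "\<And>r. r \<le> t \<Longrightarrow> msq (noise_filter l r) \<le> y" "0 \<le> v" "0 \<le> y"
  shows "msq (\<lambda>i \<omega>. noise_filter l t i \<omega> - noise_filter_frozen l s t i \<omega>) \<le> 8 * \<delta>\<^sup>2 * (y + Gam v)"
proof -
  have "msq (\<lambda>i \<omega>. noise_filter l t i \<omega> - noise_filter_frozen l s t i \<omega>) \<le> 4 * \<alpha>\<^sup>2 * real m * (real (card {s..<t}) * (2 * Gam v + 2 * y))"
  proof (rule msq_le_sum[where Y = "\<lambda>r i \<omega>. noise_term \<xi> r i \<omega> - noise_filter l r i \<omega>"])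
    show "rv_family (\<lambda>i \<omega>. noise_filter l t i \<omega> - noise_filter_frozen l s t i \<omega>)" by (intro rv_family_diff rv_family_noise_filter rv_family_noise_filter_frozen)
    show "rv_family (\<lambda>i \<omega>. noise_term \<xi> r i \<omega> - noise_filter l r i \<omega>)" for r by (intro rv_family_diff rv_family_noise_filter rv_family_noise_term)
    show "av (\<lambda>i. (norm (noise_filter l t i \<omega> - noise_filter_frozen l s t i \<omega>))\<^sup>2)
        \<le> 4 * \<alpha>\<^sup>2 * real m * (\<Sum>r\<in>{s..<t}. av (\<lambda>i. (norm (noise_term \<xi> r i \<omega> - noise_filter l r i \<omega>))\<^sup>2))" for \<omega>
      unfolding noise_filter_def noise_filter_frozen_def by (rule av_local_filter_frozen_power2_le[OF l s])
    show "msq (\<lambda>i \<omega>. noise_term \<xi> r i \<omega> - noise_filter l r i \<omega>) \<le> 2 * Gam v + 2 * y" if "r \<in> {s..<t}" for r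
      using msq_diff_le[OF rv_family_noise_term rv_family_noise_filter, of \<xi> r l r] msq_noise_term_le[OF v \<xi>01, of r] y(1)[of r] that by auto
  qed simp
  also have "\<dots> \<le> 4 * \<alpha>\<^sup>2 * real m * (real m * (2 * Gam v + 2 * y))"
    using s(2) Gam_ge[OF y(2)] y(3) by (intro mult_left_mono mult_right_mono) auto
  also have "\<dots> = 8 * \<delta>\<^sup>2 * (y + Gam v)" by (simp add: \<delta>_def power2_eq_square algebra_simps)
  finally show ?thesis .
qed

lemma frozen_point:
  assumes t: "t = s + m" and v: "\<And>r. r \<le> t \<Longrightarrow> msq (th r) \<le> v" "0 \<le> v"
  obtains Z where "\<And>i. i < N \<Longrightarrow> Z i \<in> borel_measurable (Fi s)" "\<And>i. i < N \<Longrightarrow> finite (Z i ` space P)"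
    "msq (\<lambda>i \<omega>. th t i \<omega> - Z i \<omega>) \<le> 9 * \<delta>\<^sup>2 * Gam v" "msq Z \<le> 2 * v + 2"
proof -
  define F where "F i \<omega> = frozen 1 \<theta>0 (\<lambda>t i. drift t i \<omega> + noise_term \<xi> t i \<omega>) s t i" for i \<omega>
  have Feq: "F = (\<lambda>i \<omega>. if \<exists>r. s < r \<and> r \<le> t \<and> K dvd r then av (\<lambda>j. th s j \<omega>) else th s i \<omega>)"
  proof -
    have "local_filter 1 \<theta>0 (\<lambda>t i. drift t i \<omega> + noise_term \<xi> t i \<omega>) s = (\<lambda>j. th s j \<omega>)" for \<omega>
      by (rule ext) (rule th_local_filter[symmetric])
    note e = this
    show ?thesis unfolding F_def[abs_def] frozen_def e scaleR_one by (rule refl)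
  qed
  have FFi: "bounded_rv (Fi s) (F i)" if "i < N" for i
    unfolding Feq by (intro bounded_rv_if bounded_rv_agent_avg th_Fi order_refl that)
  have famF: "rv_family F" by (intro famI bounded_rv_mono[OF FFi subalgebra_Fi])
  have "\<exists>X'. X' \<in> borel_measurable (Fi s) \<and> finite (X' ` space P) \<and> (\<forall>\<omega>\<in>space P. norm (F i \<omega> - X' \<omega>) \<le> \<delta>)" if "i < N" for i
    by (rule bounded_rv_round[OF FFi[OF that] \<delta>_pos]) auto
  then have "\<forall>i. \<exists>X'. i < N \<longrightarrow> X' \<in> borel_measurable (Fi s) \<and> finite (X' ` space P) \<and> (\<forall>\<omega>\<in>space P. norm (F i \<omega> - X' \<omega>) \<le> \<delta>)"
    by blast
  then obtain Z where Z: "\<And>i. i < N \<Longrightarrow> Z i \<in> borel_measurable (Fi s)" "\<And>i. i < N \<Longrightarrow> finite (Z i ` space P)"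
    "\<And>i \<omega>. i < N \<Longrightarrow> \<omega> \<in> space P \<Longrightarrow> norm (F i \<omega> - Z i \<omega>) \<le> \<delta>"
    unfolding choice_iff by blast
  have famZ: "rv_family Z"
    by (rule famI) (rule bounded_rv_mono[OF finite_valued_rv[OF Z(1,2)] subalgebra_Fi], auto)
  have FZ: "msq (\<lambda>i \<omega>. F i \<omega> - Z i \<omega>) \<le> \<delta>\<^sup>2"
  proof -
    have "msq (\<lambda>i \<omega>. F i \<omega> - Z i \<omega>) \<le> 0 * msq F + \<delta>\<^sup>2"
      by (rule msq_affine[OF rv_family_diff[OF famF famZ] famF]) (use Z(3) \<delta>_pos in \<open>auto intro!: power_mono\<close>)
    then show ?thesis by simp
  qed
  have "msq (\<lambda>i \<omega>. th t i \<omega> - F i \<omega>) \<le> 4 * \<alpha>\<^sup>2 * real m * (real (card {s..<t}) * Gam v)"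
  proof (rule msq_le_sum[where Y = "\<lambda>r i \<omega>. drift r i \<omega> + noise_term \<xi> r i \<omega> - th r i \<omega>"])
    show "rv_family (\<lambda>i \<omega>. th t i \<omega> - F i \<omega>)" by (intro rv_family_diff rv_family_th famF)
    show "rv_family (\<lambda>i \<omega>. drift r i \<omega> + noise_term \<xi> r i \<omega> - th r i \<omega>)" for r
      by (intro rv_family_diff rv_family_add rv_family_drift rv_family_noise_term rv_family_th)
    show "av (\<lambda>i. (norm (th t i \<omega> - F i \<omega>))\<^sup>2)
        \<le> 4 * \<alpha>\<^sup>2 * real m * (\<Sum>r\<in>{s..<t}. av (\<lambda>i. (norm (drift r i \<omega> + noise_term \<xi> r i \<omega> - th r i \<omega>))\<^sup>2))" for \<omega>
      using av_local_filter_frozen_power2_le[of 1 s t m \<theta>0 "\<lambda>t i. drift t i \<omega> + noise_term \<xi> t i \<omega>"] t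
      by (simp add: F_def th_local_filter[symmetric])
    show "msq (\<lambda>i \<omega>. drift r i \<omega> + noise_term \<xi> r i \<omega> - th r i \<omega>) \<le> Gam v" if "r \<in> {s..<t}" for r
      using that by (intro msq_increment_le v) auto
  qed simp
  also have "\<dots> = 4 * \<delta>\<^sup>2 * Gam v" using t by (simp add: \<delta>_def power2_eq_square)
  finally have tF: "msq (\<lambda>i \<omega>. th t i \<omega> - F i \<omega>) \<le> 4 * \<delta>\<^sup>2 * Gam v" .
  have "msq (\<lambda>i \<omega>. th t i \<omega> - Z i \<omega>) = msq (\<lambda>i \<omega>. (th t i \<omega> - F i \<omega>) + (F i \<omega> - Z i \<omega>))" by simp
  also have "\<dots> \<le> 2 * msq (\<lambda>i \<omega>. th t i \<omega> - F i \<omega>) + 2 * msq (\<lambda>i \<omega>. F i \<omega> - Z i \<omega>)"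
    by (intro msq_add_le rv_family_diff rv_family_th famF famZ)
  also have "\<dots> \<le> 8 * \<delta>\<^sup>2 * Gam v + \<delta>\<^sup>2 * 2" using tF FZ by linarith
  also have "\<dots> \<le> 8 * \<delta>\<^sup>2 * Gam v + \<delta>\<^sup>2 * Gam v"
    using Gam_ge[OF v(2)] by (intro add_left_mono mult_left_mono) (linarith, simp)
  finally have tZ: "msq (\<lambda>i \<omega>. th t i \<omega> - Z i \<omega>) \<le> 9 * \<delta>\<^sup>2 * Gam v" by (simp add: mult_ac)
  have "msq F \<le> msq (th s)"
    unfolding msq_def
  proof (rule bounded_rv_expectation_mono[OF rv_family_sq[OF famF] rv_family_sq[OF rv_family_th]])
    show "av (\<lambda>i. (norm (F i \<omega>))\<^sup>2) \<le> av (\<lambda>i. (norm (th s i \<omega>))\<^sup>2)" for \<omega>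
      using av_frozen_power2_le[of 1 \<theta>0 "\<lambda>t i. drift t i \<omega> + noise_term \<xi> t i \<omega>" s t]
      by (simp add: F_def th_local_filter[symmetric])
  qed
  then have "msq F \<le> v" using v(1)[of s] t by simp
  have "msq Z = msq (\<lambda>i \<omega>. F i \<omega> - (F i \<omega> - Z i \<omega>))" by simp
  also have "\<dots> \<le> 2 * msq F + 2 * msq (\<lambda>i \<omega>. F i \<omega> - Z i \<omega>)"
    by (intro msq_diff_le rv_family_diff famF famZ)
  also have "\<dots> \<le> 2 * v + 2"
  proof -
    have "\<delta>\<^sup>2 \<le> 1" using \<delta>_le \<delta>_pos by (intro power_le_one) auto
    then show ?thesis using \<open>msq F \<le> v\<close> FZ by linarith
  qed
  finally show ?thesis using that Z(1,2) tZ by blast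
qed

end

section \<open>The response of the iterates to the noise\<close>

lemma norm_convex_power2:
  fixes x y :: "'v::real_inner"
  shows "(norm ((1 - a) *\<^sub>R x + a *\<^sub>R y))\<^sup>2
    = (1 - a)\<^sup>2 * (norm x)\<^sup>2 + (2 * a * (1 - a)) * (x \<bullet> y) + a\<^sup>2 * (norm y)\<^sup>2"
  unfolding power2_norm_eq_inner inner_add_left inner_add_right inner_scaleR_left inner_scaleR_right
  by (simp add: inner_commute[of y x] power2_eq_square algebra_simps)

context fed_lag
begin

lemma obs_noise_mean_le:
  assumes i: "i < N" and y: "y \<in> space (spc I i)"
  shows "norm (obs_noise_mean \<xi> i m x y) \<le> A * \<delta> * (norm x + 1)"
proof -
  have r: "\<rho> ^ m \<le> \<delta>" using rho_m \<alpha>_\<delta> by linarith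
  have "norm (obs_noise_mean \<xi> i m x y) \<le> norm (Gbar I i x - (\<integral>z. opG I i x z \<partial>state_law I i y m))
      + norm (\<xi> *\<^sub>R (\<integral>z. opb I i z \<partial>state_law I i y m))"
    unfolding obs_noise_mean_def by (rule order_trans[OF norm_triangle_ineq]) (simp add: norm_minus_commute)
  also have "\<dots> \<le> A * norm x * \<rho> ^ m + A * \<rho> ^ m"
    using G_mix[OF i y, of x m] b_mix[OF _ i y, of m] \<xi>01 A1 \<rho>0 by (intro add_mono) auto
  also have "\<dots> \<le> A * norm x * \<delta> + A * \<delta>"
    using r A1 by (intro add_mono mult_left_mono) auto
  finally show ?thesis by (simp add: algebra_simps)
qed

lemma av_obs_noise_mean_le:
  assumes y: "\<And>i. i < N \<Longrightarrow> y i \<in> space (spc I i)"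
  shows "norm (av (\<lambda>i. obs_noise_mean 1 i m (x i) (y i))) \<le> A * \<delta> * (av (\<lambda>i. norm (x i)) + 1)"
proof -
  have r: "\<rho> ^ m \<le> \<delta>" using rho_m \<alpha>_\<delta> by linarith
  have "av (\<lambda>i. obs_noise_mean 1 i m (x i) (y i))
      = av (\<lambda>i. (\<integral>z. opG I i (x i) z \<partial>state_law I i (y i) m) - Gbar I i (x i))
        + av (\<lambda>i. \<integral>z. opb I i z \<partial>state_law I i (y i) m)"
    unfolding obs_noise_mean_def by (simp add: agent_avg_add)
  then have "norm (av (\<lambda>i. obs_noise_mean 1 i m (x i) (y i)))
      \<le> norm (av (\<lambda>i. (\<integral>z. opG I i (x i) z \<partial>state_law I i (y i) m) - Gbar I i (x i)))
        + norm (av (\<lambda>i. \<integral>z. opb I i z \<partial>state_law I i (y i) m))"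
    by (simp add: norm_triangle_ineq)
  also have "\<dots> \<le> av (\<lambda>i. A * norm (x i) * \<delta>) + A * \<delta>"
  proof (rule add_mono)
    show "norm (av (\<lambda>i. (\<integral>z. opG I i (x i) z \<partial>state_law I i (y i) m) - Gbar I i (x i))) \<le> av (\<lambda>i. A * norm (x i) * \<delta>)"
    proof (rule order_trans[OF norm_agent_avg_le agent_avg_mono])
      fix i assume i: "i < N"
      have "norm ((\<integral>z. opG I i (x i) z \<partial>state_law I i (y i) m) - Gbar I i (x i)) \<le> A * norm (x i) * \<rho> ^ m"
        using G_mix[OF i y[OF i], of "x i" m] by (simp add: norm_minus_commute)
      also have "\<dots> \<le> A * norm (x i) * \<delta>" using r A1 by (intro mult_left_mono) auto
      finally show "norm ((\<integral>z. opG I i (x i) z \<partial>state_law I i (y i) m) - Gbar I i (x i)) \<le> A * norm (x i) * \<delta>" .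
    qed
    have "A * \<rho> ^ m \<le> A * \<delta>" using r A1 by (intro mult_left_mono) auto
    then show "norm (av (\<lambda>i. \<integral>z. opb I i z \<partial>state_law I i (y i) m)) \<le> A * \<delta>"
      using b_mix_avg[OF y, of m] by linarith
  qed
  also have "av (\<lambda>i. A * norm (x i) * \<delta>) = A * \<delta> * av (\<lambda>i. norm (x i))"
    by (subst agent_avg_mult[symmetric]) (simp add: mult_ac)
  finally show ?thesis by (simp add: distrib_left)
qed

lemma lag_residual_le:
  assumes z: "0 \<le> v" "q \<le> 2 * v + 2"
  shows "2 * A\<^sup>2 * \<delta>\<^sup>2 * q + 2 * A\<^sup>2 * \<delta>\<^sup>2 \<le> \<delta>\<^sup>2 * Gam v"
proof -
  have "2 * A\<^sup>2 * \<delta>\<^sup>2 * q \<le> 2 * A\<^sup>2 * \<delta>\<^sup>2 * (2 * v + 2)" using z by (intro mult_left_mono) auto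
  moreover have "0 \<le> A\<^sup>2 * \<delta>\<^sup>2 * (4 * v + 2)" using z by (intro mult_nonneg_nonneg) auto
  ultimately show ?thesis by (simp add: Gam_def algebra_simps)
qed

lemma power2_add_one_le: "(A * \<delta> * (x + 1))\<^sup>2 \<le> 2 * A\<^sup>2 * \<delta>\<^sup>2 * x\<^sup>2 + 2 * A\<^sup>2 * \<delta>\<^sup>2"
proof -
  have "(A * \<delta> * (x + 1))\<^sup>2 = (A\<^sup>2 * \<delta>\<^sup>2) * (x + 1)\<^sup>2" by (simp add: power_mult_distrib)
  also have "\<dots> \<le> (A\<^sup>2 * \<delta>\<^sup>2) * (2 * x\<^sup>2 + 2 * 1\<^sup>2)" by (intro mult_left_mono power2_sum_le) simp
  also have "\<dots> = 2 * A\<^sup>2 * \<delta>\<^sup>2 * x\<^sup>2 + 2 * A\<^sup>2 * \<delta>\<^sup>2" by (simp add: algebra_simps)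
  finally show ?thesis .
qed

lemma cross_le:
  assumes l: "l = 0 \<or> l = 1"
    and v: "\<And>r. r \<le> t \<Longrightarrow> msq (th r) \<le> v" "0 \<le> v"
    and y: "\<And>r. r \<le> t \<Longrightarrow> msq (noise_filter l r) \<le> y" "0 \<le> y"
  shows "expectation (\<lambda>\<omega>. av (\<lambda>i. noise_filter l t i \<omega> \<bullet> noise_term \<xi> t i \<omega>)) \<le> 23 * A\<^sup>2 * \<delta> * (y + Gam v)"
proof -
  have G8: "8 \<le> Gam v" by (rule Gam_ge[OF v(2)])
  have n: "msq (noise_term \<xi> t) \<le> Gam v" by (rule msq_noise_term_le[OF v(1)[OF order_refl] \<xi>01])
  have third: "expectation (\<lambda>\<omega>. av (\<lambda>i. (noise_filter l t i \<omega> - noise_filter_frozen l s t i \<omega>) \<bullet> noise_term \<xi> t i \<omega>))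
      \<le> \<delta> * (8 * y + 9 * Gam v) / 2" if "s \<le> t" "t - s \<le> m" for s
  proof -
    have "expectation (\<lambda>\<omega>. av (\<lambda>i. (noise_filter l t i \<omega> - noise_filter_frozen l s t i \<omega>) \<bullet> noise_term \<xi> t i \<omega>))
        \<le> (1 / \<delta> * msq (\<lambda>i \<omega>. noise_filter l t i \<omega> - noise_filter_frozen l s t i \<omega>) + msq (noise_term \<xi> t) / (1 / \<delta>)) / 2"
      using \<delta>_pos by (intro msq_young rv_family_diff rv_family_noise_filter rv_family_noise_filter_frozen rv_family_noise_term) simp
    also have "\<dots> \<le> (1 / \<delta> * (8 * \<delta>\<^sup>2 * (y + Gam v)) + Gam v / (1 / \<delta>)) / 2"
      using \<delta>_pos n noise_filter_frozen_diff_le[OF l that v(1) y(1) v(2) y(2)]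
      by (intro divide_right_mono add_mono mult_left_mono) auto
    also have "\<dots> = \<delta> * (8 * y + 9 * Gam v) / 2" using \<delta>_pos by (simp add: field_simps power2_eq_square)
    finally show ?thesis .
  qed
  have yG: "0 \<le> \<delta> * (y + Gam v)" using \<delta>_pos y(2) G8 by simp
  have A2: "\<delta> * (y + Gam v) \<le> A\<^sup>2 * (\<delta> * (y + Gam v))" using mult_right_mono[OF A_sq yG] by simp
  show ?thesis
  proof (cases "m \<le> t")
    case False
    have 0: "noise_filter_frozen l 0 t = (\<lambda>i \<omega>. 0)"
      by (simp add: noise_filter_frozen_def frozen_def fun_eq_iff)
    have "expectation (\<lambda>\<omega>. av (\<lambda>i. noise_filter l t i \<omega> \<bullet> noise_term \<xi> t i \<omega>)) \<le> \<delta> * (8 * y + 9 * Gam v) / 2"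
      using third[of 0] False by (simp add: 0)
    also have "\<dots> \<le> 23 * (\<delta> * (y + Gam v))"
      using \<delta>_pos y(2) G8 mult_nonneg_nonneg[of \<delta> y] mult_nonneg_nonneg[of \<delta> "Gam v"] by (simp add: algebra_simps)
    finally show ?thesis using A2 by (simp add: mult.assoc)
  next
    case True
    define s where "s = t - m"
    have ts: "t = s + m" using True by (simp add: s_def)
    obtain Z where Z: "\<And>i. i < N \<Longrightarrow> Z i \<in> borel_measurable (Fi s)" "\<And>i. i < N \<Longrightarrow> finite (Z i ` space P)"
      and tZ: "msq (\<lambda>i \<omega>. th t i \<omega> - Z i \<omega>) \<le> 9 * \<delta>\<^sup>2 * Gam v" and mZ: "msq Z \<le> 2 * v + 2"
      using frozen_point[OF ts v] by blast
    have ZFn: "Z i \<in> borel_measurable (Fn s)" if "i < N" for i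
      by (rule measurable_from_subalg[OF subalgebra_Fi_Fn Z(1)[OF that]])
    have ZP: "bounded_rv P (Z i)" if "i < N" for i
      by (rule bounded_rv_mono[OF finite_valued_rv[OF Z(1,2)[OF that]] subalgebra_Fi]) simp
    then have famZ: "rv_family Z" by (rule famI)
    let ?yf = "noise_filter_frozen l s t"
    define nf where "nf i \<omega> = obs_noise \<xi> i (Z i \<omega>) (noise I i t \<omega>)" for i \<omega>
    define en where "en i \<omega> = obs_noise_mean \<xi> i m (Z i \<omega>) (noise I i s \<omega>)" for i \<omega>
    have fnf: "rv_family nf" unfolding nf_def[abs_def] by (intro famI obs_noise_rv ZP noise_measurable)
    have fen: "rv_family en" unfolding en_def[abs_def] by (intro famI Fn_P[OF obs_noise_mean_rv[OF _ ZFn Z(2)]])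
    have yfle: "msq ?yf \<le> y" using msq_noise_filter_frozen_le[OF l, of s t] y(1)[of s] ts by linarith
    have "expectation (\<lambda>\<omega>. av (\<lambda>i. ?yf i \<omega> \<bullet> nf i \<omega>)) = expectation (\<lambda>\<omega>. av (\<lambda>i. ?yf i \<omega> \<bullet> en i \<omega>))"
    proof -
      have "expectation (\<lambda>\<omega>. av (\<lambda>i. ?yf i \<omega> \<bullet> nf i \<omega>)) = av (\<lambda>i. expectation (\<lambda>\<omega>. ?yf i \<omega> \<bullet> nf i \<omega>))"
        using fnf rv_family_noise_filter_frozen[of l s t] by (intro expectation_agent_avg bounded_rv_inner) (auto simp: rv_family_def)
      also have "\<dots> = av (\<lambda>i. expectation (\<lambda>\<omega>. ?yf i \<omega> \<bullet> en i \<omega>))"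
        unfolding nf_def en_def ts
        by (intro agent_avg_cong expectation_inner_obs_noise ZFn Z(2) noise_filter_frozen_rv)
      also have "\<dots> = expectation (\<lambda>\<omega>. av (\<lambda>i. ?yf i \<omega> \<bullet> en i \<omega>))"
        using fen rv_family_noise_filter_frozen[of l s t] by (intro expectation_agent_avg[symmetric] bounded_rv_inner) (auto simp: rv_family_def)
      finally show ?thesis .
    qed
    also have "\<dots> \<le> (\<delta> * msq ?yf + msq en / \<delta>) / 2" by (intro msq_young rv_family_noise_filter_frozen fen \<delta>_pos)
    also have "\<dots> \<le> (\<delta> * y + \<delta>\<^sup>2 * Gam v / \<delta>) / 2"
    proof -
      have "msq en \<le> 2 * A\<^sup>2 * \<delta>\<^sup>2 * msq Z + 2 * A\<^sup>2 * \<delta>\<^sup>2"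
      proof (rule msq_affine[OF fen famZ])
        fix i \<omega> assume i: "i < N" and w: "\<omega> \<in> space P"
        have "(norm (en i \<omega>))\<^sup>2 \<le> (A * \<delta> * (norm (Z i \<omega>) + 1))\<^sup>2"
          unfolding en_def by (intro power_mono obs_noise_mean_le i noise_space w) simp
        also note power2_add_one_le
        finally show "(norm (en i \<omega>))\<^sup>2 \<le> 2 * A\<^sup>2 * \<delta>\<^sup>2 * (norm (Z i \<omega>))\<^sup>2 + 2 * A\<^sup>2 * \<delta>\<^sup>2" .
      qed
      also have "\<dots> \<le> \<delta>\<^sup>2 * Gam v" by (rule lag_residual_le[OF v(2) mZ])
      finally show ?thesis using yfle \<delta>_pos by (intro divide_right_mono add_mono mult_left_mono) auto
    qed
    finally have first: "expectation (\<lambda>\<omega>. av (\<lambda>i. ?yf i \<omega> \<bullet> nf i \<omega>)) \<le> \<delta> * (y + Gam v) / 2"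
      using \<delta>_pos by (simp add: power2_eq_square algebra_simps)
    have "msq (\<lambda>i \<omega>. noise_term \<xi> t i \<omega> - nf i \<omega>) \<le> 4 * A\<^sup>2 * msq (\<lambda>i \<omega>. th t i \<omega> - Z i \<omega>) + 0"
    proof (rule msq_affine[OF rv_family_diff[OF rv_family_noise_term fnf] rv_family_diff[OF rv_family_th famZ]])
      fix i \<omega> assume i: "i < N" and w: "\<omega> \<in> space P"
      have "(norm (noise_term \<xi> t i \<omega> - nf i \<omega>))\<^sup>2 \<le> (2 * A * norm (th t i \<omega> - Z i \<omega>))\<^sup>2"
        unfolding noise_term_def nf_def by (intro power_mono obs_noise_lip i noise_space w) simp
      then show "(norm (noise_term \<xi> t i \<omega> - nf i \<omega>))\<^sup>2 \<le> 4 * A\<^sup>2 * (norm (th t i \<omega> - Z i \<omega>))\<^sup>2 + 0"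
        by (simp add: power_mult_distrib)
    qed
    also have "\<dots> \<le> 4 * A\<^sup>2 * (9 * \<delta>\<^sup>2 * Gam v)" using tZ mult_left_mono[OF tZ, of "4 * A\<^sup>2"] by simp
    finally have nnf: "msq (\<lambda>i \<omega>. noise_term \<xi> t i \<omega> - nf i \<omega>) \<le> 36 * A\<^sup>2 * \<delta>\<^sup>2 * Gam v" by simp
    have "expectation (\<lambda>\<omega>. av (\<lambda>i. ?yf i \<omega> \<bullet> (noise_term \<xi> t i \<omega> - nf i \<omega>)))
        \<le> (\<delta> * msq ?yf + msq (\<lambda>i \<omega>. noise_term \<xi> t i \<omega> - nf i \<omega>) / \<delta>) / 2"
      by (intro msq_young rv_family_noise_filter_frozen rv_family_diff rv_family_noise_term fnf \<delta>_pos)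
    also have "\<dots> \<le> (\<delta> * y + 36 * A\<^sup>2 * \<delta>\<^sup>2 * Gam v / \<delta>) / 2"
      using yfle nnf \<delta>_pos by (intro divide_right_mono add_mono mult_left_mono) auto
    also have "\<dots> = \<delta> * (y + 36 * A\<^sup>2 * Gam v) / 2" using \<delta>_pos by (simp add: power2_eq_square algebra_simps)
    finally have second: "expectation (\<lambda>\<omega>. av (\<lambda>i. ?yf i \<omega> \<bullet> (noise_term \<xi> t i \<omega> - nf i \<omega>))) \<le> \<delta> * (y + 36 * A\<^sup>2 * Gam v) / 2" .
    have "expectation (\<lambda>\<omega>. av (\<lambda>i. noise_filter l t i \<omega> \<bullet> noise_term \<xi> t i \<omega>))
        = expectation (\<lambda>\<omega>. (av (\<lambda>i. ?yf i \<omega> \<bullet> nf i \<omega>) + av (\<lambda>i. ?yf i \<omega> \<bullet> (noise_term \<xi> t i \<omega> - nf i \<omega>)))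
            + av (\<lambda>i. (noise_filter l t i \<omega> - ?yf i \<omega>) \<bullet> noise_term \<xi> t i \<omega>))"
      unfolding agent_avg_add[symmetric] by (simp add: inner_diff_left inner_diff_right)
    also have "\<dots> = expectation (\<lambda>\<omega>. av (\<lambda>i. ?yf i \<omega> \<bullet> nf i \<omega>)) + expectation (\<lambda>\<omega>. av (\<lambda>i. ?yf i \<omega> \<bullet> (noise_term \<xi> t i \<omega> - nf i \<omega>)))
            + expectation (\<lambda>\<omega>. av (\<lambda>i. (noise_filter l t i \<omega> - ?yf i \<omega>) \<bullet> noise_term \<xi> t i \<omega>))"
      using integrable_bounded_rv[OF rv_family_inner[OF rv_family_noise_filter_frozen fnf]]
        integrable_bounded_rv[OF rv_family_inner[OF rv_family_noise_filter_frozen rv_family_diff[OF rv_family_noise_term fnf]]]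
        integrable_bounded_rv[OF rv_family_inner[OF rv_family_diff[OF rv_family_noise_filter rv_family_noise_filter_frozen] rv_family_noise_term]] by simp
    also have "\<dots> \<le> \<delta> * (y + Gam v) / 2 + \<delta> * (y + 36 * A\<^sup>2 * Gam v) / 2 + \<delta> * (8 * y + 9 * Gam v) / 2"
      using first second third[of s] ts by linarith
    also have "\<dots> = \<delta> * (10 * y + 10 * Gam v + 36 * A\<^sup>2 * Gam v) / 2" by (simp add: field_simps)
    also have "\<dots> \<le> \<delta> * (46 * (A\<^sup>2 * (y + Gam v))) / 2"
    proof (intro divide_right_mono mult_left_mono)
      have "0 \<le> A\<^sup>2 * y" using y(2) by simp
      moreover have "y + Gam v \<le> A\<^sup>2 * (y + Gam v)" using mult_right_mono[OF A_sq, of "y + Gam v"] y(2) G8 by simp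
      ultimately show "10 * y + 10 * Gam v + 36 * A\<^sup>2 * Gam v \<le> 46 * (A\<^sup>2 * (y + Gam v))"
        by (simp add: algebra_simps)
    qed (use \<delta>_pos in auto)
    finally show ?thesis by (simp add: mult_ac)
  qed
qed

lemma noise_filter_Suc_le:
  assumes l: "l = 0 \<or> l = 1"
    and v: "\<And>r. r \<le> t \<Longrightarrow> msq (th r) \<le> v" "0 \<le> v"
    and y: "\<And>r. r \<le> t \<Longrightarrow> msq (noise_filter l r) \<le> y" "0 \<le> y"
  shows "msq (noise_filter l (Suc t)) \<le> (1 - \<alpha>) * msq (noise_filter l t) + \<alpha> * (47 * A\<^sup>2 * \<delta> * (y + Gam v))"
proof -
  have G8: "8 \<le> Gam v" by (rule Gam_ge[OF v(2)])
  have yG: "0 \<le> \<delta> * (y + Gam v)" using \<delta>_pos y(2) G8 by simp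
  let ?c = "expectation (\<lambda>\<omega>. av (\<lambda>i. noise_filter l t i \<omega> \<bullet> noise_term \<xi> t i \<omega>))"
  have "msq (noise_filter l (Suc t)) \<le> expectation (\<lambda>\<omega>. 1 * ((1 - \<alpha>)\<^sup>2 * av (\<lambda>i. (norm (noise_filter l t i \<omega>))\<^sup>2)
      + (2 * \<alpha> * (1 - \<alpha>)) * av (\<lambda>i. noise_filter l t i \<omega> \<bullet> noise_term \<xi> t i \<omega>) + 0) + \<alpha>\<^sup>2 * av (\<lambda>i. (norm (noise_term \<xi> t i \<omega>))\<^sup>2) + 0)"
    unfolding msq_def
  proof (rule bounded_rv_expectation_mono)
    fix \<omega>
    have "av (\<lambda>i. (norm (noise_filter l (Suc t) i \<omega>))\<^sup>2) \<le> av (\<lambda>i. (norm ((1 - \<alpha>) *\<^sub>R noise_filter l t i \<omega> + \<alpha> *\<^sub>R noise_term \<xi> t i \<omega>))\<^sup>2)"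
      unfolding noise_filter_def by (rule is_norm_local_filter_Suc_le[OF is_norm_norm l])
    also have "\<dots> = av (\<lambda>i. (1 - \<alpha>)\<^sup>2 * (norm (noise_filter l t i \<omega>))\<^sup>2
       + (2 * \<alpha> * (1 - \<alpha>)) * (noise_filter l t i \<omega> \<bullet> noise_term \<xi> t i \<omega>) + \<alpha>\<^sup>2 * (norm (noise_term \<xi> t i \<omega>))\<^sup>2)"
      by (intro agent_avg_cong norm_convex_power2)
    finally show "av (\<lambda>i. (norm (noise_filter l (Suc t) i \<omega>))\<^sup>2) \<le> 1 * ((1 - \<alpha>)\<^sup>2 * av (\<lambda>i. (norm (noise_filter l t i \<omega>))\<^sup>2)
      + (2 * \<alpha> * (1 - \<alpha>)) * av (\<lambda>i. noise_filter l t i \<omega> \<bullet> noise_term \<xi> t i \<omega>) + 0) + \<alpha>\<^sup>2 * av (\<lambda>i. (norm (noise_term \<xi> t i \<omega>))\<^sup>2) + 0"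
      unfolding agent_avg_add agent_avg_mult by simp
  qed (intro bounded_rv_add bounded_rv_cmult bounded_rv_const rv_family_sq rv_family_inner rv_family_noise_filter rv_family_noise_term)+
  also have "\<dots> = 1 * ((1 - \<alpha>)\<^sup>2 * msq (noise_filter l t) + (2 * \<alpha> * (1 - \<alpha>)) * ?c + 0) + \<alpha>\<^sup>2 * msq (noise_term \<xi> t) + 0"
    unfolding msq_def
    by (simp only: expectation_lin[OF bounded_rv_add[OF bounded_rv_add[OF bounded_rv_cmult[OF rv_family_sq[OF rv_family_noise_filter]]
          bounded_rv_cmult[OF rv_family_inner[OF rv_family_noise_filter rv_family_noise_term]]] bounded_rv_const] rv_family_sq[OF rv_family_noise_term]]
        expectation_lin[OF rv_family_sq[OF rv_family_noise_filter] rv_family_inner[OF rv_family_noise_filter rv_family_noise_term]])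
  also have "\<dots> \<le> (1 - \<alpha>) * msq (noise_filter l t) + 2 * \<alpha> * (23 * A\<^sup>2 * \<delta> * (y + Gam v)) + \<alpha> * (\<delta> * Gam v)"
  proof -
    have h1: "(1 - \<alpha>)\<^sup>2 * msq (noise_filter l t) \<le> (1 - \<alpha>) * msq (noise_filter l t)"
      using \<alpha>_pos \<alpha>_le by (intro mult_right_mono msq_nonneg) (simp add: power2_eq_square mult_left_le)
    have h2: "(2 * \<alpha> * (1 - \<alpha>)) * ?c \<le> (2 * \<alpha> * (1 - \<alpha>)) * (23 * A\<^sup>2 * \<delta> * (y + Gam v))"
      using \<alpha>_pos \<alpha>_le cross_le[OF l v y] by (intro mult_left_mono) auto
    have h3: "(2 * \<alpha> * (1 - \<alpha>)) * (23 * A\<^sup>2 * \<delta> * (y + Gam v)) \<le> (2 * \<alpha>) * (23 * A\<^sup>2 * \<delta> * (y + Gam v))"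
      using \<alpha>_pos \<alpha>_le yG by (intro mult_right_mono) (auto simp: mult.assoc)
    have h4: "\<alpha>\<^sup>2 * msq (noise_term \<xi> t) \<le> \<alpha> * (\<delta> * Gam v)"
      unfolding power2_eq_square mult.assoc
      using \<alpha>_pos \<alpha>_\<delta> \<delta>_pos msq_noise_term_le[OF v(1)[OF order_refl] \<xi>01] msq_nonneg
      by (intro mult_left_mono mult_mono) auto
    show ?thesis unfolding mult_1 add_0_right by (rule add_mono[OF add_mono[OF h1 order_trans[OF h2 h3]] h4])
  qed
  also have "\<alpha> * (\<delta> * Gam v) \<le> \<alpha> * (A\<^sup>2 * (\<delta> * (y + Gam v)))"
  proof (intro mult_left_mono)
    have "\<delta> * Gam v \<le> \<delta> * (y + Gam v)" using \<delta>_pos y(2) by (intro mult_left_mono) auto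
    also have "\<dots> \<le> A\<^sup>2 * (\<delta> * (y + Gam v))" using mult_right_mono[OF A_sq yG] by simp
    finally show "\<delta> * Gam v \<le> A\<^sup>2 * (\<delta> * (y + Gam v))" .
  qed (use \<alpha>_pos in auto)
  finally show ?thesis by (simp add: algebra_simps)
qed

lemma noise_filter_0 [simp]: "msq (noise_filter l 0) = 0"
  by (simp add: msq_def noise_filter_def)

lemma noise_filter_msq:
  assumes l: "l = 0 \<or> l = 1" and v: "\<And>r. r \<le> T \<Longrightarrow> msq (th r) \<le> v" "0 \<le> v" and "t \<le> T"
  shows "msq (noise_filter l t) \<le> 94 * A\<^sup>2 * \<delta> * Gam v"
proof -
  define y where "y = Max ((\<lambda>r. msq (noise_filter l r)) ` {..T})"
  have y: "msq (noise_filter l r) \<le> y" if "r \<le> T" for r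
    unfolding y_def using that by (intro Max_ge) auto
  have y0: "0 \<le> y" using y[of 0] by simp
  let ?D = "47 * A\<^sup>2 * \<delta> * (y + Gam v)"
  have D: "0 \<le> ?D" using \<delta>_pos y0 Gam_ge[OF v(2)] by simp
  have "msq (noise_filter l r) \<le> ?D" if "r \<le> T" for r
    using that
  proof (induction r)
    case (Suc r)
    have "msq (noise_filter l (Suc r)) \<le> (1 - \<alpha>) * msq (noise_filter l r) + \<alpha> * ?D"
      using Suc.prems by (intro noise_filter_Suc_le l v y y0) auto
    also have "\<dots> \<le> (1 - \<alpha>) * ?D + \<alpha> * ?D"
      using mult_left_mono[OF Suc.IH, of "1 - \<alpha>"] Suc.prems \<alpha>_le by linarith
    finally show ?case by (simp add: left_diff_distrib)
  qed (use D in simp)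
  then have "y \<le> ?D" unfolding y_def by (subst Max_le_iff) auto
  moreover have "?D = (47 * A\<^sup>2 * \<delta>) * y + 47 * A\<^sup>2 * \<delta> * Gam v" by (simp add: algebra_simps)
  moreover have "(47 * A\<^sup>2 * \<delta>) * y \<le> 1 / 2 * y" using \<delta>_A2 y0 by (intro mult_right_mono) auto
  ultimately have "y \<le> 94 * A\<^sup>2 * \<delta> * Gam v" by linarith
  with y[OF \<open>t \<le> T\<close>] show ?thesis by linarith
qed

lemma noise_filter_restart_msq:
  assumes v: "\<And>r. r \<le> T \<Longrightarrow> msq (th r) \<le> v" "0 \<le> v" and "t \<le> T"
  shows "msq (noise_filter 0 t) \<le> 94 * A\<^sup>2 * Gam v * (\<alpha> * real K * \<delta>)"
proof -
  have G8: "8 \<le> Gam v" by (rule Gam_ge[OF v(2)])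
  let ?y = "94 * A\<^sup>2 * \<delta> * Gam v"
  have y: "msq (noise_filter 0 r) \<le> ?y" if "r \<le> T" for r by (rule noise_filter_msq[OF _ v that]) simp
  have yG: "?y \<le> Gam v" using mult_right_mono[of "94 * A\<^sup>2 * \<delta>" 1 "Gam v"] \<delta>_A2 \<delta>_pos G8 by simp
  let ?D = "\<alpha> * (47 * A\<^sup>2 * \<delta> * (?y + Gam v))"
  have D: "0 \<le> ?D" using \<delta>_pos \<alpha>_pos G8 by simp
  have "msq (noise_filter 0 r) \<le> real (r mod K) * ?D" if "r \<le> T" for r
    using that
  proof (induction r)
    case (Suc r)
    show ?case
    proof (cases "K dvd Suc r")
      case True
      then have "noise_filter 0 (Suc r) = (\<lambda>i \<omega>. 0)" by (simp add: noise_filter_def fun_eq_iff)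
      then show ?thesis using D by (simp add: msq_def)
    next
      case False
      then have mod: "Suc r mod K = Suc (r mod K)" by (auto simp: mod_Suc dvd_eq_mod_eq_0 split: if_splits)
      have "msq (noise_filter 0 (Suc r)) \<le> (1 - \<alpha>) * msq (noise_filter 0 r) + ?D"
        using Suc.prems \<delta>_pos G8 by (intro noise_filter_Suc_le v y) auto
      also have "\<dots> \<le> msq (noise_filter 0 r) + ?D" using \<alpha>_pos msq_nonneg[of "noise_filter 0 r"] by (simp add: algebra_simps)
      also have "\<dots> \<le> real (r mod K) * ?D + ?D" using Suc by simp
      finally show ?thesis by (simp add: mod algebra_simps)
    qed
  qed simp
  then have "msq (noise_filter 0 t) \<le> real (t mod K) * ?D" using \<open>t \<le> T\<close> by blast
  also have "\<dots> \<le> real K * (\<alpha> * (47 * A\<^sup>2 * \<delta> * (2 * Gam v)))"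
    using K1 yG \<alpha>_pos \<delta>_pos G8 by (intro mult_mono mult_left_mono mult_nonneg_nonneg) (auto simp: less_imp_le)
  finally show ?thesis by (simp add: mult_ac)
qed

end

section \<open>Boundedness of the iterates and the consensus error\<close>

lemma one_minus_power_ge:
  fixes x :: real
  assumes "0 \<le> x" "x \<le> 1 / 2" "x * real j \<le> 1"
  shows "1 \<le> exp 2 * (1 - x) ^ j"
proof -
  have "- x - 2 * x\<^sup>2 \<le> ln (1 - x)" using assms by (intro ln_one_minus_pos_lower_bound) auto
  moreover have "2 * x\<^sup>2 \<le> x" using assms mult_left_mono[of x "1/2" "2 * x"] by (simp add: power2_eq_square)
  ultimately have "- 2 * x \<le> ln (1 - x)" by linarith
  then have "real j * (- 2 * x) \<le> real j * ln (1 - x)" by (intro mult_left_mono) auto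
  moreover have "real j * (- 2 * x) = - 2 * (x * real j)" by simp
  ultimately have "- 2 \<le> real j * ln (1 - x)" using assms(3) by linarith
  then have "exp (- 2) \<le> exp (real j * ln (1 - x))" by simp
  also have "\<dots> = (1 - x) ^ j" using assms(2) by (subst exp_of_nat_mult) simp
  finally have "exp 2 * exp (- 2) \<le> exp 2 * (1 - x) ^ j" by (intro mult_left_mono) auto
  then show ?thesis by (simp add: exp_minus)
qed

context fed_lag
begin

definition "\<kappa> = 1 - \<gamma>"

lemma \<kappa>: "0 < \<kappa>" "\<kappa> \<le> 1" "\<alpha> * \<kappa> < 1" "0 < \<alpha> * \<kappa>" "\<alpha> * \<kappa> \<le> 1/2"
proof -
  show k: "0 < \<kappa>" "\<kappa> \<le> 1" using \<gamma>0 \<gamma>1 by (auto simp: \<kappa>_def)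
  have "\<alpha> * \<kappa> \<le> \<alpha>" using k \<alpha>_pos by simp
  then show "\<alpha> * \<kappa> < 1" "\<alpha> * \<kappa> \<le> 1/2" using \<alpha>_le by linarith+
  show "0 < \<alpha> * \<kappa>" using k \<alpha>_pos by simp
qed

lemma \<kappa>_div: "1 \<le> 1 / \<kappa>\<^sup>2" "1 / \<kappa> \<le> 1 / \<kappa>\<^sup>2"
proof -
  have "\<kappa>\<^sup>2 \<le> 1" "\<kappa>\<^sup>2 \<le> \<kappa>" using \<kappa> by (auto simp: power2_eq_square mult_le_one)
  then show "1 \<le> 1 / \<kappa>\<^sup>2" "1 / \<kappa> \<le> 1 / \<kappa>\<^sup>2" using \<kappa> by (auto intro!: divide_left_mono)
qed

definition "B = 1 - \<xi>"

lemma B: "0 \<le> B" "B \<le> 1" "B\<^sup>2 = B" using \<xi>01 by (auto simp: B_def)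

definition X :: "nat \<Rightarrow> nat \<Rightarrow> 'w \<Rightarrow> 'v" where
  "X t i \<omega> = local_filter 1 \<theta>0 (\<lambda>t i. drift t i \<omega>) t i"

definition U :: "nat \<Rightarrow> real" where
  "U t = expectation (\<lambda>\<omega>. av (\<lambda>i. (nrm (X t i \<omega>))\<^sup>2))"

lemma th_split: "th t i \<omega> = X t i \<omega> + noise_filter 1 t i \<omega>"
  using local_filter_add[of 1 \<theta>0 0 "\<lambda>t i. drift t i \<omega>" "\<lambda>t i. noise_term \<xi> t i \<omega>" t i]
  by (simp add: X_def noise_filter_def th_local_filter[symmetric])

lemma rv_family_X: "rv_family (X t)"
  unfolding X_def[abs_def] by (intro famI Fn_P[OF local_filter_rv[OF drift_rv]])

lemma rv_family_nrm: "rv_family Y \<Longrightarrow> bounded_rv P (\<lambda>\<omega>. av (\<lambda>i. (nrm (Y i \<omega>))\<^sup>2))"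
  by (intro bounded_rv_agent_avg bounded_rv_power2 bounded_rv_is_norm[OF nrm nrm_le]) (simp add: rv_family_def)

lemma nrm_drift_le:
  assumes i: "i < N" and w: "\<omega> \<in> space P"
  shows "nrm (drift t i \<omega>) \<le> \<gamma> * nrm (th t i \<omega>) + A\<^sup>2 * B"
proof -
  have "nrm (drift t i \<omega>) \<le> nrm (Gbar I i (th t i \<omega>)) + nrm (B *\<^sub>R opb I i (noise I i t \<omega>))"
    unfolding drift_def B_def by (rule is_norm_simps(3)[OF nrm])
  also have "nrm (B *\<^sub>R opb I i (noise I i t \<omega>)) \<le> A * (B * A)"
    by (rule order_trans[OF nrm_le]) (use A1 B b_le[OF i noise_space[OF i w]] in \<open>auto intro!: mult_left_mono\<close>)
  finally show ?thesis using Gbar_nrm[OF i, of "th t i \<omega>"] by (simp add: power2_eq_square mult_ac)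
qed

lemma norm_drift_power2_le:
  assumes i: "i < N" and w: "\<omega> \<in> space P"
  shows "(norm (drift t i \<omega>))\<^sup>2 \<le> 2 * A\<^sup>2 * (norm (th t i \<omega>))\<^sup>2 + 2 * A\<^sup>2 * B"
proof -
  have "(norm (drift t i \<omega>))\<^sup>2 \<le> 2 * (norm (Gbar I i (th t i \<omega>)))\<^sup>2 + 2 * (norm (B *\<^sub>R opb I i (noise I i t \<omega>)))\<^sup>2"
    unfolding drift_def B_def by (rule norm_add_power2_le)
  also have "\<dots> \<le> 2 * (A * norm (th t i \<omega>))\<^sup>2 + 2 * (B * A)\<^sup>2"
    using Gbar_le[OF i] b_le[OF i noise_space[OF i w]] B
    by (intro add_mono mult_left_mono power_mono) (auto intro!: mult_left_mono)
  finally show ?thesis by (simp add: power_mult_distrib B mult_ac)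
qed

lemma contraction_step:
  assumes "0 \<le> x" "0 \<le> w" "0 \<le> b"
  shows "((1 - \<alpha>) * x + \<alpha> * (\<gamma> * (x + w) + b))\<^sup>2 \<le> (1 - \<alpha> * \<kappa>) * x\<^sup>2 + (2 * \<alpha> / \<kappa>) * (w\<^sup>2 + b\<^sup>2)"
proof -
  have "(1 - \<alpha>) * x + \<alpha> * (\<gamma> * (x + w) + b) = (1 - \<alpha> * \<kappa>) * x + \<alpha> * (\<gamma> * w + b)"
    by (simp add: \<kappa>_def algebra_simps)
  also have "\<dots>\<^sup>2 \<le> (1 - \<alpha> * \<kappa>) * x\<^sup>2 + (\<alpha> * (\<gamma> * w + b))\<^sup>2 / (\<alpha> * \<kappa>)"
    by (rule convex_power2_le) (use \<kappa> in auto)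
  also have "(\<alpha> * (\<gamma> * w + b))\<^sup>2 / (\<alpha> * \<kappa>) = (\<alpha> / \<kappa>) * (\<gamma> * w + b)\<^sup>2"
    using \<alpha>_pos by (simp add: power2_eq_square)
  also have "\<dots> \<le> (\<alpha> / \<kappa>) * (2 * w\<^sup>2 + 2 * b\<^sup>2)"
  proof (intro mult_left_mono)
    have "(\<gamma> * w + b)\<^sup>2 \<le> (w + b)\<^sup>2"
      using assms \<gamma>0 \<gamma>1 by (intro power_mono add_right_mono) (auto simp: mult_left_le_one_le)
    also note power2_sum_le
    finally show "(\<gamma> * w + b)\<^sup>2 \<le> 2 * w\<^sup>2 + 2 * b\<^sup>2" .
  qed (use \<kappa> \<alpha>_pos in auto)
  finally show ?thesis by (simp add: algebra_simps)
qed

lemma U_Suc_le: "U (Suc t) \<le> (1 - \<alpha> * \<kappa>) * U t + (2 * \<alpha> / \<kappa>) * (A\<^sup>2 * msq (noise_filter 1 t) + A ^ 4 * B)"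
proof -
  have "U (Suc t) \<le> expectation (\<lambda>\<omega>. (1 - \<alpha> * \<kappa>) * av (\<lambda>i. (nrm (X t i \<omega>))\<^sup>2)
      + (2 * \<alpha> / \<kappa> * A\<^sup>2) * av (\<lambda>i. (norm (noise_filter 1 t i \<omega>))\<^sup>2) + 2 * \<alpha> / \<kappa> * (A ^ 4 * B))"
    unfolding U_def
  proof (rule bounded_rv_expectation_mono)
    fix \<omega> assume w: "\<omega> \<in> space P"
    have "av (\<lambda>i. (nrm (X (Suc t) i \<omega>))\<^sup>2) \<le> av (\<lambda>i. (nrm ((1 - \<alpha>) *\<^sub>R X t i \<omega> + \<alpha> *\<^sub>R drift t i \<omega>))\<^sup>2)"
      unfolding X_def by (rule is_norm_local_filter_Suc_le[OF nrm]) simp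
    also have "\<dots> \<le> av (\<lambda>i. (1 - \<alpha> * \<kappa>) * (nrm (X t i \<omega>))\<^sup>2 + (2 * \<alpha> / \<kappa> * A\<^sup>2) * (norm (noise_filter 1 t i \<omega>))\<^sup>2 + 2 * \<alpha> / \<kappa> * (A ^ 4 * B))"
    proof (rule agent_avg_mono)
      fix i assume i: "i < N"
      let ?x = "nrm (X t i \<omega>)" and ?w = "A * norm (noise_filter 1 t i \<omega>)"
      have "nrm ((1 - \<alpha>) *\<^sub>R X t i \<omega> + \<alpha> *\<^sub>R drift t i \<omega>) \<le> (1 - \<alpha>) * ?x + \<alpha> * nrm (drift t i \<omega>)"
        using is_norm_simps(3)[OF nrm, of "(1 - \<alpha>) *\<^sub>R X t i \<omega>" "\<alpha> *\<^sub>R drift t i \<omega>"] \<alpha>_pos \<alpha>_le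
        by (simp add: is_norm_simps(2)[OF nrm])
      also have "\<dots> \<le> (1 - \<alpha>) * ?x + \<alpha> * (\<gamma> * (?x + ?w) + A\<^sup>2 * B)"
      proof (intro add_left_mono mult_left_mono order_trans[OF nrm_drift_le[OF i w]] add_right_mono)
        show "nrm (th t i \<omega>) \<le> ?x + ?w"
          unfolding th_split using is_norm_simps(3)[OF nrm, of "X t i \<omega>" "noise_filter 1 t i \<omega>"] nrm_le[of "noise_filter 1 t i \<omega>"] by linarith
      qed (use \<alpha>_pos \<gamma>0 in auto)
      finally have "(nrm ((1 - \<alpha>) *\<^sub>R X t i \<omega> + \<alpha> *\<^sub>R drift t i \<omega>))\<^sup>2 \<le> ((1 - \<alpha>) * ?x + \<alpha> * (\<gamma> * (?x + ?w) + A\<^sup>2 * B))\<^sup>2"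
        using is_norm_simps(1)[OF nrm] by (intro power_mono)
      also have "\<dots> \<le> (1 - \<alpha> * \<kappa>) * ?x\<^sup>2 + (2 * \<alpha> / \<kappa>) * (?w\<^sup>2 + (A\<^sup>2 * B)\<^sup>2)"
        using is_norm_simps(1)[OF nrm] A1 B by (intro contraction_step) auto
      also have "\<dots> = (1 - \<alpha> * \<kappa>) * ?x\<^sup>2 + (2 * \<alpha> / \<kappa> * A\<^sup>2) * (norm (noise_filter 1 t i \<omega>))\<^sup>2 + 2 * \<alpha> / \<kappa> * (A ^ 4 * B)"
      proof -
        have "(A\<^sup>2 * B)\<^sup>2 = A ^ 4 * B" by (simp add: power_mult_distrib B)
        moreover have "?w\<^sup>2 = A\<^sup>2 * (norm (noise_filter 1 t i \<omega>))\<^sup>2" by (simp add: power_mult_distrib)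
        ultimately show ?thesis by (simp only: distrib_left mult.assoc add.assoc)
      qed
      finally show "(nrm ((1 - \<alpha>) *\<^sub>R X t i \<omega> + \<alpha> *\<^sub>R drift t i \<omega>))\<^sup>2
        \<le> (1 - \<alpha> * \<kappa>) * (nrm (X t i \<omega>))\<^sup>2 + (2 * \<alpha> / \<kappa> * A\<^sup>2) * (norm (noise_filter 1 t i \<omega>))\<^sup>2 + 2 * \<alpha> / \<kappa> * (A ^ 4 * B)" .
    qed
    finally show "av (\<lambda>i. (nrm (X (Suc t) i \<omega>))\<^sup>2) \<le> (1 - \<alpha> * \<kappa>) * av (\<lambda>i. (nrm (X t i \<omega>))\<^sup>2)
      + (2 * \<alpha> / \<kappa> * A\<^sup>2) * av (\<lambda>i. (norm (noise_filter 1 t i \<omega>))\<^sup>2) + 2 * \<alpha> / \<kappa> * (A ^ 4 * B)"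
      by (simp only: agent_avg_add agent_avg_mult agent_avg_const[OF N1])
  qed (intro bounded_rv_add bounded_rv_cmult bounded_rv_const rv_family_nrm rv_family_sq rv_family_X rv_family_noise_filter)+
  also have "\<dots> = (1 - \<alpha> * \<kappa>) * U t + (2 * \<alpha> / \<kappa> * A\<^sup>2) * msq (noise_filter 1 t) + 2 * \<alpha> / \<kappa> * (A ^ 4 * B)"
    unfolding U_def msq_def by (rule expectation_lin[OF rv_family_nrm[OF rv_family_X] rv_family_sq[OF rv_family_noise_filter]])
  also have "\<dots> = (1 - \<alpha> * \<kappa>) * U t + (2 * \<alpha> / \<kappa>) * (A\<^sup>2 * msq (noise_filter 1 t) + A ^ 4 * B)"
    by (simp only: distrib_left mult.assoc add.assoc)
  finally show ?thesis .
qed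

lemma geometric_recursion_le:
  assumes "x 0 \<le> b" "0 \<le> e" "\<And>t. t < T \<Longrightarrow> x (Suc t) \<le> (1 - \<alpha> * \<kappa>) * x t + (2 * \<alpha> / \<kappa>) * e" "t \<le> T"
  shows "x t \<le> (1 - \<alpha> * \<kappa>) ^ t * b + 2 / \<kappa>\<^sup>2 * e"
  using assms(4)
proof (induction t)
  case 0
  have "0 \<le> 2 / \<kappa>\<^sup>2 * e" using assms(2) by simp
  with assms(1) show ?case by simp
next
  case (Suc t)
  have "x (Suc t) \<le> (1 - \<alpha> * \<kappa>) * x t + (2 * \<alpha> / \<kappa>) * e" using Suc.prems by (intro assms(3)) auto
  also have "\<dots> \<le> (1 - \<alpha> * \<kappa>) * ((1 - \<alpha> * \<kappa>) ^ t * b + 2 / \<kappa>\<^sup>2 * e) + (2 * \<alpha> / \<kappa>) * e"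
    using mult_left_mono[OF Suc.IH, of "1 - \<alpha> * \<kappa>"] Suc.prems \<kappa>(3) by simp
  also have "\<dots> = (1 - \<alpha> * \<kappa>) ^ Suc t * b + 2 / \<kappa>\<^sup>2 * e"
    using \<kappa>(1) by (simp add: field_simps power2_eq_square)
  finally show ?case .
qed

lemma U_0: "U 0 \<le> A\<^sup>2 * (norm \<theta>0)\<^sup>2"
proof -
  have "U 0 = (nrm \<theta>0)\<^sup>2" using N1 by (simp add: U_def X_def agent_avg_const prob_space)
  also have "\<dots> \<le> (A * norm \<theta>0)\<^sup>2" by (intro power_mono nrm_le is_norm_simps(1)[OF nrm])
  finally show ?thesis by (simp add: power_mult_distrib)
qed

lemma msq_th_le_U: "msq (th t) \<le> 2 * A\<^sup>2 * U t + 2 * msq (noise_filter 1 t)"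
proof -
  have "msq (th t) \<le> 2 * A\<^sup>2 * U t + 2 * expectation (\<lambda>\<omega>. av (\<lambda>i. (norm (noise_filter 1 t i \<omega>))\<^sup>2)) + 0"
    unfolding U_def
  proof (rule msq_le_lin[OF rv_family_th rv_family_nrm[OF rv_family_X] rv_family_sq[OF rv_family_noise_filter]])
    fix \<omega>
    have "av (\<lambda>i. (norm (th t i \<omega>))\<^sup>2) \<le> av (\<lambda>i. 2 * A\<^sup>2 * (nrm (X t i \<omega>))\<^sup>2 + 2 * (norm (noise_filter 1 t i \<omega>))\<^sup>2)"
    proof (rule agent_avg_mono)
      fix i
      have "(norm (X t i \<omega>))\<^sup>2 \<le> (A * nrm (X t i \<omega>))\<^sup>2" by (intro power_mono norm_le) simp
      then show "(norm (th t i \<omega>))\<^sup>2 \<le> 2 * A\<^sup>2 * (nrm (X t i \<omega>))\<^sup>2 + 2 * (norm (noise_filter 1 t i \<omega>))\<^sup>2"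
        using norm_add_power2_le[of "X t i \<omega>" "noise_filter 1 t i \<omega>"] by (simp add: th_split power_mult_distrib)
    qed
    then show "av (\<lambda>i. (norm (th t i \<omega>))\<^sup>2) \<le> 2 * A\<^sup>2 * av (\<lambda>i. (nrm (X t i \<omega>))\<^sup>2) + 2 * av (\<lambda>i. (norm (noise_filter 1 t i \<omega>))\<^sup>2) + 0"
      by (simp only: agent_avg_add agent_avg_mult add_0_right)
  qed
  then show ?thesis by (simp add: msq_def)
qed

lemma msq_th_le:
  assumes v: "\<And>r. r \<le> T \<Longrightarrow> msq (th r) \<le> v" "0 \<le> v" and "t \<le> T"
  shows "msq (th t) \<le> 2 * A ^ 4 * (norm \<theta>0)\<^sup>2 * (1 - \<alpha> * \<kappa>) ^ t
    + 6 * A ^ 4 / \<kappa>\<^sup>2 * (94 * A\<^sup>2 * \<delta> * Gam v) + 6 * A ^ 8 / \<kappa>\<^sup>2 * B"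
proof -
  define S where "S = 94 * A\<^sup>2 * \<delta> * Gam v"
  have S0: "0 \<le> S" using \<delta>_pos Gam_ge[OF v(2)] by (simp add: S_def)
  have S: "msq (noise_filter 1 r) \<le> S" if "r \<le> T" for r unfolding S_def by (rule noise_filter_msq[OF _ v that]) simp
  have "U t \<le> (1 - \<alpha> * \<kappa>) ^ t * (A\<^sup>2 * (norm \<theta>0)\<^sup>2) + 2 / \<kappa>\<^sup>2 * (A\<^sup>2 * S + A ^ 4 * B)"
  proof (rule geometric_recursion_le[where x = U and T = T, OF U_0 _ _ \<open>t \<le> T\<close>])
    show "0 \<le> A\<^sup>2 * S + A ^ 4 * B" using S0 B A1 by (intro add_nonneg_nonneg mult_nonneg_nonneg) auto
    fix r assume "r < T"
    have "(2 * \<alpha> / \<kappa>) * (A\<^sup>2 * msq (noise_filter 1 r) + A ^ 4 * B) \<le> (2 * \<alpha> / \<kappa>) * (A\<^sup>2 * S + A ^ 4 * B)"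
      using S[of r] \<open>r < T\<close> \<alpha>_pos \<kappa> by (intro mult_left_mono add_right_mono) auto
    with U_Suc_le[of r] show "U (Suc r) \<le> (1 - \<alpha> * \<kappa>) * U r + (2 * \<alpha> / \<kappa>) * (A\<^sup>2 * S + A ^ 4 * B)" by linarith
  qed
  then have "2 * A\<^sup>2 * U t \<le> 2 * A\<^sup>2 * ((1 - \<alpha> * \<kappa>) ^ t * (A\<^sup>2 * (norm \<theta>0)\<^sup>2) + 2 / \<kappa>\<^sup>2 * (A\<^sup>2 * S + A ^ 4 * B))"
    by (intro mult_left_mono) auto
  also have "\<dots> = 2 * A ^ 4 * (norm \<theta>0)\<^sup>2 * (1 - \<alpha> * \<kappa>) ^ t + 4 * A ^ 4 / \<kappa>\<^sup>2 * S + 4 * A ^ 6 / \<kappa>\<^sup>2 * B"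
    by (simp add: algebra_simps power_numeral_reduce)
  finally have 1: "2 * A\<^sup>2 * U t \<le> 2 * A ^ 4 * (norm \<theta>0)\<^sup>2 * (1 - \<alpha> * \<kappa>) ^ t + 4 * A ^ 4 / \<kappa>\<^sup>2 * S + 4 * A ^ 6 / \<kappa>\<^sup>2 * B" .
  have 2: "2 * S \<le> 2 * A ^ 4 / \<kappa>\<^sup>2 * S"
    using mult_right_mono[OF mult_mono[OF one_le_power[OF A1, of 4] \<kappa>_div(1)], of "2 * S"] S0 by (simp add: mult_ac)
  have "4 * A ^ 6 \<le> 6 * A ^ 8" using A1 power_increasing[of 6 8 A] zero_le_power[of A 8] by linarith
  then have 3: "4 * A ^ 6 / \<kappa>\<^sup>2 * B \<le> 6 * A ^ 8 / \<kappa>\<^sup>2 * B" using B by (intro mult_right_mono divide_right_mono) auto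
  have "6 * A ^ 4 / \<kappa>\<^sup>2 * S = 4 * A ^ 4 / \<kappa>\<^sup>2 * S + 2 * A ^ 4 / \<kappa>\<^sup>2 * S" by (simp add: add_divide_distrib[symmetric] distrib_right[symmetric])
  moreover have "m \<le> a + s' + q'" if "m \<le> u + 2 * f" "u \<le> a + p + q" "f \<le> S" "2 * S \<le> r" "q \<le> q'" "s' = p + r"
    for m u f a p q r q' s' :: real
    using that by linarith
  ultimately show ?thesis unfolding S_def[symmetric] using msq_th_le_U[of t] 1 S[OF \<open>t \<le> T\<close>] 2 3 by blast
qed

text \<open>The second moments of the noise depend on those of the iterates; \<open>V\<close> is a bound that reproduces
  itself under this dependence.\<close>

definition "V = 4 * A ^ 4 * (norm \<theta>0)\<^sup>2 + 12 * A ^ 8 / \<kappa>\<^sup>2 + 1"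

lemma V_nonneg: "0 \<le> V"
  using A1 by (auto simp: V_def intro!: add_nonneg_nonneg)

lemma msq_th_V: "msq (th t) \<le> V"
proof -
  define v where "v = Max ((\<lambda>r. msq (th r)) ` {..t})"
  have v: "msq (th r) \<le> v" if "r \<le> t" for r
    unfolding v_def using that by (intro Max_ge) auto
  have v0: "0 \<le> v" using v[of 0] msq_nonneg[of "th 0"] by simp
  have "6 * A ^ 4 / \<kappa>\<^sup>2 * (94 * A\<^sup>2 * \<delta> * Gam v) = 9024 * A ^ 8 * \<delta> / (2 * \<kappa>\<^sup>2) * (1 + v)"
    by (simp add: Gam_def field_simps power_numeral_reduce)
  also have "\<dots> \<le> 1 / 2 * (1 + v)"
  proof (intro mult_right_mono)
    have "9024 * A ^ 8 * \<delta> \<le> \<kappa>\<^sup>2" using small by (simp add: \<delta>_def \<kappa>_def)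
    then show "9024 * A ^ 8 * \<delta> / (2 * \<kappa>\<^sup>2) \<le> 1 / 2" using \<kappa>(1) by (simp add: field_simps)
  qed (use v0 in auto)
  finally have n: "6 * A ^ 4 / \<kappa>\<^sup>2 * (94 * A\<^sup>2 * \<delta> * Gam v) \<le> 1 / 2 * (1 + v)" .
  have "msq (th r) \<le> 2 * A ^ 4 * (norm \<theta>0)\<^sup>2 + 1 / 2 * (1 + v) + 6 * A ^ 8 / \<kappa>\<^sup>2" if "r \<le> t" for r
  proof -
    have "2 * A ^ 4 * (norm \<theta>0)\<^sup>2 * (1 - \<alpha> * \<kappa>) ^ r \<le> 2 * A ^ 4 * (norm \<theta>0)\<^sup>2"
      using \<kappa> A1 by (intro mult_left_le) (auto intro: power_le_one)
    moreover have "6 * A ^ 8 / \<kappa>\<^sup>2 * B \<le> 6 * A ^ 8 / \<kappa>\<^sup>2"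
      using B A1 by (intro mult_left_le) auto
    ultimately show ?thesis using msq_th_le[OF v v0 that] n by linarith
  qed
  then have "v \<le> 2 * A ^ 4 * (norm \<theta>0)\<^sup>2 + 1 / 2 * (1 + v) + 6 * A ^ 8 / \<kappa>\<^sup>2"
    unfolding v_def by (subst Max_le_iff) auto
  then have "v \<le> 2 * (A ^ 4 * (norm \<theta>0)\<^sup>2) + (1 + v) / 2 + 6 * (A ^ 8 / \<kappa>\<^sup>2)" by simp
  then have "v \<le> 4 * (A ^ 4 * (norm \<theta>0)\<^sup>2) + 12 * (A ^ 8 / \<kappa>\<^sup>2) + 1" by (simp add: field_simps)
  then have "v \<le> V" by (simp add: V_def)
  with v[OF order_refl] show ?thesis by linarith
qed

definition "G = Gam V"

lemma G_ge: "8 \<le> G" unfolding G_def by (rule Gam_ge[OF V_nonneg])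

definition "Q1 = 6 * A ^ 4 / \<kappa>\<^sup>2 * (94 * A\<^sup>2 * G + A ^ 4)"

lemma Q1_nonneg: "0 \<le> Q1"
  using A1 G_ge by (auto simp: Q1_def intro!: mult_nonneg_nonneg add_nonneg_nonneg)

lemma msq_th_decay: "msq (th t) \<le> 2 * A ^ 4 * (norm \<theta>0)\<^sup>2 * (1 - \<alpha> * \<kappa>) ^ t + Q1 * (\<delta> + B)"
proof -
  have p: "0 \<le> 6 * A ^ 4 / \<kappa>\<^sup>2 * (94 * A\<^sup>2 * G)" "0 \<le> 6 * A ^ 4 / \<kappa>\<^sup>2 * A ^ 4"
    using A1 G_ge by (auto intro!: mult_nonneg_nonneg)
  have e: "6 * A ^ 4 / \<kappa>\<^sup>2 * (94 * A\<^sup>2 * \<delta> * G) = 6 * A ^ 4 / \<kappa>\<^sup>2 * (94 * A\<^sup>2 * G) * \<delta>"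
    "6 * A ^ 8 / \<kappa>\<^sup>2 * B = 6 * A ^ 4 / \<kappa>\<^sup>2 * A ^ 4 * B"
    "Q1 = 6 * A ^ 4 / \<kappa>\<^sup>2 * (94 * A\<^sup>2 * G) + 6 * A ^ 4 / \<kappa>\<^sup>2 * A ^ 4"
    by (simp_all add: Q1_def distrib_left power_numeral_reduce)
  have "6 * A ^ 4 / \<kappa>\<^sup>2 * (94 * A\<^sup>2 * \<delta> * G) + 6 * A ^ 8 / \<kappa>\<^sup>2 * B \<le> Q1 * (\<delta> + B)"
    unfolding e using p \<delta>_pos B mult_nonneg_nonneg[OF p(1) B(1)] mult_nonneg_nonneg[OF p(2) less_imp_le[OF \<delta>_pos]]
    by (simp add: distrib_left distrib_right)
  with msq_th_le[OF msq_th_V V_nonneg order_refl, of t] show ?thesis unfolding G_def[symmetric] by linarith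
qed

definition "R1 = 8 * A ^ 6 * exp 2 * (norm \<theta>0)\<^sup>2"
definition "R2 = 4 * A\<^sup>2 * (Q1 + 1) + 188 * A\<^sup>2 * G"

definition consensus_error :: "nat \<Rightarrow> real" where
  "consensus_error t = msq (\<lambda>i \<omega>. th t i \<omega> - av (\<lambda>j. th t j \<omega>))"

lemma consensus_error_le:
  "consensus_error t \<le> R1 * (\<alpha> * real K)\<^sup>2 * (1 - \<alpha> * \<kappa>) ^ t + R2 * ((\<alpha> * real K)\<^sup>2 * (\<delta> + B) + \<alpha> * real K * \<delta>)"
proof -
  define D where "D i \<omega> = local_filter 0 0 (\<lambda>t i. drift t i \<omega>) t i" for i \<omega>
  have famD: "rv_family D" unfolding D_def[abs_def] by (intro famI Fn_P[OF local_filter_rv[OF drift_rv]])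
  have "consensus_error t \<le> msq (\<lambda>i \<omega>. D i \<omega> + noise_filter 0 t i \<omega>)"
    unfolding consensus_error_def msq_def
  proof (rule bounded_rv_expectation_mono)
    show "bounded_rv P (\<lambda>\<omega>. av (\<lambda>i. (norm (th t i \<omega> - av (\<lambda>j. th t j \<omega>)))\<^sup>2))"
      by (rule rv_family_sq[OF rv_family_diff[OF rv_family_th]]) (simp add: rv_family_def rv_family_av[OF rv_family_th])
    show "bounded_rv P (\<lambda>\<omega>. av (\<lambda>i. (norm (D i \<omega> + noise_filter 0 t i \<omega>))\<^sup>2))"
      by (rule rv_family_sq[OF rv_family_add[OF famD rv_family_noise_filter]])
    fix \<omega>
    have e: "local_filter 1 \<theta>0 (\<lambda>t i. drift t i \<omega> + noise_term \<xi> t i \<omega>) t = (\<lambda>j. th t j \<omega>)"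
      by (rule ext) (rule th_local_filter[symmetric])
    have f: "local_filter 0 0 (\<lambda>t i. drift t i \<omega> + noise_term \<xi> t i \<omega>) t = (\<lambda>i. D i \<omega> + noise_filter 0 t i \<omega>)"
      using local_filter_add[of 0 0 0 "\<lambda>t i. drift t i \<omega>" "\<lambda>t i. noise_term \<xi> t i \<omega>" t]
      by (simp add: D_def noise_filter_def fun_eq_iff)
    show "av (\<lambda>i. (norm (th t i \<omega> - av (\<lambda>j. th t j \<omega>)))\<^sup>2) \<le> av (\<lambda>i. (norm (D i \<omega> + noise_filter 0 t i \<omega>))\<^sup>2)"
      using consensus_le[of \<theta>0 "\<lambda>t i. drift t i \<omega> + noise_term \<xi> t i \<omega>" t] unfolding e f .
  qed
  also have "\<dots> \<le> 2 * msq D + 2 * msq (noise_filter 0 t)" by (rule msq_add_le[OF famD rv_family_noise_filter])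
  finally have 1: "consensus_error t \<le> 2 * msq D + 2 * msq (noise_filter 0 t)" .
  have 2: "msq (noise_filter 0 t) \<le> 94 * A\<^sup>2 * G * (\<alpha> * real K * \<delta>)"
    unfolding G_def by (rule noise_filter_restart_msq[OF msq_th_V V_nonneg order_refl])
  define b where "b = 4 * A ^ 6 * exp 2 * (norm \<theta>0)\<^sup>2 * (1 - \<alpha> * \<kappa>) ^ t + 2 * A\<^sup>2 * (Q1 + 1) * (\<delta> + B)"
  have b0: "0 \<le> b" using A1 \<kappa> Q1_nonneg \<delta>_pos B
    by (auto simp: b_def intro!: add_nonneg_nonneg mult_nonneg_nonneg)
  have "msq D \<le> \<alpha>\<^sup>2 * real K * (real (card {t - t mod K..<t}) * b)"
  proof (rule msq_le_sum[where Y = drift])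
    show "av (\<lambda>i. (norm (D i \<omega>))\<^sup>2) \<le> \<alpha>\<^sup>2 * real K * (\<Sum>r\<in>{t - t mod K..<t}. av (\<lambda>i. (norm (drift r i \<omega>))\<^sup>2))" for \<omega>
      unfolding D_def by (rule av_local_filter_0_power2_le)
    fix r assume r: "r \<in> {t - t mod K..<t}"
    have "t mod K < K" using K1 by simp
    then have tr: "t = r + (t - r)" "t - r \<le> K" using r by auto
    have "msq (drift r) \<le> 2 * A\<^sup>2 * msq (th r) + 2 * A\<^sup>2 * B"
      by (rule msq_affine[OF rv_family_drift rv_family_th]) (rule norm_drift_power2_le)
    also have "\<dots> \<le> 2 * A\<^sup>2 * (2 * A ^ 4 * (norm \<theta>0)\<^sup>2 * (exp 2 * (1 - \<alpha> * \<kappa>) ^ t) + Q1 * (\<delta> + B)) + 2 * A\<^sup>2 * (\<delta> + B)"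
    proof (intro add_mono mult_left_mono order_trans[OF msq_th_decay])
      have "\<alpha> * \<kappa> * real (t - r) \<le> \<alpha> * 1 * real K"
        using tr(2) \<kappa> \<alpha>_pos by (intro mult_mono) auto
      then have "1 \<le> exp 2 * (1 - \<alpha> * \<kappa>) ^ (t - r)"
        using \<alpha>K \<kappa> by (intro one_minus_power_ge) auto
      then have "(1 - \<alpha> * \<kappa>) ^ r * 1 \<le> (1 - \<alpha> * \<kappa>) ^ r * (exp 2 * (1 - \<alpha> * \<kappa>) ^ (t - r))"
        using \<kappa> by (intro mult_left_mono) auto
      also have "\<dots> = exp 2 * (1 - \<alpha> * \<kappa>) ^ t"
        by (subst (2) tr(1)) (simp only: power_add mult_ac)
      finally show "(1 - \<alpha> * \<kappa>) ^ r \<le> exp 2 * (1 - \<alpha> * \<kappa>) ^ t" by simp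
    qed (use A1 \<delta>_pos Q1_nonneg in auto)
    also have "\<dots> = b" by (simp add: b_def algebra_simps power_numeral_reduce)
    finally show "msq (drift r) \<le> b" .
  qed (auto intro: famD rv_family_drift)
  also have "\<dots> \<le> \<alpha>\<^sup>2 * real K * (real K * b)"
    using b0 K1 by (intro mult_left_mono mult_right_mono) (auto simp: less_imp_le)
  finally have 3: "msq D \<le> (\<alpha> * real K)\<^sup>2 * b" by (simp add: power2_eq_square mult_ac)
  have "0 \<le> 188 * A\<^sup>2 * G * ((\<alpha> * real K)\<^sup>2 * (\<delta> + B))"
    using G_ge \<delta>_pos B by (intro mult_nonneg_nonneg) auto
  moreover have "0 \<le> 4 * A\<^sup>2 * (Q1 + 1) * (\<alpha> * real K * \<delta>)"
    using Q1_nonneg \<delta>_pos \<alpha>_pos by (intro mult_nonneg_nonneg) auto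
  moreover have "2 * ((\<alpha> * real K)\<^sup>2 * b) = R1 * (\<alpha> * real K)\<^sup>2 * (1 - \<alpha> * \<kappa>) ^ t + 4 * A\<^sup>2 * (Q1 + 1) * ((\<alpha> * real K)\<^sup>2 * (\<delta> + B))"
    by (simp add: b_def R1_def algebra_simps)
  moreover have "R2 * (x + y) = 4 * A\<^sup>2 * (Q1 + 1) * x + 4 * A\<^sup>2 * (Q1 + 1) * y + 188 * A\<^sup>2 * G * x + 188 * A\<^sup>2 * G * y" for x y
    by (simp add: R2_def algebra_simps)
  moreover have "2 * msq (noise_filter 0 t) \<le> 188 * A\<^sup>2 * G * (\<alpha> * real K * \<delta>)" using 2 by (simp add: mult_ac)
  moreover have "om \<le> a + r" if "om \<le> 2 * d + 2 * f" "d \<le> z" "2 * z = a + q1" "2 * f \<le> g2" "0 \<le> g1" "0 \<le> q2"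
    "r = q1 + q2 + g1 + g2" for om a r d f z q1 q2 g1 g2 :: real
    using that by linarith
  ultimately show ?thesis using 1 3 by blast
qed

section \<open>Variance reduction for the averaged noise\<close>

definition sq :: "('w \<Rightarrow> 'v) \<Rightarrow> real" where
  "sq Y = expectation (\<lambda>\<omega>. (norm (Y \<omega>))\<^sup>2)"

lemma msq_const: "msq (\<lambda>_. Y) = sq Y"
  by (simp add: msq_def sq_def agent_avg_const[OF N1])

lemma rv_family_const: "bounded_rv P Y \<Longrightarrow> rv_family (\<lambda>_. Y)"
  by (simp add: rv_family_def)

lemma sq_nonneg: "0 \<le> sq Y"
  unfolding msq_const[symmetric] by (rule msq_nonneg)

lemma sq_young:
  assumes "bounded_rv P Y" "bounded_rv P Z" "0 < k"
  shows "expectation (\<lambda>\<omega>. Y \<omega> \<bullet> Z \<omega>) \<le> (k * sq Y + sq Z / k) / 2"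
  using msq_young[OF rv_family_const[OF assms(1)] rv_family_const[OF assms(2)] assms(3)]
  by (simp add: msq_const agent_avg_const[OF N1])

lemma sq_add_le:
  "bounded_rv P Y \<Longrightarrow> bounded_rv P Z \<Longrightarrow> sq (\<lambda>\<omega>. Y \<omega> + Z \<omega>) \<le> 2 * sq Y + 2 * sq Z"
  using msq_add_le[OF rv_family_const rv_family_const] by (simp add: msq_const)

lemma sq_diff_le:
  "bounded_rv P Y \<Longrightarrow> bounded_rv P Z \<Longrightarrow> sq (\<lambda>\<omega>. Y \<omega> - Z \<omega>) \<le> 2 * sq Y + 2 * sq Z"
  using msq_diff_le[OF rv_family_const rv_family_const] by (simp add: msq_const)

lemma sq_av_le: "rv_family Y \<Longrightarrow> sq (\<lambda>\<omega>. av (\<lambda>i. Y i \<omega>)) \<le> msq Y"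
  unfolding sq_def msq_def
  by (rule bounded_rv_expectation_mono[OF bounded_rv_power2[OF bounded_rv_norm[OF rv_family_av]] rv_family_sq])
    (auto intro: norm_agent_avg_power2_le)

definition nbar :: "nat \<Rightarrow> 'w \<Rightarrow> 'v" where
  "nbar t \<omega> = av (\<lambda>i. noise_term 1 t i \<omega>)"

definition M :: "nat \<Rightarrow> 'w \<Rightarrow> 'v" where
  "M t \<omega> = av (local_filter 1 0 (\<lambda>t i. noise_term 1 t i \<omega>) t)"

lemma nbar_rv: "bounded_rv P (nbar t)"
  unfolding nbar_def[abs_def] by (rule rv_family_av[OF rv_family_noise_term])

lemma M_Fn: "bounded_rv (Fn t) (M t)"
  unfolding M_def[abs_def] by (intro bounded_rv_agent_avg local_filter_rv noise_term_rv)

lemma M_rv: "bounded_rv P (M t)"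
  by (rule Fn_P[OF M_Fn])

lemma M_Suc: "M (Suc t) \<omega> = (1 - \<alpha>) *\<^sub>R M t \<omega> + \<alpha> *\<^sub>R nbar t \<omega>"
  unfolding M_def nbar_def by (rule av_local_filter_Suc)

lemma M_0: "M 0 \<omega> = 0"
  by (simp add: M_def)

lemma sq_nbar_le_G: "sq (nbar t) \<le> G"
  using sq_av_le[OF rv_family_noise_term, of 1 t] msq_noise_term_le[OF msq_th_V, of 1 t] by (simp add: nbar_def[abs_def] G_def)

text \<open>Independence of the agents gives the gain \<open>1 / N\<close>, up to the error of freezing the parameter.\<close>

definition "\<nu> = 6 * G / real N + 74 * A\<^sup>2 * \<delta>\<^sup>2 * G"

lemma \<nu>_nonneg: "0 \<le> \<nu>"
  using G_ge by (auto simp: \<nu>_def intro!: add_nonneg_nonneg mult_nonneg_nonneg)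

lemma nbar_frozen:
  assumes ts: "t = s + m"
  obtains nb where "bounded_rv P nb"
    "\<And>w k. bounded_rv (Fn s) w \<Longrightarrow> 0 < k \<Longrightarrow> expectation (\<lambda>\<omega>. w \<omega> \<bullet> nb \<omega>) \<le> (k * sq w + \<delta>\<^sup>2 * G / k) / 2"
    "sq (\<lambda>\<omega>. nbar t \<omega> - nb \<omega>) \<le> 36 * A\<^sup>2 * \<delta>\<^sup>2 * G" "sq (nbar t) \<le> \<nu>"
proof -
  obtain Z where Z: "\<And>i. i < N \<Longrightarrow> Z i \<in> borel_measurable (Fi s)" "\<And>i. i < N \<Longrightarrow> finite (Z i ` space P)"
    and tZ: "msq (\<lambda>i \<omega>. th t i \<omega> - Z i \<omega>) \<le> 9 * \<delta>\<^sup>2 * G" and mZ: "msq Z \<le> 2 * V + 2"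
    using frozen_point[OF ts msq_th_V V_nonneg] unfolding G_def by blast
  have ZFn: "Z i \<in> borel_measurable (Fn s)" if "i < N" for i
    by (rule measurable_from_subalg[OF subalgebra_Fi_Fn Z(1)[OF that]])
  have ZP: "bounded_rv P (Z i)" if "i < N" for i
    by (rule bounded_rv_mono[OF finite_valued_rv[OF Z(1,2)[OF that]] subalgebra_Fi]) simp
  then have famZ: "rv_family Z" by (rule famI)
  define nf where "nf i \<omega> = obs_noise 1 i (Z i \<omega>) (noise I i t \<omega>)" for i \<omega>
  define en where "en i \<omega> = obs_noise_mean 1 i m (Z i \<omega>) (noise I i s \<omega>)" for i \<omega>
  define nb where "nb \<omega> = av (\<lambda>i. nf i \<omega>)" for \<omega>
  define eb where "eb \<omega> = av (\<lambda>i. en i \<omega>)" for \<omega>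
  have fnf: "rv_family nf" unfolding nf_def[abs_def] by (intro famI obs_noise_rv ZP noise_measurable)
  have fen: "rv_family en" unfolding en_def[abs_def] by (intro famI Fn_P[OF obs_noise_mean_rv[OF _ ZFn Z(2)]])
  have nbrv: "bounded_rv P nb" unfolding nb_def[abs_def] by (rule rv_family_av[OF fnf])
  have ebrv: "bounded_rv P eb" unfolding eb_def[abs_def] by (rule rv_family_av[OF fen])
  have eb: "sq eb \<le> \<delta>\<^sup>2 * G"
  proof -
    have "msq (\<lambda>_. eb) \<le> (2 * A\<^sup>2 * \<delta>\<^sup>2) * expectation (\<lambda>\<omega>. av (\<lambda>i. (norm (Z i \<omega>))\<^sup>2)) + 0 * expectation (\<lambda>\<omega>. 0) + 2 * A\<^sup>2 * \<delta>\<^sup>2"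
    proof (rule msq_le_lin[OF rv_family_const[OF ebrv] rv_family_sq[OF famZ] bounded_rv_const])
      fix \<omega> assume w: "\<omega> \<in> space P"
      have "(norm (eb \<omega>))\<^sup>2 \<le> (A * \<delta> * (av (\<lambda>i. norm (Z i \<omega>)) + 1))\<^sup>2"
        unfolding eb_def en_def by (intro power_mono av_obs_noise_mean_le noise_space w) simp_all
      also note power2_add_one_le
      also have "2 * A\<^sup>2 * \<delta>\<^sup>2 * (av (\<lambda>i. norm (Z i \<omega>)))\<^sup>2 \<le> 2 * A\<^sup>2 * \<delta>\<^sup>2 * av (\<lambda>i. (norm (Z i \<omega>))\<^sup>2)"
        by (intro mult_left_mono agent_avg_power2_le) simp
      finally show "av (\<lambda>_. (norm (eb \<omega>))\<^sup>2) \<le> 2 * A\<^sup>2 * \<delta>\<^sup>2 * av (\<lambda>i. (norm (Z i \<omega>))\<^sup>2) + 0 * 0 + 2 * A\<^sup>2 * \<delta>\<^sup>2"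
        by (simp add: agent_avg_const[OF N1])
    qed
    also have "\<dots> = 2 * A\<^sup>2 * \<delta>\<^sup>2 * msq Z + 2 * A\<^sup>2 * \<delta>\<^sup>2" by (simp add: msq_def)
    also have "\<dots> \<le> \<delta>\<^sup>2 * G" unfolding G_def by (rule lag_residual_le[OF V_nonneg mZ])
    finally show ?thesis by (simp add: msq_const)
  qed
  have inner: "expectation (\<lambda>\<omega>. w \<omega> \<bullet> nb \<omega>) \<le> (k * sq w + \<delta>\<^sup>2 * G / k) / 2"
    if w: "bounded_rv (Fn s) w" and k: "0 < k" for w k
  proof -
    have wP: "bounded_rv P w" by (rule Fn_P[OF w])
    have inner_av: "x \<bullet> av f = av (\<lambda>i. x \<bullet> f i)" for x :: 'v and f
      by (simp add: agent_avg_def inner_sum_right)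
    have "expectation (\<lambda>\<omega>. w \<omega> \<bullet> nb \<omega>) = av (\<lambda>i. expectation (\<lambda>\<omega>. w \<omega> \<bullet> nf i \<omega>))"
      unfolding nb_def inner_av using fnf wP by (intro expectation_agent_avg bounded_rv_inner) (auto simp: rv_family_def)
    also have "\<dots> = av (\<lambda>i. expectation (\<lambda>\<omega>. w \<omega> \<bullet> en i \<omega>))"
      unfolding nf_def en_def ts by (intro agent_avg_cong expectation_inner_obs_noise ZFn Z(2) w)
    also have "\<dots> = expectation (\<lambda>\<omega>. w \<omega> \<bullet> eb \<omega>)"
      unfolding eb_def inner_av using fen wP by (intro expectation_agent_avg[symmetric] bounded_rv_inner) (auto simp: rv_family_def)
    also have "\<dots> \<le> (k * sq w + sq eb / k) / 2" by (rule sq_young[OF wP ebrv k])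
    also have "\<dots> \<le> (k * sq w + \<delta>\<^sup>2 * G / k) / 2"
      using eb k by (intro divide_right_mono add_left_mono) auto
    finally show ?thesis .
  qed
  have nfn: "rv_family (\<lambda>i \<omega>. noise_term 1 t i \<omega> - nf i \<omega>)" by (intro rv_family_diff rv_family_noise_term fnf)
  have "msq (\<lambda>i \<omega>. noise_term 1 t i \<omega> - nf i \<omega>) \<le> 4 * A\<^sup>2 * msq (\<lambda>i \<omega>. th t i \<omega> - Z i \<omega>) + 0"
  proof (rule msq_affine[OF nfn rv_family_diff[OF rv_family_th famZ]])
    fix i \<omega> assume i: "i < N" and w: "\<omega> \<in> space P"
    have "(norm (noise_term 1 t i \<omega> - nf i \<omega>))\<^sup>2 \<le> (2 * A * norm (th t i \<omega> - Z i \<omega>))\<^sup>2"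
      unfolding noise_term_def nf_def by (intro power_mono obs_noise_lip i noise_space w) simp
    then show "(norm (noise_term 1 t i \<omega> - nf i \<omega>))\<^sup>2 \<le> 4 * A\<^sup>2 * (norm (th t i \<omega> - Z i \<omega>))\<^sup>2 + 0"
      by (simp add: power_mult_distrib)
  qed
  also have "\<dots> \<le> 4 * A\<^sup>2 * (9 * \<delta>\<^sup>2 * G)" using mult_left_mono[OF tZ, of "4 * A\<^sup>2"] by simp
  finally have "msq (\<lambda>i \<omega>. noise_term 1 t i \<omega> - nf i \<omega>) \<le> 36 * A\<^sup>2 * \<delta>\<^sup>2 * G" by (simp add: mult_ac)
  moreover have "sq (\<lambda>\<omega>. nbar t \<omega> - nb \<omega>) \<le> msq (\<lambda>i \<omega>. noise_term 1 t i \<omega> - nf i \<omega>)"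
    using sq_av_le[OF nfn] by (simp add: nbar_def nb_def agent_avg_diff)
  ultimately have dif: "sq (\<lambda>\<omega>. nbar t \<omega> - nb \<omega>) \<le> 36 * A\<^sup>2 * \<delta>\<^sup>2 * G" by linarith
  have "msq nf \<le> 8 * A\<^sup>2 * msq Z + 8 * A\<^sup>2"
  proof (rule msq_affine[OF fnf famZ])
    fix i \<omega> assume i: "i < N" and w: "\<omega> \<in> space P"
    from obs_noise_le_power2[OF i noise_space[OF i w, of t], of 1 "Z i \<omega>"]
    show "(norm (nf i \<omega>))\<^sup>2 \<le> 8 * A\<^sup>2 * (norm (Z i \<omega>))\<^sup>2 + 8 * A\<^sup>2" by (simp add: nf_def algebra_simps)
  qed
  also have "\<dots> \<le> 8 * A\<^sup>2 * (2 * V + 2) + 8 * A\<^sup>2" using mZ by (intro add_right_mono mult_left_mono) auto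
  also have "\<dots> \<le> 3 * G" using V_nonneg by (simp add: G_def Gam_def algebra_simps)
  finally have mnf: "msq nf \<le> 3 * G" .
  have "sq nb \<le> av (\<lambda>i. expectation (\<lambda>\<omega>. (norm (nf i \<omega>))\<^sup>2)) / real N + sq eb"
    unfolding sq_def nb_def eb_def nf_def en_def ts by (rule independent_second_moment[OF Z(1,2)])
  also have "av (\<lambda>i. expectation (\<lambda>\<omega>. (norm (nf i \<omega>))\<^sup>2)) = msq nf"
    unfolding msq_def using fnf
    by (intro expectation_agent_avg[symmetric] bounded_rv_power2 bounded_rv_norm) (simp add: rv_family_def)
  finally have nb: "sq nb \<le> 3 * G / real N + \<delta>\<^sup>2 * G"
    using eb divide_right_mono[OF mnf, of "real N"] by simp
  have "sq (nbar t) = sq (\<lambda>\<omega>. nb \<omega> + (nbar t \<omega> - nb \<omega>))" by simp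
  also have "\<dots> \<le> 2 * sq nb + 2 * sq (\<lambda>\<omega>. nbar t \<omega> - nb \<omega>)"
    by (rule sq_add_le[OF nbrv bounded_rv_diff[OF nbar_rv nbrv]])
  also have "\<dots> \<le> 2 * (3 * G / real N + \<delta>\<^sup>2 * G) + 2 * (36 * A\<^sup>2 * \<delta>\<^sup>2 * G)" by (intro add_mono mult_left_mono nb dif) auto
  also have "\<dots> \<le> \<nu>"
    using mult_right_mono[OF A_sq, of "2 * (\<delta>\<^sup>2 * G)"] G_ge by (simp add: \<nu>_def algebra_simps)
  finally have "sq (nbar t) \<le> \<nu>" .
  with that[OF nbrv inner dif] show ?thesis by blast
qed

lemma sq_nbar_le: "m \<le> t \<Longrightarrow> sq (nbar t) \<le> \<nu>"
  using nbar_frozen[of t "t - m"] by auto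

lemma M_early:
  assumes "t \<le> 2 * m"
  shows "sq (M t) \<le> 4 * \<delta>\<^sup>2 * G"
proof -
  have le: "norm (M t \<omega>) \<le> \<alpha> * (\<Sum>r<t. norm (nbar r \<omega>))" for \<omega> t
  proof (induction t)
    case (Suc t)
    have "norm (M (Suc t) \<omega>) \<le> (1 - \<alpha>) * norm (M t \<omega>) + \<alpha> * norm (nbar t \<omega>)"
      unfolding M_Suc using norm_triangle_ineq[of "(1 - \<alpha>) *\<^sub>R M t \<omega>" "\<alpha> *\<^sub>R nbar t \<omega>"] \<alpha>_pos \<alpha>_le by simp
    also have "\<dots> \<le> norm (M t \<omega>) + \<alpha> * norm (nbar t \<omega>)" using \<alpha>_pos by (simp add: algebra_simps)
    finally show ?case using Suc.IH by (simp add: distrib_left)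
  qed (simp add: M_0)
  have "msq (\<lambda>_. M t) \<le> \<alpha>\<^sup>2 * real t * (real (card {..<t}) * G)"
  proof (rule msq_le_sum[where Y = "\<lambda>r _. nbar r"])
    fix \<omega>
    have "(norm (M t \<omega>))\<^sup>2 \<le> (\<alpha> * (\<Sum>r<t. norm (nbar r \<omega>)))\<^sup>2" by (intro power_mono le) simp
    also have "\<dots> \<le> \<alpha>\<^sup>2 * (real t * (\<Sum>r<t. (norm (nbar r \<omega>))\<^sup>2))"
      using sum_squared_le_sum_of_squares[of "\<lambda>r. norm (nbar r \<omega>)" "{..<t}"]
      by (simp add: power_mult_distrib mult_left_mono mult.commute)
    finally show "av (\<lambda>_. (norm (M t \<omega>))\<^sup>2) \<le> \<alpha>\<^sup>2 * real t * (\<Sum>r<t. av (\<lambda>_. (norm (nbar r \<omega>))\<^sup>2))"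
      by (simp add: agent_avg_const[OF N1] mult.assoc)
    show "msq (\<lambda>_. nbar r) \<le> G" for r unfolding msq_const by (rule sq_nbar_le_G)
  qed (use \<alpha>_pos in \<open>auto intro: rv_family_const M_rv nbar_rv\<close>)
  also have "\<dots> = \<alpha>\<^sup>2 * (real t * real t) * G" by simp
  also have "\<dots> \<le> \<alpha>\<^sup>2 * (real (2 * m) * real (2 * m)) * G"
    using assms G_ge by (intro mult_right_mono mult_left_mono mult_mono) auto
  finally show ?thesis by (simp add: msq_const \<delta>_def power2_eq_square mult_ac)
qed

lemma M_diff_le:
  assumes ts: "t = s + m" and "m \<le> s" and y: "\<And>r. r \<le> t \<Longrightarrow> sq (M r) \<le> y"
  shows "sq (\<lambda>\<omega>. M t \<omega> - M s \<omega>) \<le> \<delta>\<^sup>2 * (2 * \<nu> + 2 * y)"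
proof -
  have "msq (\<lambda>_ \<omega>. M t \<omega> - M s \<omega>) \<le> \<alpha>\<^sup>2 * real m * (real (card {s..<t}) * (2 * \<nu> + 2 * y))"
  proof (rule msq_le_sum[where Y = "\<lambda>r _ \<omega>. nbar r \<omega> - M r \<omega>"])
    fix \<omega>
    have "norm (M t \<omega> - M s \<omega>) \<le> \<alpha> * (\<Sum>r\<in>{s..<t}. norm (nbar r \<omega> - M r \<omega>))"
      using norm_av_local_filter_diff_le[of s t 0 "\<lambda>t i. noise_term 1 t i \<omega>"] ts
      by (simp add: M_def nbar_def agent_avg_diff)
    then have "(norm (M t \<omega> - M s \<omega>))\<^sup>2 \<le> (\<alpha> * (\<Sum>r\<in>{s..<t}. norm (nbar r \<omega> - M r \<omega>)))\<^sup>2"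
      by (intro power_mono) simp_all
    also have "\<dots> \<le> \<alpha>\<^sup>2 * (real m * (\<Sum>r\<in>{s..<t}. (norm (nbar r \<omega> - M r \<omega>))\<^sup>2))"
      using sum_squared_le_sum_of_squares[of "\<lambda>r. norm (nbar r \<omega> - M r \<omega>)" "{s..<t}"] ts
      by (simp add: power_mult_distrib mult_left_mono mult.commute)
    finally show "av (\<lambda>_. (norm (M t \<omega> - M s \<omega>))\<^sup>2) \<le> \<alpha>\<^sup>2 * real m * (\<Sum>r\<in>{s..<t}. av (\<lambda>_. (norm (nbar r \<omega> - M r \<omega>))\<^sup>2))"
      by (simp add: agent_avg_const[OF N1] mult.assoc)
    show "msq (\<lambda>_ \<omega>. nbar r \<omega> - M r \<omega>) \<le> 2 * \<nu> + 2 * y" if "r \<in> {s..<t}" for r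
      using sq_diff_le[OF nbar_rv M_rv, of r r] sq_nbar_le[of r] y[of r] that \<open>m \<le> s\<close> by (simp add: msq_const)
  qed (use \<alpha>_pos in \<open>auto intro!: rv_family_const bounded_rv_diff M_rv nbar_rv\<close>)
  also have "\<dots> = \<delta>\<^sup>2 * (2 * \<nu> + 2 * y)" using ts by (simp add: \<delta>_def power2_eq_square mult_ac)
  finally show ?thesis by (simp add: msq_const)
qed

lemma M_cross_le:
  assumes t: "2 * m \<le> t" and y: "\<And>r. r \<le> t \<Longrightarrow> sq (M r) \<le> y"
  shows "expectation (\<lambda>\<omega>. M t \<omega> \<bullet> nbar t \<omega>) \<le> 3 * y / 16 + 148 * A\<^sup>2 * \<delta>\<^sup>2 * G + 3 * \<delta> * \<nu> / 2"
proof -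
  define s where "s = t - m"
  have ts: "t = s + m" "m \<le> s" using t by (auto simp: s_def)
  have y0: "0 \<le> y" using y[of 0] sq_nonneg[of "M 0"] by simp
  obtain nb where nb: "bounded_rv P nb"
    "\<And>w k. bounded_rv (Fn s) w \<Longrightarrow> 0 < k \<Longrightarrow> expectation (\<lambda>\<omega>. w \<omega> \<bullet> nb \<omega>) \<le> (k * sq w + \<delta>\<^sup>2 * G / k) / 2"
    "sq (\<lambda>\<omega>. nbar t \<omega> - nb \<omega>) \<le> 36 * A\<^sup>2 * \<delta>\<^sup>2 * G" "sq (nbar t) \<le> \<nu>"
    using nbar_frozen[OF ts(1)] by blast
  have ys: "sq (M s) \<le> y" using y[of s] ts by simp
  note d = bounded_rv_diff[OF nbar_rv nb(1), of t] and e = bounded_rv_diff[OF M_rv M_rv, of t s]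
  have 1: "expectation (\<lambda>\<omega>. M s \<omega> \<bullet> nb \<omega>) \<le> y / 16 + 4 * (\<delta>\<^sup>2 * G)"
    using nb(2)[OF M_Fn, of "1/8"] ys by simp
  have 2: "expectation (\<lambda>\<omega>. M s \<omega> \<bullet> (nbar t \<omega> - nb \<omega>)) \<le> y / 16 + 144 * A\<^sup>2 * \<delta>\<^sup>2 * G"
    using sq_young[OF M_rv d, of "1/8" s] ys nb(3) by simp
  have "expectation (\<lambda>\<omega>. (M t \<omega> - M s \<omega>) \<bullet> nbar t \<omega>)
      \<le> (1 / \<delta> * sq (\<lambda>\<omega>. M t \<omega> - M s \<omega>) + sq (nbar t) / (1 / \<delta>)) / 2"
    using \<delta>_pos by (intro sq_young e nbar_rv) simp
  also have "\<dots> \<le> (1 / \<delta> * (\<delta>\<^sup>2 * (2 * \<nu> + 2 * y)) + \<nu> / (1 / \<delta>)) / 2"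
    using \<delta>_pos M_diff_le[OF ts y] nb(4) by (intro divide_right_mono add_mono mult_left_mono) auto
  also have "\<dots> = 3 * \<delta> * \<nu> / 2 + \<delta> * y" using \<delta>_pos by (simp add: field_simps power2_eq_square)
  also have "\<delta> * y \<le> 1 / 16 * y" using \<delta>_le y0 by (intro mult_right_mono) auto
  finally have 3: "expectation (\<lambda>\<omega>. (M t \<omega> - M s \<omega>) \<bullet> nbar t \<omega>) \<le> 3 * \<delta> * \<nu> / 2 + y / 16" by simp
  have "expectation (\<lambda>\<omega>. M t \<omega> \<bullet> nbar t \<omega>)
      = expectation (\<lambda>\<omega>. (M s \<omega> \<bullet> nb \<omega> + M s \<omega> \<bullet> (nbar t \<omega> - nb \<omega>)) + (M t \<omega> - M s \<omega>) \<bullet> nbar t \<omega>)"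
    by (simp add: inner_diff_left inner_diff_right)
  also have "\<dots> = expectation (\<lambda>\<omega>. M s \<omega> \<bullet> nb \<omega>) + expectation (\<lambda>\<omega>. M s \<omega> \<bullet> (nbar t \<omega> - nb \<omega>))
      + expectation (\<lambda>\<omega>. (M t \<omega> - M s \<omega>) \<bullet> nbar t \<omega>)"
    using integrable_bounded_rv[OF bounded_rv_inner[OF M_rv nb(1)], of s] integrable_bounded_rv[OF bounded_rv_inner[OF M_rv d], of s]
      integrable_bounded_rv[OF bounded_rv_inner[OF e nbar_rv], of t] by simp
  also have "\<dots> \<le> 3 * y / 16 + 4 * (\<delta>\<^sup>2 * G) + 144 * A\<^sup>2 * \<delta>\<^sup>2 * G + 3 * \<delta> * \<nu> / 2" using 1 2 3 by linarith
  also have "\<dots> \<le> 3 * y / 16 + 148 * A\<^sup>2 * \<delta>\<^sup>2 * G + 3 * \<delta> * \<nu> / 2"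
    using mult_right_mono[OF A_sq, of "4 * (\<delta>\<^sup>2 * G)"] G_ge by (simp add: mult_ac)
  finally show ?thesis .
qed

lemma M_Suc_le:
  assumes t: "2 * m \<le> t" and y: "\<And>r. r \<le> t \<Longrightarrow> sq (M r) \<le> y"
  shows "sq (M (Suc t)) \<le> (1 - \<alpha>) * sq (M t) + \<alpha> * (3 * y / 8 + 296 * A\<^sup>2 * \<delta>\<^sup>2 * G + 4 * \<delta> * \<nu>)"
proof -
  let ?c = "expectation (\<lambda>\<omega>. M t \<omega> \<bullet> nbar t \<omega>)" and ?D = "3 * y / 16 + 148 * A\<^sup>2 * \<delta>\<^sup>2 * G + 3 * \<delta> * \<nu> / 2"
  have y0: "0 \<le> y" using y[of 0] sq_nonneg[of "M 0"] by simp
  have D: "0 \<le> ?D" using y0 G_ge \<delta>_pos \<nu>_nonneg by (intro add_nonneg_nonneg) auto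
  have "sq (M (Suc t)) = expectation (\<lambda>\<omega>. 1 * ((1 - \<alpha>)\<^sup>2 * (norm (M t \<omega>))\<^sup>2 + (2 * \<alpha> * (1 - \<alpha>)) * (M t \<omega> \<bullet> nbar t \<omega>) + 0)
      + \<alpha>\<^sup>2 * (norm (nbar t \<omega>))\<^sup>2 + 0)"
    unfolding sq_def M_Suc norm_convex_power2 by simp
  also have "\<dots> = 1 * ((1 - \<alpha>)\<^sup>2 * sq (M t) + (2 * \<alpha> * (1 - \<alpha>)) * ?c + 0) + \<alpha>\<^sup>2 * sq (nbar t) + 0"
    unfolding sq_def
    by (simp only: expectation_lin[OF bounded_rv_add[OF bounded_rv_add[OF bounded_rv_cmult[OF bounded_rv_power2[OF bounded_rv_norm[OF M_rv]]]
          bounded_rv_cmult[OF bounded_rv_inner[OF M_rv nbar_rv]]] bounded_rv_const] bounded_rv_power2[OF bounded_rv_norm[OF nbar_rv]]]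
        expectation_lin[OF bounded_rv_power2[OF bounded_rv_norm[OF M_rv]] bounded_rv_inner[OF M_rv nbar_rv]])
  also have "\<dots> \<le> (1 - \<alpha>) * sq (M t) + 2 * \<alpha> * ?D + \<alpha> * (\<delta> * \<nu>)"
  proof -
    have h1: "(1 - \<alpha>)\<^sup>2 * sq (M t) \<le> (1 - \<alpha>) * sq (M t)"
      using \<alpha>_pos \<alpha>_le by (intro mult_right_mono sq_nonneg) (simp add: power2_eq_square mult_left_le)
    have h2: "(2 * \<alpha> * (1 - \<alpha>)) * ?c \<le> (2 * \<alpha> * (1 - \<alpha>)) * ?D"
      using \<alpha>_pos \<alpha>_le by (intro mult_left_mono M_cross_le[OF t y]) auto
    have h3: "(2 * \<alpha> * (1 - \<alpha>)) * ?D \<le> 2 * \<alpha> * ?D"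
      using \<alpha>_pos \<alpha>_le by (intro mult_right_mono D) auto
    have h4: "\<alpha>\<^sup>2 * sq (nbar t) \<le> \<alpha> * (\<delta> * \<nu>)"
      unfolding power2_eq_square mult.assoc
      using \<alpha>_pos \<alpha>_\<delta> \<delta>_pos sq_nbar_le[of t] t sq_nonneg by (intro mult_left_mono mult_mono) auto
    show ?thesis unfolding mult_1 add_0_right by (rule add_mono[OF add_mono[OF h1 order_trans[OF h2 h3]] h4])
  qed
  finally show ?thesis by (simp add: field_simps)
qed

definition "Mbd = 480 * A\<^sup>2 * \<delta>\<^sup>2 * G + 40 * \<delta> * G / real N"

lemma Mbd_nonneg: "0 \<le> Mbd"
  using G_ge \<delta>_pos by (auto simp: Mbd_def intro!: add_nonneg_nonneg mult_nonneg_nonneg)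

lemma sq_M_le: "sq (M t) \<le> Mbd"
proof -
  define y where "y = Max ((\<lambda>r. sq (M r)) ` {..t})"
  have y: "sq (M r) \<le> y" if "r \<le> t" for r
    unfolding y_def using that by (intro Max_ge) auto
  have y0: "0 \<le> y" using y[of 0] sq_nonneg[of "M 0"] by simp
  have dnu: "\<delta> * \<nu> \<le> 6 * \<delta> * G / real N + A\<^sup>2 * \<delta>\<^sup>2 * G"
  proof -
    have "\<delta> * \<nu> = 6 * \<delta> * G / real N + (74 * \<delta>) * (A\<^sup>2 * \<delta>\<^sup>2 * G)" by (simp add: \<nu>_def distrib_left mult_ac)
    moreover have "(74 * \<delta>) * (A\<^sup>2 * \<delta>\<^sup>2 * G) \<le> 1 * (A\<^sup>2 * \<delta>\<^sup>2 * G)"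
      using \<delta>_le G_ge by (intro mult_right_mono) auto
    ultimately show ?thesis by simp
  qed
  define e where "e = 3 * y / 8 + 300 * A\<^sup>2 * \<delta>\<^sup>2 * G + 24 * \<delta> * G / real N"
  have AG: "0 \<le> A\<^sup>2 * \<delta>\<^sup>2 * G" "0 \<le> \<delta> * G / real N" using G_ge \<delta>_pos by auto
  have e0: "4 * \<delta>\<^sup>2 * G \<le> e"
  proof -
    have "\<delta>\<^sup>2 * G \<le> A\<^sup>2 * (\<delta>\<^sup>2 * G)" using mult_right_mono[OF A_sq, of "\<delta>\<^sup>2 * G"] G_ge by simp
    then show ?thesis using y0 AG unfolding e_def by (simp add: mult.assoc)
  qed
  have e1: "3 * y / 8 + 296 * A\<^sup>2 * \<delta>\<^sup>2 * G + 4 * \<delta> * \<nu> \<le> e"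
  proof -
    have "3 * y / 8 + 296 * A\<^sup>2 * \<delta>\<^sup>2 * G + 4 * \<delta> * \<nu> = 3 * y / 8 + 296 * A\<^sup>2 * \<delta>\<^sup>2 * G + 4 * (\<delta> * \<nu>)" by simp
    also have "\<dots> \<le> 3 * y / 8 + 296 * A\<^sup>2 * \<delta>\<^sup>2 * G + 4 * (6 * \<delta> * G / real N + A\<^sup>2 * \<delta>\<^sup>2 * G)"
      by (intro add_left_mono mult_left_mono dnu) simp
    also have "\<dots> = e" by (simp add: e_def algebra_simps)
    finally show ?thesis .
  qed
  have "sq (M r) \<le> e" if "r \<le> t" for r
    using that
  proof (induction r)
    case 0
    show ?case using M_early[of 0] e0 by simp
  next
    case (Suc r)
    show ?case
    proof (cases "Suc r \<le> 2 * m")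
      case True
      then show ?thesis using M_early[OF True] e0 by simp
    next
      case False
      have "sq (M (Suc r)) \<le> (1 - \<alpha>) * sq (M r) + \<alpha> * (3 * y / 8 + 296 * A\<^sup>2 * \<delta>\<^sup>2 * G + 4 * \<delta> * \<nu>)"
        using False Suc.prems by (intro M_Suc_le y) auto
      also have "\<dots> \<le> (1 - \<alpha>) * e + \<alpha> * e"
        by (rule add_mono[OF mult_left_mono[OF Suc.IH] mult_left_mono[OF e1]]) (use Suc.prems \<alpha>_le \<alpha>_pos in auto)
      finally show ?thesis by (simp add: left_diff_distrib)
    qed
  qed
  then have "y \<le> e" unfolding y_def by (subst Max_le_iff) auto
  moreover have "e = 3 * y / 8 + 300 * (A\<^sup>2 * \<delta>\<^sup>2 * G) + 24 * (\<delta> * G / real N)"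
    "Mbd = 480 * (A\<^sup>2 * \<delta>\<^sup>2 * G) + 40 * (\<delta> * G / real N)"
    by (simp_all add: e_def Mbd_def mult_ac)
  moreover have "y' \<le> b" if "y' \<le> e'" "e' = 3 * y' / 8 + 300 * p + 24 * q" "b = 480 * p + 40 * q" "0 \<le> p" "0 \<le> q"
    for y' e' b p q :: real
    using that by linarith
  ultimately have "y \<le> Mbd" using AG by blast
  with y[OF order_refl] show ?thesis by linarith
qed

definition Xb :: "nat \<Rightarrow> 'w \<Rightarrow> 'v" where
  "Xb t \<omega> = av (\<lambda>i. th t i \<omega>) - M t \<omega>"

definition Zx :: "nat \<Rightarrow> real" where
  "Zx t = expectation (\<lambda>\<omega>. (nrm (Xb t \<omega>))\<^sup>2)"

lemma Xb_rv: "bounded_rv P (Xb t)"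
  unfolding Xb_def[abs_def] by (intro bounded_rv_diff rv_family_av rv_family_th M_rv)

lemma nrm_power2_rv: "bounded_rv P Y \<Longrightarrow> bounded_rv P (\<lambda>\<omega>. (nrm (Y \<omega>))\<^sup>2)"
  by (intro bounded_rv_power2 bounded_rv_is_norm[OF nrm nrm_le])

lemma Xb_Suc: "Xb (Suc t) \<omega> = (1 - \<alpha>) *\<^sub>R Xb t \<omega> + \<alpha> *\<^sub>R av (\<lambda>i. Gbar I i (th t i \<omega>))"
proof -
  have e: "local_filter 1 \<theta>0 (\<lambda>t i. Gbar I i (th t i \<omega>) + noise_term 1 t i \<omega>) t = (\<lambda>i. th t i \<omega>)" for t
    by (rule ext) (rule th_local_filter_full[symmetric])
  have "av (\<lambda>i. th (Suc t) i \<omega>) = (1 - \<alpha>) *\<^sub>R av (\<lambda>i. th t i \<omega>) + \<alpha> *\<^sub>R av (\<lambda>i. Gbar I i (th t i \<omega>) + noise_term 1 t i \<omega>)"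
    using av_local_filter_Suc[of \<theta>0 "\<lambda>t i. Gbar I i (th t i \<omega>) + noise_term 1 t i \<omega>" t] unfolding e .
  then show ?thesis
    unfolding Xb_def M_Suc nbar_def agent_avg_add by (simp add: algebra_simps)
qed

lemma Zx_Suc_le: "Zx (Suc t) \<le> (1 - \<alpha> * \<kappa>) * Zx t + (2 * \<alpha> / \<kappa>) * (A\<^sup>2 * (sq (M t) + consensus_error t))"
proof -
  let ?d = "\<lambda>\<omega>. av (\<lambda>i. (norm (th t i \<omega> - av (\<lambda>j. th t j \<omega>)))\<^sup>2)"
  have drv: "bounded_rv P ?d"
    by (rule rv_family_sq[OF rv_family_diff[OF rv_family_th]]) (simp add: rv_family_def rv_family_av[OF rv_family_th])
  have "Zx (Suc t) \<le> expectation (\<lambda>\<omega>. 1 * ((1 - \<alpha> * \<kappa>) * (nrm (Xb t \<omega>))\<^sup>2 + (2 * \<alpha> / \<kappa> * A\<^sup>2) * (norm (M t \<omega>))\<^sup>2 + 0)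
      + (2 * \<alpha> / \<kappa> * A\<^sup>2) * ?d \<omega> + 0)"
    unfolding Zx_def
  proof (rule bounded_rv_expectation_mono)
    fix \<omega> assume w: "\<omega> \<in> space P"
    let ?x = "nrm (Xb t \<omega>)" and ?w = "A * norm (M t \<omega>)"
    let ?b = "A * av (\<lambda>i. norm (th t i \<omega> - av (\<lambda>j. th t j \<omega>)))"
    have b0: "0 \<le> av (\<lambda>i. norm (th t i \<omega> - av (\<lambda>j. th t j \<omega>)))" by (intro agent_avg_nonneg) simp
    have "nrm (av (\<lambda>i. Gbar I i (th t i \<omega>))) \<le> av (\<lambda>i. nrm (Gbar I i (th t i \<omega>)))"
      by (rule is_norm_agent_avg_le[OF nrm])
    also have "\<dots> \<le> av (\<lambda>i. \<gamma> * (?x + ?w) + A * norm (th t i \<omega> - av (\<lambda>j. th t j \<omega>)))"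
    proof (rule agent_avg_mono)
      fix i assume i: "i < N"
      have "th t i \<omega> = (Xb t \<omega> + M t \<omega>) + (th t i \<omega> - av (\<lambda>j. th t j \<omega>))" by (simp add: Xb_def)
      then have "nrm (th t i \<omega>) \<le> nrm (Xb t \<omega> + M t \<omega>) + nrm (th t i \<omega> - av (\<lambda>j. th t j \<omega>))"
        using is_norm_simps(3)[OF nrm, of "Xb t \<omega> + M t \<omega>" "th t i \<omega> - av (\<lambda>j. th t j \<omega>)"] by simp
      also have "\<dots> \<le> (?x + ?w) + A * norm (th t i \<omega> - av (\<lambda>j. th t j \<omega>))"
        using is_norm_simps(3)[OF nrm, of "Xb t \<omega>" "M t \<omega>"] nrm_le[of "M t \<omega>"] nrm_le[of "th t i \<omega> - av (\<lambda>j. th t j \<omega>)"] by linarith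
      finally have "\<gamma> * nrm (th t i \<omega>) \<le> \<gamma> * ((?x + ?w) + A * norm (th t i \<omega> - av (\<lambda>j. th t j \<omega>)))"
        using \<gamma>0 by (intro mult_left_mono)
      also have "\<dots> \<le> \<gamma> * (?x + ?w) + A * norm (th t i \<omega> - av (\<lambda>j. th t j \<omega>))"
        using \<gamma>0 \<gamma>1 A1 mult_right_mono[of \<gamma> 1 "A * norm (th t i \<omega> - av (\<lambda>j. th t j \<omega>))"] by (simp add: distrib_left)
      finally show "nrm (Gbar I i (th t i \<omega>)) \<le> \<gamma> * (?x + ?w) + A * norm (th t i \<omega> - av (\<lambda>j. th t j \<omega>))"
        using Gbar_nrm[OF i, of "th t i \<omega>"] by linarith
    qed
    also have "\<dots> = \<gamma> * (?x + ?w) + ?b" by (simp only: agent_avg_add agent_avg_mult agent_avg_const[OF N1])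
    finally have g: "nrm (av (\<lambda>i. Gbar I i (th t i \<omega>))) \<le> \<gamma> * (?x + ?w) + ?b" .
    have "nrm (Xb (Suc t) \<omega>) \<le> (1 - \<alpha>) * ?x + \<alpha> * nrm (av (\<lambda>i. Gbar I i (th t i \<omega>)))"
      unfolding Xb_Suc using is_norm_simps(3)[OF nrm, of "(1 - \<alpha>) *\<^sub>R Xb t \<omega>" "\<alpha> *\<^sub>R av (\<lambda>i. Gbar I i (th t i \<omega>))"] \<alpha>_pos \<alpha>_le
      by (simp add: is_norm_simps(2)[OF nrm])
    also have "\<dots> \<le> (1 - \<alpha>) * ?x + \<alpha> * (\<gamma> * (?x + ?w) + ?b)"
      using g \<alpha>_pos by (intro add_left_mono mult_left_mono) auto
    finally have "(nrm (Xb (Suc t) \<omega>))\<^sup>2 \<le> ((1 - \<alpha>) * ?x + \<alpha> * (\<gamma> * (?x + ?w) + ?b))\<^sup>2"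
      by (intro power_mono is_norm_simps(1)[OF nrm])
    also have "\<dots> \<le> (1 - \<alpha> * \<kappa>) * ?x\<^sup>2 + (2 * \<alpha> / \<kappa>) * (?w\<^sup>2 + ?b\<^sup>2)"
      using is_norm_simps(1)[OF nrm] A1 b0 by (intro contraction_step) auto
    also have "\<dots> \<le> (1 - \<alpha> * \<kappa>) * ?x\<^sup>2 + (2 * \<alpha> / \<kappa>) * (A\<^sup>2 * (norm (M t \<omega>))\<^sup>2 + A\<^sup>2 * ?d \<omega>)"
      unfolding power_mult_distrib using \<alpha>_pos \<kappa> by (intro add_left_mono mult_left_mono agent_avg_power2_le) auto
    finally have "(nrm (Xb (Suc t) \<omega>))\<^sup>2 \<le> (1 - \<alpha> * \<kappa>) * ?x\<^sup>2 + (2 * \<alpha> / \<kappa>) * (A\<^sup>2 * (norm (M t \<omega>))\<^sup>2 + A\<^sup>2 * ?d \<omega>)" .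
    then show "(nrm (Xb (Suc t) \<omega>))\<^sup>2 \<le> 1 * ((1 - \<alpha> * \<kappa>) * ?x\<^sup>2 + (2 * \<alpha> / \<kappa> * A\<^sup>2) * (norm (M t \<omega>))\<^sup>2 + 0)
      + (2 * \<alpha> / \<kappa> * A\<^sup>2) * ?d \<omega> + 0"
      by (simp only: distrib_left mult.assoc add.assoc mult_1 add_0_right)
  qed (intro bounded_rv_add bounded_rv_cmult bounded_rv_const nrm_power2_rv bounded_rv_power2 bounded_rv_norm Xb_rv M_rv drv)+
  also have "\<dots> = 1 * ((1 - \<alpha> * \<kappa>) * Zx t + (2 * \<alpha> / \<kappa> * A\<^sup>2) * sq (M t) + 0) + (2 * \<alpha> / \<kappa> * A\<^sup>2) * consensus_error t + 0"
    unfolding Zx_def sq_def consensus_error_def msq_def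
    by (simp only: expectation_lin[OF bounded_rv_add[OF bounded_rv_add[OF bounded_rv_cmult[OF nrm_power2_rv[OF Xb_rv]]
          bounded_rv_cmult[OF bounded_rv_power2[OF bounded_rv_norm[OF M_rv]]]] bounded_rv_const] drv]
        expectation_lin[OF nrm_power2_rv[OF Xb_rv] bounded_rv_power2[OF bounded_rv_norm[OF M_rv]]])
  finally show ?thesis by (simp only: distrib_left mult.assoc add.assoc mult_1 add_0_right)
qed

definition "Obd = (\<alpha> * real K)\<^sup>2 * (\<delta> + B) + \<alpha> * real K * \<delta>"

lemma Obd_nonneg: "0 \<le> Obd"
  using \<alpha>_pos \<delta>_pos B by (auto simp: Obd_def)

lemma R_nonneg: "0 \<le> R1" "0 \<le> R2"
  using A1 Q1_nonneg G_ge by (auto simp: R1_def R2_def intro!: add_nonneg_nonneg mult_nonneg_nonneg)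

lemma Zx_le: "Zx t \<le> (1 - \<alpha> * \<kappa>) ^ t * (A\<^sup>2 * (norm \<theta>0)\<^sup>2 + 4 * A\<^sup>2 / \<kappa> * R1 * (\<alpha> * real t))
    + 2 * A\<^sup>2 / \<kappa>\<^sup>2 * (Mbd + R2 * Obd)"
proof (induction t)
  case 0
  have "Zx 0 = (nrm \<theta>0)\<^sup>2" using N1 by (simp add: Zx_def Xb_def M_0 agent_avg_const prob_space)
  also have "\<dots> \<le> (A * norm \<theta>0)\<^sup>2" by (intro power_mono nrm_le is_norm_simps(1)[OF nrm])
  moreover have "0 \<le> 2 * A\<^sup>2 / \<kappa>\<^sup>2 * (Mbd + R2 * Obd)" using Mbd_nonneg Obd_nonneg R_nonneg by simp
  ultimately show ?case by (simp add: power_mult_distrib)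
next
  case (Suc t)
  let ?p = "(1 - \<alpha> * \<kappa>) ^ t" and ?E = "Mbd + R2 * Obd" and ?r = "A\<^sup>2 * (norm \<theta>0)\<^sup>2"
  have p0: "0 \<le> ?p" using \<kappa> by simp
  have "consensus_error t \<le> R1 * (\<alpha> * real K)\<^sup>2 * ?p + R2 * Obd" unfolding Obd_def by (rule consensus_error_le)
  also have "R1 * (\<alpha> * real K)\<^sup>2 * ?p \<le> R1 * 1 * ?p"
    using R_nonneg p0 \<alpha>K \<alpha>_pos by (intro mult_right_mono mult_left_mono power_le_one) auto
  also have "R1 * 1 * ?p \<le> R1 * (2 * (1 - \<alpha> * \<kappa>)) * ?p"
    using R_nonneg p0 \<kappa> by (intro mult_right_mono mult_left_mono) auto
  finally have "sq (M t) + consensus_error t \<le> R1 * (2 * (1 - \<alpha> * \<kappa>)) * ?p + ?E" using sq_M_le[of t] by linarith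
  then have "(2 * \<alpha> / \<kappa>) * (A\<^sup>2 * (sq (M t) + consensus_error t)) \<le> (2 * \<alpha> / \<kappa>) * (A\<^sup>2 * (R1 * (2 * (1 - \<alpha> * \<kappa>)) * ?p + ?E))"
    using \<alpha>_pos \<kappa> by (intro mult_left_mono) auto
  moreover have "(1 - \<alpha> * \<kappa>) * Zx t \<le> (1 - \<alpha> * \<kappa>) * (?p * (?r + 4 * A\<^sup>2 / \<kappa> * R1 * (\<alpha> * real t)) + 2 * A\<^sup>2 / \<kappa>\<^sup>2 * ?E)"
    using \<kappa> by (intro mult_left_mono[OF Suc.IH]) auto
  ultimately have "Zx (Suc t) \<le> (1 - \<alpha> * \<kappa>) * (?p * (?r + 4 * A\<^sup>2 / \<kappa> * R1 * (\<alpha> * real t)) + 2 * A\<^sup>2 / \<kappa>\<^sup>2 * ?E)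
      + (2 * \<alpha> / \<kappa>) * (A\<^sup>2 * (R1 * (2 * (1 - \<alpha> * \<kappa>)) * ?p + ?E))"
    using Zx_Suc_le[of t] by linarith
  also have "\<dots> = (1 - \<alpha> * \<kappa>) ^ Suc t * (?r + 4 * A\<^sup>2 / \<kappa> * R1 * (\<alpha> * real (Suc t))) + 2 * A\<^sup>2 / \<kappa>\<^sup>2 * ?E"
  proof -
    have q: "(2 * \<alpha> / \<kappa>) * (A\<^sup>2 * ?E) = \<alpha> * \<kappa> * (2 * A\<^sup>2 / \<kappa>\<^sup>2 * ?E)"
      using \<kappa>(1) by (simp add: field_simps power2_eq_square)
    have q': "(2 * \<alpha> / \<kappa>) * (A\<^sup>2 * (R1 * (2 * (1 - \<alpha> * \<kappa>)) * ?p)) = (1 - \<alpha> * \<kappa>) * ?p * (4 * A\<^sup>2 / \<kappa> * R1 * \<alpha>)"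
      by (simp add: field_simps)
    have "(1 - k) * (p * (r + a * (\<alpha> * real t)) + E) + ((1 - k) * p * (a * \<alpha>) + k * E)
        = (1 - k) * p * (r + a * (\<alpha> * real (Suc t))) + E" for k p r a E :: real
      by (simp add: algebra_simps)
    moreover have "(2 * \<alpha> / \<kappa>) * (A\<^sup>2 * (x + y)) = (2 * \<alpha> / \<kappa>) * (A\<^sup>2 * x) + (2 * \<alpha> / \<kappa>) * (A\<^sup>2 * y)" for x y
      by (simp only: distrib_left)
    ultimately show ?thesis
      using q q' power_Suc by metis
  qed
  finally show ?case .
qed

lemma theta_avg_error:
  "expectation (\<lambda>\<omega>. (nrm (theta_avg I \<theta>0 \<alpha> K t \<omega>))\<^sup>2)
    \<le> 2 * (1 - \<alpha> * \<kappa>) ^ t * (A\<^sup>2 * (norm \<theta>0)\<^sup>2 + 4 * A\<^sup>2 / \<kappa> * R1 * (\<alpha> * real t))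
      + 6 * A\<^sup>2 / \<kappa>\<^sup>2 * (Mbd + R2 * Obd)"
proof -
  have th: "theta_avg I \<theta>0 \<alpha> K t \<omega> = Xb t \<omega> + M t \<omega>" for \<omega>
    by (simp add: theta_avg_def Xb_def)
  have "expectation (\<lambda>\<omega>. (nrm (theta_avg I \<theta>0 \<alpha> K t \<omega>))\<^sup>2)
      \<le> expectation (\<lambda>\<omega>. 2 * (nrm (Xb t \<omega>))\<^sup>2 + (2 * A\<^sup>2) * (norm (M t \<omega>))\<^sup>2 + 0)"
  proof (rule bounded_rv_expectation_mono)
    show "bounded_rv P (\<lambda>\<omega>. (nrm (theta_avg I \<theta>0 \<alpha> K t \<omega>))\<^sup>2)"
      unfolding th by (intro nrm_power2_rv bounded_rv_add Xb_rv M_rv)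
    fix \<omega>
    have "nrm (theta_avg I \<theta>0 \<alpha> K t \<omega>) \<le> nrm (Xb t \<omega>) + A * norm (M t \<omega>)"
      unfolding th using is_norm_simps(3)[OF nrm, of "Xb t \<omega>" "M t \<omega>"] nrm_le[of "M t \<omega>"] by linarith
    then have "(nrm (theta_avg I \<theta>0 \<alpha> K t \<omega>))\<^sup>2 \<le> (nrm (Xb t \<omega>) + A * norm (M t \<omega>))\<^sup>2"
      by (intro power_mono is_norm_simps(1)[OF nrm])
    also have "\<dots> \<le> 2 * (nrm (Xb t \<omega>))\<^sup>2 + 2 * (A * norm (M t \<omega>))\<^sup>2" by (rule power2_sum_le)
    finally show "(nrm (theta_avg I \<theta>0 \<alpha> K t \<omega>))\<^sup>2 \<le> 2 * (nrm (Xb t \<omega>))\<^sup>2 + (2 * A\<^sup>2) * (norm (M t \<omega>))\<^sup>2 + 0"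
      by (simp add: power_mult_distrib)
  qed (intro bounded_rv_add bounded_rv_cmult bounded_rv_const nrm_power2_rv bounded_rv_power2 bounded_rv_norm Xb_rv M_rv)+
  also have "\<dots> = 2 * Zx t + (2 * A\<^sup>2) * sq (M t) + 0"
    unfolding Zx_def sq_def by (rule expectation_lin[OF nrm_power2_rv[OF Xb_rv] bounded_rv_power2[OF bounded_rv_norm[OF M_rv]]])
  finally have 1: "expectation (\<lambda>\<omega>. (nrm (theta_avg I \<theta>0 \<alpha> K t \<omega>))\<^sup>2) \<le> 2 * Zx t + (2 * A\<^sup>2) * sq (M t)" by simp
  have RO: "0 \<le> R2 * Obd" using R_nonneg Obd_nonneg by simp
  have "(2 * A\<^sup>2) * sq (M t) \<le> 2 * A\<^sup>2 * (Mbd + R2 * Obd)"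
    using sq_M_le[of t] RO by (intro mult_left_mono) auto
  also have "\<dots> \<le> 2 * A\<^sup>2 / \<kappa>\<^sup>2 * (Mbd + R2 * Obd)"
    using mult_right_mono[OF \<kappa>_div(1), of "2 * A\<^sup>2 * (Mbd + R2 * Obd)"] RO Mbd_nonneg by (simp add: mult_ac)
  finally have 2: "(2 * A\<^sup>2) * sq (M t) \<le> 2 * A\<^sup>2 / \<kappa>\<^sup>2 * (Mbd + R2 * Obd)" .
  have "2 * Zx t \<le> 2 * ((1 - \<alpha> * \<kappa>) ^ t * (A\<^sup>2 * (norm \<theta>0)\<^sup>2 + 4 * A\<^sup>2 / \<kappa> * R1 * (\<alpha> * real t))
    + 2 * A\<^sup>2 / \<kappa>\<^sup>2 * (Mbd + R2 * Obd))" by (intro mult_left_mono Zx_le) simp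
  moreover have "6 * A\<^sup>2 / \<kappa>\<^sup>2 * x = 2 * (2 * A\<^sup>2 / \<kappa>\<^sup>2 * x) + 2 * A\<^sup>2 / \<kappa>\<^sup>2 * x" for x by (simp add: field_simps)
  moreover have "e \<le> 2 * p * q + r" if "e \<le> z + w" "z \<le> 2 * (p * q + x)" "w \<le> x" "r = 2 * x + x" for e z w p q x r :: real
    using that by simp
  ultimately show ?thesis using 1 2 by blast
qed

end

section \<open>Sampling the output\<close>

lemma sum_power_reverse:
  fixes x :: real
  assumes "0 < x"
  shows "(\<Sum>t<T. x ^ t) * inverse x ^ (T - 1) = (\<Sum>t<T. inverse x ^ t)"
proof -
  have "(\<Sum>t<T. inverse x ^ t) = (\<Sum>t<T. inverse x ^ (T - Suc t))"
    by (rule sum.nat_diff_reindex[symmetric])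
  also have "\<dots> = (\<Sum>t<T. x ^ t * inverse x ^ (T - 1))"
  proof (intro sum.cong refl)
    fix t assume "t \<in> {..<T}"
    then have "T - 1 = t + (T - Suc t)" by auto
    then have "inverse x ^ (T - 1) = inverse x ^ t * inverse x ^ (T - Suc t)" by (metis power_add)
    then show "inverse x ^ (T - Suc t) = x ^ t * inverse x ^ (T - 1)"
      using assms by (simp add: power_inverse)
  qed
  finally show ?thesis by (simp add: sum_distrib_right)
qed

lemma sampled_geometric_le:
  fixes x :: real
  assumes x: "0 < x" and T: "1 \<le> T" and f: "\<And>t. t < T \<Longrightarrow> f t \<le> a * (x\<^sup>2) ^ t + b"
  shows "(\<Sum>t<T. inverse x ^ t / (\<Sum>t'<T. inverse x ^ t') * f t) \<le> a * x ^ (T - 1) + b"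
proof -
  define S where "S = (\<Sum>t'<T. inverse x ^ t')"
  have S: "0 < S" unfolding S_def using x T by (intro sum_pos) (auto simp: lessThan_empty_iff)
  have "(\<Sum>t<T. inverse x ^ t / S * f t) \<le> (\<Sum>t<T. inverse x ^ t / S * (a * (x\<^sup>2) ^ t + b))"
    using f x S by (intro sum_mono mult_left_mono) auto
  also have "\<dots> = (\<Sum>t<T. a / S * x ^ t + b / S * inverse x ^ t)"
  proof (intro sum.cong refl)
    fix t
    have "(x\<^sup>2) ^ t = x ^ t * x ^ t" by (simp add: power2_eq_square power_mult_distrib)
    then have "inverse x ^ t * (x\<^sup>2) ^ t = x ^ t" using x by (simp add: power_inverse)
    then show "inverse x ^ t / S * (a * (x\<^sup>2) ^ t + b) = a / S * x ^ t + b / S * inverse x ^ t"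
      by (simp add: distrib_left mult_ac)
  qed
  also have "\<dots> = a / S * (\<Sum>t<T. x ^ t) + b / S * S"
    by (simp only: sum.distrib sum_distrib_left[symmetric] S_def)
  also have "(\<Sum>t<T. x ^ t) = S * x ^ (T - 1)"
    unfolding S_def sum_power_reverse[OF x, symmetric] using x by (simp add: power_inverse)
  finally show ?thesis using S unfolding S_def[symmetric] by simp
qed

context fed_run
begin

lemma independent_output_expectation:
  assumes D: "D \<in> sets P" and ind: "indep_set {D} (sets (gen_alg P ({..<N} \<times> UNIV) (\<lambda>(i, t). spc I i) (\<lambda>(i, t). noise I i t)))"
    and F: "bounded_rv (Fn t) F"
  shows "expectation (\<lambda>\<omega>. F \<omega> * indicator D \<omega>) = prob D * expectation F"
proof -
  let ?Q = "gen_alg P ({..<N} \<times> UNIV) (\<lambda>(i, t). spc I i) (\<lambda>(i, t). noise I i t)"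
  have Q: "subalgebra P ?Q" by (rule subalgebra_gen_alg) (auto intro: noise_measurable)
  have "noise I i r \<in> ?Q \<rightarrow>\<^sub>M spc I i" if "i < N" for i r
    using measurable_gen_alg[of "(i, r)" "{..<N} \<times> UNIV" "\<lambda>(i, r). noise I i r" P "\<lambda>(i, r). spc I i"] noise_space that
    by auto
  then have "subalgebra ?Q (Fn t)"
    unfolding noise_filtration_def by (intro subalgebra_gen_alg) auto
  then have FQ: "bounded_rv ?Q F" by (rule bounded_rv_mono[OF F])
  interpret finite_measure_subalgebra P ?Q by standard (rule Q)
  have Drv: "bounded_rv P (indicator D :: 'w \<Rightarrow> real)"
    using D by (intro bounded_rvI[where C = 1]) (auto simp: indicator_def)
  have "AE \<omega> in P. real_cond_exp P ?Q (indicator D) \<omega> = prob D"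
  proof (rule real_cond_exp_charact)
    fix E assume E: "E \<in> sets ?Q"
    then have EP: "E \<in> sets P" using Q by (auto simp: subalgebra_def)
    have "(\<integral>\<omega>\<in>E. indicator D \<omega> \<partial>P) = prob (D \<inter> E)"
      using D EP sets.sets_into_space[OF D]
      by (simp add: set_lebesgue_integral_def indicator_inter_arith[symmetric] Int_commute Int_absorb1 inf.coboundedI1 flip: indicator_inter_arith)
    also have "\<dots> = prob D * prob E" by (rule indep_setD[OF ind _ E]) simp
    also have "\<dots> = (\<integral>\<omega>\<in>E. prob D \<partial>P)"
      using EP sets.sets_into_space[OF EP] by (simp add: set_lebesgue_integral_def Int_absorb2 mult.commute)
    finally show "(\<integral>\<omega>\<in>E. indicator D \<omega> \<partial>P) = (\<integral>\<omega>\<in>E. prob D \<partial>P)" .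
  qed (use Drv in \<open>auto intro: integrable_bounded_rv\<close>)
  then have AE: "AE \<omega> in P. F \<omega> * real_cond_exp P ?Q (indicator D) \<omega> = F \<omega> * prob D" by eventually_elim simp
  have FP: "bounded_rv P F" by (rule Fn_P[OF F])
  have "expectation (\<lambda>\<omega>. F \<omega> * indicator D \<omega>) = expectation (\<lambda>\<omega>. F \<omega> * real_cond_exp P ?Q (indicator D) \<omega>)"
    by (rule real_cond_exp_intg(2)[symmetric, OF integrable_bounded_rv[OF bounded_rv_mult[OF FP Drv]]
          bounded_rv_measurable[OF FQ] bounded_rv_measurable[OF Drv]])
  also have "\<dots> = expectation (\<lambda>\<omega>. F \<omega> * prob D)"
    using bounded_rv_measurable[OF FP] by (intro integral_cong_AE AE) auto
  finally show ?thesis by simp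
qed

lemma theta_avg_rv: "bounded_rv (Fn t) (\<lambda>\<omega>. (nrm (theta_avg I \<theta>0 \<alpha> K t \<omega>))\<^sup>2)"
  unfolding theta_avg_def by (intro bounded_rv_power2 bounded_rv_is_norm[OF nrm nrm_le] bounded_rv_agent_avg th_rv)

lemma output_error_le:
  fixes c :: "'v constants"
  assumes out: "output_time c I \<alpha> T That" and x: "0 < c_fsam c \<alpha>" and T: "1 \<le> T"
    and f: "\<And>t. t < T \<Longrightarrow> expectation (\<lambda>\<omega>. (nrm (theta_avg I \<theta>0 \<alpha> K t \<omega>))\<^sup>2) \<le> a * ((c_fsam c \<alpha>)\<^sup>2) ^ t + b"
  shows "expectation (\<lambda>\<omega>. (nrm (theta_avg I \<theta>0 \<alpha> K (That \<omega>) \<omega>))\<^sup>2) \<le> a * c_fsam c \<alpha> ^ (T - 1) + b"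
proof -
  let ?F = "\<lambda>t \<omega>. (nrm (theta_avg I \<theta>0 \<alpha> K t \<omega>))\<^sup>2" and ?x = "c_fsam c \<alpha>"
  define D where "D t = {\<omega> \<in> space P. That \<omega> = t}" for t
  have q: "prob (D t) = inverse ?x ^ t / (\<Sum>t'<T. inverse ?x ^ t')" if "t < T" for t
    using out that by (auto simp: output_time_def D_def)
  have Tm: "That \<in> P \<rightarrow>\<^sub>M count_space UNIV" using out by (simp add: output_time_def)
  have D_eq: "D t = That -` {t} \<inter> space P" for t by (auto simp: D_def)
  have D: "D t \<in> sets P" for t unfolding D_eq by (rule measurable_sets[OF Tm]) simp
  have ind: "indep_set {D t} (sets (gen_alg P ({..<N} \<times> UNIV) (\<lambda>(i, t). spc I i) (\<lambda>(i, t). noise I i t)))" for t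
  proof -
    have "indep_set {That -` A \<inter> space P | A. A \<in> UNIV}
        (sets (gen_alg P ({..<N} \<times> UNIV) (\<lambda>(i, t). spc I i) (\<lambda>(i, t). noise I i t)))"
      using out by (simp add: output_time_def)
    then show ?thesis
      unfolding indep_set_def
      by (rule indep_sets_mono_sets) (auto simp: D_eq split: bool.split)
  qed
  have S: "0 < (\<Sum>t'<T. inverse ?x ^ t')" using x T by (intro sum_pos) (auto simp: lessThan_empty_iff)
  have "prob (\<Union>t\<in>{..<T}. D t) = (\<Sum>t<T. prob (D t))"
    using D by (intro finite_measure_finite_Union) (auto simp: disjoint_family_on_def D_def)
  also have "\<dots> = (\<Sum>t<T. inverse ?x ^ t / (\<Sum>t'<T. inverse ?x ^ t'))" by (intro sum.cong) (auto simp: q)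
  also have "\<dots> = 1" using S by (simp add: sum_divide_distrib[symmetric])
  finally have "AE \<omega> in P. \<omega> \<in> (\<Union>t\<in>{..<T}. D t)" using D by (subst (asm) prob_eq_1) auto
  then have AE: "AE \<omega> in P. ?F (That \<omega>) \<omega> = (\<Sum>t<T. ?F t \<omega> * indicator (D t) \<omega>)"
  proof eventually_elim
    fix \<omega> assume "\<omega> \<in> (\<Union>t\<in>{..<T}. D t)"
    then have "That \<omega> < T" "\<omega> \<in> space P" by (auto simp: D_def)
    have "(\<Sum>t<T. ?F t \<omega> * indicator (D t) \<omega>) = (\<Sum>t<T. if t = That \<omega> then ?F t \<omega> else 0)"
      using \<open>\<omega> \<in> space P\<close> by (intro sum.cong) (auto simp: D_def indicator_def)
    also have "\<dots> = ?F (That \<omega>) \<omega>" using \<open>That \<omega> < T\<close> by simp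
    finally show "?F (That \<omega>) \<omega> = (\<Sum>t<T. ?F t \<omega> * indicator (D t) \<omega>)" by simp
  qed
  have FP: "bounded_rv P (?F t)" for t by (rule Fn_P[OF theta_avg_rv])
  have Drv: "bounded_rv P (indicator (D t) :: 'w \<Rightarrow> real)" for t
    using D[of t] by (intro bounded_rvI[where C = 1]) (auto simp: indicator_def)
  have FD: "bounded_rv P (\<lambda>\<omega>. ?F t \<omega> * indicator (D t) \<omega>)" for t by (rule bounded_rv_mult[OF FP Drv])
  have m1: "(\<lambda>\<omega>. ?F (That \<omega>) \<omega>) \<in> borel_measurable P"
    by (rule measurable_compose_countable[OF bounded_rv_measurable[OF FP] Tm])
  have "expectation (\<lambda>\<omega>. ?F (That \<omega>) \<omega>) = expectation (\<lambda>\<omega>. \<Sum>t<T. ?F t \<omega> * indicator (D t) \<omega>)"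
    by (rule integral_cong_AE[OF m1 bounded_rv_measurable[OF bounded_rv_sum[OF FD]] AE])
  also have "\<dots> = (\<Sum>t<T. expectation (\<lambda>\<omega>. ?F t \<omega> * indicator (D t) \<omega>))"
    by (intro Bochner_Integration.integral_sum integrable_bounded_rv FD)
  also have "\<dots> = (\<Sum>t<T. inverse ?x ^ t / (\<Sum>t'<T. inverse ?x ^ t') * expectation (?F t))"
    by (intro sum.cong refl) (simp add: independent_output_expectation[OF D ind theta_avg_rv] q)
  also have "\<dots> \<le> a * ?x ^ (T - 1) + b" by (rule sampled_geometric_le[OF x T f])
  finally show ?thesis .
qed

lemma norm_th_le:
  assumes w: "\<omega> \<in> space P"
  shows "i < N \<Longrightarrow> norm (th t i \<omega>) + 1 \<le> (1 + A) ^ t * (norm \<theta>0 + 1)"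
proof (induction t arbitrary: i)
  case (Suc t)
  have loc: "norm (th t j \<omega> + \<alpha> *\<^sub>R (opG I j (th t j \<omega>) (noise I j t \<omega>) - th t j \<omega> + opb I j (noise I j t \<omega>)))
      \<le> (1 + A) ^ Suc t * (norm \<theta>0 + 1) - 1" if j: "j < N" for j
  proof -
    let ?x = "th t j \<omega>" and ?y = "noise I j t \<omega>"
    have "?x + \<alpha> *\<^sub>R (opG I j ?x ?y - ?x + opb I j ?y) = (1 - \<alpha>) *\<^sub>R ?x + \<alpha> *\<^sub>R (opG I j ?x ?y + opb I j ?y)"
      by (simp add: algebra_simps)
    also have "norm \<dots> \<le> (1 - \<alpha>) * norm ?x + \<alpha> * norm (opG I j ?x ?y + opb I j ?y)"
      using norm_triangle_ineq[of "(1 - \<alpha>) *\<^sub>R ?x" "\<alpha> *\<^sub>R (opG I j ?x ?y + opb I j ?y)"] \<alpha>_pos \<alpha>_le by simp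
    also have "\<dots> \<le> 1 * norm ?x + 1 * (A * norm ?x + A)"
    proof (intro add_mono mult_mono)
      show "norm (opG I j ?x ?y + opb I j ?y) \<le> A * norm ?x + A"
        using norm_triangle_ineq[of "opG I j ?x ?y" "opb I j ?y"] G_le[OF j noise_space[OF j w, of t], of ?x] b_le[OF j noise_space[OF j w, of t]]
        by linarith
    qed (use \<alpha>_pos \<alpha>_le A1 in auto)
    also have "\<dots> = (1 + A) * (norm ?x + 1) - 1" by (simp add: algebra_simps)
    also have "\<dots> \<le> (1 + A) * ((1 + A) ^ t * (norm \<theta>0 + 1)) - 1"
      using Suc.IH[OF j] A1 by (intro diff_right_mono mult_left_mono) auto
    finally show ?thesis by (simp add: mult_ac)
  qed
  show ?case
  proof (cases "K dvd Suc t")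
    case True
    have "norm (th (Suc t) i \<omega>) \<le> av (\<lambda>j. (1 + A) ^ Suc t * (norm \<theta>0 + 1) - 1)"
      using True unfolding theta.simps Let_def by (simp del: power_Suc) (rule order_trans[OF norm_agent_avg_le agent_avg_mono[OF loc]])
    then show ?thesis by (simp add: agent_avg_const[OF N1])
  next
    case False
    then show ?thesis using loc[OF Suc.prems] by (simp add: Let_def)
  qed
qed simp

lemma theta_avg_crude:
  "expectation (\<lambda>\<omega>. (nrm (theta_avg I \<theta>0 \<alpha> K t \<omega>))\<^sup>2) \<le> (A * ((1 + A) ^ t * (norm \<theta>0 + 1)))\<^sup>2"
proof -
  have "expectation (\<lambda>\<omega>. (nrm (theta_avg I \<theta>0 \<alpha> K t \<omega>))\<^sup>2)
      \<le> expectation (\<lambda>\<omega>. (A * ((1 + A) ^ t * (norm \<theta>0 + 1)))\<^sup>2)"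
  proof (rule bounded_rv_expectation_mono[OF Fn_P[OF theta_avg_rv] bounded_rv_const])
    fix \<omega> assume w: "\<omega> \<in> space P"
    have "nrm (theta_avg I \<theta>0 \<alpha> K t \<omega>) \<le> A * norm (theta_avg I \<theta>0 \<alpha> K t \<omega>)" by (rule nrm_le)
    also have "norm (theta_avg I \<theta>0 \<alpha> K t \<omega>) \<le> av (\<lambda>i. norm (th t i \<omega>))"
      unfolding theta_avg_def by (rule norm_agent_avg_le)
    also have "\<dots> \<le> av (\<lambda>i. (1 + A) ^ t * (norm \<theta>0 + 1))"
      using norm_th_le[OF w] by (intro agent_avg_mono) (smt (verit))
    finally show "(nrm (theta_avg I \<theta>0 \<alpha> K t \<omega>))\<^sup>2 \<le> (A * ((1 + A) ^ t * (norm \<theta>0 + 1)))\<^sup>2"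
      using A1 is_norm_simps(1)[OF nrm] by (intro power_mono) (simp_all add: agent_avg_const[OF N1])
  qed
  then show ?thesis by (simp add: prob_space)
qed

end

definition norm_bound :: "'v constants \<Rightarrow> real" where
  "norm_bound c = 1 + uc2 c + 1 / lc2 c + uc2 c / lc2 c * (cA1 c + cA2 c + gam c + m1 c) + (cB c + m2 c + m4 c) / lc2 c"

lemma fed_run_fegsam:
  fixes c :: "('v::euclidean_space) constants" and I :: "('v, 's, 'w) fed"
  assumes c: "valid_constants c" and f: "fegsam c \<theta>0 I \<alpha> K T That"
    and s: "1 \<le> nag I" "1 \<le> K" "0 < \<alpha>" "\<alpha> \<le> 1/2"
    and \<xi>: "\<xi> = 0 \<or> \<xi> = 1" "\<xi> = 1 \<Longrightarrow> heterogeneity c I = 0"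
  shows "fed_run I K \<alpha> \<theta>0 (nrm_c c) (norm_bound c) (gam c) (rho c) \<xi>"
proof -
  define A where "A = norm_bound c"
  have cc: "is_norm (nrm_c c)" "0 < lc2 c" "0 < uc2 c" "\<And>x. lc2 c * norm x \<le> nrm_c c x" "\<And>x. nrm_c c x \<le> uc2 c * norm x"
    "0 < gam c" "gam c < 1" "0 \<le> cA1 c" "0 \<le> cA2 c" "0 \<le> cB c" "0 \<le> m1 c" "0 \<le> m2 c" "0 \<le> m4 c" "0 \<le> rho c"
    using c by (auto simp: valid_constants_def)
  note noise_term = is_norm_simps[OF cc(1)]
  let ?r = "uc2 c / lc2 c"
  have r0: "0 < ?r" using cc by simp
  have Alist: "1 \<le> A" "uc2 c \<le> A" "1 / lc2 c \<le> A" "?r * cA1 c \<le> A" "?r * cA2 c \<le> A" "?r * gam c \<le> A" "?r * m1 c \<le> A"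
    "cB c / lc2 c \<le> A" "m2 c / lc2 c \<le> A" "m4 c / lc2 c \<le> A"
  proof -
    have p: "0 \<le> 1 / lc2 c" "0 \<le> ?r * cA1 c" "0 \<le> ?r * cA2 c" "0 \<le> ?r * gam c" "0 \<le> ?r * m1 c"
      "0 \<le> cB c / lc2 c" "0 \<le> m2 c / lc2 c" "0 \<le> m4 c / lc2 c" "0 \<le> uc2 c"
      using cc r0 by auto
    have "A = 1 + uc2 c + 1 / lc2 c + (?r * cA1 c + ?r * cA2 c + ?r * gam c + ?r * m1 c) + (cB c / lc2 c + m2 c / lc2 c + m4 c / lc2 c)"
      unfolding A_def norm_bound_def by (simp only: distrib_left add_divide_distrib)
    with p show "1 \<le> A" "uc2 c \<le> A" "1 / lc2 c \<le> A" "?r * cA1 c \<le> A" "?r * cA2 c \<le> A" "?r * gam c \<le> A" "?r * m1 c \<le> A"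
      "cB c / lc2 c \<le> A" "m2 c / lc2 c \<le> A" "m4 c / lc2 c \<le> A" by linarith+
  qed
  have n1: "norm x \<le> A * norm y" if "nrm_c c x \<le> q * nrm_c c y" "?r * q \<le> A" "0 \<le> q" for x y q
  proof -
    have "lc2 c * norm x \<le> q * (uc2 c * norm y)"
      using cc(4)[of x] that(1) mult_left_mono[OF cc(5)[of y] that(3)] by linarith
    then have "norm x \<le> (?r * q) * norm y" using cc(2) by (simp add: field_simps)
    also have "\<dots> \<le> A * norm y" using that(2) by (intro mult_right_mono) auto
    finally show ?thesis .
  qed
  have n2: "norm x \<le> A * p" if "nrm_c c x \<le> q * p" "q / lc2 c \<le> A" "0 \<le> p" for x q p
  proof -
    have "lc2 c * norm x \<le> q * p" using cc(4)[of x] that(1) by linarith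
    then have "norm x \<le> (q / lc2 c) * p" using cc(2) by (simp add: field_simps)
    also have "\<dots> \<le> A * p" using that by (intro mult_right_mono) auto
    finally show ?thesis .
  qed
  have fs: "markov_noise I" "mixing c I" "contraction c I" "lipschitz_bounded c I" "independent_agents I \<theta>0 \<alpha> K"
    using f by (auto simp: fegsam_def)
  have null: "x = 0" if "nrm_c c x \<le> 0" for x
    using cc(1) that unfolding is_norm_def by (metis order_antisym)
  have G0: "Gbar I i 0 = 0" if i: "i < nag I" for i
  proof -
    interpret prob_space "prb I" using fs(1) by (simp add: markov_noise_def)
    obtain \<omega> where w: "\<omega> \<in> space (prb I)" using not_empty by blast
    have "noise I i 0 \<in> prb I \<rightarrow>\<^sub>M spc I i" using fs(1) i by (simp add: markov_noise_def)
    then have y: "noise I i 0 \<omega> \<in> space (spc I i)" using w by (rule measurable_space)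
    have "opG I i 0 \<in> borel_measurable (spc I i)" "nrm_c c (opG I i 0 (noise I i 0 \<omega>)) \<le> cA2 c * nrm_c c 0"
      using fs(4) i y by (auto simp: lipschitz_bounded_def)
    then have "(\<integral>z. opG I i 0 z \<partial>state_law I i (noise I i 0 \<omega>) 0) = 0"
      using y null[of "opG I i 0 (noise I i 0 \<omega>)"] by (simp add: integral_return noise_term(4))
    moreover have "nrm_c c (Gbar I i 0 - (\<integral>z. opG I i 0 z \<partial>state_law I i (noise I i 0 \<omega>) 0)) \<le> m1 c * nrm_c c 0 * rho c ^ 0"
      using fs(2) i y unfolding mixing_def by blast
    ultimately show ?thesis using null[of "Gbar I i 0"] by (simp add: noise_term(4))
  qed
  have eta0: "eta c I i = 0" if "\<xi> = 1" "i < nag I" for i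
  proof -
    have "(\<Sum>i<nag I. eta c I i) = 0"
      using \<xi>(2)[OF that(1)] s(1) by (simp add: heterogeneity_def)
    moreover have "\<And>i. 0 \<le> eta c I i" by (simp add: eta_def noise_term(1))
    ultimately show ?thesis using that(2) by (simp add: sum_nonneg_eq_0_iff)
  qed
  show ?thesis
    unfolding A_def[symmetric]
  proof (unfold_locales)
    show "1 \<le> nag I" "1 \<le> K" "0 < \<alpha>" "\<alpha> \<le> 1/2" by (fact s)+
    show "markov_noise I" "independent_agents I \<theta>0 \<alpha> K" by (fact fs)+
    show "opG I i x \<in> borel_measurable (spc I i)" "opb I i \<in> borel_measurable (spc I i)" if "i < nag I" for i x
      using fs(4) that by (auto simp: lipschitz_bounded_def)
    show "norm (opG I i x z - opG I i x' z) \<le> A * norm (x - x')" if "i < nag I" "z \<in> space (spc I i)" for i z x x'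
      by (rule n1[where q = "cA1 c"]) (use fs(4) that Alist cc in \<open>auto simp: lipschitz_bounded_def\<close>)
    show "norm (opG I i x z) \<le> A * norm x" if "i < nag I" "z \<in> space (spc I i)" for i z x
      by (rule n1[where q = "cA2 c"]) (use fs(4) that Alist cc in \<open>auto simp: lipschitz_bounded_def\<close>)
    show "norm (opb I i z) \<le> A" if "i < nag I" "z \<in> space (spc I i)" for i z
      using n2[of "opb I i z" "cB c" 1] fs(4) that Alist by (auto simp: lipschitz_bounded_def)
    show "norm (Gbar I i x - Gbar I i x') \<le> A * norm (x - x')" if "i < nag I" for i x x'
      by (rule n1[where q = "gam c"]) (use fs(3) that Alist cc in \<open>auto simp: contraction_def\<close>)
    show "Gbar I i 0 = 0" if "i < nag I" for i by (rule G0[OF that])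
    show "nrm_c c (Gbar I i x) \<le> gam c * nrm_c c x" if "i < nag I" for i x
      using fs(3) that G0[OF that] unfolding contraction_def by (metis diff_zero)
    show "norm (Gbar I i x - (\<integral>z. opG I i x z \<partial>state_law I i y t)) \<le> A * norm x * rho c ^ t"
      if "i < nag I" "y \<in> space (spc I i)" for i y x t
    proof -
      have "nrm_c c (Gbar I i x - (\<integral>z. opG I i x z \<partial>state_law I i y t)) \<le> m1 c * nrm_c c x * rho c ^ t"
        using fs(2) that unfolding mixing_def by blast
      also have "\<dots> \<le> (m1 c * uc2 c) * (norm x * rho c ^ t)"
        using mult_right_mono[OF mult_left_mono[OF cc(5)[of x] cc(11)], of "rho c ^ t"] cc(14) by (simp add: mult_ac)
      finally show ?thesis
        using n2[of "Gbar I i x - (\<integral>z. opG I i x z \<partial>state_law I i y t)" "m1 c * uc2 c" "norm x * rho c ^ t"] Alist(7) cc(14)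
        by (simp add: mult_ac)
    qed
    show "norm (agent_avg (nag I) (\<lambda>i. \<integral>z. opb I i z \<partial>state_law I i (ys i) t)) \<le> A * rho c ^ t"
      if "\<And>i. i < nag I \<Longrightarrow> ys i \<in> space (spc I i)" for ys t
      by (rule n2[where q = "m4 c"]) (use fs(2) that Alist cc in \<open>auto simp: mixing_def\<close>)
    show "norm (\<integral>z. opb I i z \<partial>state_law I i y t) \<le> A * rho c ^ t"
      if "\<xi> = 1" "i < nag I" "y \<in> space (spc I i)" for i y t
    proof (rule n2[where q = "m2 c"])
      have "nrm_c c (\<integral>z. opb I i z \<partial>state_law I i y t) \<le> m2 c * rho c ^ t + m3 c * eta c I i"
        using fs(2) that unfolding mixing_def by blast
      then show "nrm_c c (\<integral>z. opb I i z \<partial>state_law I i y t) \<le> m2 c * rho c ^ t"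
        by (simp add: eta0[OF that(1,2)])
    qed (use Alist cc in auto)
    show "\<xi> = 0 \<or> \<xi> = 1" by (fact \<xi>)
    show "is_norm (nrm_c c)" by (fact cc)
    show "nrm_c c x \<le> A * norm x" for x
      using cc(5)[of x] mult_right_mono[OF Alist(2) norm_ge_zero[of x]] by linarith
    show "norm x \<le> A * nrm_c c x" for x
      using n2[of x 1 "nrm_c c x"] Alist(3) noise_term(1) by simp
    show "1 \<le> A" "0 \<le> gam c" "gam c < 1" "0 \<le> rho c" using Alist cc by auto
  qed
qed

section \<open>The error bound in terms of the number of iterations\<close>

context fed_lag
begin

definition "P1 = 2 * A\<^sup>2 * (norm \<theta>0)\<^sup>2 + 8 * A\<^sup>2 / \<kappa> * R1"
definition "P2 = 6 * A\<^sup>2 / \<kappa>\<^sup>2 * (480 * A\<^sup>2 * G + 40 * G + R2)"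

lemma P_nonneg: "0 \<le> P1" "0 \<le> P2"
  using R_nonneg G_ge \<kappa> by (auto simp: P1_def P2_def intro!: add_nonneg_nonneg mult_nonneg_nonneg)

lemma theta_avg_error_shape:
  "expectation (\<lambda>\<omega>. (nrm (theta_avg I \<theta>0 \<alpha> K t \<omega>))\<^sup>2)
    \<le> P1 * (1 - \<alpha> * \<kappa>) ^ t * (1 + \<alpha> * real t) + P2 * (\<delta> / real N + \<delta>\<^sup>2 + Obd)"
proof -
  have "2 * (1 - \<alpha> * \<kappa>) ^ t * (A\<^sup>2 * (norm \<theta>0)\<^sup>2 + 4 * A\<^sup>2 / \<kappa> * R1 * (\<alpha> * real t))
      \<le> P1 * (1 - \<alpha> * \<kappa>) ^ t * (1 + \<alpha> * real t)"
  proof -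
    have "0 \<le> A\<^sup>2 * (norm \<theta>0)\<^sup>2 * (\<alpha> * real t)" "0 \<le> 4 * A\<^sup>2 / \<kappa> * R1" using \<alpha>_pos R_nonneg \<kappa> by auto
    moreover have "a + b * x \<le> (a + b) * (1 + x)" if "0 \<le> a * x" "0 \<le> b" for a b x :: real
      using that by (simp add: algebra_simps)
    ultimately have "A\<^sup>2 * (norm \<theta>0)\<^sup>2 + 4 * A\<^sup>2 / \<kappa> * R1 * (\<alpha> * real t)
        \<le> (A\<^sup>2 * (norm \<theta>0)\<^sup>2 + 4 * A\<^sup>2 / \<kappa> * R1) * (1 + \<alpha> * real t)"
      by blast
    then have "2 * (1 - \<alpha> * \<kappa>) ^ t * (A\<^sup>2 * (norm \<theta>0)\<^sup>2 + 4 * A\<^sup>2 / \<kappa> * R1 * (\<alpha> * real t))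
        \<le> 2 * (1 - \<alpha> * \<kappa>) ^ t * ((A\<^sup>2 * (norm \<theta>0)\<^sup>2 + 4 * A\<^sup>2 / \<kappa> * R1) * (1 + \<alpha> * real t))"
      using \<kappa> by (intro mult_left_mono) auto
    then show ?thesis by (simp add: P1_def algebra_simps)
  qed
  moreover have "Mbd + R2 * Obd \<le> (480 * A\<^sup>2 * G + 40 * G + R2) * (\<delta> / real N + \<delta>\<^sup>2 + Obd)"
  proof -
    define a b d where "a = 480 * A\<^sup>2 * G" and "b = \<delta> / real N" and "d = \<delta>\<^sup>2"
    have p: "0 \<le> a" "0 \<le> b" "0 \<le> d" "0 \<le> G" using G_ge \<delta>_pos by (auto simp: a_def b_def d_def)
    have "Mbd = a * d + 40 * G * b" by (simp add: Mbd_def a_def b_def d_def mult_ac)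
    moreover have "0 \<le> a * b" "0 \<le> a * Obd" "0 \<le> G * d" "0 \<le> G * Obd" "0 \<le> R2 * b" "0 \<le> R2 * d"
      using p R_nonneg Obd_nonneg by auto
    ultimately show ?thesis unfolding a_def[symmetric] b_def[symmetric] d_def[symmetric] by (simp add: algebra_simps)
  qed
  then have "6 * A\<^sup>2 / \<kappa>\<^sup>2 * (Mbd + R2 * Obd) \<le> 6 * A\<^sup>2 / \<kappa>\<^sup>2 * ((480 * A\<^sup>2 * G + 40 * G + R2) * (\<delta> / real N + \<delta>\<^sup>2 + Obd))"
    by (intro mult_left_mono) auto
  then have "6 * A\<^sup>2 / \<kappa>\<^sup>2 * (Mbd + R2 * Obd) \<le> P2 * (\<delta> / real N + \<delta>\<^sup>2 + Obd)"
    by (simp only: P2_def mult.assoc)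
  ultimately show ?thesis using theta_avg_error[of t] by linarith
qed

end

definition log_rate :: "'v constants \<Rightarrow> real" where
  "log_rate c = (if rho c = 0 then 0 else 1 / - ln (rho c))"

lemma valid_constants_phi2:
  fixes c :: "('v::euclidean_space) constants"
  assumes "valid_constants c"
  shows "0 < phi2 c" "phi2 c < 1" "phi2 c \<le> 1 - gam c" "0 \<le> log_rate c"
proof -
  have c: "is_norm (nrm_s c)" "0 < lcs c" "0 < ucs c" "\<And>x. lcs c * nrm_s c x \<le> nrm_c c x" "\<And>x. nrm_c c x \<le> ucs c * nrm_s c x"
    "0 < psi c" "0 < gam c" "0 \<le> rho c" "rho c < 1"
    using assms by (auto simp: valid_constants_def)
  show "0 < phi2 c" "phi2 c < 1" using assms by (auto simp: valid_constants_def)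
  obtain b :: 'v where "b \<in> Basis" using nonempty_Basis by blast
  then have "b \<noteq> 0" by auto
  then have "0 < nrm_s c b" using c(1) unfolding is_norm_def by (metis order_le_less)
  then have "lcs c \<le> ucs c" using order_trans[OF c(4,5), of b] by simp
  then have "(lcs c)\<^sup>2 \<le> (ucs c)\<^sup>2" using c(2) by (intro power_mono) auto
  then have "1 + psi c * (lcs c)\<^sup>2 \<le> 1 + psi c * (ucs c)\<^sup>2" using c(6) by simp
  moreover have "0 < 1 + psi c * (lcs c)\<^sup>2" using c(6) by (simp add: add_pos_nonneg)
  ultimately have "1 \<le> phi1 c" by (simp add: phi1_def)
  then have "1 \<le> sqrt (phi1 c)" by simp
  then have "gam c * 1 \<le> gam c * sqrt (phi1 c)" using c(7) by (intro mult_left_mono) auto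
  then show "phi2 c \<le> 1 - gam c" by (simp add: phi2_def)
  show "0 \<le> log_rate c" using c(8,9) ln_le_zero_iff[of "rho c"] by (auto simp: log_rate_def)
qed

lemma step_size_bounds:
  assumes "0 < phi2 c" "phi2 c < 1" "1 \<le> N" "N < T"
  shows "1 / real T \<le> step_size c N T" "0 < step_size c N T"
    "step_size c N T \<le> 16 / phi2 c * ((1 + ln (real T)) / real T)"
    "1 \<le> 1 + ln (real T)" "1 \<le> real T" "2 \<le> real T"
proof -
  have T: "2 \<le> real T" "0 < real N" "1 \<le> real N" "real N \<le> real T" using assms(3,4) by auto
  then show "1 \<le> real T" "1 \<le> 1 + ln (real T)" "2 \<le> real T" by auto
  have NT: "2 \<le> real N * real T" using mult_mono[of 1 "real N" 2 "real T"] T by simp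
  have "ln 2 \<le> ln (real N * real T)" using NT by simp
  moreover have "1 / 8 \<le> ln (2::real)" using ln2_ge_two_thirds by simp
  ultimately have l: "1 \<le> 8 * ln (real N * real T)" by simp
  have "1 / real T \<le> 8 * ln (real N * real T) / real T" using l T by (intro divide_right_mono) auto
  also have "\<dots> \<le> 8 * ln (real N * real T) / (real T * phi2 c)"
    using assms(1,2) T l NT by (intro divide_left_mono) (auto simp: mult_left_le)
  finally show 1: "1 / real T \<le> step_size c N T" by (simp add: step_size_def)
  have "0 < 1 / real T" using T by simp
  with 1 show "0 < step_size c N T" by linarith
  have "ln (real N * real T) \<le> 2 * ln (real T)"
    using T by (simp add: ln_mult)
  then have "8 * ln (real N * real T) / (real T * phi2 c) \<le> 16 * (1 + ln (real T)) / (real T * phi2 c)"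
    using assms(1) T by (intro divide_right_mono) auto
  then show "step_size c N T \<le> 16 / phi2 c * ((1 + ln (real T)) / real T)"
    by (simp add: step_size_def mult_ac)
qed

lemma log_rho_bounds:
  fixes c :: "('v::euclidean_space) constants"
  assumes "valid_constants c" and \<alpha>: "1 / real T \<le> \<alpha>" "\<alpha> \<le> 1" and T: "1 \<le> real T"
  shows "0 \<le> log (rho c) \<alpha>" "log (rho c) \<alpha> \<le> log_rate c * ln (real T)"
    "real (mix_time c \<alpha>) \<le> 2 * log_rate c * ln (real T) + 1" "rho c ^ Suc (mix_time c \<alpha>) \<le> \<alpha>"
proof -
  have r: "0 \<le> rho c" "rho c < 1" using assms(1) by (auto simp: valid_constants_def)
  have "0 < 1 / real T" using T by simp
  then have \<alpha>0: "0 < \<alpha>" using \<alpha>(1) by linarith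
  have ln\<alpha>: "ln \<alpha> \<le> 0" "- ln (real T) \<le> ln \<alpha>"
  proof -
    show "ln \<alpha> \<le> 0" using \<alpha> \<alpha>0 by simp
    have "ln (1 / real T) \<le> ln \<alpha>" using \<alpha>(1) \<alpha>0 T by (subst ln_le_cancel_iff) auto
    then show "- ln (real T) \<le> ln \<alpha>" using T by (simp add: ln_div)
  qed
  show 1: "0 \<le> log (rho c) \<alpha>"
  proof (cases "rho c = 0")
    case False
    then have "ln (rho c) < 0" using r by simp
    then show ?thesis using ln\<alpha>(1) by (simp add: log_def divide_nonpos_neg)
  qed (simp add: log_def)
  show 2: "log (rho c) \<alpha> \<le> log_rate c * ln (real T)"
  proof (cases "rho c = 0")
    case False
    then have "ln (rho c) < 0" using r by simp
    then show ?thesis using ln\<alpha>(2) False by (simp add: log_def log_rate_def field_simps)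
  qed (simp add: log_def log_rate_def)
  have "real (mix_time c \<alpha>) \<le> 2 * log (rho c) \<alpha> + 1"
    unfolding mix_time_def using 1 by linarith
  then show "real (mix_time c \<alpha>) \<le> 2 * log_rate c * ln (real T) + 1" using 2 by linarith
  show "rho c ^ Suc (mix_time c \<alpha>) \<le> \<alpha>"
  proof (cases "rho c = 0")
    case False
    then have r0: "0 < rho c" using r by simp
    have "log (rho c) \<alpha> \<le> real (Suc (mix_time c \<alpha>))"
      unfolding mix_time_def using 1 by linarith
    then have "rho c powr real (Suc (mix_time c \<alpha>)) \<le> rho c powr log (rho c) \<alpha>"
      using r0 r(2) by (intro powr_mono') auto
    also have "\<dots> = \<alpha>" using r0 r(2) \<alpha>0 by (simp add: powr_log_cancel)
    finally show ?thesis using r0 by (simp only: powr_realpow)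
  qed (use \<alpha>0 in simp)
qed

lemma admissible_bounds:
  fixes c :: "('v::euclidean_space) constants"
  assumes c: "valid_constants c" and adm: "admissible c N T K"
  defines "\<alpha> \<equiv> step_size c N T"
  shows "1 \<le> N" "1 \<le> K" "N < T" "\<alpha> \<le> 1 / 3" "\<alpha> * real K \<le> 1" "\<alpha> * phi2 c \<le> 1"
proof -
  show N: "1 \<le> N" "1 \<le> K" "N < T" using adm by (auto simp: admissible_def)
  note ph = valid_constants_phi2[OF c]
  note ss = step_size_bounds[OF ph(1,2) N(1,3), folded \<alpha>_def]
  have ok: "\<alpha> \<le> 1 / C1 c" "\<alpha>\<^sup>2 \<le> 1 / (phi2 c)\<^sup>2" "\<alpha>\<^sup>2 * (2 * (1 + tA1 c) * (real K - 1)\<^sup>2) \<le> ln (5 / 4)"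
    using adm by (auto simp: admissible_def step_size_ok_def \<alpha>_def)
  have "1 \<le> sqrt ((cA2 c)\<^sup>2 + 1)" by simp
  then have "1 / C1 c \<le> 1 / 3" unfolding C1_def by (intro divide_left_mono) (auto simp: add_nonneg_pos)
  with ok(1) show a3: "\<alpha> \<le> 1 / 3" by linarith
  have t: "0 \<le> tA1 c" unfolding tA1_def by simp
  have "2 * (\<alpha> * (real K - 1))\<^sup>2 = \<alpha>\<^sup>2 * (2 * 1 * (real K - 1)\<^sup>2)" by (simp add: power_mult_distrib)
  also have "\<dots> \<le> \<alpha>\<^sup>2 * (2 * (1 + tA1 c) * (real K - 1)\<^sup>2)" using t by (intro mult_left_mono mult_right_mono) auto
  also have "\<dots> \<le> 1 / 4" using ok(3) ln_add_one_self_le_self[of "1/4"] by simp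
  finally have "(\<alpha> * (real K - 1))\<^sup>2 \<le> (1 / 2)\<^sup>2" by (simp add: power2_eq_square)
  then have "\<alpha> * (real K - 1) \<le> 1 / 2" by (rule power2_le_imp_le) simp
  with a3 show "\<alpha> * real K \<le> 1" by (simp add: right_diff_distrib)
  have "(\<alpha> * phi2 c)\<^sup>2 \<le> 1\<^sup>2" using ok(2) ph(1) by (simp add: power_mult_distrib field_simps)
  then show "\<alpha> * phi2 c \<le> 1" by (rule power2_le_imp_le) simp
qed

lemma output_error_le_polylog:
  fixes c :: "('v::euclidean_space) constants" and \<theta>0 :: 'v
  assumes c: "valid_constants c"
  shows "\<exists>C>0. \<forall>(I :: ('v, 's, 'w) fed) T K That.
    fegsam c \<theta>0 I (step_size c (nag I) T) K T That \<longrightarrow> admissible c (nag I) T K \<longrightarrow>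
    heterogeneity c I = 0 \<and> real K = real T / real (nag I) \<or> real K = sqrt (real T) / real (nag I) \<longrightarrow>
    output_error c \<theta>0 I (step_size c (nag I) T) K That \<le> C * (1 + ln (real T)) ^ 4 / (real (nag I) * real T)"
proof -
  note ph = valid_constants_phi2[OF c]
  define A where "A = norm_bound c"
  define g where "g = gam c"
  have g: "g < 1" using c by (simp add: g_def valid_constants_def)
  define e1 where "e1 = 16 / phi2 c"
  define k0 where "k0 = 2 * log_rate c + 2"
  define d1 where "d1 = e1 * k0"
  have e1: "0 < e1" using ph by (simp add: e1_def)
  have k0: "0 < k0" using ph by (simp add: k0_def)
  have d1: "0 < d1" using e1 k0 by (simp add: d1_def)
  define P1 where "P1 = \<bar>fed_lag.P1 \<theta>0 A g\<bar>"
  define P2 where "P2 = \<bar>fed_lag.P2 \<theta>0 A g\<bar>"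
  define s0 where "s0 = (1 - g)\<^sup>2 / (9024 * A ^ 8 + 1)"
  have A8: "0 < 9024 * A ^ 8 + 1" by (simp add: add_nonneg_pos zero_le_even_power)
  have s0: "0 < s0" using g A8 by (simp add: s0_def)
  have "(\<lambda>T. d1 * ((1 + ln (real T))\<^sup>2 / real T)) \<longlonglongrightarrow> 0"
    by real_asymp
  then have "eventually (\<lambda>T. d1 * ((1 + ln (real T))\<^sup>2 / real T) < min s0 1) sequentially"
    using s0 by (intro order_tendstoD) auto
  then obtain T1 where T1: "\<And>T. T1 \<le> T \<Longrightarrow> d1 * ((1 + ln (real T))\<^sup>2 / real T) < min s0 1"
    unfolding eventually_sequentially by blast
  define CC where "CC = (A * ((1 + A) ^ T1 * (norm \<theta>0 + 1)))\<^sup>2"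
  define C where "C = P1 * (1 + e1) * 2 + P2 * (d1 + d1\<^sup>2 + (e1\<^sup>2 * d1 + 2 * e1\<^sup>2 + e1 * d1)) + CC * (real T1)\<^sup>2 + 1"
  have Cparts: "0 \<le> P1 * (1 + e1) * 2" "0 \<le> P2 * (d1 + d1\<^sup>2 + (e1\<^sup>2 * d1 + 2 * e1\<^sup>2 + e1 * d1))" "0 \<le> CC * (real T1)\<^sup>2"
    using e1 d1 by (auto simp: P1_def P2_def CC_def)
  show ?thesis
  proof (intro exI[of _ C] conjI allI impI)
    show "0 < C" using Cparts by (simp add: C_def)
  next
    fix I :: "('v, 's, 'w) fed" and T K That
    let ?N = "nag I"
    assume f: "fegsam c \<theta>0 I (step_size c ?N T) K T That" and adm: "admissible c ?N T K"
      and KT: "heterogeneity c I = 0 \<and> real K = real T / real ?N \<or> real K = sqrt (real T) / real ?N"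
    define \<alpha> where "\<alpha> = step_size c ?N T"
    define L where "L = 1 + ln (real T)"
    define m where "m = Suc (mix_time c \<alpha>)"
    define \<delta> where "\<delta> = \<alpha> * real m"
    define \<xi> :: real where "\<xi> = (if heterogeneity c I = 0 then 1 else 0)"
    define x where "x = c_fsam c \<alpha>"
    note ab = admissible_bounds[OF c adm, folded \<alpha>_def]
    note ss = step_size_bounds[OF ph(1,2) ab(1,3), folded \<alpha>_def e1_def L_def]
    have \<alpha>1: "\<alpha> \<le> 1" using ab(4) by simp
    note lr = log_rho_bounds[OF c ss(1) \<alpha>1 ss(5)]
    have L1: "1 \<le> L" by (rule ss(4))
    have N0: "1 \<le> real ?N" "0 < real ?N" "0 < real T" "real ?N \<le> real T" using ab ss by auto
    have NT: "0 < real ?N * real T" using N0 by simp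
    have L4: "1 \<le> L ^ 4" "L \<le> L ^ 4" "L\<^sup>2 \<le> L ^ 4" "L ^ 3 \<le> L ^ 4"
      using L1 power_increasing[of 1 4 L] power_increasing[of 2 4 L] power_increasing[of 3 4 L] one_le_power[of L 4] by auto
    have m: "real m \<le> k0 * L"
    proof -
      have "real m \<le> 2 * log_rate c * ln (real T) + 2" using lr(3) by (simp add: m_def)
      also have "\<dots> \<le> k0 * L" using ph(4) ss(5) by (simp add: k0_def L_def algebra_simps)
      finally show ?thesis .
    qed
    have \<delta>0: "0 \<le> \<delta>" using ss(2) by (simp add: \<delta>_def)
    have \<delta>: "\<delta> \<le> d1 * (L\<^sup>2 / real T)"
    proof -
      have "\<delta> \<le> (e1 * (L / real T)) * (k0 * L)"
        unfolding \<delta>_def using ss(2,3) m L1 e1 N0 by (intro mult_mono) auto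
      then show ?thesis by (simp add: d1_def power2_eq_square mult_ac)
    qed
    have \<alpha>T: "\<alpha> * real T \<le> e1 * L"
      using mult_right_mono[OF ss(3), of "real T"] N0 by simp
    interpret fr: fed_run I K \<alpha> \<theta>0 "nrm_c c" A g "rho c" \<xi>
      unfolding A_def g_def
      by (rule fed_run_fegsam[OF c f[folded \<alpha>_def] ab(1,2) ss(2)]) (use ab(4) in \<open>auto simp: \<xi>_def split: if_splits\<close>)
    have out: "output_time c I \<alpha> T That" using f by (simp add: fegsam_def \<alpha>_def)
    have x: "1 / 2 \<le> x" "0 < x" "x < 1" using ab(6) ss(2) ph(1) by (auto simp: x_def c_fsam_def)
    have T1': "1 \<le> T" using ab by simp
    have err: "output_error c \<theta>0 I \<alpha> K That \<le> a * x ^ (T - 1) + b"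
      if "\<And>t. t < T \<Longrightarrow> fr.expectation (\<lambda>\<omega>. (nrm_c c (theta_avg I \<theta>0 \<alpha> K t \<omega>))\<^sup>2) \<le> a * (x\<^sup>2) ^ t + b" for a b
      unfolding output_error_def x_def
      by (rule fr.output_error_le[OF out]) (use x T1' that in \<open>auto simp: x_def\<close>)
    have goal: "output_error c \<theta>0 I \<alpha> K That \<le> C * L ^ 4 / (real ?N * real T)"
    proof (cases "T1 \<le> T")
      case False
      have "output_error c \<theta>0 I \<alpha> K That \<le> 0 * x ^ (T - 1) + CC"
      proof (rule err)
        fix t assume "t < T"
        then have "(1 + A) ^ t \<le> (1 + A) ^ T1" using False fr.A1 by (intro power_increasing) auto
        then have "(A * ((1 + A) ^ t * (norm \<theta>0 + 1)))\<^sup>2 \<le> CC"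
          unfolding CC_def using fr.A1 by (intro power_mono mult_left_mono mult_right_mono) auto
        with fr.theta_avg_crude[of t] show "fr.expectation (\<lambda>\<omega>. (nrm_c c (theta_avg I \<theta>0 \<alpha> K t \<omega>))\<^sup>2) \<le> 0 * (x\<^sup>2) ^ t + CC"
          by simp
      qed
      also have "\<dots> \<le> CC * (real T1)\<^sup>2 * L ^ 4 / (real ?N * real T)"
      proof -
        have "real ?N * real T \<le> real T1 * real T1" using ab False by (intro mult_mono) auto
        then have "real ?N * real T \<le> (real T1)\<^sup>2 * L ^ 4"
          using L4(1) mult_left_mono[OF L4(1), of "(real T1)\<^sup>2"] by (simp add: power2_eq_square)
        then have "CC * (real ?N * real T) \<le> CC * ((real T1)\<^sup>2 * L ^ 4)" by (intro mult_left_mono) (simp_all add: CC_def)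
        then show ?thesis using NT by (simp add: field_simps)
      qed
      also have "\<dots> \<le> C * L ^ 4 / (real ?N * real T)"
        using Cparts NT L4(1) by (intro divide_right_mono mult_right_mono) (auto simp: C_def)
      finally show ?thesis .
    next
      case True
      have small: "\<delta> \<le> s0" "\<delta> \<le> 1" using T1[OF True] \<delta> by (auto simp: L_def)
      have "9024 * A ^ 8 * \<delta> \<le> (9024 * A ^ 8 + 1) * s0"
        using small(1) \<delta>0 s0 A8 by (intro mult_mono) (auto simp: zero_le_even_power)
      then have sm: "9024 * A ^ 8 * (\<alpha> * real m) \<le> (1 - g)\<^sup>2" using A8 by (simp add: s0_def \<delta>_def)
      interpret fl: fed_lag I K \<alpha> \<theta>0 "nrm_c c" A g "rho c" \<xi> m
        by unfold_locales (use lr(4) sm ab(5) in \<open>auto simp: m_def\<close>)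
      have P12: "P1 = fl.P1" "P2 = fl.P2" using fl.P_nonneg by (simp_all add: P1_def P2_def)
      have dd: "fl.\<delta> = \<delta>" by (simp add: fl.\<delta>_def \<delta>_def)
      define b where "b = \<delta> / real ?N + \<delta>\<^sup>2 + fl.Obd"
      have "output_error c \<theta>0 I \<alpha> K That \<le> (P1 * (1 + \<alpha> * real T)) * x ^ (T - 1) + P2 * b"
      proof (rule err)
        fix t assume "t < T"
        have k: "1 - \<alpha> * fl.\<kappa> \<le> x\<^sup>2"
        proof -
          have "\<alpha> * phi2 c \<le> \<alpha> * fl.\<kappa>" using ph(3) ss(2) unfolding fl.\<kappa>_def g_def[symmetric] by (intro mult_left_mono) auto
          moreover have "1 - p \<le> (1 - p / 2)\<^sup>2" for p :: real by (simp add: power2_eq_square algebra_simps)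
          from this[of "\<alpha> * phi2 c"] have "1 - \<alpha> * phi2 c \<le> x\<^sup>2" by (simp add: x_def c_fsam_def)
          ultimately show ?thesis by linarith
        qed
        have "P1 * (1 - \<alpha> * fl.\<kappa>) ^ t * (1 + \<alpha> * real t) \<le> P1 * (x\<^sup>2) ^ t * (1 + \<alpha> * real T)"
          using \<open>t < T\<close> k fl.\<kappa> ss(2) fl.P_nonneg unfolding P12
          by (intro mult_mono mult_left_mono power_mono add_left_mono) auto
        then show "fr.expectation (\<lambda>\<omega>. (nrm_c c (theta_avg I \<theta>0 \<alpha> K t \<omega>))\<^sup>2) \<le> P1 * (1 + \<alpha> * real T) * (x\<^sup>2) ^ t + P2 * b"
          using fl.theta_avg_error_shape[of t] unfolding dd b_def[symmetric] P12[symmetric] by (simp add: mult_ac)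
      qed
      also have "\<dots> \<le> P1 * (1 + e1) * 2 * L ^ 4 / (real ?N * real T)
          + P2 * (d1 + d1\<^sup>2 + (e1\<^sup>2 * d1 + 2 * e1\<^sup>2 + e1 * d1)) * L ^ 4 / (real ?N * real T)"
      proof (rule add_mono)
        have "x ^ T = x ^ (T - 1) * x" using T1' by (cases T) auto
        then have "x ^ (T - 1) * (1 / 2) \<le> x ^ T" using x by (simp add: mult_left_mono)
        also have "x ^ T \<le> exp (- (\<alpha> * phi2 c / 2)) ^ T"
          using x exp_ge_add_one_self[of "- (\<alpha> * phi2 c / 2)"] by (intro power_mono) (auto simp: x_def c_fsam_def)
        also have "\<dots> = exp (- (real T * (\<alpha> * phi2 c / 2)))" by (simp add: exp_of_nat_mult[symmetric])
        also have "real T * (\<alpha> * phi2 c / 2) = 4 * ln (real ?N * real T)"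
          using ph(1) N0 by (simp add: \<alpha>_def step_size_def)
        also have "exp (- (4 * ln (real ?N * real T))) \<le> exp (- ln (real ?N * real T))"
        proof -
          have "1 \<le> real ?N * real T" using mult_mono[of 1 "real ?N" 1 "real T"] N0 ss(5) by simp
          then show ?thesis by simp
        qed
        also have "\<dots> = 1 / (real ?N * real T)" using NT by (simp add: exp_minus inverse_eq_divide)
        finally have xT: "x ^ (T - 1) \<le> 2 / (real ?N * real T)" by simp
        have "e1 * L \<le> e1 * L ^ 4" using L4(2) e1 by (intro mult_left_mono) auto
        then have "1 + \<alpha> * real T \<le> 1 * L ^ 4 + e1 * L ^ 4" using \<alpha>T L4(1) by linarith
        then have "(P1 * (1 + \<alpha> * real T)) * x ^ (T - 1) \<le> (P1 * (1 * L ^ 4 + e1 * L ^ 4)) * (2 / (real ?N * real T))"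
          using xT x ss(2) e1 L1 by (intro mult_mono mult_left_mono) (auto simp: P1_def)
        also have "\<dots> = P1 * (1 + e1) * 2 * L ^ 4 / (real ?N * real T)"
          by (simp only: times_divide_eq_right) (simp add: algebra_simps)
        finally show "(P1 * (1 + \<alpha> * real T)) * x ^ (T - 1) \<le> P1 * (1 + e1) * 2 * L ^ 4 / (real ?N * real T)" .
      next
        define Q where "Q = L ^ 4 / (real ?N * real T)"
        have b1: "\<delta> / real ?N \<le> d1 * Q"
        proof -
          have "\<delta> / real ?N \<le> d1 * (L\<^sup>2 / real T) / real ?N" using \<delta> N0 by (intro divide_right_mono) auto
          also have "\<dots> = d1 * (L\<^sup>2 / (real ?N * real T))" by simp
          also have "\<dots> \<le> d1 * Q" unfolding Q_def using d1 L4 NT by (intro mult_left_mono divide_right_mono) auto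
          finally show ?thesis .
        qed
        have b2: "\<delta>\<^sup>2 \<le> d1\<^sup>2 * Q"
        proof -
          have "\<delta>\<^sup>2 \<le> (d1 * (L\<^sup>2 / real T))\<^sup>2" by (intro power_mono \<delta> \<delta>0)
          also have "\<dots> = d1\<^sup>2 * (L ^ 4 / (real T * real T))" by (simp add: power_mult_distrib power_divide power2_eq_square mult_ac power_numeral_reduce)
          also have "\<dots> \<le> d1\<^sup>2 * Q" unfolding Q_def using N0 L1 by (intro mult_left_mono divide_left_mono mult_right_mono) auto
          finally show ?thesis .
        qed
        have b3: "fl.Obd \<le> (e1\<^sup>2 * d1 + 2 * e1\<^sup>2 + e1 * d1) * Q"
        proof (cases "heterogeneity c I = 0 \<and> real K = real T / real ?N")
          case True
          have "\<xi> = 1" using True by (simp add: \<xi>_def)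
          then have "fl.B = 0" unfolding fl.B_def by simp
          have a: "\<alpha> * real K \<le> e1 * (L / real ?N)"
            using True divide_right_mono[OF \<alpha>T, of "real ?N"] N0 by simp
          have a0: "0 \<le> \<alpha> * real K" using ss(2) by simp
          have "(\<alpha> * real K)\<^sup>2 * \<delta> \<le> (e1 * (L / real ?N))\<^sup>2 * (d1 * (L\<^sup>2 / real T))"
            by (rule mult_mono[OF power_mono[OF a a0] \<delta>]) (use \<delta>0 in auto)
          also have "\<dots> = e1\<^sup>2 * d1 * (L ^ 4 / (real ?N * (real ?N * real T)))"
            by (simp add: power_mult_distrib power_divide power2_eq_square mult_ac power_numeral_reduce)
          also have "\<dots> \<le> e1\<^sup>2 * d1 * Q" unfolding Q_def
            using N0 NT e1 d1 L1 by (intro mult_left_mono divide_left_mono) (auto simp: mult_left_le mult_le_cancel_right1)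
          finally have 1: "(\<alpha> * real K)\<^sup>2 * \<delta> \<le> e1\<^sup>2 * d1 * Q" .
          have "\<alpha> * real K * \<delta> \<le> (e1 * (L / real ?N)) * (d1 * (L\<^sup>2 / real T))"
            by (rule mult_mono[OF a \<delta>]) (use \<delta>0 e1 L1 in auto)
          also have "\<dots> = e1 * d1 * (L ^ 3 / (real ?N * real T))" by (simp add: power2_eq_square mult_ac power_numeral_reduce)
          also have "\<dots> \<le> e1 * d1 * Q" unfolding Q_def using NT e1 d1 L4 by (intro mult_left_mono divide_right_mono) auto
          finally have 2: "\<alpha> * real K * \<delta> \<le> e1 * d1 * Q" .
          have "0 \<le> 2 * e1\<^sup>2 * Q" using NT L1 by (simp add: Q_def)
          then show ?thesis using 1 2 unfolding fl.Obd_def dd \<open>fl.B = 0\<close> distrib_right[of _ _ Q] add_0_right by linarith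
        next
          case False
          then have K: "real K = sqrt (real T) / real ?N" using KT by blast
          have sq: "sqrt (real T) * sqrt (real T) = real T" "1 \<le> sqrt (real T)" using ss(5) by auto
          have a: "\<alpha> * real K \<le> e1 * (L / (real ?N * sqrt (real T)))"
          proof -
            have "\<alpha> * real K \<le> e1 * (L / real T) * (sqrt (real T) / real ?N)"
              unfolding K using ss(3) N0 by (intro mult_right_mono) auto
            also have "\<dots> = e1 * (L / (real ?N * sqrt (real T)))"
              using sq N0 by (simp add: field_simps) 
            finally show ?thesis .
          qed
          have a0: "0 \<le> \<alpha> * real K" using ss(2) by simp
          have "(\<alpha> * real K)\<^sup>2 * (\<delta> + fl.B) \<le> (e1 * (L / (real ?N * sqrt (real T))))\<^sup>2 * 2"
            by (rule mult_mono[OF power_mono[OF a a0]]) (use small(2) \<delta>0 fl.B in auto)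
          also have "\<dots> = 2 * e1\<^sup>2 * (L\<^sup>2 / (real ?N * (real ?N * real T)))"
            using N0 by (simp add: power_mult_distrib power_divide power2_eq_square[of "real ?N"] mult_ac)
          also have "\<dots> \<le> 2 * e1\<^sup>2 * Q" unfolding Q_def
            using N0 NT e1 L1 L4 by (intro mult_left_mono frac_le) (auto simp: mult_le_cancel_right1)
          finally have 1: "(\<alpha> * real K)\<^sup>2 * (\<delta> + fl.B) \<le> 2 * e1\<^sup>2 * Q" .
          have "\<alpha> * real K * \<delta> \<le> (e1 * (L / (real ?N * sqrt (real T)))) * (d1 * (L\<^sup>2 / real T))"
            by (rule mult_mono[OF a \<delta>]) (use \<delta>0 e1 L1 N0 in auto)
          also have "\<dots> = e1 * d1 * (L ^ 3 / (sqrt (real T) * (real ?N * real T)))" by (simp add: power2_eq_square mult_ac power_numeral_reduce)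
          also have "\<dots> \<le> e1 * d1 * Q"
          proof -
            have "real ?N * real T \<le> sqrt (real T) * (real ?N * real T)"
              using mult_right_mono[OF sq(2), of "real ?N * real T"] NT by simp
            then have "L ^ 3 / (sqrt (real T) * (real ?N * real T)) \<le> Q"
              unfolding Q_def using L4(4) L1 NT by (intro frac_le) auto
            then show ?thesis using e1 d1 by (intro mult_left_mono) auto
          qed
          finally have 2: "\<alpha> * real K * \<delta> \<le> e1 * d1 * Q" .
          have "0 \<le> e1\<^sup>2 * d1 * Q" using NT L1 d1 by (simp add: Q_def)
          then show ?thesis using 1 2 unfolding fl.Obd_def dd distrib_right[of _ _ Q] by linarith
        qed
        have "b \<le> (d1 + d1\<^sup>2 + (e1\<^sup>2 * d1 + 2 * e1\<^sup>2 + e1 * d1)) * Q"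
          unfolding b_def distrib_right[of _ _ Q] using b1 b2 b3 unfolding distrib_right[of _ _ Q] by linarith
        then have "P2 * b \<le> P2 * ((d1 + d1\<^sup>2 + (e1\<^sup>2 * d1 + 2 * e1\<^sup>2 + e1 * d1)) * Q)"
          by (intro mult_left_mono) (simp_all add: P2_def)
        then show "P2 * b \<le> P2 * (d1 + d1\<^sup>2 + (e1\<^sup>2 * d1 + 2 * e1\<^sup>2 + e1 * d1)) * L ^ 4 / (real ?N * real T)"
          by (simp add: Q_def mult.assoc)
      qed
      also have "\<dots> = (P1 * (1 + e1) * 2 + P2 * (d1 + d1\<^sup>2 + (e1\<^sup>2 * d1 + 2 * e1\<^sup>2 + e1 * d1))) * L ^ 4 / (real ?N * real T)"
        by (simp only: distrib_right add_divide_distrib)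
      also have "\<dots> \<le> C * L ^ 4 / (real ?N * real T)"
        using Cparts NT L4(1) by (intro divide_right_mono mult_right_mono) (auto simp: C_def)
      finally show ?thesis .
    qed
    then show "output_error c \<theta>0 I (step_size c ?N T) K That \<le> C * (1 + ln (real T)) ^ 4 / (real ?N * real T)"
      by (simp add: \<alpha>_def L_def)
  qed
qed

section \<open>Admissible schedules\<close>

lemma ex_small_scale:
  fixes cs :: "(real \<times> real) list"
  assumes "\<And>M b. (M, b) \<in> set cs \<Longrightarrow> 0 < b"
  shows "\<exists>d>0. \<forall>(M, b)\<in>set cs. M * d \<le> b"
  using assms
proof (induction cs)
  case (Cons p cs)
  obtain M b where p: "p = (M, b)" by (cases p)
  have b: "0 < b" using Cons.prems p by auto
  obtain d where d: "0 < d" "\<And>M b. (M, b) \<in> set cs \<Longrightarrow> M * d \<le> b" using Cons by fastforce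
  define d' where "d' = min d (b / (\<bar>M\<bar> + 1))"
  have d'0: "0 < d'" using d b by (simp add: d'_def add_nonneg_pos)
  have "M * d' \<le> \<bar>M\<bar> * (b / (\<bar>M\<bar> + 1))" using d'0 by (intro mult_mono) (auto simp: d'_def)
  also have "\<dots> \<le> b" using b by (simp add: field_simps)
  finally have "M * d' \<le> b" .
  moreover have "M' * d' \<le> b'" if "(M', b') \<in> set cs" for M' b'
  proof (cases "0 \<le> M'")
    case True
    have "M' * d' \<le> M' * d" using True by (intro mult_left_mono) (auto simp: d'_def)
    then show ?thesis using d(2)[OF that] by linarith
  next
    case False
    have "M' * d' \<le> 0" using False d'0 by (simp add: mult_nonpos_nonneg)
    then show ?thesis using Cons.prems[of M' b'] that by auto
  qed
  ultimately show ?case using d'0 p by (intro exI[of _ d']) auto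
qed (auto intro: exI[of _ 1])

lemma continuous_unit_bound:
  fixes f :: "real \<Rightarrow> real"
  assumes "continuous_on {0..1} f"
  obtains Q where "0 \<le> Q" "\<And>x. 0 \<le> x \<Longrightarrow> x \<le> 1 \<Longrightarrow> \<bar>f x\<bar> \<le> Q"
proof -
  have "bounded (f ` {0..1})" by (intro compact_imp_bounded compact_continuous_image assms compact_Icc)
  then obtain Q where Q: "\<forall>y\<in>f ` {0..1}. norm y \<le> Q" unfolding bounded_iff by blast
  have "\<bar>f x\<bar> \<le> max Q 0" if "0 \<le> x" "x \<le> 1" for x using Q that by (force simp: le_max_iff_disj)
  then show ?thesis using that[of "max Q 0"] by simp
qed

lemma continuous_C4: "continuous_on S (C4 c)"
proof -
  have "\<exists>k0 k1 k2 k3 k4 k5 k6. \<forall>\<alpha>. C4 c \<alpha> = k0 * (k1 + \<alpha> * k2 * k3 + \<alpha> * k4 * k5 + k6 * \<alpha>\<^sup>2)"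
    unfolding C4_def by (rule exI)+ (rule allI, rule refl)
  then obtain k0 k1 k2 k3 k4 k5 k6 where "\<And>\<alpha>. C4 c \<alpha> = k0 * (k1 + \<alpha> * k2 * k3 + \<alpha> * k4 * k5 + k6 * \<alpha>\<^sup>2)"
    by blast
  then have "C4 c = (\<lambda>\<alpha>. k0 * (k1 + \<alpha> * k2 * k3 + \<alpha> * k4 * k5 + k6 * \<alpha>\<^sup>2))" by (rule ext)
  then show ?thesis by (simp only:) (intro continuous_intros)
qed

lemma continuous_C5: "continuous_on S (C5 c)"
proof -
  have "\<exists>k0 k1 k2. \<forall>\<alpha>. C5 c \<alpha> = k0 * (k1 + k2 * \<alpha>\<^sup>2 / 2)"
    unfolding C5_def by (rule exI)+ (rule allI, rule refl)
  then obtain k0 k1 k2 where "\<And>\<alpha>. C5 c \<alpha> = k0 * (k1 + k2 * \<alpha>\<^sup>2 / 2)" by blast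
  then have "C5 c = (\<lambda>\<alpha>. k0 * (k1 + k2 * \<alpha>\<^sup>2 / 2))" by (rule ext)
  then show ?thesis by (simp only:) (intro continuous_intros, simp)
qed

lemma continuous_C6: "continuous_on S (C6 c)"
proof -
  have "\<exists>k0 k1 k2. \<forall>\<alpha>. C6 c \<alpha> = k0 * (k1 + k2 * \<alpha>)"
    unfolding C6_def by (rule exI)+ (rule allI, rule refl)
  then obtain k0 k1 k2 where "\<And>\<alpha>. C6 c \<alpha> = k0 * (k1 + k2 * \<alpha>)" by blast
  then have "C6 c = (\<lambda>\<alpha>. k0 * (k1 + k2 * \<alpha>))" by (rule ext)
  then show ?thesis by (simp only:) (intro continuous_intros)
qed

lemma continuous_vden: "continuous_on S (vden c)"
  unfolding vden_def[abs_def] C17_def by (intro continuous_intros continuous_C4 continuous_C5 continuous_C6)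

lemma admissible_if_small:
  fixes c :: "('v::euclidean_space) constants"
  assumes c: "valid_constants c"
  obtains d where "0 < d"
    "\<And>N T K. 1 \<le> N \<Longrightarrow> N < T \<Longrightarrow> 1 \<le> K \<Longrightarrow> step_size c N T * (1 + ln (real T))\<^sup>2 \<le> d \<Longrightarrow>
       (step_size c N T * real K)\<^sup>2 * (1 + ln (real T)) ^ 3 \<le> d \<Longrightarrow> admissible c N T K"
proof -
  note ph = valid_constants_phi2[OF c]
  define k where "k = 2 * log_rate c + 2"
  have k: "1 \<le> k" using ph by (simp add: k_def)
  define p15 where "p15 = 6 * m1 c * smL c * (ucm c)\<^sup>2 / ((lcs c)\<^sup>2 * psi c)
      + 6 * smL c * (cA2 c + 1)\<^sup>2 * (ucm c)\<^sup>2 / (2 * psi c * (lcs c)\<^sup>2)"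
  define c15 where "c15 \<alpha> = p15 + 144 * ((cA2 c)\<^sup>2 + 1) * C4 c \<alpha> * (ucm c)\<^sup>2" for \<alpha>
  have c15: "continuous_on {0..1} c15" unfolding c15_def[abs_def] by (intro continuous_intros continuous_C4)
  obtain Q where Q: "0 \<le> Q" "\<And>\<alpha>. 0 \<le> \<alpha> \<Longrightarrow> \<alpha> \<le> 1 \<Longrightarrow> \<bar>c15 \<alpha>\<bar> \<le> Q"
    using continuous_unit_bound[OF c15] by blast
  obtain W where W: "0 \<le> W" "\<And>\<alpha>. 0 \<le> \<alpha> \<Longrightarrow> \<alpha> \<le> 1 \<Longrightarrow> \<bar>vden c \<alpha>\<bar> \<le> W"
    using continuous_unit_bound[OF continuous_vden[of _ c]] by blast
  define a where "a = (cA2 c)\<^sup>2 + 1"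
  have a: "1 \<le> a" "0 < sqrt a" by (simp_all add: a_def add_nonneg_pos)
  have A2: "0 \<le> cA2 c" using c by (simp add: valid_constants_def)
  have C1: "0 < C1 c" using a by (simp add: C1_def a_def)
  then have C2: "0 < C2 c" by (simp add: C2_def)
  define E where "E = exp (- phi2 c * sqrt (ln (5 / 4) / (2 * (1 + tA1 c))))"
  have t1: "0 \<le> tA1 c" unfolding tA1_def by simp
  have "\<exists>d>0. \<forall>(M, b)\<in>set [(1, 1), (360 * k * a, 1), (2 * Q * k\<^sup>2, phi2 c), (2 * (1 + tA1 c), ln (5 / 4)),
      (2 * W * k, phi2 c), (4 * W * k ^ 3 * exp k, phi2 c * E), (k, 1 / (24 * sqrt a)), (k, 1 / (8 * (cA2 c + 1))),
      (1, 1 / C1 c), (8 * k * C2 c, 1), (40 * k * (C1 c)\<^sup>2, 1), (8 * k, 1)]. M * d \<le> b"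
    by (rule ex_small_scale) (use ph a A2 C1 C2 in \<open>auto simp: E_def\<close>)
  then obtain d where d: "0 < d" "1 * d \<le> 1" "360 * k * a * d \<le> 1" "2 * Q * k\<^sup>2 * d \<le> phi2 c" "2 * (1 + tA1 c) * d \<le> ln (5 / 4)"
      "2 * W * k * d \<le> phi2 c" "4 * W * k ^ 3 * exp k * d \<le> phi2 c * E" "k * d \<le> 1 / (24 * sqrt a)" "k * d \<le> 1 / (8 * (cA2 c + 1))"
      "1 * d \<le> 1 / C1 c" "8 * k * C2 c * d \<le> 1" "40 * k * (C1 c)\<^sup>2 * d \<le> 1" "8 * k * d \<le> 1"
    by auto
  show ?thesis
  proof (rule that[OF d(1)])
    fix N T K :: nat
    assume N: "1 \<le> N" "N < T" "1 \<le> K"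
    define \<alpha> where "\<alpha> = step_size c N T"
    define L where "L = 1 + ln (real T)"
    define lr where "lr = log (rho c) \<alpha>"
    define \<tau> where "\<tau> = mix_time c \<alpha>"
    assume "step_size c N T * (1 + ln (real T))\<^sup>2 \<le> d" "(step_size c N T * real K)\<^sup>2 * (1 + ln (real T)) ^ 3 \<le> d"
    then have s: "\<alpha> * L\<^sup>2 \<le> d" "(\<alpha> * real K)\<^sup>2 * L ^ 3 \<le> d" by (simp_all add: \<alpha>_def L_def)
    note ss = step_size_bounds[OF ph(1,2) N(1,2), folded \<alpha>_def L_def]
    have L: "1 \<le> L" by (rule ss(4))
    have \<alpha>0: "0 < \<alpha>" by (rule ss(2))
    have LL: "L \<le> L\<^sup>2" "1 \<le> L\<^sup>2" "L \<le> L ^ 3" "1 \<le> L ^ 3"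
      using L power_increasing[of 1 2 L] power_increasing[of 1 3 L] by auto
    have \<alpha>L: "\<alpha> * L \<le> d" "\<alpha> \<le> d"
    proof -
      have "\<alpha> * L \<le> \<alpha> * L\<^sup>2" "\<alpha> * 1 \<le> \<alpha> * L\<^sup>2" using LL \<alpha>0 by (intro mult_left_mono; simp)+
      with s(1) show "\<alpha> * L \<le> d" "\<alpha> \<le> d" by linarith+
    qed
    have aK: "(\<alpha> * real K)\<^sup>2 * L \<le> d" "(\<alpha> * real K)\<^sup>2 \<le> d"
    proof -
      have "(\<alpha> * real K)\<^sup>2 * L \<le> (\<alpha> * real K)\<^sup>2 * L ^ 3" "(\<alpha> * real K)\<^sup>2 * 1 \<le> (\<alpha> * real K)\<^sup>2 * L ^ 3"
        using LL by (intro mult_left_mono; simp)+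
      with s(2) show "(\<alpha> * real K)\<^sup>2 * L \<le> d" "(\<alpha> * real K)\<^sup>2 \<le> d" by linarith+
    qed
    have \<alpha>1: "\<alpha> \<le> 1" using \<alpha>L(2) d(2) by simp
    note lrb = log_rho_bounds[OF c ss(1) \<alpha>1 ss(5), folded lr_def \<tau>_def]
    have lT: "ln (real T) = L - 1" by (simp add: L_def)
    have kL: "2 * log_rate c * (L - 1) + 1 \<le> k * L"
      using ph(4) L by (simp add: k_def algebra_simps)
    have \<tau>: "real \<tau> \<le> k * L" using lrb(3) kL unfolding lT by linarith
    have lr0: "0 \<le> lr" by (rule lrb(1))
    have lr2: "2 * lr + 1 \<le> k * L" using lrb(2) kL unfolding lT by linarith
    then have lr1: "lr + 1 \<le> k * L" using lr0 by linarith
    have \<alpha>\<tau>: "\<alpha> * real \<tau> \<le> k * d"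
    proof -
      have "\<alpha> * real \<tau> \<le> \<alpha> * (k * L)" using \<tau> \<alpha>0 by (intro mult_left_mono) auto
      also have "\<dots> = k * (\<alpha> * L)" by simp
      also have "\<dots> \<le> k * d" using \<alpha>L k by (intro mult_left_mono) auto
      finally show ?thesis .
    qed
    have scaled: "\<alpha> * (p * real \<tau> * q) \<le> 1" if "p * k * q * d \<le> 1" "0 \<le> p" "0 \<le> q" for p q
    proof -
      have "\<alpha> * (p * real \<tau> * q) = p * q * (\<alpha> * real \<tau>)" by simp
      also have "\<dots> \<le> p * q * (k * d)" using \<alpha>\<tau> that by (intro mult_left_mono) auto
      finally show ?thesis using that(1) by (simp add: mult_ac)
    qed
    have c2: "\<alpha> * (2 * C15 c \<alpha> \<tau>) \<le> phi2 c"
    proof -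
      have "C15 c \<alpha> \<tau> = c15 \<alpha> * (real \<tau>)\<^sup>2" by (simp add: C15_def c15_def p15_def)
      also have "\<dots> \<le> Q * (k * L)\<^sup>2"
        using Q(2)[of \<alpha>] \<alpha>0 \<alpha>1 \<tau> Q(1) by (intro mult_mono power_mono) auto
      finally have "\<alpha> * (2 * C15 c \<alpha> \<tau>) \<le> \<alpha> * (2 * (Q * (k * L)\<^sup>2))" using \<alpha>0 by (intro mult_left_mono) auto
      also have "\<dots> = 2 * Q * k\<^sup>2 * (\<alpha> * L\<^sup>2)" by (simp add: power_mult_distrib)
      also have "\<dots> \<le> 2 * Q * k\<^sup>2 * d" using s(1) Q(1) by (intro mult_left_mono) auto
      finally show ?thesis using d by linarith
    qed
    have c3: "\<alpha>\<^sup>2 \<le> 1 / (phi2 c)\<^sup>2"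
    proof -
      have "\<alpha>\<^sup>2 \<le> 1" using \<alpha>0 \<alpha>1 by (simp add: power_le_one)
      also have "1 \<le> 1 / (phi2 c)\<^sup>2" using ph by (simp add: power_le_one)
      finally show ?thesis .
    qed
    have c4: "\<alpha>\<^sup>2 * (2 * (1 + tA1 c) * (real K - 1)\<^sup>2) \<le> ln (5 / 4)"
    proof -
      have "\<alpha>\<^sup>2 * (2 * (1 + tA1 c) * (real K - 1)\<^sup>2) \<le> \<alpha>\<^sup>2 * (2 * (1 + tA1 c) * (real K)\<^sup>2)"
        using t1 N(3) by (intro mult_left_mono power_mono) auto
      also have "\<dots> = 2 * (1 + tA1 c) * (\<alpha> * real K)\<^sup>2" by (simp add: power_mult_distrib)
      also have "\<dots> \<le> 2 * (1 + tA1 c) * d" using aK t1 by (intro mult_left_mono) auto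
      finally show ?thesis using d by linarith
    qed
    have Wv: "vden c \<alpha> \<le> W" using W(2)[of \<alpha>] \<alpha>0 \<alpha>1 by auto
    have c5: "\<alpha>\<^sup>2 * (lr + 1) * (2 * (real K)\<^sup>2 * vden c \<alpha>) \<le> phi2 c"
    proof -
      have "\<alpha>\<^sup>2 * (lr + 1) * (2 * (real K)\<^sup>2 * vden c \<alpha>) \<le> \<alpha>\<^sup>2 * (lr + 1) * (2 * (real K)\<^sup>2 * W)"
        using Wv lr0 by (intro mult_left_mono) auto
      also have "\<dots> \<le> \<alpha>\<^sup>2 * (k * L) * (2 * (real K)\<^sup>2 * W)"
        using lr1 W(1) by (intro mult_right_mono mult_left_mono) auto
      also have "\<dots> = 2 * W * k * ((\<alpha> * real K)\<^sup>2 * L)" by (simp add: power_mult_distrib)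
      also have "\<dots> \<le> 2 * W * k * d" using aK W(1) k by (intro mult_left_mono) auto
      finally show ?thesis using d by linarith
    qed
    have c6: "\<alpha>\<^sup>2 * (lr + 1) ^ 3 * exp (\<alpha> * phi2 c * (2 * lr + 1)) * (4 * real K * vden c \<alpha>) \<le> phi2 c * E"
    proof -
      have "\<alpha> * phi2 c * (2 * lr + 1) \<le> \<alpha> * 1 * (k * L)"
        using ph lr2 lr0 \<alpha>0 k L by (intro mult_mono) auto
      also have "\<dots> = k * (\<alpha> * L)" by simp
      also have "\<dots> \<le> k * 1" using \<alpha>L(1) d(2) k by (intro mult_left_mono) auto
      finally have ex: "exp (\<alpha> * phi2 c * (2 * lr + 1)) \<le> exp k" by simp
      have K2: "real K \<le> (real K)\<^sup>2" using N(3) by (simp add: power2_eq_square)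
      have "\<alpha>\<^sup>2 * (lr + 1) ^ 3 * exp (\<alpha> * phi2 c * (2 * lr + 1)) * (4 * real K * vden c \<alpha>)
          \<le> \<alpha>\<^sup>2 * (lr + 1) ^ 3 * exp (\<alpha> * phi2 c * (2 * lr + 1)) * (4 * real K * W)"
        using Wv lr0 by (intro mult_left_mono) auto
      also have "\<dots> \<le> \<alpha>\<^sup>2 * (k * L) ^ 3 * exp k * (4 * (real K)\<^sup>2 * W)"
        using lr1 lr0 ex K2 W(1) k L \<alpha>0 by (intro mult_mono power_mono mult_nonneg_nonneg) auto
      also have "\<dots> = 4 * W * k ^ 3 * exp k * ((\<alpha> * real K)\<^sup>2 * L ^ 3)" by (simp add: power_mult_distrib)
      also have "\<dots> \<le> 4 * W * k ^ 3 * exp k * d" using s(2) W(1) k by (intro mult_left_mono) auto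
      finally show ?thesis using d by linarith
    qed
    have "step_size_ok c \<alpha> \<tau> K"
      unfolding step_size_ok_def lr_def[symmetric] E_def[symmetric] a_def[symmetric]
    proof (intro conjI)
      show "\<alpha> * (360 * real \<tau> * a) \<le> 1" using d(3) a by (intro scaled) auto
      show "\<alpha> * (8 * real \<tau> * C2 c) \<le> 1" using d C2 by (intro scaled) auto
      show "\<alpha> * (40 * real \<tau> * (C1 c)\<^sup>2) \<le> 1" using d by (intro scaled) auto
      show "\<alpha> * real \<tau> \<le> 1 / (24 * sqrt a)" "\<alpha> * real \<tau> \<le> 1 / (8 * (cA2 c + 1))" using \<alpha>\<tau> d by linarith+
      show "\<alpha> \<le> 1 / C1 c" using \<alpha>L d by linarith
    qed (fact c2 c3 c4 c5 c6)+
    moreover have "4 * \<tau> < T"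
    proof -
      have "L\<^sup>2 / real T \<le> \<alpha> * L\<^sup>2" using mult_right_mono[OF ss(1), of "L\<^sup>2"] by simp
      then have "L\<^sup>2 / real T \<le> d" using s(1) by linarith
      then have "L\<^sup>2 \<le> d * real T" using ss(5) by (simp add: pos_divide_le_eq)
      then have "L \<le> d * real T" using LL by linarith
      then have "4 * k * L \<le> 4 * k * (d * real T)" using k by (intro mult_left_mono) auto
      also have "\<dots> = (8 * k * d) * (real T / 2)" by simp
      also have "\<dots> \<le> 1 * (real T / 2)" using d by (intro mult_right_mono) auto
      also have "\<dots> < real T" using ss(5) by simp
      finally have "4 * real \<tau> < real T" using \<tau> by linarith
      then show ?thesis by linarith
    qed
    ultimately show "admissible c N T K" using N by (simp add: admissible_def \<alpha>_def \<tau>_def)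
  qed
qed

lemma polylog_inverse:
  fixes C :: real
  obtains D where "2 \<le> D"
    "\<And>x T. 0 < x \<Longrightarrow> 1 \<le> T \<Longrightarrow> D * x * (1 + ln (1 + x)) ^ 4 \<le> T \<Longrightarrow> C * (1 + ln T) ^ 4 * x \<le> T"
proof -
  define C' where "C' = \<bar>C\<bar>"
  have "eventually (\<lambda>s::real. 625 * C' * (1 + ln (1 + s)) ^ 4 \<le> s) at_top"
    by real_asymp
  then obtain D where D: "\<And>s. D \<le> s \<Longrightarrow> 625 * C' * (1 + ln (1 + s)) ^ 4 \<le> s"
    unfolding eventually_at_top_linorder by blast
  show ?thesis
  proof (rule that[of "max D 2"])
    fix x T :: real
    assume x: "0 < x" and T: "1 \<le> T" and le: "max D 2 * x * (1 + ln (1 + x)) ^ 4 \<le> T"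
    define l where "l = 1 + ln (1 + x)"
    have l: "1 \<le> l" using x by (simp add: l_def)
    define z where "z = x * l ^ 4"
    define s where "s = T / z"
    have xl: "0 < z" using x l by (simp add: z_def)
    have sT: "T = s * z" using xl by (simp add: s_def)
    have "max D 2 * z \<le> T" using le by (simp add: z_def l_def mult.assoc)
    then have sD: "max D 2 \<le> s" using xl by (simp only: s_def pos_le_divide_eq[OF xl])
    then have s: "D \<le> s" "2 \<le> s" by auto
    define u where "u = 1 + ln (1 + s)"
    have u: "1 \<le> u" using s by (simp add: u_def)
    have "T \<le> (1 + s) * ((1 + x) * l ^ 4)" unfolding sT z_def using s x l by (intro mult_mono) auto
    then have "ln T \<le> ln ((1 + s) * ((1 + x) * l ^ 4))" using T by (subst ln_le_cancel_iff) auto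
    also have "\<dots> = ln (1 + s) + (ln (1 + x) + 4 * ln l)" using s x l by (simp add: ln_mult ln_realpow)
    also have "\<dots> \<le> (u - 1) + ((l - 1) + 4 * (l - 1))"
      using ln_le_minus_one[of l] l by (simp add: u_def l_def)
    finally have "1 + ln T \<le> u + 5 * (l - 1)" by simp
    also have "\<dots> \<le> 5 * (l * u)"
      using mult_mono[of 1 l 0 "u - 1"] mult_nonneg_nonneg[of "l - 1" "u - 1"] l u by (simp add: algebra_simps)
    finally have "(1 + ln T) ^ 4 \<le> (5 * (l * u)) ^ 4" using T by (intro power_mono) auto
    also have "\<dots> = 625 * (l ^ 4 * u ^ 4)" by (simp add: power_mult_distrib)
    finally have "C * (1 + ln T) ^ 4 * x \<le> C' * (625 * (l ^ 4 * u ^ 4)) * x"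
      using x by (intro mult_right_mono mult_mono) (auto simp: C'_def)
    also have "\<dots> = (625 * C' * u ^ 4) * z" by (simp add: z_def)
    also have "\<dots> \<le> s * z" using D[OF s(1)] xl by (intro mult_right_mono) (auto simp: u_def)
    finally show "C * (1 + ln T) ^ 4 * x \<le> T" by (simp add: sT)
  qed simp
qed

lemma comm_rounds_mult:
  assumes "1 \<le> K"
  shows "comm_rounds (K * n) K = n"
proof -
  have "bij_betw (\<lambda>j. K * Suc j - 1) {..<n} {t. t < K * n \<and> K dvd Suc t}"
  proof (rule bij_betwI[where g = "\<lambda>t. Suc t div K - 1"])
    show "(\<lambda>j. K * Suc j - 1) \<in> {..<n} \<rightarrow> {t. t < K * n \<and> K dvd Suc t}"
    proof
      fix j assume "j \<in> {..<n}"
      then have "K * Suc j \<le> K * n" by (intro mult_le_mono) auto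
      moreover have "1 \<le> K * Suc j" using assms by simp
      ultimately have "K * Suc j - 1 < K * n" "Suc (K * Suc j - 1) = K * Suc j" by linarith+
      then show "K * Suc j - 1 \<in> {t. t < K * n \<and> K dvd Suc t}" by simp
    qed
    show "(\<lambda>t. Suc t div K - 1) \<in> {t. t < K * n \<and> K dvd Suc t} \<rightarrow> {..<n}"
    proof
      fix t assume t: "t \<in> {t. t < K * n \<and> K dvd Suc t}"
      then obtain q where q: "Suc t = K * q" by auto
      then have "0 < q" by (cases q) auto
      moreover have "Suc t \<le> K * n" using t by auto
      then have "K * q \<le> K * n" unfolding q .
      then have "q \<le> n" using assms by simp
      ultimately show "Suc t div K - 1 \<in> {..<n}" using q assms by auto
    qed
    show "Suc (K * Suc j - 1) div K - 1 = j" if "j \<in> {..<n}" for j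
    proof -
      have "Suc (K * Suc j - 1) = K * Suc j" using assms by (simp add: Suc_diff_1)
      then show ?thesis using assms by (simp del: mult_Suc_right)
    qed
    show "K * Suc (Suc t div K - 1) - 1 = t" if "t \<in> {t. t < K * n \<and> K dvd Suc t}" for t
    proof -
      from that obtain q where q: "Suc t = K * q" by auto
      then have "0 < q" by (cases q) auto
      then show ?thesis using q assms by auto
    qed
  qed
  from bij_betw_same_card[OF this] show ?thesis by (simp add: comm_rounds_def)
qed

lemma nat_ceiling_bounds:
  fixes x :: real
  assumes "0 \<le> x"
  shows "x \<le> real (nat \<lceil>x\<rceil>)" "real (nat \<lceil>x\<rceil>) < x + 1"
proof -
  have "real (nat \<lceil>x\<rceil>) = real_of_int \<lceil>x\<rceil>" using assms by simp
  then show "x \<le> real (nat \<lceil>x\<rceil>)" "real (nat \<lceil>x\<rceil>) < x + 1" by linarith+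
qed

lemma ex_homogeneous_schedule:
  fixes c :: "('v::euclidean_space) constants"
  assumes c: "valid_constants c" and D: "2 \<le> D"
  defines "T0 \<equiv> \<lambda>N e. D * (1 / (real N * e)) * (1 + ln (1 + 1 / (real N * e))) ^ 4"
  shows "\<exists>e0>0. \<exists>(a::real) (q::nat). \<forall>N e. 0 < e \<longrightarrow> e < e0 \<longrightarrow> a * ln (1 / e) ^ q \<le> real N \<longrightarrow> real N \<le> 1 / sqrt e \<longrightarrow>
    (\<exists>T K. admissible c N T K \<and> real K = real T / real N \<and> T0 N e \<le> real T \<and> real T \<le> 4 * T0 N e)"
proof -
  obtain d where d: "0 < d" "\<And>N T K. 1 \<le> N \<Longrightarrow> N < T \<Longrightarrow> 1 \<le> K \<Longrightarrow> step_size c N T * (1 + ln (real T))\<^sup>2 \<le> d \<Longrightarrow>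
       (step_size c N T * real K)\<^sup>2 * (1 + ln (real T)) ^ 3 \<le> d \<Longrightarrow> admissible c N T K"
    using admissible_if_small[OF c] by blast
  note ph = valid_constants_phi2[OF c]
  define e1 where "e1 = 16 / phi2 c"
  have e1: "0 < e1" using ph by (simp add: e1_def)
  have "eventually (\<lambda>y::real. 2 * D * y * (1 + ln (1 + y)) ^ 4 \<le> y\<^sup>2) at_top" by real_asymp
  moreover have "eventually (\<lambda>y::real. 27 * e1 * ln y ^ 3 / sqrt y < d) at_top"
    by (rule order_tendstoD(2)[OF _ d(1)]) real_asymp
  moreover have "eventually (\<lambda>y::real. 243 * e1\<^sup>2 / ln y < d) at_top"
    by (rule order_tendstoD(2)[OF _ d(1)]) real_asymp
  moreover have "eventually (\<lambda>y::real. 1 \<le> ln y) at_top" by real_asymp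
  moreover have "eventually (\<lambda>y::real. 1 \<le> y) at_top" by real_asymp
  ultimately have "eventually (\<lambda>y::real. 2 * D * y * (1 + ln (1 + y)) ^ 4 \<le> y\<^sup>2 \<and> 27 * e1 * ln y ^ 3 / sqrt y < d \<and>
      243 * e1\<^sup>2 / ln y < d \<and> 1 \<le> ln y \<and> 1 \<le> y) at_top" by eventually_elim simp
  then obtain y0 where y0: "\<And>y. y0 \<le> y \<Longrightarrow> 2 * D * y * (1 + ln (1 + y)) ^ 4 \<le> y\<^sup>2 \<and> 27 * e1 * ln y ^ 3 / sqrt y < d \<and>
      243 * e1\<^sup>2 / ln y < d \<and> 1 \<le> ln y \<and> 1 \<le> y"
    unfolding eventually_at_top_linorder by blast
  show ?thesis
  proof (rule exI[of _ "1 / max 1 y0"], rule conjI[rotated], rule exI[of _ "1::real"], rule exI[of _ "3::nat"], intro allI impI)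
    show "0 < 1 / max 1 y0" by simp
  next
    fix N :: nat and e :: real
    assume e: "0 < e" "e < 1 / max 1 y0" and Nl: "1 * ln (1 / e) ^ 3 \<le> real N" and Nu: "real N \<le> 1 / sqrt e"
    define y where "y = 1 / e"
    define Y where "Y = ln y"
    define M where "M = max 1 y0"
    have "0 < M" by (simp add: M_def)
    then have "M < 1 / e" using e unfolding M_def[symmetric] by (simp add: field_simps)
    then have "y0 \<le> y" by (simp add: y_def M_def)
    note Y0 = y0[OF this, folded Y_def]
    have Y: "1 \<le> Y" "1 \<le> y" using Y0 by auto
    have N: "Y ^ 3 \<le> real N" using Nl by (simp add: Y_def y_def)
    have "1 \<le> Y ^ 3" using Y by (intro one_le_power) auto
    then have N1: "1 \<le> real N" using N by linarith
    then have Npos: "0 < real N" "1 \<le> N" by auto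
    define x where "x = 1 / (real N * e)"
    have xy: "x = y / real N" by (simp add: x_def y_def)
    have "1 / sqrt e = sqrt y" by (simp add: y_def real_sqrt_divide)
    then have sy: "sqrt y * sqrt y = y" "real N \<le> sqrt y" "1 \<le> sqrt y"
      using Nu Y by simp_all
    have x1: "sqrt y \<le> x"
    proof -
      have "sqrt y * real N \<le> sqrt y * sqrt y" using sy by (intro mult_left_mono) auto
      then show ?thesis using Npos sy(1) by (simp add: xy pos_le_divide_eq)
    qed
    have x2: "x \<le> y" using N1 Y by (simp add: xy divide_le_eq)
    have x0: "0 < x" using x1 sy by linarith
    define l where "l = (1 + ln (1 + x)) ^ 4"
    have l1: "1 \<le> l" unfolding l_def using x0 by (intro one_le_power) simp
    have T0: "T0 N e = D * x * l" by (simp add: T0_def x_def l_def)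
    have T0x: "2 * x \<le> T0 N e"
    proof -
      have "2 * x \<le> D * x" using D x0 by (intro mult_right_mono) auto
      also have "\<dots> \<le> D * x * l" using mult_left_mono[OF l1, of "D * x"] D x0 by simp
      finally show ?thesis by (simp add: T0)
    qed
    have T0N: "2 * real N \<le> T0 N e" using T0x x1 sy by linarith
    have T0y: "2 * T0 N e \<le> y\<^sup>2"
    proof -
      have "l \<le> (1 + ln (1 + y)) ^ 4" unfolding l_def using x0 x2 by (intro power_mono add_left_mono) auto
      then have "D * x * l \<le> D * y * (1 + ln (1 + y)) ^ 4"
        using D x0 x2 l1 by (intro mult_mono) auto
      then show ?thesis using Y0 by (simp add: T0)
    qed
    define n where "n = nat \<lceil>T0 N e / real N\<rceil>"
    define T where "T = N * n"
    have n: "T0 N e / real N \<le> real n" "real n < T0 N e / real N + 1"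
      unfolding n_def using T0N Npos by (intro nat_ceiling_bounds divide_nonneg_pos; simp)+
    have T: "T0 N e \<le> real T" "real T \<le> 2 * T0 N e"
    proof -
      show "T0 N e \<le> real T" using n(1) Npos by (simp add: T_def pos_divide_le_eq mult.commute)
      have "real N * real n \<le> real N * (T0 N e / real N + 1)" using n(2) Npos by (intro mult_left_mono) auto
      also have "\<dots> = T0 N e + real N" using Npos by (simp add: distrib_left)
      finally show "real T \<le> 2 * T0 N e" using T0N Npos by (simp add: T_def)
    qed
    have KT: "real n = real T / real N" using Npos by (simp add: T_def)
    have NT: "N < T" using T T0N Npos by linarith
    have n1: "1 \<le> n" using NT by (cases n) (auto simp: T_def)
    note ss = step_size_bounds[OF ph(1,2) Npos(2) NT, folded e1_def]
    define L where "L = 1 + ln (real T)"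
    have L1: "1 \<le> L" using ss(4) by (simp add: L_def)
    have L: "L \<le> 3 * Y"
    proof -
      have "real T \<le> y\<^sup>2" using T T0y by linarith
      then have "ln (real T) \<le> ln (y\<^sup>2)" using ss(5) by (subst ln_le_cancel_iff) auto
      also have "\<dots> = 2 * Y" using Y by (simp add: ln_realpow Y_def)
      finally show ?thesis using Y by (simp add: L_def)
    qed
    have Tx: "sqrt y \<le> real T" using T T0x x1 x0 by linarith
    have \<alpha>: "step_size c N T \<le> 3 * e1 * Y / real T"
    proof -
      have "step_size c N T \<le> e1 * (L / real T)" using ss(3) by (simp add: L_def)
      also have "\<dots> \<le> e1 * (3 * Y / real T)" using L e1 ss(5) by (intro mult_left_mono divide_right_mono) auto
      finally show ?thesis by (simp add: mult.commute mult.left_commute)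
    qed
    have "step_size c N T * L\<^sup>2 \<le> (3 * e1 * Y / real T) * (3 * Y)\<^sup>2"
      using \<alpha> L L1 ss(2,5) e1 Y by (intro mult_mono power_mono) auto
    also have "\<dots> = 27 * e1 * Y ^ 3 / real T" by (simp add: power2_eq_square power3_eq_cube)
    also have "\<dots> \<le> 27 * e1 * Y ^ 3 / sqrt y" using Tx sy ss(5) e1 Y by (intro divide_left_mono mult_pos_pos) auto
    finally have 1: "step_size c N T * L\<^sup>2 \<le> d" using Y0 by linarith
    have "step_size c N T * real n \<le> (3 * e1 * Y / real T) * real n" using \<alpha> by (intro mult_right_mono) auto
    also have "\<dots> = 3 * e1 * Y / real N" using ss(5) by (simp add: KT)
    also have "\<dots> \<le> 3 * e1 * Y / Y ^ 3" using N Y e1 Npos by (intro divide_left_mono mult_pos_pos zero_less_power) auto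
    also have "\<dots> = 3 * e1 / Y\<^sup>2" using Y by (simp add: power2_eq_square power3_eq_cube)
    finally have aK: "step_size c N T * real n \<le> 3 * e1 / Y\<^sup>2" .
    have "(step_size c N T * real n)\<^sup>2 * L ^ 3 \<le> (3 * e1 / Y\<^sup>2)\<^sup>2 * (3 * Y) ^ 3"
      using aK L L1 ss(2) by (intro mult_mono power_mono) auto
    also have "\<dots> = 243 * e1\<^sup>2 / Y" using Y by (simp add: field_simps power2_eq_square power3_eq_cube)
    finally have 2: "(step_size c N T * real n)\<^sup>2 * L ^ 3 \<le> d" using Y0 by linarith
    have "admissible c N T n"
      using d(2)[OF Npos(2) NT n1] 1 2 by (simp add: L_def)
    moreover have "real T \<le> 4 * T0 N e" using T T0N Npos by linarith
    ultimately show "\<exists>T K. admissible c N T K \<and> real K = real T / real N \<and> T0 N e \<le> real T \<and> real T \<le> 4 * T0 N e"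
      using KT T(1) by blast
  qed
qed

lemma ex_heterogeneous_schedule:
  fixes c :: "('v::euclidean_space) constants"
  assumes c: "valid_constants c" and D: "2 \<le> D" and N: "1 \<le> (N :: nat)"
  defines "T0 \<equiv> \<lambda>e. D * (1 / (real N * e)) * (1 + ln (1 + 1 / (real N * e))) ^ 4"
  shows "\<exists>e0>0. \<forall>e. 0 < e \<longrightarrow> e < e0 \<longrightarrow>
    (\<exists>T K. admissible c N T K \<and> real K = sqrt (real T) / real N \<and> T0 e \<le> real T \<and> real T \<le> 4 * T0 e)"
proof -
  obtain d where d: "0 < d" "\<And>N T K. 1 \<le> N \<Longrightarrow> N < T \<Longrightarrow> 1 \<le> K \<Longrightarrow> step_size c N T * (1 + ln (real T))\<^sup>2 \<le> d \<Longrightarrow>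
       (step_size c N T * real K)\<^sup>2 * (1 + ln (real T)) ^ 3 \<le> d \<Longrightarrow> admissible c N T K"
    using admissible_if_small[OF c] by blast
  note ph = valid_constants_phi2[OF c]
  define e1 where "e1 = 16 / phi2 c"
  have e1: "0 < e1" using ph by (simp add: e1_def)
  have "eventually (\<lambda>T::nat. e1 * (1 + ln (real T)) ^ 3 / real T < d) sequentially"
    by (rule order_tendstoD(2)[OF _ d(1)]) real_asymp
  moreover have "eventually (\<lambda>T::nat. e1\<^sup>2 * (1 + ln (real T)) ^ 5 / real T < d) sequentially"
    by (rule order_tendstoD(2)[OF _ d(1)]) real_asymp
  ultimately have "eventually (\<lambda>T::nat. e1 * (1 + ln (real T)) ^ 3 / real T < d \<and> e1\<^sup>2 * (1 + ln (real T)) ^ 5 / real T < d) sequentially"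
    by eventually_elim simp
  then obtain T1 where T1: "\<And>T. T1 \<le> T \<Longrightarrow> e1 * (1 + ln (real T)) ^ 3 / real T < d"
    "\<And>T. T1 \<le> T \<Longrightarrow> e1\<^sup>2 * (1 + ln (real T)) ^ 5 / real T < d"
    unfolding eventually_sequentially by blast
  define S where "S = real T1 + (real N)\<^sup>2 + 1"
  have S0: "0 < S" by (simp add: S_def add_nonneg_pos)
  have Npos: "0 < real N" "1 \<le> real N" using N by auto
  show ?thesis
  proof (intro exI[of _ "1 / (real N * S)"] conjI allI impI)
    show "0 < 1 / (real N * S)" using S0 Npos by simp
  next
    fix e :: real assume e: "0 < e" "e < 1 / (real N * S)"
    define x where "x = 1 / (real N * e)"
    have xS: "S < x" using e S0 Npos by (simp add: x_def field_simps)
    have x0: "0 < x" using xS S0 by linarith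
    define l where "l = (1 + ln (1 + x)) ^ 4"
    have l1: "1 \<le> l" unfolding l_def using x0 by (intro one_le_power) simp
    have T0: "T0 e = D * x * l" by (simp add: T0_def x_def l_def)
    have "1 * x \<le> D * x" using D x0 by (intro mult_right_mono) auto
    also have "\<dots> \<le> D * x * l" using mult_left_mono[OF l1, of "D * x"] D x0 by simp
    finally have T0x: "x \<le> T0 e" by (simp add: T0)
    have T0S: "real T1 < T0 e" "(real N)\<^sup>2 < T0 e" using T0x xS zero_le_power2[of "real N"] of_nat_0_le_iff[of T1] unfolding S_def by linarith+
    have T00: "0 < T0 e" using T0x x0 by linarith
    have Nsq: "real N \<le> sqrt (T0 e)" using T0S(2) by (intro real_le_rsqrt) simp
    define K where "K = nat \<lceil>sqrt (T0 e) / real N\<rceil>"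
    define T where "T = (K * N)\<^sup>2"
    have K: "sqrt (T0 e) / real N \<le> real K" "real K < sqrt (T0 e) / real N + 1"
      unfolding K_def using T00 Npos by (intro nat_ceiling_bounds divide_nonneg_pos; simp)+
    have KN: "sqrt (T0 e) \<le> real K * real N" "real K * real N \<le> 2 * sqrt (T0 e)"
    proof -
      show "sqrt (T0 e) \<le> real K * real N" using K(1) Npos by (simp add: pos_divide_le_eq)
      have "real K * real N \<le> (sqrt (T0 e) / real N + 1) * real N" using K(2) Npos by (intro mult_right_mono) auto
      also have "\<dots> = sqrt (T0 e) + real N" using Npos by (simp add: distrib_right)
      finally show "real K * real N \<le> 2 * sqrt (T0 e)" using Nsq by simp
    qed
    have rT: "real T = (real K * real N)\<^sup>2" by (simp add: T_def)
    have sT: "sqrt (real T) = real K * real N" by (simp add: rT)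
    have Tl: "T0 e \<le> real T"
      using power_mono[OF KN(1), of 2] T00 by (simp add: rT)
    have Tu: "real T \<le> 4 * T0 e"
      using power_mono[OF KN(2), of 2] T00 by (simp add: rT power_mult_distrib)
    have KT: "real K = sqrt (real T) / real N" using Npos by (simp add: sT)
    have "real N * 1 \<le> (real N)\<^sup>2" unfolding power2_eq_square using Npos by (intro mult_left_mono) auto
    then have "real N < real T" using T0S Tl by linarith
    then have NT: "N < T" by simp
    have K1: "1 \<le> K" using NT by (cases K) (auto simp: T_def)
    have "real T1 \<le> real T" using T0S Tl by linarith
    then have TT1: "T1 \<le> T" by simp
    note ss = step_size_bounds[OF ph(1,2) N NT, folded e1_def]
    define L where "L = 1 + ln (real T)"
    have L1: "1 \<le> L" using ss(4) by (simp add: L_def)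
    have \<alpha>: "step_size c N T \<le> e1 * L / real T" using ss(3) by (simp add: L_def)
    have "step_size c N T * L\<^sup>2 \<le> (e1 * L / real T) * L\<^sup>2" using \<alpha> by (intro mult_right_mono) auto
    also have "\<dots> = e1 * L ^ 3 / real T" by (simp add: power2_eq_square power3_eq_cube)
    finally have 1: "step_size c N T * L\<^sup>2 \<le> d" using T1(1)[OF TT1] by (simp add: L_def)
    have "(step_size c N T * real K)\<^sup>2 \<le> (e1 * L / real T * sqrt (real T))\<^sup>2"
    proof (intro power_mono mult_mono \<alpha>)
      show "real K \<le> sqrt (real T)" unfolding sT using Npos mult_left_mono[of 1 "real N" "real K"] by simp
    qed (use ss e1 L1 in auto)
    also have "\<dots> = e1\<^sup>2 * L\<^sup>2 / real T"
    proof -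
      have "(e1 * L / real T * sqrt (real T))\<^sup>2 = (e1 * L / real T)\<^sup>2 * real T"
        unfolding power_mult_distrib[of "e1 * L / real T" "sqrt (real T)"] by simp
      then show ?thesis using ss(5) by (simp add: power_divide power_mult_distrib power2_eq_square)
    qed
    finally have "(step_size c N T * real K)\<^sup>2 * L ^ 3 \<le> (e1\<^sup>2 * L\<^sup>2 / real T) * L ^ 3"
      using L1 by (intro mult_right_mono) auto
    also have "\<dots> = e1\<^sup>2 * L ^ 5 / real T" by (simp add: power_add[symmetric])
    finally have 2: "(step_size c N T * real K)\<^sup>2 * L ^ 3 \<le> d" using T1(2)[OF TT1] by (simp add: L_def)
    have "admissible c N T K" using d(2)[OF N NT K1] 1 2 by (simp add: L_def)
    then show "\<exists>T K. admissible c N T K \<and> real K = sqrt (real T) / real N \<and> T0 e \<le> real T \<and> real T \<le> 4 * T0 e"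
      using KT Tl Tu by blast
  qed
qed

section \<open>Sample and communication complexity\<close>

theorem corollary3p1p1:
  fixes c :: "(real ^ 'd) constants" and \<theta>0 :: "real ^ 'd"
  assumes "valid_constants c"
  shows
    "(\<exists>T0.
        soft_O T0 (\<lambda>N e. 1 / (real N * e)) \<and>
        (\<forall>(I :: (real ^ 'd, 's, 'w) fed) T K That e.
           fegsam c \<theta>0 I (step_size c (nag I) T) K T That \<longrightarrow>
           admissible c (nag I) T K \<longrightarrow> heterogeneity c I = 0 \<longrightarrow>
           real K = real T / real (nag I) \<longrightarrow> 0 < e \<longrightarrow> T0 (nag I) e \<le> real T \<longrightarrow>
             output_error c \<theta>0 I (step_size c (nag I) T) K That \<le> e) \<and>
        (\<forall>N T K. admissible c N T K \<longrightarrow> real K = real T / real N \<longrightarrow>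
           real (comm_rounds T K) = real T / real K \<and> real T / real K = real N) \<and>
        (\<exists>e0>0. \<exists>(a::real) (q::nat). \<forall>N e.
           0 < e \<longrightarrow> e < e0 \<longrightarrow> a * ln (1 / e) ^ q \<le> real N \<longrightarrow> real N \<le> 1 / sqrt e \<longrightarrow>
           (\<exists>T K. admissible c N T K \<and> real K = real T / real N \<and>
                  T0 N e \<le> real T \<and> real T \<le> 4 * T0 N e)))
     \<and>
     (\<exists>T0 R.
        soft_O T0 (\<lambda>N e. 1 / (real N * e)) \<and>
        soft_Theta R (\<lambda>N e. sqrt (real N) / sqrt e) \<and>
        (\<forall>(I :: (real ^ 'd, 's, 'w) fed) T K That e.
           fegsam c \<theta>0 I (step_size c (nag I) T) K T That \<longrightarrow>
           admissible c (nag I) T K \<longrightarrow> 0 < heterogeneity c I \<longrightarrow>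
           real K = sqrt (real T) / real (nag I) \<longrightarrow> 0 < e \<longrightarrow> T0 (nag I) e \<le> real T \<longrightarrow>
             output_error c \<theta>0 I (step_size c (nag I) T) K That \<le> e) \<and>
        (\<forall>N T K e. admissible c N T K \<longrightarrow> real K = sqrt (real T) / real N \<longrightarrow>
           0 < e \<longrightarrow> T0 N e \<le> real T \<longrightarrow> real T \<le> 4 * T0 N e \<longrightarrow>
           real (comm_rounds T K) = real T / real K \<and>
           R N e \<le> real T / real K \<and> real T / real K \<le> 2 * R N e) \<and>
        (\<forall>N\<ge>1. \<exists>e0>0. \<forall>e. 0 < e \<longrightarrow> e < e0 \<longrightarrow>
           (\<exists>T K. admissible c N T K \<and> real K = sqrt (real T) / real N \<and>
                  T0 N e \<le> real T \<and> real T \<le> 4 * T0 N e)))"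
proof -
  obtain C where C: "0 < C" "\<And>(I :: (real ^ 'd, 's, 'w) fed) T K That.
      fegsam c \<theta>0 I (step_size c (nag I) T) K T That \<Longrightarrow> admissible c (nag I) T K \<Longrightarrow>
      heterogeneity c I = 0 \<and> real K = real T / real (nag I) \<or> real K = sqrt (real T) / real (nag I) \<Longrightarrow>
      output_error c \<theta>0 I (step_size c (nag I) T) K That \<le> C * (1 + ln (real T)) ^ 4 / (real (nag I) * real T)"
    using output_error_le_polylog[OF assms, of \<theta>0] by blast
  obtain D where D: "2 \<le> D"
    "\<And>x T. 0 < x \<Longrightarrow> 1 \<le> T \<Longrightarrow> D * x * (1 + ln (1 + x)) ^ 4 \<le> T \<Longrightarrow> C * (1 + ln T) ^ 4 * x \<le> T"
    using polylog_inverse[of C] by blast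
  define T0 where "T0 = (\<lambda>N e. D * (1 / (real N * e)) * (1 + ln (1 + 1 / (real N * e))) ^ 4)"
  define R where "R = (\<lambda>N e. real N * sqrt (T0 N e))"
  have T0_pos: "0 < T0 N e" if "1 \<le> N" "0 < e" for N e
  proof -
    have "0 < 1 / (real N * e)" using that by simp
    then have "0 < 1 + ln (1 + 1 / (real N * e))" by (simp add: add_pos_nonneg)
    then show ?thesis using D(1) that by (simp add: T0_def)
  qed
  have soft_T0: "soft_O T0 (\<lambda>N e. 1 / (real N * e))"
    unfolding soft_O_def
  proof (intro exI[of _ D] exI[of _ "4::nat"] allI impI)
    fix N :: nat and e :: real assume "1 \<le> N" "0 < e"
    then have "0 < 1 / (real N * e)" by simp
    then show "\<bar>T0 N e\<bar> \<le> D * \<bar>1 / (real N * e)\<bar> * (1 + ln (1 + \<bar>1 / (real N * e)\<bar>)) ^ 4"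
      using T0_pos[OF \<open>1 \<le> N\<close> \<open>0 < e\<close>] by (simp only: abs_of_pos) (simp add: T0_def)
  qed
  have error: "output_error c \<theta>0 I (step_size c (nag I) T) K That \<le> e"
    if "fegsam c \<theta>0 I (step_size c (nag I) T) K T That" "admissible c (nag I) T K"
      "heterogeneity c I = 0 \<and> real K = real T / real (nag I) \<or> real K = sqrt (real T) / real (nag I)"
      "0 < e" "T0 (nag I) e \<le> real T" for I :: "(real ^ 'd, 's, 'w) fed" and T K That e
  proof -
    have N: "1 \<le> nag I" "nag I < T" using that(2) by (auto simp: admissible_def)
    then have pos: "0 < real (nag I)" "1 \<le> real T" "0 < 1 / (real (nag I) * e)" using that(4) by auto
    have "C * (1 + ln (real T)) ^ 4 * (1 / (real (nag I) * e)) \<le> real T"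
      using that(5) by (intro D(2) pos) (simp add: T0_def)
    then have "C * (1 + ln (real T)) ^ 4 \<le> real T * (real (nag I) * e)"
      using pos(1) that(4) by (simp add: pos_divide_le_eq)
    then have "C * (1 + ln (real T)) ^ 4 / (real (nag I) * real T) \<le> e"
      using pos by (simp add: pos_divide_le_eq mult_ac)
    then show ?thesis using C(2)[OF that(1-3)] by linarith
  qed
  have rounds_hom: "real (comm_rounds T K) = real T / real K \<and> real T / real K = real N"
    if "admissible c N T K" "real K = real T / real N" for N T K
  proof -
    have NK: "1 \<le> N" "1 \<le> K" using that(1) by (auto simp: admissible_def)
    then have "real T = real (K * N)" using that(2) by simp
    then have "T = K * N" by (simp only: of_nat_eq_iff)
    then show ?thesis using comm_rounds_mult[OF NK(2), of N] NK by simp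
  qed
  have rounds_het: "real (comm_rounds T K) = real T / real K \<and> R N e \<le> real T / real K \<and> real T / real K \<le> 2 * R N e"
    if "admissible c N T K" "real K = sqrt (real T) / real N" "0 < e" "T0 N e \<le> real T" "real T \<le> 4 * T0 N e" for N T K e
  proof -
    have NK: "1 \<le> N" "1 \<le> K" "N < T" using that(1) by (auto simp: admissible_def)
    have s: "sqrt (real T) = real K * real N" using NK that(2) by simp
    then have "real T = (real K * real N)\<^sup>2" using real_sqrt_pow2[of "real T"] by simp
    then have "real T = real (K * (K * N\<^sup>2))" by (simp add: power2_eq_square)
    then have T: "T = K * (K * N\<^sup>2)" by (simp only: of_nat_eq_iff)
    have TK: "real T / real K = real N * sqrt (real T)"
      unfolding s using NK by (simp add: T power2_eq_square)
    have "real (comm_rounds T K) = real T / real K"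
      using comm_rounds_mult[OF NK(2), of "K * N\<^sup>2"] NK by (simp add: T)
    moreover have "R N e \<le> real T / real K"
      unfolding TK R_def using that(4) by (intro mult_left_mono) auto
    moreover have "sqrt (real T) \<le> 2 * sqrt (T0 N e)"
      using real_sqrt_le_mono[OF that(5)] by (simp add: real_sqrt_mult)
    then have "real N * sqrt (real T) \<le> real N * (2 * sqrt (T0 N e))" by (intro mult_left_mono) auto
    then have "real T / real K \<le> 2 * R N e" unfolding TK R_def by simp
    ultimately show ?thesis by blast
  qed
  have R_eq: "R N e = sqrt D * (sqrt (real N) / sqrt e) * (1 + ln (1 + 1 / (real N * e)))\<^sup>2" if "1 \<le> N" "0 < e" for N e
  proof -
    have "sqrt ((1 + ln (1 + 1 / (real N * e))) ^ 4) = (1 + ln (1 + 1 / (real N * e)))\<^sup>2"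
      by (rule real_sqrt_unique) (simp_all flip: power_mult)
    then have "sqrt (T0 N e) = sqrt D * (1 / (sqrt (real N) * sqrt e)) * (1 + ln (1 + 1 / (real N * e)))\<^sup>2"
      by (simp add: T0_def real_sqrt_mult real_sqrt_divide)
    then have "R N e = sqrt D * (real N * (1 / (sqrt (real N) * sqrt e))) * (1 + ln (1 + 1 / (real N * e)))\<^sup>2"
      by (simp add: R_def)
    moreover have "real N * (1 / (sqrt (real N) * sqrt e)) = sqrt (real N) / sqrt e"
      using that real_div_sqrt[of "real N"] by (simp add: field_simps)
    ultimately show ?thesis by (simp only:)
  qed
  have soft_R: "soft_Theta R (\<lambda>N e. sqrt (real N) / sqrt e)"
    unfolding soft_Theta_def
  proof
    show "soft_O R (\<lambda>N e. sqrt (real N) / sqrt e)"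
      unfolding soft_O_def
    proof (intro exI[of _ "4 * sqrt D"] exI[of _ "2::nat"] allI impI)
      fix N :: nat and e :: real assume N: "1 \<le> N" and e: "0 < e"
      define g where "g = sqrt (real N) / sqrt e"
      define l where "l = 1 + ln (1 + 1 / (real N * e))"
      have g: "0 < g" using N e by (simp add: g_def)
      have x: "0 < 1 / (real N * e)" using N e by simp
      have l0: "0 \<le> l" using x by (simp add: l_def)
      have "1 / (real N * e) \<le> real N / e"
        using N e mult_mono[of 1 "real N" 1 "real N"] by (simp add: field_simps)
      also have "\<dots> = g\<^sup>2" using e by (simp add: g_def power_divide)
      finally have "1 + 1 / (real N * e) \<le> (1 + g)\<^sup>2" using g by (simp add: power2_sum)
      then have "ln (1 + 1 / (real N * e)) \<le> ln ((1 + g)\<^sup>2)"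
        using add_pos_pos[OF zero_less_one x] g by (subst ln_le_cancel_iff) auto
      also have "\<dots> = 2 * ln (1 + g)" using g by (simp add: ln_realpow)
      finally have "l \<le> 2 * (1 + ln (1 + g))" using g by (simp add: l_def)
      then have "l\<^sup>2 \<le> (2 * (1 + ln (1 + g)))\<^sup>2" using l0 by (intro power_mono)
      then have "l\<^sup>2 \<le> 4 * (1 + ln (1 + g))\<^sup>2" unfolding power_mult_distrib by simp
      then have "sqrt D * g * l\<^sup>2 \<le> sqrt D * g * (4 * (1 + ln (1 + g))\<^sup>2)"
        using g D(1) by (intro mult_left_mono) auto
      moreover have "\<bar>R N e\<bar> = sqrt D * g * l\<^sup>2" using g D(1) e by (simp add: R_eq[OF N e] g_def l_def)
      ultimately show "\<bar>R N e\<bar> \<le> 4 * sqrt D * \<bar>sqrt (real N) / sqrt e\<bar> * (1 + ln (1 + \<bar>sqrt (real N) / sqrt e\<bar>))\<^sup>2"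
        unfolding g_def[symmetric] using g by (simp add: mult_ac)
    qed
    show "soft_O (\<lambda>N e. sqrt (real N) / sqrt e) R"
      unfolding soft_O_def
    proof (intro exI[of _ "1::real"] exI[of _ "0::nat"] allI impI)
      fix N :: nat and e :: real assume N: "1 \<le> N" and e: "0 < e"
      define g where "g = sqrt (real N) / sqrt e"
      have g: "0 < g" using N e by (simp add: g_def)
      have "0 < 1 / (real N * e)" using N e by simp
      then have l: "1 \<le> (1 + ln (1 + 1 / (real N * e)))\<^sup>2" by (intro one_le_power) simp
      have "1 * g * 1 \<le> sqrt D * g * (1 + ln (1 + 1 / (real N * e)))\<^sup>2"
        using D(1) g l by (intro mult_mono) auto
      then have "g \<le> R N e" by (simp add: R_eq[OF N e] g_def)
      then show "\<bar>sqrt (real N) / sqrt e\<bar> \<le> 1 * \<bar>R N e\<bar> * (1 + ln (1 + \<bar>R N e\<bar>)) ^ 0"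
        unfolding g_def[symmetric] using g by simp
    qed
  qed
  have sched_hom: "\<exists>e0>0. \<exists>(a::real) (q::nat). \<forall>N e.
      0 < e \<longrightarrow> e < e0 \<longrightarrow> a * ln (1 / e) ^ q \<le> real N \<longrightarrow> real N \<le> 1 / sqrt e \<longrightarrow>
      (\<exists>T K. admissible c N T K \<and> real K = real T / real N \<and> T0 N e \<le> real T \<and> real T \<le> 4 * T0 N e)"
    unfolding T0_def by (rule ex_homogeneous_schedule[OF assms D(1)])
  have sched_het: "\<forall>N\<ge>1. \<exists>e0>0. \<forall>e. 0 < e \<longrightarrow> e < e0 \<longrightarrow>
      (\<exists>T K. admissible c N T K \<and> real K = sqrt (real T) / real N \<and> T0 N e \<le> real T \<and> real T \<le> 4 * T0 N e)"
    unfolding T0_def using ex_heterogeneous_schedule[OF assms D(1)] by blast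
  show ?thesis
    apply (rule conjI)
     apply (rule exI[of _ T0], intro conjI soft_T0 sched_hom)
      apply (blast intro: error)
     apply (blast intro: rounds_hom[THEN conjunct1] rounds_hom[THEN conjunct2])
    apply (rule exI[of _ T0], rule exI[of _ R], intro conjI soft_T0 soft_R sched_het)
     apply (blast intro: error)
    apply (intro allI impI)
    apply (rule rounds_het; assumption)
    done
qed

end
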